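(* Let $L>0$, $T>0$, $\Omega=(0,L)$, $1/2<\alpha<1$, $F\in W^1_\infty\bigl((0,T);L_\infty(\Omega)\bigr)$ with $1+F(x,t)^2\le C_F$ for $0<x<L$ and $0<t<T$ (for some constant $C_F$), and $g\in L_1\bigl((0,T);L_2(\Omega)\bigr)$. Let $u$ satisfy $$\langle u_t,v\rangle+\langle\partial_t^{1-\alpha}u_x,v_x\rangle-\langle F\partial_t^{1-\alpha}u,v_x\rangle=\langle g(t),v\rangle\quad\text{for all }v\in H^1_0(\Omega),\qquad u(0)=u_0,$$ and let $u_h:[0,T]\to\mathbb{S}_h$ be the finite element solution, i.e. $$\langle u_{ht},v\rangle+\langle\partial_t^{1-\alpha}u_{hx},v_x\rangle-\langle F\partial_t^{1-\alpha}u_h,v_x\rangle=\langle g(t),v\rangle\quad\text{for all }v\in\mathbb{S}_h,\qquad u_h(0)=u_{0h}\in\mathbb{S}_h.$$ Then there is a constant $C$ depending on $\alpha$, $F$, $T$ and $L$ (but not on $h$) such that, for $r\in\{1,2\}$ with $u\in H^1\bigl((0,T),H^r(\Omega)\bigr)$, and for $0\le t\le T$, $$\|u_h(t)-u(t)\|^2\le C\|u_{0h}-R_hu_0\|_1^2+Ch^{2r}\biggl(\|u_0\|_r^2+\int_0^t\|u_t(s)\|_r^2\,ds\biggr).$$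
   Context: $\langle\cdot,\cdot\rangle$ and $\|\cdot\|$ are the inner product and norm of $L_2(\Omega)$; $\|\cdot\|_r$ is the norm of $H^r(\Omega)$. Subscripts $x,t$ denote partial derivatives; $u_{ht}=\partial u_h/\partial t$, $u_{hx}=\partial u_h/\partial x$. The fractional integral is $I^\alpha v(t)=\int_0^t\omega_\alpha(t-s)v(s)\,ds$ with $\omega_\alpha(t)=t^{\alpha-1}/\Gamma(\alpha)$, and the Riemann--Liouville derivative is $\partial_t^{1-\alpha}v=(I^\alpha v)_t$. Functions of $(x,t)$ are viewed as functions of $t$ with values in function spaces on $\Omega$. Given an arbitrary partition $0=x_0<x_1<\cdots<x_P=L$ of $\Omega$, $\mathbb{S}_h\subseteq H^1_0(\Omega)$ is the space of continuous functions on $[0,L]$ that are linear on each $[x_{p-1},x_p]$ and vanish at $0$ and $L$; $h=\max_p(x_p-x_{p-1})$. The Ritz projection $R_h:H^1_0(\Omega)\to\mathbb{S}_h$ is defined by $\langle(R_hw)_x,v_x\rangle=\langle w_x,v_x\rangle$ for all $v\in\mathbb{S}_h$. The equation for $u$ is the weak form of $u_t-\kappa_\alpha\partial_t^{1-\alpha}u_{xx}+\mu_\alpha^{-1}(F\partial_t^{1-\alpha}u)_x=g$ for $0<x<L$, $0<t<T$, with $u(x,0)=u_0(x)$, $u(0,t)=0=u(L,t)$ and $\kappa_\alpha=\mu_\alpha=1$; $u(t)\in H^1_0(\Omega)$. *)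

theory Defs
  imports "HOL-Analysis.Analysis" "HOL-Probability.Essential_Supremum"
begin

text \<open>Elements of all function spaces are plain functions on the reals. Only their values on
  the open interval matter, and elements at distance 0 (functions that agree almost
  everywhere) are never identified explicitly.\<close>

record fun_space =
  fs_carrier :: "(real \<Rightarrow> real) set"
  fs_norm :: "(real \<Rightarrow> real) \<Rightarrow> real"

definition inner_L2 :: "real \<Rightarrow> (real \<Rightarrow> real) \<Rightarrow> (real \<Rightarrow> real) \<Rightarrow> real" where
  "inner_L2 L f g = (\<integral>x. f x * g x \<partial>lebesgue_on {0<..<L})"

definition norm_L2 :: "real \<Rightarrow> (real \<Rightarrow> real) \<Rightarrow> real" where
  "norm_L2 L f = sqrt (inner_L2 L f f)"

definition space_L2 :: "real \<Rightarrow> fun_space" where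
  "space_L2 L =
     \<lparr>fs_carrier = {f \<in> borel_measurable (lebesgue_on {0<..<L}).
                      integrable (lebesgue_on {0<..<L}) (\<lambda>x. (f x)\<^sup>2)},
      fs_norm = norm_L2 L\<rparr>"

definition space_Linf :: "real \<Rightarrow> fun_space" where
  "space_Linf L =
     \<lparr>fs_carrier = {f \<in> borel_measurable (lebesgue_on {0<..<L}).
                      esssup (lebesgue_on {0<..<L}) (\<lambda>x. ereal \<bar>f x\<bar>) < \<infinity>},
      fs_norm = (\<lambda>f. real_of_ereal (esssup (lebesgue_on {0<..<L}) (\<lambda>x. ereal \<bar>f x\<bar>)))\<rparr>"

definition test_fun :: "real \<Rightarrow> real \<Rightarrow> (real \<Rightarrow> real) \<Rightarrow> bool" where
  "test_fun a b \<phi> \<longleftrightarrow>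
     (\<forall>n x. (deriv ^^ n) \<phi> field_differentiable at x) \<and>
     (\<exists>c d. a < c \<and> d < b \<and> (\<forall>x. x \<notin> {c..d} \<longrightarrow> \<phi> x = 0))"

text \<open>\<open>z\<close> is the weak derivative of order \<open>k\<close> of \<open>w\<close>.\<close>

definition has_wderiv :: "real \<Rightarrow> nat \<Rightarrow> (real \<Rightarrow> real) \<Rightarrow> (real \<Rightarrow> real) \<Rightarrow> bool" where
  "has_wderiv L k w z \<longleftrightarrow>
     (\<forall>\<phi>. test_fun 0 L \<phi> \<longrightarrow> inner_L2 L w ((deriv ^^ k) \<phi>) = (-1) ^ k * inner_L2 L z \<phi>)"

definition wderiv :: "real \<Rightarrow> nat \<Rightarrow> (real \<Rightarrow> real) \<Rightarrow> (real \<Rightarrow> real)" where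
  "wderiv L k w = (SOME z. z \<in> fs_carrier (space_L2 L) \<and> has_wderiv L k w z)"

abbreviation dx :: "real \<Rightarrow> (real \<Rightarrow> real) \<Rightarrow> (real \<Rightarrow> real)" where
  "dx L \<equiv> wderiv L 1"

definition norm_H :: "real \<Rightarrow> nat \<Rightarrow> (real \<Rightarrow> real) \<Rightarrow> real" where
  "norm_H L r w = sqrt (\<Sum>k\<le>r. (norm_L2 L (wderiv L k w))\<^sup>2)"

definition space_H :: "real \<Rightarrow> nat \<Rightarrow> fun_space" where
  "space_H L r =
     \<lparr>fs_carrier = {w \<in> fs_carrier (space_L2 L).
                      \<forall>k\<le>r. \<exists>z \<in> fs_carrier (space_L2 L). has_wderiv L k w z},
      fs_norm = norm_H L r\<rparr>"

text \<open>The closure of the test functions in \<open>H\<^sup>1\<close>.\<close>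

definition H10 :: "real \<Rightarrow> (real \<Rightarrow> real) set" where
  "H10 L = {w \<in> fs_carrier (space_H L 1).
              \<exists>\<phi>. (\<forall>n. test_fun 0 L (\<phi> n)) \<and>
                  (\<lambda>n. norm_H L 1 (\<lambda>x. w x - \<phi> n x)) \<longlonglongrightarrow> 0}"

text \<open>A simple function of time is a list of pairs \<open>(A, f)\<close>; it stands for the sum of the
  functions taking the value \<open>f\<close> on \<open>A\<close> and 0 elsewhere.\<close>

definition simple_fn :: "fun_space \<Rightarrow> real \<Rightarrow> real \<Rightarrow> (real set \<times> (real \<Rightarrow> real)) list \<Rightarrow> bool" where
  "simple_fn X a b S \<longleftrightarrow>
     (\<forall>(A, f) \<in> set S. A \<in> sets lebesgue \<and> A \<subseteq> {a<..<b} \<and> f \<in> fs_carrier X)"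

definition simple_val :: "(real set \<times> (real \<Rightarrow> real)) list \<Rightarrow> real \<Rightarrow> real \<Rightarrow> real" where
  "simple_val S t x = (\<Sum>(A, f)\<leftarrow>S. indicator A t * f x)"

definition simple_int :: "(real set \<times> (real \<Rightarrow> real)) list \<Rightarrow> real \<Rightarrow> real" where
  "simple_int S x = (\<Sum>(A, f)\<leftarrow>S. measure lebesgue A * f x)"

definition bochner_measurable ::
    "fun_space \<Rightarrow> real \<Rightarrow> real \<Rightarrow> (real \<Rightarrow> real \<Rightarrow> real) \<Rightarrow> bool" where
  "bochner_measurable X a b v \<longleftrightarrow>
     (AE t in lebesgue_on {a<..<b}. v t \<in> fs_carrier X) \<and>
     (\<exists>S. (\<forall>n. simple_fn X a b (S n)) \<and>
          (AE t in lebesgue_on {a<..<b}.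
             (\<lambda>n. fs_norm X (\<lambda>x. v t x - simple_val (S n) t x)) \<longlonglongrightarrow> 0))"

text \<open>\<open>I\<close> is the Bochner integral of \<open>v\<close> over the interval from \<open>a\<close> to \<open>b\<close>. It is determined
  only up to distance 0 in \<open>X\<close>.\<close>

definition has_bint ::
    "fun_space \<Rightarrow> real \<Rightarrow> real \<Rightarrow> (real \<Rightarrow> real \<Rightarrow> real) \<Rightarrow> (real \<Rightarrow> real) \<Rightarrow> bool" where
  "has_bint X a b v I \<longleftrightarrow>
     bochner_measurable X a b v \<and> I \<in> fs_carrier X \<and>
     (\<exists>S. (\<forall>n. simple_fn X a b (S n)) \<and>
          (\<lambda>n. \<integral>\<^sup>+t. ennreal (fs_norm X (\<lambda>x. v t x - simple_val (S n) t x))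
                 \<partial>lebesgue_on {a<..<b}) \<longlonglongrightarrow> 0 \<and>
          (\<lambda>n. fs_norm X (\<lambda>x. I x - simple_int (S n) x)) \<longlonglongrightarrow> 0)"

definition bint :: "fun_space \<Rightarrow> real \<Rightarrow> real \<Rightarrow> (real \<Rightarrow> real \<Rightarrow> real) \<Rightarrow> (real \<Rightarrow> real)" where
  "bint X a b v = (SOME I. has_bint X a b v I)"

definition bochner_Lp :: "real \<Rightarrow> real \<Rightarrow> fun_space \<Rightarrow> (real \<Rightarrow> real \<Rightarrow> real) set" where
  "bochner_Lp p T X = {v. bochner_measurable X 0 T v \<and>
     integrable (lebesgue_on {0<..<T}) (\<lambda>t. fs_norm X (v t) powr p)}"

definition bochner_Linf :: "real \<Rightarrow> fun_space \<Rightarrow> (real \<Rightarrow> real \<Rightarrow> real) set" where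
  "bochner_Linf T X = {v. bochner_measurable X 0 T v \<and>
     esssup (lebesgue_on {0<..<T}) (\<lambda>t. ereal (fs_norm X (v t))) < \<infinity>}"

text \<open>\<open>w\<close> is the weak time derivative of \<open>v\<close>.\<close>

definition has_tderiv ::
    "fun_space \<Rightarrow> real \<Rightarrow> (real \<Rightarrow> real \<Rightarrow> real) \<Rightarrow> (real \<Rightarrow> real \<Rightarrow> real) \<Rightarrow> bool" where
  "has_tderiv X T v w \<longleftrightarrow>
     v \<in> bochner_Lp 1 T X \<and> w \<in> bochner_Lp 1 T X \<and>
     (\<forall>\<phi>. test_fun 0 T \<phi> \<longrightarrow>
        (\<exists>I. has_bint X 0 T (\<lambda>t x. deriv \<phi> t * v t x) I \<and>
             has_bint X 0 T (\<lambda>t x. \<phi> t * w t x) (\<lambda>x. - I x)))"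

definition bochner_W1p :: "real \<Rightarrow> real \<Rightarrow> fun_space \<Rightarrow> (real \<Rightarrow> real \<Rightarrow> real) set" where
  "bochner_W1p p T X =
     {v \<in> bochner_Lp p T X. \<exists>w \<in> bochner_Lp p T X. has_tderiv X T v w}"

definition bochner_W1inf :: "real \<Rightarrow> fun_space \<Rightarrow> (real \<Rightarrow> real \<Rightarrow> real) set" where
  "bochner_W1inf T X =
     {v \<in> bochner_Linf T X. \<exists>w \<in> bochner_Linf T X. has_tderiv X T v w}"

text \<open>The time derivative of functions of time with values in \<open>L\<^sub>2(\<Omega>)\<close>; if the values lie in
  \<open>H\<^sup>r\<close> and the function is weakly differentiable there, it is the same derivative almost
  everywhere.\<close>

definition tderiv :: "real \<Rightarrow> real \<Rightarrow> (real \<Rightarrow> real \<Rightarrow> real) \<Rightarrow> (real \<Rightarrow> real \<Rightarrow> real)" where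
  "tderiv L T v = (SOME w. has_tderiv (space_L2 L) T v w)"

definition omega :: "real \<Rightarrow> real \<Rightarrow> real" where
  "omega \<alpha> t = t powr (\<alpha> - 1) / Gamma \<alpha>"

definition frac_int :: "real \<Rightarrow> real \<Rightarrow> (real \<Rightarrow> real \<Rightarrow> real) \<Rightarrow> (real \<Rightarrow> real \<Rightarrow> real)" where
  "frac_int L \<alpha> v t = bint (space_L2 L) 0 t (\<lambda>s x. omega \<alpha> (t - s) * v s x)"

text \<open>The Riemann-Liouville derivative of order \<open>1 - \<alpha>\<close>.\<close>

definition frac_deriv ::
    "real \<Rightarrow> real \<Rightarrow> real \<Rightarrow> (real \<Rightarrow> real \<Rightarrow> real) \<Rightarrow> (real \<Rightarrow> real \<Rightarrow> real)" where
  "frac_deriv L T \<alpha> v = tderiv L T (frac_int L \<alpha> v)"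

text \<open>The same equation defines the exact solution (\<open>V = H10 L\<close>) and the finite element solution
  (\<open>V\<close> the finite element space). The first five conditions fix the representative of \<open>u\<close>
  that is continuous in time (so that \<open>u t\<close> makes sense for every \<open>t\<close>) and ensure that all
  the derivatives in the equation, which holds for almost every \<open>t\<close>, exist.\<close>

definition variational_solution ::
    "real \<Rightarrow> real \<Rightarrow> real \<Rightarrow> (real \<Rightarrow> real \<Rightarrow> real) \<Rightarrow> (real \<Rightarrow> real \<Rightarrow> real) \<Rightarrow> (real \<Rightarrow> real) set
      \<Rightarrow> (real \<Rightarrow> real) \<Rightarrow> (real \<Rightarrow> real \<Rightarrow> real) \<Rightarrow> bool" where
  "variational_solution L T \<alpha> F g V u0 u \<longleftrightarrow>
     (\<forall>t\<in>{0..T}. u t \<in> V) \<and>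
     (\<forall>t\<in>{0..T}. ((\<lambda>s. norm_L2 L (\<lambda>x. u s x - u t x)) \<longlongrightarrow> 0) (at t within {0..T})) \<and>
     u \<in> bochner_W1p 1 T (space_L2 L) \<inter> bochner_Lp 1 T (space_H L 1) \<and>
     frac_int L \<alpha> u \<in> bochner_W1p 1 T (space_L2 L) \<and>
     frac_int L \<alpha> (\<lambda>t. dx L (u t)) \<in> bochner_W1p 1 T (space_L2 L) \<and>
     u0 \<in> V \<and> (AE x in lebesgue_on {0<..<L}. u 0 x = u0 x) \<and>
     (AE t in lebesgue_on {0<..<T}. \<forall>v\<in>V.
        inner_L2 L (tderiv L T u t) v
        + inner_L2 L (frac_deriv L T \<alpha> (\<lambda>t. dx L (u t)) t) (dx L v)
        - inner_L2 L (\<lambda>x. F t x * frac_deriv L T \<alpha> u t x) (dx L v)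
        = inner_L2 L (g t) v)"

definition is_partition :: "real \<Rightarrow> nat \<Rightarrow> (nat \<Rightarrow> real) \<Rightarrow> bool" where
  "is_partition L P \<xi> \<longleftrightarrow> 1 \<le> P \<and> \<xi> 0 = 0 \<and> \<xi> P = L \<and> (\<forall>p\<in>{1..P}. \<xi> (p - 1) < \<xi> p)"

definition mesh_size :: "nat \<Rightarrow> (nat \<Rightarrow> real) \<Rightarrow> real" where
  "mesh_size P \<xi> = Max ((\<lambda>p. \<xi> p - \<xi> (p - 1)) ` {1..P})"

definition fe_space :: "real \<Rightarrow> nat \<Rightarrow> (nat \<Rightarrow> real) \<Rightarrow> (real \<Rightarrow> real) set" where
  "fe_space L P \<xi> =
     {v. continuous_on {0..L} v \<and> v 0 = 0 \<and> v L = 0 \<and>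
         (\<forall>p\<in>{1..P}. \<exists>a b. \<forall>x\<in>{\<xi> (p - 1)..\<xi> p}. v x = a + b * x)}"

definition ritz :: "real \<Rightarrow> nat \<Rightarrow> (nat \<Rightarrow> real) \<Rightarrow> (real \<Rightarrow> real) \<Rightarrow> (real \<Rightarrow> real)" where
  "ritz L P \<xi> w = (SOME z. z \<in> fe_space L P \<xi> \<and>
     (\<forall>v\<in>fe_space L P \<xi>. inner_L2 L (dx L z) (dx L v) = inner_L2 L (dx L w) (dx L v)))"

end

theory Submission
  imports Defs
begin

text \<open>The error is compared with the Ritz projection: $u_h - u = \theta - \rho$ with
  $\rho = u - R_h u$ and $\theta = u_h - R_h u \in S_h$. Writing $\theta(t) = \theta(0) + \int_0^t \phi$ and testing the error equation
  with $w = I^\alpha \phi$ leaves $\langle \phi, w \rangle \le M (\|w\|^2 + E)$, where $E$ collects $\rho$, $\rho_t$ and $\theta(0)$. The kernel of $I^\alpha$ is a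
  superposition of exponentials $e^{-ls}$ with a positive density in $l$, and each exponential
  contributes the energy of a scalar ODE; hence, with the weight $e^{-2 \mu s}$ and $\mu$
  large, $\langle \phi, w \rangle$ dominates both $M \|w\|^2$ and $\|\int_0^t \phi\|^2$. In one space dimension the
  derivatives of the Ritz projection are the element averages of $u_x$, so elements of the finite
  element space and the equation can be handled through finitely many scalar functions of time.\<close>

text \<open>Two obstacles shape the argument. The solutions are only weakly differentiable in time
  with integrable derivative, so the coefficients of theta_t are at first merely integrable, while
  the energy argument needs them square integrable. Testing the discrete equation with theta_t
  itself repairs this: all norms on the finite element space are equivalent, and the mesh-dependent
  constant of that equivalence is used only qualitatively. Second, the fractional derivative of
  theta is the fractional integral of theta_t plus theta(0) times the singular kernel, and likewise
  for rho. This factor has to be square integrable in time, which is what \<alpha> > 1/2 provides;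
  it also brings the slopes of theta(0), hence its H^1 norm, into the bound. The constant does not
  see the mesh because coercivity is proved for scalar functions, with a constant depending only on
  \<alpha>, T and the bound on F, and a diagonalisation of the Gram matrix carries it over to any
  number of coefficients without loss.\<close>

abbreviation leb :: "real \<Rightarrow> real measure" where "leb X \<equiv> lebesgue_on {0<..<X}"
lemmas intc_B = Bochner_Integration.integral_cong
lemmas intz_B = Bochner_Integration.integral_zero
lemmas intb_B = Bochner_Integration.integrable_bound
lemmas inta_B = Bochner_Integration.integrable_add
lemmas ints_B = Bochner_Integration.integral_sum
abbreviation ivl :: "real => real => real measure" where "ivl a b \<equiv> lebesgue_on {a<..<b}"
abbreviation ind :: "'a set => 'a => 'b::zero_neq_one" where "ind \<equiv> indicator"
abbreviation bmf :: "'a measure => ('a => 'b::topological_space) set" where "bmf \<equiv> borel_measurable"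
abbreviation limseq :: "(nat => 'a::topological_space) => 'a => bool" ("((_)/ ----> (_))" [60, 60] 60) where "X ----> l \<equiv> X \<longlonglongrightarrow> l"
abbreviation ip :: "real \<Rightarrow> (real \<Rightarrow> real) \<Rightarrow> (real \<Rightarrow> real) \<Rightarrow> real" where "ip \<equiv> inner_L2"
abbreviation nrm :: "real \<Rightarrow> (real \<Rightarrow> real) \<Rightarrow> real" where "nrm \<equiv> norm_L2"

section \<open>Test functions\<close>

text \<open>The classical flat function exp(-1/x), with powers of 1/x attached because
  differentiation produces them: with these powers the family is closed under derivatives up to
  linear combinations.\<close>

definition flat_fun :: "nat => real => real" where
 "flat_fun m x = (if 0 < x then inverse x ^ m * exp (- inverse x) else 0)"

lemma flat_fun_nonpos [simp]: "x <= 0 ==> flat_fun m x = 0"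
 by (simp add: flat_fun_def)

lemma flat_fun_tendsto_0: "(flat_fun m \<longlongrightarrow> 0) (at_right 0)"
proof -
 have "((%x::real. x ^ m / exp x) \<longlongrightarrow> 0) at_top"
  by (rule tendsto_power_div_exp_0)
 hence "((%x::real. inverse x ^ m / exp (inverse x)) \<longlongrightarrow> 0) (at_right 0)"
  by (rule filterlim_compose[OF _ filterlim_inverse_at_top_right])
 moreover have "\<forall>\<^sub>F x in at_right 0. inverse x ^ m / exp (inverse x) = flat_fun m x"
  unfolding eventually_at_right_field
  by (intro exI[of _ 1]) (auto simp: flat_fun_def exp_minus divide_inverse)
 ultimately show ?thesis
  by (rule Lim_transform_eventually)
qed

lemma flat_fun_deriv:
 "(flat_fun m has_real_derivative (flat_fun (m + 2) x - real m * flat_fun (m + 1) x)) (at x)"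
proof (cases "x = 0")
 case True
 \<comment> \<open>Dividing by \<open>y\<close> only raises the exponent by one, so the right
   difference quotient at 0 is itself a flat function.\<close>
 have "((%y. flat_fun m y / y) \<longlongrightarrow> 0) (at_right 0)"
 proof (rule Lim_transform_eventually[OF flat_fun_tendsto_0[of "Suc m"]])
  show "\<forall>\<^sub>F y in at_right 0. flat_fun (Suc m) y = flat_fun m y / y"
   unfolding eventually_at_right_field
   by (intro exI[of _ 1]) (auto simp: flat_fun_def divide_inverse)
 qed
 moreover have "((%y. flat_fun m y / y) \<longlongrightarrow> 0) (at_left 0)"
  by (rule tendsto_eventually) (auto simp: eventually_at_left_field intro!: exI[of _ "-1"])
 ultimately have "((%y. flat_fun m y / y) \<longlongrightarrow> 0) (at 0)"
  by (simp add: filterlim_at_split)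
 thus ?thesis
  using True by (simp add: has_field_derivative_iff)
next
 case False
 consider "x > 0" | "x < 0" using False by linarith
 thus ?thesis
 proof cases
  case 1
  have "((%x. inverse x ^ m * exp (- inverse x)) has_real_derivative
    real m * (- (inverse x * 1 * inverse x) * inverse x ^ (m - Suc 0)) * exp (- inverse x)
     + exp (- inverse x) * (- (- (inverse x * 1 * inverse x))) * inverse x ^ m) (at x)"
   using 1
   by (intro DERIV_mult DERIV_power DERIV_inverse' DERIV_minus DERIV_chain2[OF DERIV_exp] DERIV_ident) auto
  also have "real m * (- (inverse x * 1 * inverse x) * inverse x ^ (m - Suc 0)) * exp (- inverse x)
     + exp (- inverse x) * (- (- (inverse x * 1 * inverse x))) * inverse x ^ m
    = flat_fun (m + 2) x - real m * flat_fun (m + 1) x"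
   using 1 by (cases m) (simp_all add: flat_fun_def algebra_simps power2_eq_square)
  finally have "((%x. inverse x ^ m * exp (- inverse x)) has_real_derivative
    (flat_fun (m + 2) x - real m * flat_fun (m + 1) x)) (at x)" .
  moreover have "\<forall>\<^sub>F y in nhds x. flat_fun m y = inverse y ^ m * exp (- inverse y)"
   using eventually_nhds_in_open[of "{0<..}" x] 1
   by (auto simp: flat_fun_def elim!: eventually_mono)
  ultimately show ?thesis
   by (subst DERIV_cong_ev[OF refl _ refl])
 next
  case 2
  have "((%x. 0) has_real_derivative
    (flat_fun (m + 2) x - real m * flat_fun (m + 1) x)) (at x)"
   using 2 by simp
  moreover have "\<forall>\<^sub>F y in nhds x. flat_fun m y = 0"
   using eventually_nhds_in_open[of "{..<0}" x] 2
   by (auto simp: flat_fun_def elim!: eventually_mono)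
  ultimately show ?thesis
   by (subst DERIV_cong_ev[OF refl _ refl])
 qed
qed

definition smooth :: "(real => real) => bool" where
 "smooth f \<longleftrightarrow> (\<forall>n x. (deriv ^^ n) f field_differentiable at x)"

text \<open>An algebra generated by flat functions of affine arguments. It is closed under
  differentiation, so every member is smooth and no formula for the higher derivatives of a product
  has to be written down.\<close>

inductive flat_alg :: "(real => real) => bool" where
 gen: "flat_alg (%x. flat_fun m (a * x + b))"
| const: "flat_alg (%x. c)"
| add: "flat_alg f ==> flat_alg g ==> flat_alg (%x. f x + g x)"
| mult: "flat_alg f ==> flat_alg g ==> flat_alg (%x. f x * g x)"

lemma flat_alg_deriv: "flat_alg f ==> \<exists>g. flat_alg g \<and> (\<forall>x. (f has_real_derivative g x) (at x))"
proof (induction rule: flat_alg.induct)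
 case (gen m a b)
 let ?g = "%x. a * flat_fun (m + 2) (a * x + b) + (- real m * a) * flat_fun (m + 1) (a * x + b)"
 have "flat_alg ?g"
  by (intro flat_alg.intros)
 moreover have "((%x. flat_fun m (a * x + b)) has_real_derivative ?g x) (at x)" for x
 proof -
  have "((%x. a * x + b) has_real_derivative a) (at x)"
   by (auto intro!: derivative_eq_intros)
  from DERIV_chain2[where f = "flat_fun m" and g = "%x. a * x + b", OF flat_fun_deriv this]
  show ?thesis by (simp add: algebra_simps)
 qed
 ultimately show ?case by blast
next
 case (const c)
 show ?case
  by (intro exI[of _ "%x. 0"]) (auto intro: flat_alg.const)
next
 case (add f g)
 then obtain f' g' where "flat_alg f'" "flat_alg g'"
  "!!x. (f has_real_derivative f' x) (at x)" "!!x. (g has_real_derivative g' x) (at x)"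
  by blast
 thus ?case
  by (intro exI[of _ "%x. f' x + g' x"]) (auto intro: flat_alg.add DERIV_add)
next
 case (mult f g)
 then obtain f' g' where *: "flat_alg f'" "flat_alg g'"
  "!!x. (f has_real_derivative f' x) (at x)" "!!x. (g has_real_derivative g' x) (at x)"
  by blast
 have "flat_alg (%x. f' x * g x + g' x * f x)"
  by (intro flat_alg.add flat_alg.mult * mult.hyps)
 thus ?case
  using * by (intro exI[of _ "%x. f' x * g x + g' x * f x"]) (auto intro: DERIV_mult)
qed

lemma flat_alg_smooth: assumes "flat_alg f" shows "smooth f"
proof -
 have alg: "flat_alg ((deriv ^^ n) f)" for n
 proof (induction n)
  case (Suc n)
  then obtain g where "flat_alg g" "!!x. ((deriv ^^ n) f has_real_derivative g x) (at x)"
   using flat_alg_deriv by blast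
  thus ?case
   using DERIV_imp_deriv by (metis ext comp_apply funpow.simps(2))
 qed (simp add: assms)
 show ?thesis
  unfolding smooth_def
  using flat_alg_deriv[OF alg] field_differentiable_def by blast
qed

lemma smooth_iff: "smooth f \<longleftrightarrow> (\<forall>x. f field_differentiable at x) \<and> smooth (deriv f)"
proof -
 have "(deriv ^^ n) (deriv f) = (deriv ^^ Suc n) f" for n
  by (simp add: funpow_swap1)
 hence "smooth (deriv f) \<longleftrightarrow> (\<forall>n x. (deriv ^^ Suc n) f field_differentiable at x)"
  by (simp add: smooth_def)
 moreover have "smooth f \<longleftrightarrow> (\<forall>x. (deriv ^^ 0) f field_differentiable at x) \<and>
   (\<forall>n x. (deriv ^^ Suc n) f field_differentiable at x)"
  unfolding smooth_def by (metis not0_implies_Suc)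
 ultimately show ?thesis by simp
qed

lemma smooth_linear:
 assumes "smooth f" "smooth g" shows "smooth (%x. a * f x + b * g x)"
proof -
 have d: "((%x. a * (deriv ^^ n) f x + b * (deriv ^^ n) g x) has_real_derivative
   (a * (deriv ^^ Suc n) f x + b * (deriv ^^ Suc n) g x)) (at x)" for n x
 proof -
  have "((deriv ^^ n) h has_real_derivative (deriv ^^ Suc n) h x) (at x)" if "smooth h" for h
   using that by (simp add: smooth_def field_differentiable_derivI)
  thus ?thesis
   using assms by (intro DERIV_add DERIV_cmult) auto
 qed
 have "(deriv ^^ n) (%x. a * f x + b * g x) = (%x. a * (deriv ^^ n) f x + b * (deriv ^^ n) g x)" for n
 proof (induction n)
  case (Suc n)
  show ?case
   using DERIV_imp_deriv[OF d[of n]] Suc by auto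
 qed simp
 thus ?thesis
  unfolding smooth_def using d field_differentiable_def by metis
qed

lemma smooth_DERIV: "smooth f ==> (f has_real_derivative deriv f x) (at x)"
 using smooth_iff field_differentiable_derivI by blast

lemma smooth_continuous: "smooth f ==> continuous_on S f"
 by (meson DERIV_isCont continuous_at_imp_continuous_on smooth_DERIV)

lemma test_fun_iff:
 "test_fun a b f \<longleftrightarrow> smooth f \<and> (\<exists>c d. a < c \<and> d < b \<and> (\<forall>x. x \<notin> {c..d} \<longrightarrow> f x = 0))"
 by (simp add: test_fun_def smooth_def)

lemma test_fun_smooth: "test_fun a b f ==> smooth f"
 by (simp add: test_fun_iff)

lemma test_fun_deriv: assumes "test_fun a b f" shows "test_fun a b (deriv f)"
proof -
 obtain c d where cd: "a < c" "d < b" "\<forall>x. x \<notin> {c..d} \<longrightarrow> f x = 0"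
  using assms by (auto simp: test_fun_iff)
 have "deriv f x = 0" if "x \<notin> {c..d}" for x
 proof -
  have "\<forall>\<^sub>F y in nhds x. f y = 0"
   using eventually_nhds_in_open[of "- {c..d}" x] that cd(3)
   by (auto elim!: eventually_mono simp: open_Compl)
  hence "deriv f x = deriv (%_. 0) x"
   by (intro deriv_cong_ev) auto
  thus ?thesis by simp
 qed
 moreover have "smooth (deriv f)"
  using assms smooth_iff[of f] by (simp add: test_fun_iff)
 ultimately show ?thesis
  using cd unfolding test_fun_iff by blast
qed

lemma test_fun_deriv_n: "test_fun a b f ==> test_fun a b ((deriv ^^ n) f)"
 by (induction n) (auto intro: test_fun_deriv)

lemma test_fun_linear:
 assumes "test_fun a b f" "test_fun a b g" shows "test_fun a b (%x. r * f x + s * g x)"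
proof -
 obtain c d where cd: "a < c" "d < b" "\<forall>x. x \<notin> {c..d} \<longrightarrow> f x = 0"
  using assms by (auto simp: test_fun_iff)
 obtain c' d' where cd': "a < c'" "d' < b" "\<forall>x. x \<notin> {c'..d'} \<longrightarrow> g x = 0"
  using assms by (auto simp: test_fun_iff)
 have "smooth (%x. r * f x + s * g x)"
  using assms by (intro smooth_linear) (auto simp: test_fun_iff)
 moreover have "r * f x + s * g x = 0" if "x \<notin> {min c c'..max d d'}" for x
 proof -
  have "x \<notin> {c..d}" "x \<notin> {c'..d'}" using that by auto
  thus ?thesis using cd(3) cd'(3) by simp
 qed
 moreover have "a < min c c'" "max d d' < b" using cd cd' by auto
 ultimately show ?thesis
  unfolding test_fun_iff by blast
qed

lemma test_fun_bounded: assumes "test_fun a b f" obtains B where "!!x. \<bar>f x\<bar> <= B" "0 <= B"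
proof -
 obtain c d where cd: "\<forall>x. x \<notin> {c..d} \<longrightarrow> f x = 0"
  using assms by (auto simp: test_fun_iff)
 have "compact (f ` {c..d})"
  using assms by (intro compact_continuous_image smooth_continuous test_fun_smooth) auto
 then obtain B where "\<forall>y\<in>f ` {c..d}. norm y <= B"
  using compact_imp_bounded bounded_iff by blast
 hence "\<bar>f x\<bar> <= max B 0" if "x : {c..d}" for x
  using that by (simp add: le_max_iff_disj)
 hence "\<bar>f x\<bar> <= max B 0" for x
  using cd by (cases "x : {c..d}") simp_all
 thus ?thesis
  using that[of "max B 0"] by simp
qed

lemma test_fun_borel [measurable_dest]: "test_fun a b f ==> f : bmf borel"
 using borel_measurable_continuous_onI smooth_continuous test_fun_smooth by blast

lemma test_fun_eq_0: "test_fun a b f ==> x <= a \<or> b <= x ==> f x = 0"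
 unfolding test_fun_iff by (metis atLeastAtMost_iff dual_order.strict_trans1 leD linorder_not_le)

text \<open>The approximants are products of two flat functions, one rising from each end and
  steeper as \<open>n\<close> grows. Pulling the support inwards by \<open>e n\<close> keeps it
  compact in the open interval even if \<open>c = a\<close> or \<open>d = b\<close>.\<close>

lemma indicator_test_fun_approx:
 fixes a b c d :: real
 assumes "a <= c" "c < d" "d <= b"
 shows "\<exists>\<phi>. (\<forall>n. test_fun a b (\<phi> n)) \<and> (\<forall>n x. 0 <= \<phi> n x \<and> \<phi> n x <= 1) \<and>
  (\<forall>x. (%n. \<phi> n x) ----> ind {c<..<d} x)"
proof -
 define e where "e n = (d - c) / (real n + 3)" for n
 have e0: "e n > 0" for n
  using assms by (simp add: e_def)
 have elim: "e ----> 0"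
 proof -
  have "(%n. inverse (real n)) ----> 0"
   by (rule lim_inverse_n)
  hence "(%n. inverse (real (n + 3))) ----> 0"
   by (rule LIMSEQ_ignore_initial_segment)
  hence "(%n. (d - c) * inverse (real (n + 3))) ----> (d - c) * 0"
   by (intro tendsto_mult tendsto_const)
  thus ?thesis
   by (simp add: e_def[abs_def] divide_inverse)
 qed
 define \<phi> where "\<phi> n x = flat_fun 0 (real n * (x - c - e n)) * flat_fun 0 (real n * (d - e n - x))" for n x
 have le1: "0 <= flat_fun 0 x \<and> flat_fun 0 x <= 1" for x
  by (auto simp: flat_fun_def)
 have "test_fun a b (\<phi> n)" for n
 proof -
  have "flat_alg (%x. flat_fun 0 (real n * x + (- real n * (c + e n))) * flat_fun 0 ((- real n) * x + real n * (d - e n)))"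
   by (intro flat_alg.intros)
  also have "(%x. flat_fun 0 (real n * x + (- real n * (c + e n))) * flat_fun 0 ((- real n) * x + real n * (d - e n))) = \<phi> n"
   unfolding \<phi>_def by (intro ext arg_cong2[where f = "(*)"] arg_cong[where f = "flat_fun 0"]) (simp_all add: algebra_simps)
  finally have "flat_alg (\<phi> n)" .
  moreover have "\<phi> n x = 0" if "x \<notin> {c + e n..d - e n}" for x
  proof -
   from that have "x - c - e n <= 0 \<or> d - e n - x <= 0" by auto
   thus ?thesis
    by (auto simp: \<phi>_def mult_nonneg_nonpos)
  qed
  moreover have "a < c + e n" "d - e n < b"
   using assms e0[of n] by auto
  ultimately show ?thesis
   unfolding test_fun_iff using flat_alg_smooth by blast
 qed
 moreover have "0 <= \<phi> n x \<and> \<phi> n x <= 1" for n x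
  using le1 by (auto simp: \<phi>_def intro!: mult_le_one)
 moreover have "(%n. \<phi> n x) ----> ind {c<..<d} x" for x
 proof (cases "x : {c<..<d}")
  case False
  hence "\<phi> n x = 0" for n
   using e0[of n] by (auto simp: \<phi>_def mult_nonneg_nonpos)
  thus ?thesis using False by simp
 next
  case True
  have key: "(%n. flat_fun 0 (real n * (y - e n))) ----> 1" if "y > 0" for y
  proof -
   have "filterlim (%n. (y - e n) * real n) at_top sequentially"
    by (rule filterlim_tendsto_pos_mult_at_top[where c = y])
     (use that elim in \<open>auto intro!: tendsto_eq_intros filterlim_real_sequentially\<close>)
   hence lim: "filterlim (%n. real n * (y - e n)) at_top sequentially"
    by (simp add: mult.commute)
   hence "(%n. exp (- inverse (real n * (y - e n)))) ----> exp (- 0)"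
    by (intro tendsto_exp tendsto_minus tendsto_inverse_0_at_top)
   moreover have "\<forall>\<^sub>F n in sequentially. exp (- inverse (real n * (y - e n))) = flat_fun 0 (real n * (y - e n))"
    using filterlim_at_top_dense[THEN iffD1, OF lim, rule_format, of 0]
    by eventually_elim (auto simp: flat_fun_def)
   ultimately show ?thesis
    by (auto intro: Lim_transform_eventually)
  qed
  have "(%n. flat_fun 0 (real n * (x - c - e n))) ----> 1"
   using key[of "x - c"] True by simp
  moreover have "(%n. flat_fun 0 (real n * (d - e n - x))) ----> 1"
  proof -
   have "d - e n - x = d - x - e n" for n by simp
   thus ?thesis
    using key[of "d - x"] True by (simp only: greaterThanLessThan_iff diff_gt_0_iff_gt)
  qed
  ultimately have "(%n. \<phi> n x) ----> 1 * 1"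
   unfolding \<phi>_def by (intro tendsto_mult)
  thus ?thesis using True by simp
 qed
 ultimately show ?thesis by blast
qed

section \<open>Lebesgue integrals over intervals\<close>

lemma AE_Ioo_iff:
 "(AE x in ivl a b. P x) \<longleftrightarrow> (AE x in lborel. x : {a<..<b} \<longrightarrow> P x)" for a b :: real
 by (subst AE_restrict_space_iff) (auto simp: AE_completion_iff)

lemma AE_Ioo_mono_set:
 fixes a b :: real
 assumes "AE x in ivl a b. P x" "{c<..<d} \<subseteq> {a<..<b}"
 shows "AE x in lebesgue_on {c<..<d}. P x"
 using assms(1) unfolding AE_Ioo_iff by eventually_elim (use assms(2) in auto)

lemma borel_measurable_Ioo: "f : bmf borel ==> f : bmf (ivl a b)"
 for f :: "real => real"
 by (simp add: measurable_completion measurable_restrict_space1)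

lemma integrable_Ioo_iff:
 fixes f :: "real => real"
 assumes "f : bmf borel"
 shows "integrable (ivl a b) f \<longleftrightarrow> integrable lborel (%x. ind {a<..<b} x * f x)"
proof -
 have [measurable]: "f : bmf borel" by fact
 have "integrable (ivl a b) f \<longleftrightarrow> integrable lebesgue (%x. ind {a<..<b} x *\<^sub>R f x)"
  by (rule integrable_restrict_space) simp
 also have "... \<longleftrightarrow> integrable lborel (%x. ind {a<..<b} x *\<^sub>R f x)"
  by (rule integrable_completion) simp
 finally show ?thesis by simp
qed

lemma integral_Ioo_eq:
 fixes f :: "real => real"
 assumes "f : bmf borel"
 shows "(LINT x|ivl a b. f x) = (LBINT x. ind {a<..<b} x * f x)"
proof -
 have [measurable]: "f : bmf borel" by fact
 have "(LINT x|ivl a b. f x) = (LINT x|lebesgue. ind {a<..<b} x *\<^sub>R f x)"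
  by (rule integral_restrict_space) simp
 also have "... = (LBINT x. ind {a<..<b} x *\<^sub>R f x)"
  by (rule integral_completion) simp
 finally show ?thesis by simp
qed

text \<open>Fubini and the affine substitutions are carried out on \<open>lborel\<close>, while
  elements of the function spaces are only Lebesgue measurable on an interval. The representative
  vanishes outside the interval, so integrals over the interval become integrals over the
  line.\<close>

lemma borel_representative:
 fixes f :: "real => real"
 assumes "f : bmf (ivl a b)"
 obtains f' where "f' : bmf borel" "!!x. x \<notin> {a<..<b} ==> f' x = 0"
  "AE x in ivl a b. f x = f' x"
proof -
 let ?h = "%x. if x : {a<..<b} then f x else 0"
 have "?h : bmf lebesgue"
  using assms by (subst borel_measurable_if) auto
 then obtain g where g: "g : bmf lborel" "AE x in lborel. ?h x = g x"
  using completion_ex_borel_measurable_real by blast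
 have [measurable]: "g : bmf borel" using g(1) by simp
 show ?thesis
 proof
  show "(%x. ind {a<..<b} x * g x) : bmf borel" by measurable
  show "AE x in ivl a b. f x = ind {a<..<b} x * g x"
   unfolding AE_Ioo_iff using g(2) by eventually_elim auto
 qed auto
qed

lemma integrable_borel_representative:
 fixes f :: "real => real"
 assumes "integrable (ivl a b) f"
 obtains f' where "f' : bmf borel" "!!x. x \<notin> {a<..<b} ==> f' x = 0"
  "AE x in ivl a b. f x = f' x" "integrable lborel f'"
proof -
 obtain f' where f': "f' : bmf borel" "!!x. x \<notin> {a<..<b} ==> f' x = 0"
  "AE x in ivl a b. f x = f' x"
  using borel_representative assms by (metis borel_measurable_integrable)
 have "integrable (ivl a b) f'"
 proof (rule integrable_cong_AE_imp[OF assms])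
  show "f' : bmf (ivl a b)"
   by (rule borel_measurable_Ioo) fact
  show "AE x in ivl a b. f x = f' x"
   by (rule f'(3))
 qed
 moreover have "(%x. ind {a<..<b} x * f' x) = f'"
 proof
  fix x show "ind {a<..<b} x * f' x = f' x"
   by (cases "x : {a<..<b}") (simp_all add: f'(2))
 qed
 ultimately have "integrable lborel f'"
  by (simp add: integrable_Ioo_iff f'(1))
 with f' that show ?thesis by blast
qed

text \<open>This rests on the completeness of Lebesgue measure. It allows any function that agrees
  almost everywhere with a measurable one to take its place.\<close>

lemma measurable_AE_lebesgue_on:
 fixes f g :: "real => real"
 assumes "f : bmf (ivl a b)" "AE x in ivl a b. f x = g x"
 shows "g : bmf (ivl a b)"
proof -
 have "(%x. if x : {a<..<b} then f x else 0) : bmf lebesgue"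
  using assms(1) by (subst borel_measurable_if) auto
 moreover have "AE x in lebesgue. (if x : {a<..<b} then f x else 0) = (if x : {a<..<b} then g x else 0)"
  using assms(2) unfolding AE_Ioo_iff AE_completion_iff by eventually_elim auto
 ultimately have "(%x. if x : {a<..<b} then g x else 0) : bmf lebesgue"
  by (rule borel_measurable_AE)
 thus ?thesis
  by (subst (asm) borel_measurable_if) auto
qed

lemma integrable_const_Ioo: "integrable (ivl a b) (%x. c :: real)" for a b :: real
proof -
 have "finite_measure (ivl a b)"
  by (rule finite_measure_lebesgue_on) simp
 thus ?thesis by (rule finite_measure.integrable_const)
qed

section \<open>Criteria for a function to vanish almost everywhere\<close>

text \<open>A Dynkin system argument: half-lines are stable under intersection and generate the
  Borel sets, and the sets over which the integral vanishes are closed under complements and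
  countable disjoint unions.\<close>

lemma AE_zero_if_lborel_integrals_zero:
 fixes f :: "real => real"
 assumes f: "integrable lborel f" and z: "!!c. (LBINT x. ind {..c} x * f x) = 0"
 shows "AE x in lborel. f x = 0"
proof -
 have ii: "integrable lborel (%x. ind A x * f x)" if "A : sets borel" for A
  using integrable_mult_indicator[OF _ f, of A] that by simp
 \<comment> \<open>The complement step below subtracts from the integral over the whole line, which
   is a limit of half-lines.\<close>
 have total: "(LBINT x. f x) = 0"
 proof -
  have "(%n. \<integral>x. ind {..real n} x * f x \<partial>lborel) ----> (LBINT x. f x)"
  proof (rule integral_dominated_convergence[where w = "%x. \<bar>f x\<bar>"])
   show "AE x in lborel. (%n. ind {..real n} x * f x) ----> f x"
   proof (rule AE_I2)
    fix x
    have "\<forall>\<^sub>F n in sequentially. x <= real n"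
     using filterlim_real_sequentially by (simp add: filterlim_at_top)
    thus "(%n. ind {..real n} x * f x) ----> f x"
     by (intro tendsto_eventually, eventually_elim) simp
   qed
  qed (use f ii in \<open>auto simp: indicator_def\<close>)
  hence "(%n::nat. 0) ----> (LBINT x. f x)"
   by (simp only: z)
  thus ?thesis
   using LIMSEQ_unique tendsto_const by blast
 qed
 have "(LBINT x. ind A x * f x) = 0" if A: "A : sets borel" for A
 proof -
  have b: "sets borel = sigma_sets UNIV (range (%a::real. {..a}))"
   by (subst borel_eq_atMost) simp
  have sb: "B : sets borel" if "B : sigma_sets UNIV (range (%a::real. {..a}))" for B
   using that by (simp add: b)
  have int: "Int_stable (range (%a::real. {..a}))"
   unfolding Int_stable_def
  proof (intro ballI)
   fix A B :: "real set" assume "A : range atMost" "B : range atMost"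
   then obtain a b where "A = {..a}" "B = {..b}" by blast
   hence "A \<inter> B = {..min a b}" by auto
   thus "A \<inter> B : range atMost" by blast
  qed
  have "range (%a::real. {..a}) \<subseteq> Pow UNIV" by simp
  moreover have "A : sigma_sets UNIV (range (%a::real. {..a}))"
   using A by (simp add: b)
  ultimately show ?thesis
  proof (induction rule: sigma_sets_induct_disjoint[OF int, consumes 2, case_names basic empty compl union])
   case (basic A)
   thus ?case using z by auto
  next
   case (compl A)
   have "(LBINT x. ind (UNIV - A) x * f x) = (LBINT x. f x - ind A x * f x)"
    by (intro intc_B) (auto simp: indicator_def)
   also have "... = 0"
    using compl total ii[OF sb[OF compl(1)]] f by simp
   finally show ?case .
  next
   case (union A)
   have "(%n. \<integral>x. ind (\<Union>i<n. A i) x * f x \<partial>lborel) ----> (LBINT x. ind (\<Union>i. A i) x * f x)"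
   proof (rule integral_dominated_convergence[where w = "%x. \<bar>f x\<bar>"])
    show "AE x in lborel. (%n. ind (\<Union>i<n. A i) x * f x) ----> ind (\<Union>i. A i) x * f x"
     by (intro AE_I2 tendsto_mult tendsto_const LIMSEQ_indicator_UN)
    have [measurable]: "A i : sets borel" for i using union(2) sb by auto
    have [measurable]: "f : bmf borel" using f by auto
    show "(%x. ind (\<Union>i. A i) x * f x) : bmf lborel" by measurable
    show "(%x. ind (\<Union>i<n. A i) x * f x) : bmf lborel" for n by measurable
   qed (use f in \<open>auto simp: indicator_def\<close>)
   moreover have "(LBINT x. ind (\<Union>i<n. A i) x * f x) = 0" for n
   proof (induction n)
    case (Suc n)
    have "(LBINT x. ind (\<Union>i<Suc n. A i) x * f x)
      = (LBINT x. ind (\<Union>i<n. A i) x * f x + ind (A n) x * f x)"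
    proof (intro intc_B refl)
     fix x
     have "A n \<inter> A i = {}" if "i < n" for i
      using union(1) that by (simp add: disjoint_family_on_def)
     hence "A n \<inter> (\<Union>i<n. A i) = {}" by blast
     thus "ind (\<Union>i<Suc n. A i) x * f x = ind (\<Union>i<n. A i) x * f x + ind (A n) x * f x"
      by (auto simp: indicator_def lessThan_Suc)
    qed
    also have "... = 0"
     using union(2,3) sb Suc by (subst Bochner_Integration.integral_add) (auto intro!: ii)
    finally show ?case .
   qed simp
   ultimately have "(%n::nat. 0) ----> (LBINT x. ind (\<Union>i. A i) x * f x)"
    by simp
   thus ?case
    using LIMSEQ_unique tendsto_const by blast
  qed simp
 qed
 thus ?thesis
  by (intro sigma_finite_measure.density_zero[OF lborel.sigma_finite_measure_axioms] f) (auto simp: set_lebesgue_integral_def)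
qed

lemma exists_rat_sequence_below:
 fixes a c :: real assumes "a < c"
 obtains q :: "nat => real" where "!!n. q n : \<rat>" "!!n. a < q n" "!!n. q n < c" "q ----> c"
proof -
 have "\<exists>r\<in>\<rat>. max a (c - 1 / Suc n) < r \<and> r < c" for n
  using assms by (intro Rats_dense_in_real) auto
 then obtain q where q: "!!n. q n : \<rat>" "!!n. max a (c - 1 / Suc n) < q n" "!!n. q n < c"
  by metis
 have "(%n. c - 1 / Suc n) ----> c - 0"
  by (intro tendsto_diff tendsto_const LIMSEQ_Suc lim_1_over_n)
 hence lim: "(%n. c - 1 / Suc n) ----> c" by simp
 have "c - 1 / Suc n <= q n" "q n <= c" "a < q n" for n
  using q(2)[of n] q(3)[of n] by linarith+
 hence "q ----> c"
  by (intro tendsto_sandwich[OF _ _ lim tendsto_const[of c]] always_eventually allI)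
 with q(1,3) \<open>!!n. a < q n\<close> that show ?thesis by blast
qed

text \<open>Only rational endpoints are tested. The criterion is later applied to the values of a
  function of time, where each test costs a null set of times and only countably many such sets may
  be united.\<close>

lemma AE_zero_if_integrals_zero:
 fixes f :: "real => real"
 assumes f: "integrable (ivl a b) f"
  and z: "!!q. q : \<rat> ==> a < q ==> q < b ==> (LINT x|ivl a b. ind {a<..<q} x * f x) = 0"
 shows "AE x in ivl a b. f x = 0"
proof -
 obtain f' where f': "f' : bmf borel" "!!x. x \<notin> {a<..<b} ==> f' x = 0"
  "AE x in ivl a b. f x = f' x" "integrable lborel f'"
  using integrable_borel_representative[OF f] by blast
 have [measurable]: "f' : bmf borel" by fact
 have fm: "f : bmf (ivl a b)" using f by auto
 have q0: "(LBINT x. ind {..<q} x * f' x) = 0" if "q : \<rat>" "a < q" "q < b" for q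
 proof -
  have "(LBINT x. ind {..<q} x * f' x) = (LBINT x. ind {a<..<b} x * (ind {a<..<q} x * f' x))"
  proof (intro intc_B refl)
   fix x show "ind {..<q} x * f' x = ind {a<..<b} x * (ind {a<..<q} x * f' x)"
    using f'(2)[of x] that by (cases "x : {a<..<b}") (simp_all add: indicator_def)
  qed
  also have "... = (LINT x|ivl a b. ind {a<..<q} x * f' x)"
   by (subst integral_Ioo_eq) auto
  also have "... = (LINT x|ivl a b. ind {a<..<q} x * f x)"
  proof (rule integral_cong_AE)
   show "AE x in ivl a b. ind {a<..<q} x * f' x = ind {a<..<q} x * f x"
    using f'(3) by eventually_elim auto
   have "(ind {a<..<q} :: real => real) : bmf (ivl a b)"
    by (rule borel_measurable_Ioo) auto
   thus "(%x. ind {a<..<q} x * f x) : bmf (ivl a b)"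
    using fm by (rule borel_measurable_times)
   show "(%x. ind {a<..<q} x * f' x) : bmf (ivl a b)"
    by (rule borel_measurable_Ioo) auto
  qed
  finally show ?thesis using z that by simp
 qed
 have c0: "(LBINT x. ind {..<c} x * f' x) = 0" if "a < c" "c <= b" for c
 proof -
  obtain q :: "nat => real" where q: "!!n. q n : \<rat>" "!!n. a < q n" "!!n. q n < c" "q ----> c"
   using exists_rat_sequence_below[OF \<open>a < c\<close>] by blast
  have "(%n. \<integral>x. ind {..<q n} x * f' x \<partial>lborel) ----> (LBINT x. ind {..<c} x * f' x)"
  proof (rule integral_dominated_convergence[where w = "%x. \<bar>f' x\<bar>"])
   show "AE x in lborel. (%n. ind {..<q n} x * f' x) ----> ind {..<c} x * f' x"
   proof (rule AE_I2)
    fix x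
    have "\<forall>\<^sub>F n in sequentially. ind {..<q n} x * f' x = ind {..<c} x * f' x"
    proof (cases "x < c")
     case True
     thus ?thesis
      by (intro eventually_mono[OF order_tendstoD(1)[OF q(4) True]]) (simp add: True)
    next
     case False
     hence "\<not> x < q n" for n using q(3)[of n] by simp
     thus ?thesis using False by simp
    qed
    thus "(%n. ind {..<q n} x * f' x) ----> ind {..<c} x * f' x"
     by (rule tendsto_eventually)
   qed
  qed (use f'(4) in \<open>auto simp: indicator_def\<close>)
  moreover have "(LBINT x. ind {..<q n} x * f' x) = 0" for n
   using q0 q that by (meson less_le_trans)
  ultimately have "(%n::nat. 0) ----> (LBINT x. ind {..<c} x * f' x)"
   by simp
  thus ?thesis
   using LIMSEQ_unique tendsto_const by blast
 qed
 have "AE x in lborel. f' x = 0"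
 proof (rule AE_zero_if_lborel_integrals_zero[OF f'(4)])
  fix c
  consider "c <= a" | "a < c" "c < b" | "a < b" "b <= c" | "b <= a" by linarith
  thus "(LBINT x. ind {..c} x * f' x) = 0"
  proof cases
   case 1
   hence "ind {..c} x * f' x = 0" for x using f'(2)[of x] by (auto simp: indicator_def)
   thus ?thesis by (simp only: intz_B)
  next
   case 4
   hence "ind {..c} x * f' x = 0" for x using f'(2)[of x] by (auto simp: indicator_def)
   thus ?thesis by (simp only: intz_B)
  next
   case 2
   have "(LBINT x. ind {..c} x * f' x) = (LBINT x. ind {..<c} x * f' x)"
   proof (rule integral_cong_AE)
    have "AE x in lborel. x \<noteq> c" by (rule AE_lborel_singleton)
    thus "AE x in lborel. ind {..c} x * f' x = ind {..<c} x * f' x"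
     by eventually_elim (auto simp: indicator_def)
   qed measurable
   thus ?thesis using c0 2 by simp
  next
   case 3
   have "(%x. ind {..c} x * f' x) = (%x. ind {..<b} x * f' x)"
   proof
    fix x show "ind {..c} x * f' x = ind {..<b} x * f' x"
     using f'(2)[of x] 3 by (auto simp: indicator_def)
   qed
   thus ?thesis using c0[of b] 3 by simp
  qed
 qed
 hence "AE x in ivl a b. f' x = 0"
  unfolding AE_Ioo_iff by eventually_elim auto
 with f'(3) show ?thesis by eventually_elim auto
qed

lemma integrable_bounded_mult:
 fixes f g :: "'a => real"
 assumes "integrable M f" "g : bmf M" "!!x. \<bar>g x\<bar> <= B"
 shows "integrable M (%x. f x * g x)" "integrable M (%x. g x * f x)"
proof -
 show "integrable M (%x. f x * g x)"
 proof (rule intb_B)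
  show "integrable M (%x. B * \<bar>f x\<bar>)" using assms(1) by auto
  show "AE x in M. norm (f x * g x) <= norm (B * \<bar>f x\<bar>)"
  proof (rule AE_I2)
   fix x
   have "\<bar>f x\<bar> * \<bar>g x\<bar> <= \<bar>f x\<bar> * B" using assms(3)[of x] by (intro mult_left_mono) auto
   also have "... <= \<bar>B * \<bar>f x\<bar>\<bar>" by (simp add: mult.commute)
   finally show "norm (f x * g x) <= norm (B * \<bar>f x\<bar>)" by (simp add: abs_mult)
  qed
 qed (use assms in auto)
 thus "integrable M (%x. g x * f x)" by (simp add: mult.commute)
qed

lemma integrable_mult_test_fun:
 assumes "integrable (ivl a b) f" "test_fun c d \<phi>"
 shows "integrable (ivl a b) (%x. f x * \<phi> x)"
proof -
 obtain B where "!!x. \<bar>\<phi> x\<bar> <= B" using test_fun_bounded[OF assms(2)] by blast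
 thus ?thesis
  using assms by (intro integrable_bounded_mult) (auto intro: borel_measurable_Ioo test_fun_borel)
qed

text \<open>Test functions converge boundedly to the indicators of the intervals in the preceding
  criterion, so dominated convergence transfers the hypothesis to these indicators.\<close>

theorem fundamental_lemma:
 fixes f :: "real => real"
 assumes f: "integrable (ivl a b) f"
  and z: "!!\<phi>. test_fun a b \<phi> ==> (LINT x|ivl a b. f x * \<phi> x) = 0"
 shows "AE x in ivl a b. f x = 0"
proof (rule AE_zero_if_integrals_zero[OF f])
 fix q :: real assume q: "a < q" "q < b"
 obtain \<phi> where \<phi>: "!!n. test_fun a b (\<phi> n)" "!!n x. 0 <= \<phi> n x \<and> \<phi> n x <= 1"
  "!!x. (%n. \<phi> n x) ----> ind {a<..<q} x"
  using indicator_test_fun_approx[of a a q b] q by (metis less_imp_le order_refl)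
 have [measurable]: "f : bmf (ivl a b)" using f by auto
 have "(%n. \<integral>x. f x * \<phi> n x \<partial>ivl a b) ----> (LINT x|ivl a b. f x * ind {a<..<q} x)"
 proof (rule integral_dominated_convergence[where w = "%x. \<bar>f x\<bar>"])
  show "AE x in ivl a b. (%n. f x * \<phi> n x) ----> f x * ind {a<..<q} x"
   using \<phi>(3) by (intro AE_I2 tendsto_mult tendsto_const)
  show "AE x in ivl a b. norm (f x * \<phi> n x) <= \<bar>f x\<bar>" for n
  proof (rule AE_I2)
   fix x
   have "\<bar>f x\<bar> * \<bar>\<phi> n x\<bar> <= \<bar>f x\<bar> * 1" using \<phi>(2)[of n x] by (intro mult_left_mono) auto
   thus "norm (f x * \<phi> n x) <= \<bar>f x\<bar>" by (simp add: abs_mult)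
  qed
  show "(%x. f x * \<phi> n x) : bmf (ivl a b)" for n
   using integrable_mult_test_fun[OF f \<phi>(1)] by auto
  have "(ind {a<..<q} :: real => real) : bmf (ivl a b)"
   by (rule borel_measurable_Ioo) auto
  thus "(%x. f x * ind {a<..<q} x) : bmf (ivl a b)"
   by measurable
 qed (use f in auto)
 hence "(%n::nat. 0) ----> (LINT x|ivl a b. f x * ind {a<..<q} x)"
  by (simp only: z[OF \<phi>(1)])
 hence "(LINT x|ivl a b. f x * ind {a<..<q} x) = 0"
  using LIMSEQ_unique tendsto_const by blast
 thus "(LINT x|ivl a b. ind {a<..<q} x * f x) = 0"
  by (simp add: mult.commute)
qed

section \<open>Primitives and the lemma of du Bois-Reymond\<close>

text \<open>The integration range is the part of the interval below \<open>x\<close>, so the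
  primitive is defined and continuous on the whole line, is 0 to the left and constant to the right
  of the interval. It serves in space with end point \<open>L\<close> and in time with end point
  \<open>T\<close>.\<close>

definition prim :: "real => (real => real) => real => real" where
 "prim L g x = (LINT y|leb L. ind {0<..<x} y * g y)"

lemma prim_cong_AE:
 assumes "g : bmf (leb L)" "AE x in leb L. g x = g' x"
 shows "prim L g x = prim L g' x"
proof -
 have m: "g' : bmf (leb L)"
  using measurable_AE_lebesgue_on assms by blast
 have i: "(ind {0<..<x} :: real => real) : bmf (leb L)"
  by (rule borel_measurable_Ioo) auto
 show ?thesis
  unfolding prim_def
  by (rule integral_cong_AE) (use assms m i in auto)
qed

lemma prim_integrable:
 fixes g :: "real => real"
 assumes "integrable (leb L) g"
 shows "integrable (leb L) (%y. ind {0<..<x} y * g y)"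
 by (rule integrable_bounded_mult(2)[OF assms, where B = 1])
  (auto intro: borel_measurable_Ioo simp: indicator_def)

lemma prim_bound:
 assumes "integrable (leb L) g"
 shows "\<bar>prim L g x\<bar> <= (LINT y|leb L. \<bar>g y\<bar>)"
proof -
 have "\<bar>prim L g x\<bar> <= (LINT y|leb L. \<bar>ind {0<..<x} y * g y\<bar>)"
  unfolding prim_def by (rule integral_abs_bound)
 also have "... <= (LINT y|leb L. \<bar>g y\<bar>)"
  using assms prim_integrable[OF assms] by (intro integral_mono) (auto simp: indicator_def)
 finally show ?thesis .
qed

lemma prim_borel_eq:
 fixes g :: "real => real"
 assumes "g : bmf borel" "!!x. x \<notin> {0<..<L} ==> g x = 0"
 shows "prim L g x = (LBINT y. ind {..<x} y * g y)"
proof -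
 have [measurable]: "g : bmf borel" by fact
 have "prim L g x = (LBINT y. ind {0<..<L} y * (ind {0<..<x} y * g y))"
  unfolding prim_def by (rule integral_Ioo_eq) auto
 also have "... = (LBINT y. ind {..<x} y * g y)"
 proof (intro intc_B refl)
  fix y show "ind {0<..<L} y * (ind {0<..<x} y * g y) = ind {..<x} y * g y"
   using assms(2)[of y] by (cases "y : {0<..<L}") (simp_all add: indicator_def)
 qed
 finally show ?thesis .
qed

lemma prim_continuous:
 assumes "integrable (leb L) g"
 shows "continuous_on UNIV (prim L g)"
proof -
 obtain g' where g': "g' : bmf borel" "!!x. x \<notin> {0<..<L} ==> g' x = 0"
  "AE x in leb L. g x = g' x" "integrable lborel g'"
  using integrable_borel_representative[OF assms] by blast
 have [measurable]: "g' : bmf borel" by fact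
 have eq: "prim L g x = (LBINT y. ind {..<x} y * g' y)" for x
  using prim_cong_AE[of g L g' x] prim_borel_eq[of g' L x] g' assms by auto
 have "(%n. prim L g (s n)) ----> prim L g x" if "s ----> x" for s x
  unfolding eq
 proof (rule integral_dominated_convergence[where w = "%x. \<bar>g' x\<bar>"])
  have "AE y in lborel. y \<noteq> x" by (rule AE_lborel_singleton)
  thus "AE y in lborel. (%n. ind {..<s n} y * g' y) ----> ind {..<x} y * g' y"
  proof eventually_elim
   case (elim y)
   then consider "y < x" | "y > x" by linarith
   hence "\<forall>\<^sub>F n in sequentially. ind {..<s n} y * g' y = ind {..<x} y * g' y"
   proof cases
    case 1
    show ?thesis by (intro eventually_mono[OF order_tendstoD(1)[OF that 1]]) (simp add: 1)
   next
    case 2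
    show ?thesis by (intro eventually_mono[OF order_tendstoD(2)[OF that 2]]) (use 2 in simp)
   qed
   thus ?case by (rule tendsto_eventually)
  qed
 qed (use g'(4) in \<open>auto simp: indicator_def\<close>)
 thus ?thesis
  by (simp add: continuous_on_sequentially comp_def)
qed

lemma integrable_lborel_product:
 fixes f g :: "real => real"
 assumes f: "integrable lborel f" and g: "integrable lborel g"
 shows "integrable (lborel \<Otimes>\<^sub>M lborel) (%(x, y). f x * g y)"
proof (rule lborel_pair.Fubini_integrable)
 have [measurable]: "f : bmf borel" "g : bmf borel"
  using f g by auto
 show "(%(x, y). f x * g y) : bmf (lborel \<Otimes>\<^sub>M lborel)"
  by measurable
 show "integrable lborel (%x. \<integral>y. norm (case (x, y) of (x, y) => f x * g y) \<partial>lborel)"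
  using f by (simp add: abs_mult)
 show "AE x in lborel. integrable lborel (%y. case (x, y) of (x, y) => f x * g y)"
  using g by simp
qed

text \<open>Integration by parts when \<open>g\<close> is merely integrable: Fubini on the triangle
  below the diagonal leaves an inner integral of \<open>deriv \<phi>\<close> alone, which the
  fundamental theorem evaluates.\<close>

lemma test_fun_prim_mult:
 assumes g: "integrable (leb L) g" and \<phi>: "test_fun 0 L \<phi>"
 shows "(LINT x|leb L. prim L g x * deriv \<phi> x) = - (LINT x|leb L. g x * \<phi> x)"
proof -
 obtain g' where g': "g' : bmf borel" "!!x. x \<notin> {0<..<L} ==> g' x = 0"
  "AE x in leb L. g x = g' x" "integrable lborel g'"
  using integrable_borel_representative[OF g] by blast
 have [measurable]: "g' : bmf borel" by fact
 have \<phi>': "test_fun 0 L (deriv \<phi>)" by (rule test_fun_deriv[OF \<phi>])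
 have [measurable]: "\<phi> : bmf borel" "deriv \<phi> : bmf borel"
  using \<phi> \<phi>' by (auto intro: test_fun_borel)
 obtain B where B: "!!x. \<bar>deriv \<phi> x\<bar> <= B" "0 <= B" using test_fun_bounded[OF \<phi>'] by blast
 have z: "\<phi> x = 0" "deriv \<phi> x = 0" if "x <= 0 \<or> L <= x" for x
  using test_fun_eq_0[OF \<phi>] test_fun_eq_0[OF \<phi>'] that by auto
 have i2: "integrable lborel (%x. deriv \<phi> x)"
 proof -
  have "integrable (leb L) (%x. 1 * deriv \<phi> x)"
   by (rule integrable_mult_test_fun[OF _ \<phi>']) (rule integrable_const_Ioo)
  hence "integrable lborel (%x. ind {0<..<L} x * (deriv \<phi> x))"
   by (simp add: integrable_Ioo_iff)
  also have "(%x. ind {0<..<L} x * (deriv \<phi> x)) = deriv \<phi>"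
  proof
   fix x show "ind {0<..<L} x * (deriv \<phi> x) = deriv \<phi> x"
    using z(2)[of x] by (cases "x : {0<..<L}") (auto simp: not_less)
  qed
  finally show ?thesis .
 qed
 have eq: "prim L g x = (LBINT y. ind {..<x} y * g' y)" for x
  using prim_cong_AE[of g L g' x] prim_borel_eq[of g' L x] g' g by auto
 have int: "integrable (lborel \<Otimes>\<^sub>M lborel) (%(x, y). (deriv \<phi> x * g' y) * ind {..<x} y)"
 proof -
  have "integrable (lborel \<Otimes>\<^sub>M lborel) (%(x, y). deriv \<phi> x * g' y)"
   by (rule integrable_lborel_product[OF i2 g'(4)])
  moreover have "(%(x::real, y). (deriv \<phi> x * g' y) * ind {..<x} y) : bmf (lborel \<Otimes>\<^sub>M lborel)"
  proof -
   have "Measurable.pred (borel \<Otimes>\<^sub>M borel) (%p::real\<times>real. snd p < fst p)"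
    by measurable
   hence [measurable]: "{p::real\<times>real. snd p < fst p} : sets (borel \<Otimes>\<^sub>M borel)"
    by (simp add: pred_def space_pair_measure)
   have "(%(x::real, y). (deriv \<phi> x * g' y) * ind {..<x} y) = (%p. (deriv \<phi> (fst p) * g' (snd p)) * ind {p. snd p < fst p} p)"
    by (auto simp: indicator_def)
   thus ?thesis by simp
  qed
  ultimately show ?thesis
   by (rule intb_B) (auto simp: indicator_def)
 qed
 \<comment> \<open>The range runs from \<open>y\<close> to \<open>L\<close>, beyond which
   \<open>deriv \<phi>\<close> vanishes. Writing \<open>max y L\<close> covers points
   \<open>y\<close> to the right of \<open>L\<close>, where both sides are 0.\<close>
 have inner: "(LBINT x. (deriv \<phi> x * g' y) * ind {..<x} y) = - (g' y * \<phi> y)" for y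
 proof -
  have "(LBINT x. deriv \<phi> x * ind {y..max y L} x) = \<phi> (max y L) - \<phi> y"
   by (rule integral_FTC_Icc_real)
    (use smooth_DERIV[OF test_fun_smooth[OF \<phi>]] DERIV_isCont[OF smooth_DERIV[OF test_fun_smooth[OF \<phi>']]] in auto)
  moreover have "(LBINT x. (deriv \<phi> x * g' y) * ind {..<x} y) = g' y * (LBINT x. deriv \<phi> x * ind {y..max y L} x)"
  proof -
   have "(LBINT x. (deriv \<phi> x * g' y) * ind {..<x} y) = (LBINT x. g' y * (deriv \<phi> x * ind {y..max y L} x))"
   proof (rule integral_cong_AE)
    have "AE x in lborel. x \<noteq> y" by (rule AE_lborel_singleton)
    thus "AE x in lborel. (deriv \<phi> x * g' y) * ind {..<x} y = g' y * (deriv \<phi> x * ind {y..max y L} x)"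
    proof eventually_elim
     case (elim x)
     thus ?case
      using z(2)[of x] by (cases "L <= x") (simp_all add: indicator_def)
    qed
    have [measurable]: "{x. y < x} : sets borel" by measurable
    have "(%x. (deriv \<phi> x * g' y) * ind {..<x} y) = (%x. (deriv \<phi> x * g' y) * ind {x. y < x} x)"
     by (auto simp: indicator_def)
    thus "(%x. (deriv \<phi> x * g' y) * ind {..<x} y) : bmf lborel"
     by simp
   qed measurable
   thus ?thesis by simp
  qed
  ultimately show ?thesis using z(1)[of "max y L"] by auto
 qed
 have "(LINT x|leb L. prim L g x * deriv \<phi> x) = (LBINT x. prim L g x * deriv \<phi> x)"
 proof (subst integral_Ioo_eq)
  show "(%x. prim L g x * deriv \<phi> x) : bmf borel"
   using borel_measurable_continuous_onI[OF prim_continuous[OF g]] by measurable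
  show "(LBINT x. ind {0<..<L} x * (prim L g x * deriv \<phi> x)) = (LBINT x. prim L g x * deriv \<phi> x)"
  proof (intro intc_B refl)
   fix x show "ind {0<..<L} x * (prim L g x * deriv \<phi> x) = prim L g x * deriv \<phi> x"
    using z(2)[of x] by (cases "x : {0<..<L}") (auto simp: not_less)
  qed
 qed
 also have "... = (LBINT x. (LBINT y. (deriv \<phi> x * g' y) * ind {..<x} y))"
  unfolding eq by (intro intc_B refl) (simp add: mult_ac flip: Bochner_Integration.integral_mult_right_zero)
 also have "... = (LBINT y. (LBINT x. (deriv \<phi> x * g' y) * ind {..<x} y))"
  using lborel_pair.Fubini_integral[OF int] by simp
 also have "... = - (LBINT y. g' y * \<phi> y)"
  unfolding inner by simp
 also have "(LBINT y. g' y * \<phi> y) = (LINT y|leb L. g' y * \<phi> y)"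
 proof (subst integral_Ioo_eq)
  show "(LBINT y. g' y * \<phi> y) = (LBINT x. ind {0<..<L} x * (g' x * \<phi> x))"
  proof (intro intc_B refl)
   fix y show "g' y * \<phi> y = ind {0<..<L} y * (g' y * \<phi> y)"
    using g'(2)[of y] by (cases "y : {0<..<L}") simp_all
  qed
 qed measurable
 also have "... = (LINT y|leb L. g y * \<phi> y)"
 proof (rule integral_cong_AE)
  show "(%y. g' y * \<phi> y) : bmf (leb L)"
   by (rule borel_measurable_Ioo) auto
  show "(%y. g y * \<phi> y) : bmf (leb L)"
   using integrable_mult_test_fun[OF g \<phi>] by auto
  show "AE x in leb L. g' x * \<phi> x = g x * \<phi> x"
   using g'(3) by eventually_elim simp
 qed
 finally show ?thesis by simp
qed

text \<open>The antiderivative that starts at 0 vanishes to the left of the support anyway; mean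
  value zero is exactly what makes it vanish to the right.\<close>

lemma test_fun_antiderivative:
 assumes \<psi>: "test_fun 0 L \<psi>" and zero: "(LINT x|leb L. \<psi> x) = 0"
 obtains \<phi> where "test_fun 0 L \<phi>" "deriv \<phi> = \<psi>"
proof -
 obtain c d where cd: "0 < c" "d < L" "\<forall>x. x \<notin> {c..d} \<longrightarrow> \<psi> x = 0"
  using \<psi> by (auto simp: test_fun_iff)
 have cont: "isCont \<psi> x" for x
  using smooth_DERIV[OF test_fun_smooth[OF \<psi>]] DERIV_isCont by blast
 have [measurable]: "\<psi> : bmf borel" by (rule test_fun_borel[OF \<psi>])
 obtain F where "!!x. (F has_vector_derivative \<psi> x) (at x)"
  using einterval_antiderivative[of "-\<infinity>" "\<infinity>" \<psi>] cont by auto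
 hence F: "(F has_real_derivative \<psi> x) (at x)" for x
  by (simp add: has_real_derivative_iff_has_vector_derivative)
 have FTC: "(LBINT x. \<psi> x * ind {a..b} x) = F b - F a" if "a <= b" for a b
  by (rule integral_FTC_Icc_real) (use that F cont in auto)
 define \<phi> where "\<phi> x = F x - F 0" for x
 have D: "(\<phi> has_real_derivative \<psi> x) (at x)" for x
  unfolding \<phi>_def by (auto intro!: derivative_eq_intros F)
 hence d: "deriv \<phi> = \<psi>" using DERIV_imp_deriv by blast
 have "\<phi> x = 0" if x: "x \<notin> {c..d}" for x
 proof (cases "x < c")
  case True
  have "(%y. \<psi> y * ind {min 0 x..max 0 x} y) = (%y. 0)"
  proof
   fix y show "\<psi> y * ind {min 0 x..max 0 x} y = 0"
   proof (cases "y < c")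
    case False
    hence "y \<notin> {min 0 x..max 0 x}" using cd(1) True by auto
    thus ?thesis by simp
   qed (use cd in auto)
  qed
  hence "F (max 0 x) - F (min 0 x) = 0"
   using FTC[of "min 0 x" "max 0 x"] by simp
  thus ?thesis by (auto simp: \<phi>_def min_def max_def split: if_splits)
 next
  case False
  hence "d < x" using x by auto
  have "\<phi> x = (LBINT y. \<psi> y * ind {0..x} y)"
   using FTC[of 0 x] False cd by (simp add: \<phi>_def)
  also have "... = (LBINT y. ind {0<..<L} y * \<psi> y)"
  proof (intro intc_B refl)
   fix y show "\<psi> y * ind {0..x} y = ind {0<..<L} y * \<psi> y"
    using cd \<open>d < x\<close> by (cases "y : {c..d}") auto
  qed
  also have "... = 0" using zero by (subst (asm) integral_Ioo_eq) auto
  finally show ?thesis .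
 qed
 moreover have "smooth \<phi>"
  unfolding smooth_iff[of \<phi>] d using D test_fun_smooth[OF \<psi>] field_differentiable_def by blast
 ultimately have "test_fun 0 L \<phi>"
  unfolding test_fun_iff using cd by blast
 with d that show ?thesis by blast
qed

lemma exists_test_fun_integral_pos:
 assumes "0 < L"
 obtains \<psi> where "test_fun 0 L \<psi>" "(LINT x|leb L. \<psi> x) > 0"
proof -
 obtain \<phi> where \<phi>: "!!n. test_fun 0 L (\<phi> n)" "!!n x. 0 <= \<phi> n x \<and> \<phi> n x <= 1"
  "!!x. (%n. \<phi> n x) ----> ind {0<..<L} x"
  using indicator_test_fun_approx[of 0 0 L L] assms by (metis order_refl)
 have [measurable]: "\<phi> n : bmf borel" for n by (rule test_fun_borel[OF \<phi>(1)])
 have "(%n. \<integral>x. \<phi> n x \<partial>leb L) ----> (LINT x|leb L. ind {0<..<L} x)"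
 proof (rule integral_dominated_convergence[where w = "%x. 1"])
  show "AE x in leb L. (%n. \<phi> n x) ----> ind {0<..<L} x"
   using \<phi>(3) by (intro AE_I2)
  show "integrable (leb L) (%x. 1::real)" by (rule integrable_const_Ioo)
  show "(ind {0<..<L} :: real => real) : bmf (leb L)"
   by (rule borel_measurable_Ioo) auto
  show "\<phi> n : bmf (leb L)" for n
   by (rule borel_measurable_Ioo) auto
  show "AE x in leb L. norm (\<phi> n x) <= 1" for n
   using \<phi>(2)[of n] by (intro AE_I2) auto
 qed
 moreover have "(LINT x|leb L. ind {0<..<L} x) = L"
  using assms by (subst integral_Ioo_eq) (auto simp flip: indicator_inter_arith)
 ultimately have "\<forall>\<^sub>F n in sequentially. (LINT x|leb L. \<phi> n x) > 0"
  using order_tendstoD(1) assms by metis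
 thus ?thesis
  using that \<phi>(1) eventually_happens by (metis trivial_limit_sequentially)
qed

text \<open>After subtraction of the primitive, the remainder annihilates all derivatives of test
  functions, that is, all test functions of mean zero. Subtracting a multiple of the fixed
  \<open>\<psi>0\<close> gives any test function mean zero, so the remainder acts like the constant
  \<open>c\<close>, its weighted mean against \<open>\<psi>0\<close>.\<close>

theorem du_bois_reymond:
 fixes f g :: "real => real"
 assumes "0 < L" and f: "integrable (leb L) f" and g: "integrable (leb L) g"
  and weak: "!!\<phi>. test_fun 0 L \<phi> ==>
   (LINT x|leb L. f x * deriv \<phi> x) = - (LINT x|leb L. g x * \<phi> x)"
 obtains c where "AE x in leb L. f x = c + prim L g x"
proof -
 let ?M = "leb L"
 define h where "h x = f x - prim L g x" for x
 have pm: "prim L g : bmf borel"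
  by (rule borel_measurable_continuous_onI[OF prim_continuous[OF g]])
 have pi: "integrable ?M (prim L g)"
 proof -
  have "integrable ?M (%x. 1 * prim L g x)"
   by (rule integrable_bounded_mult(1)[OF integrable_const_Ioo borel_measurable_Ioo[OF pm] prim_bound[OF g]])
  thus ?thesis by simp
 qed
 have h: "integrable ?M h" unfolding h_def using f pi by simp
 have h0: "(\<integral>x. h x * deriv \<phi> x \<partial>?M) = 0" if \<phi>: "test_fun 0 L \<phi>" for \<phi>
 proof -
  note * = integrable_mult_test_fun[OF f test_fun_deriv[OF \<phi>]] integrable_mult_test_fun[OF pi test_fun_deriv[OF \<phi>]]
  have "(\<integral>x. h x * deriv \<phi> x \<partial>?M) = (\<integral>x. f x * deriv \<phi> x - prim L g x * deriv \<phi> x \<partial>?M)"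
   by (simp add: h_def algebra_simps)
  also have "... = 0"
   using * weak[OF \<phi>] test_fun_prim_mult[OF g \<phi>] by simp
  finally show ?thesis .
 qed
 obtain \<psi>0 where \<psi>0: "test_fun 0 L \<psi>0" "(\<integral>x. \<psi>0 x \<partial>?M) > 0"
  using exists_test_fun_integral_pos[OF \<open>0 < L\<close>] by blast
 have ti: "integrable ?M \<psi>" if "test_fun 0 L \<psi>" for \<psi>
  using integrable_mult_test_fun[OF integrable_const_Ioo that, of 0 L 1] by simp
 define c where "c = (\<integral>x. h x * \<psi>0 x \<partial>?M) / (\<integral>x. \<psi>0 x \<partial>?M)"
 have "AE x in ?M. h x - c = 0"
 proof (rule fundamental_lemma)
  show "integrable ?M (%x. h x - c)" using h integrable_const_Ioo by simp
  fix \<psi> assume \<psi>: "test_fun 0 L \<psi>"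
  define r where "r = (\<integral>x. \<psi> x \<partial>?M) / (\<integral>x. \<psi>0 x \<partial>?M)"
  have t: "test_fun 0 L (%x. 1 * \<psi> x + (- r) * \<psi>0 x)"
   by (rule test_fun_linear[OF \<psi> \<psi>0(1)])
  moreover have "(\<integral>x. 1 * \<psi> x + (- r) * \<psi>0 x \<partial>?M) = 0"
   using ti[OF \<psi>] ti[OF \<psi>0(1)] \<psi>0(2) by (simp add: r_def)
  ultimately obtain \<phi> where \<phi>: "test_fun 0 L \<phi>" "deriv \<phi> = (%x. 1 * \<psi> x + (- r) * \<psi>0 x)"
   by (rule test_fun_antiderivative)
  note i = integrable_mult_test_fun[OF h \<psi>] integrable_mult_test_fun[OF h \<psi>0(1)] ti[OF \<psi>]
  have "0 = (\<integral>x. h x * \<psi> x - r * (h x * \<psi>0 x) \<partial>?M)"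
   using h0[OF \<phi>(1)] by (simp add: \<phi>(2) algebra_simps)
  also have "... = (\<integral>x. h x * \<psi> x \<partial>?M) - r * (\<integral>x. h x * \<psi>0 x \<partial>?M)"
   using i by simp
  also have "r * (\<integral>x. h x * \<psi>0 x \<partial>?M) = c * (\<integral>x. \<psi> x \<partial>?M)"
   by (simp add: r_def c_def)
  also have "(\<integral>x. h x * \<psi> x \<partial>?M) - c * (\<integral>x. \<psi> x \<partial>?M) = (\<integral>x. (h x - c) * \<psi> x \<partial>?M)"
   using i by (simp add: left_diff_distrib)
  finally show "(\<integral>x. (h x - c) * \<psi> x \<partial>?M) = 0" by simp
 qed
 hence "AE x in ?M. f x = c + prim L g x"
  by eventually_elim (simp add: h_def)
 thus ?thesis by (rule that)
qed

section \<open>The space of square integrable functions\<close>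

abbreviation L2 :: "real => (real => real) set" where
 "L2 L \<equiv> fs_carrier (space_L2 L)"

lemma L2_iff: "f : L2 L \<longleftrightarrow> f : bmf (leb L) \<and>
  integrable (leb L) (%x. (f x)^2)"
 by (simp add: space_L2_def)

lemma L2_measurable: "f : L2 L ==> f : bmf (leb L)"
 by (simp add: L2_iff)

lemma L2_mult_integrable:
 assumes "f : L2 L" "g : L2 L" shows "integrable (leb L) (%x. f x * g x)"
proof (rule intb_B)
 show "integrable (leb L) (%x. (f x)^2 + (g x)^2)"
  using assms by (simp add: L2_iff)
 show "(%x. f x * g x) : bmf (leb L)"
  using assms by (auto simp: L2_iff intro: borel_measurable_times)
 show "AE x in leb L. norm (f x * g x) <= norm ((f x)^2 + (g x)^2)"
 proof (rule AE_I2)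
  fix x
  have "2 * (\<bar>f x\<bar> * \<bar>g x\<bar>) <= (f x)^2 + (g x)^2"
   using sum_squares_bound[of "\<bar>f x\<bar>" "\<bar>g x\<bar>"] by simp
  moreover have "0 <= \<bar>f x\<bar> * \<bar>g x\<bar>" by simp
  ultimately have "\<bar>f x\<bar> * \<bar>g x\<bar> <= (f x)^2 + (g x)^2" by linarith
  thus "norm (f x * g x) <= norm ((f x)^2 + (g x)^2)" by (simp add: abs_mult)
 qed
qed

lemma L2_zero [simp]: "(%x. 0) : L2 L"
 by (simp add: L2_iff)

lemma L2_scale [intro]: "f : L2 L ==> (%x. c * f x) : L2 L"
 by (auto simp: L2_iff power_mult_distrib)

lemma L2_add [intro]: assumes "f : L2 L" "g : L2 L" shows "(%x. f x + g x) : L2 L"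
 using L2_mult_integrable[OF assms] assms by (auto simp: L2_iff power2_sum mult.assoc)

lemma L2_uminus [intro]: "f : L2 L ==> (%x. - f x) : L2 L"
 by (simp add: L2_iff)

lemma L2_diff [intro]: "f : L2 L ==> g : L2 L ==> (%x. f x - g x) : L2 L"
 using L2_add[OF _ L2_uminus] by fastforce

lemma L2_sum [intro]: "(!!i. i : I ==> f i : L2 L) ==> (%x. \<Sum>i\<in>I. f i x) : L2 L"
 by (induction I rule: infinite_finite_induct) auto

lemma L2_bounded_mult:
 assumes "f : L2 L" "g : bmf (leb L)" "!!x. x : {0<..<L} ==> (g x)^2 <= B"
 shows "(%x. g x * f x) : L2 L"
proof -
 have "integrable (leb L) (%x. (g x * f x)^2)"
 proof (rule intb_B)
  show "integrable (leb L) (%x. B * (f x)^2)"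
   using assms(1) by (simp add: L2_iff)
  show "(%x. (g x * f x)^2) : bmf (leb L)"
   using assms(1,2) by (auto simp: L2_iff)
  show "AE x in leb L. norm ((g x * f x)^2) <= norm (B * (f x)^2)"
  proof (rule AE_I2)
   fix x assume "x : space (leb L)"
   hence "(g x)^2 * (f x)^2 <= B * (f x)^2"
    using assms(3) by (intro mult_right_mono) auto
   thus "norm ((g x * f x)^2) <= norm (B * (f x)^2)"
    by (simp add: power_mult_distrib)
  qed
 qed
 thus ?thesis using assms by (auto simp: L2_iff)
qed

lemma L2_const: "(%x. c) : L2 L"
 by (simp add: L2_iff integrable_const_Ioo)

lemma L2_bounded:
 assumes "g : bmf (leb L)" "!!x. x : {0<..<L} ==> \<bar>g x\<bar> <= B"
 shows "g : L2 L"
proof -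
 have "(g x)^2 <= B^2" if "x : {0<..<L}" for x
  using assms(2)[OF that] by (metis abs_ge_zero power2_abs power_mono)
 thus ?thesis using L2_bounded_mult[OF L2_const[of 1 L] assms(1), of "B^2"] by simp
qed

lemma L2_test_fun: assumes "test_fun a b \<phi>" shows "\<phi> : L2 L"
proof -
 obtain B where "!!x. \<bar>\<phi> x\<bar> <= B" using test_fun_bounded[OF assms] by blast
 thus ?thesis
  using assms by (intro L2_bounded[of _ _ B] borel_measurable_Ioo test_fun_borel) auto
qed

lemma L2_indicator: "A : sets borel ==> (ind A :: real => real) : L2 L"
 by (rule L2_bounded[of _ _ 1]) (auto intro!: borel_measurable_Ioo simp: indicator_def)

lemma L2_continuous: assumes "continuous_on {0..L} f" shows "f : L2 L"
proof -
 have "compact (f ` {0..L})" using assms compact_continuous_image by blast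
 then obtain B where "\<forall>y\<in>f ` {0..L}. norm y <= B"
  using compact_imp_bounded bounded_iff by blast
 moreover have "f : bmf (leb L)"
  by (rule continuous_imp_measurable_on_sets_lebesgue)
   (auto intro: continuous_on_subset[OF assms])
 ultimately show ?thesis by (intro L2_bounded[of _ _ B]) auto
qed

lemma inner_L2_commute: "ip L f g = ip L g f"
 by (simp add: inner_L2_def mult.commute)

lemma inner_L2_add_left: "f : L2 L ==> g : L2 L ==> h : L2 L ==>
  ip L (%x. f x + g x) h = ip L f h + ip L g h"
 using L2_mult_integrable[of f L h] L2_mult_integrable[of g L h]
 by (simp add: inner_L2_def distrib_right)

lemma inner_L2_diff_left: "f : L2 L ==> g : L2 L ==> h : L2 L ==>
  ip L (%x. f x - g x) h = ip L f h - ip L g h"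
 using L2_mult_integrable[of f L h] L2_mult_integrable[of g L h]
 by (simp add: inner_L2_def left_diff_distrib)

lemma inner_L2_scale_left: "ip L (%x. c * f x) h = c * ip L f h"
 by (simp add: inner_L2_def mult.assoc)

lemma inner_L2_zero_left [simp]: "ip L (%x. 0) h = 0"
 by (simp add: inner_L2_def)

lemma inner_L2_sum_left: "(!!i. i : I ==> f i : L2 L) ==> h : L2 L ==>
  ip L (%x. \<Sum>i\<in>I. f i x) h = (\<Sum>i\<in>I. ip L (f i) h)"
proof (induction I rule: infinite_finite_induct)
 case (insert i I)
 thus ?case
  using inner_L2_add_left[of "f i" L "%x. \<Sum>i\<in>I. f i x" h] by (simp add: L2_sum)
qed auto

lemma inner_L2_add_right: "f : L2 L ==> g : L2 L ==> h : L2 L ==>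
  ip L h (%x. f x + g x) = ip L h f + ip L h g"
 using inner_L2_add_left[of f L g h] by (simp only: inner_L2_commute[of L h])

lemma inner_L2_scale_right: "ip L h (%x. c * f x) = c * ip L h f"
 using inner_L2_scale_left[of L c f h] by (simp only: inner_L2_commute[of L h])

lemma inner_L2_sum_right: "(!!i. i : I ==> f i : L2 L) ==> h : L2 L ==>
  ip L h (%x. \<Sum>i\<in>I. f i x) = (\<Sum>i\<in>I. ip L h (f i))"
 using inner_L2_sum_left[of I f L h] by (simp only: inner_L2_commute[of L h])

lemma inner_L2_cong_AE:
 assumes "f : bmf (leb L)" "g : bmf (leb L)"
  "AE x in leb L. f x = f' x" "AE x in leb L. g x = g' x"
 shows "ip L f g = ip L f' g'"
 unfolding inner_L2_def
proof (rule integral_cong_AE)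
 note [measurable] = assms(1,2) measurable_AE_lebesgue_on[OF assms(1,3)] measurable_AE_lebesgue_on[OF assms(2,4)]
 show "(%x. f x * g x) : bmf (leb L)" by measurable
 show "(%x. f' x * g' x) : bmf (leb L)" by measurable
 show "AE x in leb L. f x * g x = f' x * g' x"
  using assms(3,4) by eventually_elim simp
qed

lemma L2_cong_AE:
 assumes "f : L2 L" "AE x in leb L. f x = f' x" shows "f' : L2 L"
proof -
 have m: "f' : bmf (leb L)"
  using assms measurable_AE_lebesgue_on L2_measurable by blast
 have "integrable (leb L) (%x. (f' x)^2)"
 proof (rule integrable_cong_AE_imp)
  show "integrable (leb L) (%x. (f x)^2)" using assms by (simp add: L2_iff)
  show "AE x in leb L. (f x)^2 = (f' x)^2"
   using assms(2) by eventually_elim simp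
 qed (use m in simp)
 with m show ?thesis by (simp add: L2_iff)
qed

lemma norm_L2_nonneg [simp]: "0 <= nrm L f"
 by (simp add: norm_L2_def inner_L2_def)

lemma norm_L2_square: "(nrm L f)^2 = ip L f f"
 by (simp add: norm_L2_def inner_L2_def)

lemma norm_L2_cong_AE:
 assumes "f : bmf (leb L)" "AE x in leb L. f x = f' x"
 shows "nrm L f = nrm L f'"
 using inner_L2_cong_AE[OF assms(1,1) assms(2,2)] by (simp add: norm_L2_def)

lemma norm_L2_eq_0_iff:
 assumes "f : L2 L" shows "nrm L f = 0 \<longleftrightarrow> (AE x in leb L. f x = 0)"
proof -
 have "nrm L f = 0 \<longleftrightarrow> (LINT x|leb L. (f x)^2) = 0"
  by (simp add: norm_L2_def inner_L2_def power2_eq_square)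
 also have "... \<longleftrightarrow> (AE x in leb L. (f x)^2 = 0)"
  using assms by (intro integral_nonneg_eq_0_iff_AE) (auto simp: L2_iff)
 finally show ?thesis by simp
qed

lemma norm_L2_scale: "nrm L (%x. c * f x) = \<bar>c\<bar> * nrm L f"
proof -
 have "ip L (%x. c * f x) (%x. c * f x) = c^2 * ip L f f"
  by (simp add: inner_L2_scale_left inner_L2_scale_right power2_eq_square)
 thus ?thesis by (simp add: norm_L2_def real_sqrt_mult)
qed

lemma norm_L2_minus: "nrm L (%x. - f x) = nrm L f"
 using norm_L2_scale[of L "-1" f] by simp

lemma norm_L2_minus_commute: "nrm L (%x. f x - g x) = nrm L (%x. g x - f x)"
 using norm_L2_minus[of L "%x. g x - f x"] by simp

lemma norm_L2_zero [simp]: "nrm L (%x. 0) = 0"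
 by (simp add: norm_L2_def)

lemma norm_L2_add_square:
 assumes "f : L2 L" "g : L2 L"
 shows "(nrm L (%x. f x + g x))^2 = (nrm L f)^2 + 2 * ip L f g + (nrm L g)^2"
 using assms inner_L2_commute[of L g f]
 by (simp add: norm_L2_square inner_L2_add_left inner_L2_add_right L2_add)

lemma inner_L2_Cauchy_Schwarz:
 assumes f: "f : L2 L" and g: "g : L2 L"
 shows "\<bar>ip L f g\<bar> <= nrm L f * nrm L g"
proof -
 define a b where "a = nrm L f" and "b = nrm L g"
 have zero: "ip L f g = 0" if "nrm L f = 0" "f : L2 L" "g : L2 L" for f g
  using inner_L2_cong_AE[of f L g "%x. 0" g] that norm_L2_eq_0_iff[of f L] by (simp add: L2_iff)
 show ?thesis
 proof (cases "a = 0 \<or> b = 0")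
  case True
  thus ?thesis
   using zero[of f g] zero[of g f] f g inner_L2_commute[of L f g] by (auto simp: a_def b_def)
 next
  case False
  hence ab: "a > 0" "b > 0"
   using norm_L2_nonneg[of L f] norm_L2_nonneg[of L g] unfolding a_def b_def by linarith+
  \<comment> \<open>Expanding the norm of \<open>b f - s a g\<close> for a sign \<open>s\<close>
    gives both one-sided bounds at once.\<close>
  have "s * ip L f g <= a * b" if "s^2 = 1" for s
  proof -
   have f': "(%x. b * f x) : L2 L" and g': "(%x. (- s * a) * g x) : L2 L"
    using f g by (auto intro: L2_scale)
   have "0 <= (nrm L (%x. b * f x + (- s * a) * g x))^2" by simp
   also have "... = (\<bar>b\<bar> * a)^2 + 2 * (b * ((- s * a) * ip L f g)) + (\<bar>- s * a\<bar> * b)^2"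
    unfolding norm_L2_add_square[OF f' g'] norm_L2_scale inner_L2_scale_left inner_L2_scale_right
    by (simp only: a_def b_def)
   also have "... = (a * b) * a * b + s^2 * ((a * b) * (a * b)) - 2 * (a * b) * (s * ip L f g)"
    using ab by (simp add: power_mult_distrib abs_mult) (simp add: power2_eq_square)
   also have "... = 2 * (a * b) * (a * b - s * ip L f g)"
    by (simp add: that algebra_simps)
   finally show ?thesis
    using mult_pos_pos[OF ab] by (simp add: zero_le_mult_iff not_le)
  qed
  from this[of 1] this[of "-1"] have "ip L f g <= a * b" "- ip L f g <= a * b"
   by simp_all
  thus ?thesis unfolding a_def b_def by (rule abs_leI)
 qed
qed

lemma norm_L2_triangle:
 assumes "f : L2 L" "g : L2 L"
 shows "nrm L (%x. f x + g x) <= nrm L f + nrm L g"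
proof (rule power2_le_imp_le)
 show "(nrm L (%x. f x + g x))^2 <= (nrm L f + nrm L g)^2"
  using norm_L2_add_square[OF assms] inner_L2_Cauchy_Schwarz[OF assms] by (simp add: power2_sum)
qed simp

lemma norm_L2_triangle_diff:
 assumes "f : L2 L" "g : L2 L" "h : L2 L"
 shows "nrm L (%x. f x - h x) <= nrm L (%x. f x - g x) + nrm L (%x. g x - h x)"
 using norm_L2_triangle[OF L2_diff[OF assms(1,2)] L2_diff[OF assms(2,3)]] by simp

lemma norm_L2_diff_abs:
 assumes "f : L2 L" "g : L2 L"
 shows "\<bar>nrm L f - nrm L g\<bar> <= nrm L (%x. f x - g x)"
proof -
 have "nrm L f <= nrm L (%x. f x - g x) + nrm L g"
  using norm_L2_triangle[OF L2_diff[OF assms] assms(2)] by simp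
 moreover have "nrm L g <= nrm L (%x. g x - f x) + nrm L f"
  using norm_L2_triangle[OF L2_diff[OF assms(2,1)] assms(1)] by simp
 ultimately show ?thesis
  unfolding norm_L2_minus_commute[of L g f] by linarith
qed

lemma norm_L2_sum_le: "(!!i. i : I ==> f i : L2 L) ==>
  nrm L (%x. \<Sum>i\<in>I. f i x) <= (\<Sum>i\<in>I. nrm L (f i))"
proof (induction I rule: infinite_finite_induct)
 case (insert i I)
 hence "nrm L (%x. f i x + (\<Sum>i\<in>I. f i x)) <= nrm L (f i) + nrm L (%x. \<Sum>i\<in>I. f i x)"
  by (intro norm_L2_triangle L2_sum) auto
 thus ?case using insert by simp
qed auto

lemma norm_L2_mono:
 assumes "f : L2 L" "g : L2 L" "AE x in leb L. \<bar>f x\<bar> <= \<bar>g x\<bar>"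
 shows "nrm L f <= nrm L g"
proof -
 have "(LINT x|leb L. f x * f x) <= (LINT x|leb L. g x * g x)"
 proof (rule integral_mono_AE)
  show "AE x in leb L. f x * f x <= g x * g x"
   using assms(3) by eventually_elim (simp add: abs_le_square_iff power2_eq_square)
 qed (use assms L2_mult_integrable in auto)
 thus ?thesis by (simp add: norm_L2_def inner_L2_def)
qed

lemma L2_integrable: "f : L2 L ==> integrable (leb L) f"
 using L2_mult_integrable[OF _ L2_const[of 1 L], of f] by simp

lemma norm_L2_bound:
 assumes "f : L2 L" "!!x. x : {0<..<L} ==> \<bar>f x\<bar> <= B" "0 <= L" "0 <= B"
 shows "nrm L f <= sqrt L * B"
proof -
 have "nrm L f <= nrm L (%x. B)"
 proof (intro norm_L2_mono L2_const AE_I2)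
  fix x assume "x : space (leb L)"
  thus "\<bar>f x\<bar> <= \<bar>B\<bar>" using assms(2)[of x] assms(4) by simp
 qed (rule assms(1))
 also have "nrm L (%x. B) = sqrt L * B"
 proof -
  have "ip L (%x. B) (%x. B) = L * B^2"
   unfolding inner_L2_def using assms(3)
   by (subst integral_Ioo_eq) (auto simp: power2_eq_square)
  thus ?thesis using assms(4) by (simp add: norm_L2_def real_sqrt_mult)
 qed
 finally show ?thesis .
qed

lemma integral_abs_le_norm_L2:
 assumes "f : L2 L" "0 <= L"
 shows "(LINT x|leb L. \<bar>f x\<bar>) <= sqrt L * nrm L f"
proof -
 have a: "(%x. \<bar>f x\<bar>) : L2 L" using assms by (auto simp: L2_iff)
 have "(LINT x|leb L. \<bar>f x\<bar>) = ip L (%x. 1) (%x. \<bar>f x\<bar>)"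
  by (simp add: inner_L2_def)
 also have "... <= nrm L (%x. 1) * nrm L (%x. \<bar>f x\<bar>)"
  using inner_L2_Cauchy_Schwarz[OF L2_const[of 1 L] a] by linarith
 also have "nrm L (%x. \<bar>f x\<bar>) = nrm L f"
  by (simp add: norm_L2_def inner_L2_def)
 also have "nrm L (%x. 1) * nrm L f <= sqrt L * nrm L f"
  using norm_L2_bound[OF L2_const[of 1 L], of 1] assms(2) by (intro mult_right_mono) auto
 finally show ?thesis .
qed

lemma L2_AE_eqI:
 assumes "f : L2 L" "g : L2 L"
  and "!!q. q : \<rat> ==> 0 < q ==> q < L ==> ip L f (ind {0<..<q}) = ip L g (ind {0<..<q})"
 shows "AE x in leb L. f x = g x"
proof -
 have "AE x in leb L. f x - g x = 0"
 proof (rule AE_zero_if_integrals_zero)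
  show "integrable (leb L) (%x. f x - g x)"
   using assms by (intro L2_integrable L2_diff)
  fix q :: real assume q: "q : \<rat>" "0 < q" "q < L"
  have "ip L (%x. f x - g x) (ind {0<..<q}) = 0"
   using assms q by (subst inner_L2_diff_left) (auto intro: L2_indicator)
  thus "(LINT x|leb L. ind {0<..<q} x * (f x - g x)) = 0"
   by (simp add: inner_L2_def mult.commute)
 qed
 thus ?thesis by eventually_elim simp
qed

lemma norm_L2_tendsto_dominated:
 assumes "!!n. f n : L2 L" "g : L2 L" "AE x in leb L. (%n. f n x) ----> 0"
  and "!!n. AE x in leb L. \<bar>f n x\<bar> <= g x"
 shows "(%n. nrm L (f n)) ----> 0"
proof -
 have "(%n. \<integral>x. f n x * f n x \<partial>leb L) ----> (LINT x|leb L. 0)"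
 proof (rule integral_dominated_convergence[where w = "%x. g x * g x"])
  show "AE x in leb L. (%n. f n x * f n x) ----> 0"
   using assms(3) by eventually_elim (auto intro: tendsto_mult_zero)
  show "AE x in leb L. norm (f n x * f n x) <= g x * g x" for n
   using assms(4)[of n]
  proof eventually_elim
   case (elim x)
   hence "\<bar>f n x\<bar> * \<bar>f n x\<bar> <= g x * g x" by (intro mult_mono) auto
   thus ?case by (simp add: abs_mult)
  qed
  show "integrable (leb L) (%x. g x * g x)" by (rule L2_mult_integrable[OF assms(2,2)])
  show "(%x. f n x * f n x) : bmf (leb L)" for n
   using L2_mult_integrable[OF assms(1,1)] by auto
 qed auto
 hence "(%n. sqrt (ip L (f n) (f n))) ----> sqrt 0"
  unfolding inner_L2_def by (intro tendsto_real_sqrt) simp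
 thus ?thesis by (simp add: norm_L2_def)
qed

text \<open>An absolutely convergent series converges almost everywhere, because by monotone
 convergence the sum of the absolute values is square integrable.\<close>

lemma L2_series_converges:
 assumes f: "!!n. f n : L2 L" and summable: "summable (%n. nrm L (f n))"
 obtains g where "g : L2 L" "(%N. nrm L (%x. g x - (\<Sum>n<N. f n x))) ----> 0"
proof -
 let ?M = "leb L"
 define G where "G N x = (\<Sum>n<N. \<bar>f n x\<bar>)" for N x
 define K where "K = (\<Sum>n. nrm L (f n))"
 have af: "(%x. \<bar>f n x\<bar>) : L2 L" for n using f[of n] by (auto simp: L2_iff)
 have GL: "G N : L2 L" for N unfolding G_def by (intro L2_sum af)
 have GK: "nrm L (G N) <= K" for N
 proof -
  have "nrm L (G N) <= (\<Sum>n<N. nrm L (%x. \<bar>f n x\<bar>))"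
   unfolding G_def by (rule norm_L2_sum_le) (rule af)
  also have "... = (\<Sum>n<N. nrm L (f n))"
   by (simp add: norm_L2_def inner_L2_def)
  also have "... <= K" unfolding K_def by (rule sum_le_suminf[OF summable]) auto
  finally show ?thesis .
 qed
 have mono: "G N x <= G N' x" if "N <= N'" for N N' x
  unfolding G_def using that by (intro sum_mono2) auto
 have G0: "0 <= G N x" for N x by (simp add: G_def sum_nonneg)
 have meas [measurable]: "G N : bmf ?M" "f N : bmf ?M" for N
  using GL f by (auto simp: L2_iff)
 have bd: "(\<integral>\<^sup>+x. (SUP N. ennreal ((G N x)^2)) \<partial>?M) <= ennreal (K^2)"
 proof -
  have "(\<integral>\<^sup>+x. (SUP N. ennreal ((G N x)^2)) \<partial>?M) = (SUP N. \<integral>\<^sup>+x. ennreal ((G N x)^2) \<partial>?M)"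
  proof (rule nn_integral_monotone_convergence_SUP)
   show "incseq (%N x. ennreal ((G N x)^2))"
    using mono G0 by (auto simp: incseq_def le_fun_def intro!: ennreal_leI power_mono)
  qed measurable
  also have "... <= ennreal (K^2)"
  proof (rule SUP_least)
   fix N
   have "(\<integral>\<^sup>+x. ennreal ((G N x)^2) \<partial>?M) = ennreal ((nrm L (G N))^2)"
    using GL[of N] by (subst nn_integral_eq_integral)
     (auto simp: L2_iff norm_L2_square inner_L2_def simp flip: power2_eq_square)
   also have "... <= ennreal (K^2)" using GK[of N] by (intro ennreal_leI power_mono) auto
   finally show "(\<integral>\<^sup>+x. ennreal ((G N x)^2) \<partial>?M) <= ennreal (K^2)" .
  qed
  finally show ?thesis .
 qed
 have fin: "AE x in ?M. (SUP N. ennreal ((G N x)^2)) \<noteq> \<infinity>"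
 proof (rule nn_integral_noteq_infinite)
  show "(\<integral>\<^sup>+x. (SUP N. ennreal ((G N x)^2)) \<partial>?M) \<noteq> \<infinity>"
  proof
   assume "(\<integral>\<^sup>+x. (SUP N. ennreal ((G N x)^2)) \<partial>?M) = \<infinity>"
   with bd show False by (simp only: infinity_ennreal_def top_unique ennreal_neq_top)
  qed
 qed measurable
 have summ: "AE x in ?M. summable (%n. \<bar>f n x\<bar>)"
  using fin
 proof eventually_elim
  case (elim x)
  then obtain B where B: "(SUP N. ennreal ((G N x)^2)) = ennreal B" "0 <= B"
   by (metis ennreal_cases infinity_ennreal_def)
  have "G N x <= sqrt B" for N
  proof -
   have "ennreal ((G N x)^2) <= ennreal B" unfolding B(1)[symmetric] by (rule SUP_upper) simp
   hence "(G N x)^2 <= B" using B(2) by (simp add: ennreal_le_iff)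
   thus ?thesis by (rule real_le_rsqrt)
  qed
  thus ?case
   unfolding G_def by (intro summableI_nonneg_bounded[where x = "sqrt B"]) auto
 qed
 define g where "g x = (\<Sum>n. f n x)" for x
 define H where "H x = (\<Sum>n. \<bar>f n x\<bar>)" for x
 have mH [measurable]: "H : bmf ?M" "g : bmf ?M"
  unfolding H_def g_def by measurable
 have Hle: "AE x in ?M. ennreal ((H x)^2) <= (SUP N. ennreal ((G N x)^2)) \<and> (\<forall>N. G N x <= H x)"
  using summ
 proof eventually_elim
  case (elim x)
  have "(%N. G N x) ----> H x"
   unfolding G_def H_def by (rule summable_LIMSEQ[OF elim])
  hence "(%N. ennreal ((G N x)^2)) ----> ennreal ((H x)^2)"
   by (intro tendsto_ennrealI tendsto_power)
  moreover have "ennreal ((G N x)^2) <= (SUP N. ennreal ((G N x)^2))" for N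
   by (rule SUP_upper) simp
  moreover have "G N x <= H x" for N
   unfolding G_def H_def by (rule sum_le_suminf[OF elim]) auto
  ultimately show ?case by (auto intro: LIMSEQ_le_const2)
 qed
 have HL: "H : L2 L"
 proof -
  have "(\<integral>\<^sup>+x. ennreal ((H x)^2) \<partial>?M) <= (\<integral>\<^sup>+x. (SUP N. ennreal ((G N x)^2)) \<partial>?M)"
   using Hle by (intro nn_integral_mono_AE) (auto elim!: eventually_mono)
  also have "... < \<infinity>" using le_less_trans[OF bd ennreal_less_top] by simp
  finally have "integrable ?M (%x. (H x)^2)"
   by (intro integrableI_bounded) auto
  thus ?thesis by (simp add: L2_iff)
 qed
 have gH: "AE x in ?M. \<bar>g x\<bar> <= H x \<and> (%N. \<Sum>n<N. f n x) ----> g x"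
  using summ
 proof eventually_elim
  case (elim x)
  thus ?case
   unfolding g_def H_def using summable_rabs[OF elim] summable_LIMSEQ[OF summable_rabs_cancel[OF elim]] by auto
 qed
 have gL: "g : L2 L"
 proof -
  have "integrable ?M (%x. (g x)^2)"
  proof (rule intb_B)
   show "integrable ?M (%x. (H x)^2)" using HL by (simp add: L2_iff)
   show "AE x in ?M. norm ((g x)^2) <= norm ((H x)^2)"
    using gH
   proof eventually_elim
    case (elim x)
    hence "\<bar>g x\<bar> <= \<bar>H x\<bar>" by linarith
    thus ?case by (simp add: abs_le_square_iff)
   qed
  qed measurable
  thus ?thesis by (simp add: L2_iff)
 qed
 have "(%N. nrm L (%x. g x - (\<Sum>n<N. f n x))) ----> 0"
 proof (rule norm_L2_tendsto_dominated)
  show "(%x. g x - (\<Sum>n<N. f n x)) : L2 L" for N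
   using gL f by (intro L2_diff L2_sum) auto
  show "(%x. 2 * H x) : L2 L" using HL by (rule L2_scale)
  show "AE x in ?M. (%N. g x - (\<Sum>n<N. f n x)) ----> 0"
   using gH
  proof eventually_elim
   case (elim x)
   hence "(%N. g x - (\<Sum>n<N. f n x)) ----> g x - g x"
    by (intro tendsto_diff tendsto_const) auto
   thus ?case by simp
  qed
  show "AE x in ?M. \<bar>g x - (\<Sum>n<N. f n x)\<bar> <= 2 * H x" for N
   using gH Hle
  proof eventually_elim
   case (elim x)
   have "\<bar>\<Sum>n<N. f n x\<bar> <= G N x" unfolding G_def by (rule sum_abs)
   moreover have "G N x <= H x" using elim by blast
   ultimately show ?case using elim by linarith
  qed
 qed
 with gL that show ?thesis by blast
qed

text \<open>A subsequence with geometrically small increments is an absolutely convergent series,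
  and a Cauchy sequence inherits the limit of a subsequence.\<close>

lemma L2_complete:
 assumes f: "!!n. f n : L2 L"
  and Cauchy: "!!e. e > 0 ==> \<exists>N. \<forall>m\<ge>N. \<forall>n\<ge>N. nrm L (%x. f m x - f n x) < e"
 obtains g where "g : L2 L" "(%n. nrm L (%x. g x - f n x)) ----> 0"
proof -
 have "\<forall>k. \<exists>N. \<forall>m\<ge>N. \<forall>n\<ge>N. nrm L (%x. f m x - f n x) < (1 / 2) ^ k"
  using Cauchy by simp
 then obtain N where N: "!!k m n. m \<ge> N k ==> n \<ge> N k ==> nrm L (%x. f m x - f n x) < (1 / 2) ^ k"
  by metis
 \<comment> \<open>The maximum makes the indices monotone and places each beyond its threshold
   \<open>N k\<close>; the summand \<open>k\<close> makes them tend to infinity.\<close>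
 define s where "s k = k + Max (N ` {..k})" for k
 have sN: "s k \<ge> N k" for k unfolding s_def by (simp add: trans_le_add2)
 have "Max (N ` {..k}) <= Max (N ` {..Suc k})" for k by (intro Max_mono) auto
 hence sS: "s k <= s (Suc k)" for k unfolding s_def by (simp add: add_mono le_SucI)
 have sk: "k <= s k" for k by (simp add: s_def)
 \<comment> \<open>The increments are preceded by the first member itself, so that the partial sums
   telescope to the members of the subsequence.\<close>
 define d where "d k x = (case k of 0 => f (s 0) x | Suc k => f (s (Suc k)) x - f (s k) x)" for k x
 have dL: "d k : L2 L" for k
  unfolding d_def using f by (cases k) auto
 have "summable (%k. nrm L (d k))"
 proof (subst summable_Suc_iff[symmetric], rule summable_comparison_test')
  show "summable (%k. (1 / 2 :: real) ^ k)" by (rule summable_geometric) simp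
  show "norm (nrm L (d (Suc n))) <= (1 / 2) ^ n" if "n \<ge> 0" for n
   using N[of n "s (Suc n)" "s n"] sN[of n] sS[of n] by (simp add: d_def[abs_def] less_imp_le)
 qed
 then obtain g where g: "g : L2 L" "(%N. nrm L (%x. g x - (\<Sum>n<N. d n x))) ----> 0"
  by (rule L2_series_converges[OF dL])
 have tel: "(\<Sum>n<Suc k. d n x) = f (s k) x" for k x
 proof (induction k)
  case (Suc k)
  thus ?case by (simp only: sum.lessThan_Suc[of _ "Suc k"]) (simp add: d_def)
 qed (simp add: d_def)
 have lim: "(%k. nrm L (%x. g x - f (s k) x)) ----> 0"
  using LIMSEQ_Suc[OF g(2)] by (simp only: tel)
 have "(%n. nrm L (%x. g x - f n x)) ----> 0"
 proof (rule LIMSEQ_I)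
  fix e :: real assume e: "e > 0"
  obtain K where K: "!!m n. m \<ge> K ==> n \<ge> K ==> nrm L (%x. f m x - f n x) < e / 2"
   using Cauchy[of "e / 2"] e by auto
  obtain K' where K': "!!k. k \<ge> K' ==> nrm L (%x. g x - f (s k) x) < e / 2"
   using LIMSEQ_D[OF lim, of "e / 2"] e by auto
  show "\<exists>no. \<forall>n\<ge>no. norm (nrm L (%x. g x - f n x) - 0) < e"
  proof (intro exI allI impI)
   fix n assume "n \<ge> K"
   define k where "k = max K K'"
   have "nrm L (%x. g x - f n x) <= nrm L (%x. g x - f (s k) x) + nrm L (%x. f (s k) x - f n x)"
    using g f by (intro norm_L2_triangle_diff)
   also have "... < e / 2 + e / 2"
    using K'[of k] K[of "s k" n] sk[of k] \<open>n \<ge> K\<close> by (intro add_strict_mono) (auto simp: k_def)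
   finally show "norm (nrm L (%x. g x - f n x) - 0) < e" by simp
  qed
 qed
 with g(1) that show ?thesis by blast
qed

section \<open>Weak derivatives in space\<close>

lemma has_wderiv_cong_AE:
 assumes "w : L2 L" "AE x in leb L. w x = w' x"
 shows "has_wderiv L k w = has_wderiv L k w'"
proof -
 have "ip L w ((deriv ^^ k) \<phi>) = ip L w' ((deriv ^^ k) \<phi>)" if "test_fun 0 L \<phi>" for \<phi>
  using assms L2_test_fun[OF test_fun_deriv_n[OF that]] by (intro inner_L2_cong_AE) (auto simp: L2_iff)
 thus ?thesis by (auto simp: has_wderiv_def fun_eq_iff)
qed

lemma wderiv_cong_AE:
 assumes "w : L2 L" "AE x in leb L. w x = w' x"
 shows "wderiv L k w = wderiv L k w'"
 using has_wderiv_cong_AE[OF assms] by (simp add: wderiv_def)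

lemma has_wderiv_unique:
 assumes "has_wderiv L k w z" "has_wderiv L k w z'" "z : L2 L" "z' : L2 L"
 shows "AE x in leb L. z x = z' x"
proof -
 have "AE x in leb L. z x - z' x = 0"
 proof (rule fundamental_lemma)
  show "integrable (leb L) (%x. z x - z' x)"
   using assms by (intro L2_integrable L2_diff)
  fix \<phi> assume \<phi>: "test_fun 0 L \<phi>"
  have "(-1) ^ k * ip L z \<phi> = (-1) ^ k * ip L z' \<phi>"
   using assms(1,2) \<phi> by (simp add: has_wderiv_def)
  hence "ip L (%x. z x - z' x) \<phi> = 0"
   using assms L2_test_fun[OF \<phi>] by (subst inner_L2_diff_left) auto
  thus "(LINT x|leb L. (z x - z' x) * \<phi> x) = 0"
   by (simp add: inner_L2_def)
 qed
 thus ?thesis by eventually_elim simp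
qed

text \<open>\<open>wderiv\<close> is an arbitrary choice among the weak derivatives, hence it can be
  compared with a known derivative only almost everywhere. All computations with
  \<open>wderiv\<close> pass through this fact.\<close>

lemma wderivI:
 assumes "z : L2 L" "has_wderiv L k w z"
 shows "wderiv L k w : L2 L" "has_wderiv L k w (wderiv L k w)"
  "AE x in leb L. wderiv L k w x = z x"
proof -
 have *: "wderiv L k w : L2 L \<and> has_wderiv L k w (wderiv L k w)"
  unfolding wderiv_def by (rule someI[where x = z]) (use assms in simp)
 thus "wderiv L k w : L2 L" "has_wderiv L k w (wderiv L k w)" by auto
 thus "AE x in leb L. wderiv L k w x = z x"
  using has_wderiv_unique assms by blast
qed

lemma has_wderiv_0: "has_wderiv L 0 w w"
 by (simp add: has_wderiv_def)

lemma has_wderiv_linear: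
 assumes "has_wderiv L k w z" "has_wderiv L k w' z'" "w : L2 L" "w' : L2 L" "z : L2 L" "z' : L2 L"
 shows "has_wderiv L k (%x. a * w x + b * w' x) (%x. a * z x + b * z' x)"
 unfolding has_wderiv_def
proof (intro allI impI)
 fix \<phi> assume \<phi>: "test_fun 0 L \<phi>"
 note t = L2_test_fun[OF \<phi>] L2_test_fun[OF test_fun_deriv_n[OF \<phi>, of k]]
 show "ip L (%x. a * w x + b * w' x) ((deriv ^^ k) \<phi>) = (-1) ^ k * ip L (%x. a * z x + b * z' x) \<phi>"
  using assms t \<phi> by (simp add: inner_L2_add_left L2_scale inner_L2_scale_left has_wderiv_def algebra_simps)
qed

abbreviation Hk :: "real => nat => (real => real) set" where
 "Hk L r \<equiv> fs_carrier (space_H L r)"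

lemma Hk_iff: "w : Hk L r \<longleftrightarrow> w : L2 L \<and> (\<forall>k\<le>r. \<exists>z\<in>L2 L. has_wderiv L k w z)"
 by (simp add: space_H_def)

lemma Hk_L2: "w : Hk L r ==> w : L2 L"
 by (simp add: Hk_iff)

lemma Hk_wderiv:
 assumes "w : Hk L r" "k <= r"
 shows "wderiv L k w : L2 L" "has_wderiv L k w (wderiv L k w)"
 using assms wderivI by (auto simp: Hk_iff)

lemma wderiv_0: assumes "w : L2 L"
 shows "AE x in leb L. wderiv L 0 w x = w x" "nrm L (wderiv L 0 w) = nrm L w"
proof -
 show *: "AE x in leb L. wderiv L 0 w x = w x"
  by (rule wderivI(3)[OF assms has_wderiv_0])
 show "nrm L (wderiv L 0 w) = nrm L w"
  using * wderivI(1)[OF assms has_wderiv_0] by (intro norm_L2_cong_AE) (auto simp: L2_iff)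
qed

lemma Hk_linear:
 assumes "w : Hk L r" "w' : Hk L r" shows "(%x. a * w x + b * w' x) : Hk L r"
 unfolding Hk_iff
proof (intro conjI allI impI)
 show "(%x. a * w x + b * w' x) : L2 L" by (intro L2_add L2_scale Hk_L2[OF assms(1)] Hk_L2[OF assms(2)])
 fix k assume "k <= r"
 note d = Hk_wderiv[OF assms(1) this] Hk_wderiv[OF assms(2) this]
 show "\<exists>z\<in>L2 L. has_wderiv L k (%x. a * w x + b * w' x) z"
 proof (rule bexI)
  show "has_wderiv L k (%x. a * w x + b * w' x) (%x. a * wderiv L k w x + b * wderiv L k w' x)"
   by (rule has_wderiv_linear[OF d(2,4) Hk_L2[OF assms(1)] Hk_L2[OF assms(2)] d(1,3)])
  show "(%x. a * wderiv L k w x + b * wderiv L k w' x) : L2 L"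
   by (intro L2_add L2_scale d)
 qed
qed

lemma wderiv_linear:
 assumes "w : Hk L r" "w' : Hk L r" "k <= r"
 shows "AE x in leb L. wderiv L k (%x. a * w x + b * w' x) x = a * wderiv L k w x + b * wderiv L k w' x"
proof -
 note d = Hk_wderiv[OF assms(1,3)] Hk_wderiv[OF assms(2,3)]
 show ?thesis
  by (rule wderivI(3)[OF _ has_wderiv_linear[OF d(2,4) Hk_L2[OF assms(1)] Hk_L2[OF assms(2)] d(1,3)]])
   (intro L2_add L2_scale d)
qed

lemma norm_wderiv_le_norm_H: "k <= r ==> nrm L (wderiv L k w) <= norm_H L r w"
 unfolding norm_H_def by (intro real_le_rsqrt member_le_sum) auto

lemma norm_H_nonneg: "0 <= norm_H L r w"
 by (simp add: norm_H_def sum_nonneg)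

lemma norm_H_cong_AE:
 assumes "w : L2 L" "AE x in leb L. w x = w' x"
 shows "norm_H L r w = norm_H L r w'"
 unfolding norm_H_def using wderiv_cong_AE[OF assms] by simp

text \<open>Integration by parts for the primitive; the constant drops out because the derivative of
  a test function has mean zero.\<close>

lemma has_wderiv_1_prim:
 assumes "z : L2 L" "AE x in leb L. w x = c + prim L z x" "w : L2 L"
 shows "has_wderiv L 1 w z"
 unfolding has_wderiv_def
proof (intro allI impI)
 fix \<phi> assume \<phi>: "test_fun 0 L \<phi>"
 have zi: "integrable (leb L) z" by (rule L2_integrable[OF assms(1)])
 have t: "deriv \<phi> : L2 L" by (rule L2_test_fun[OF test_fun_deriv[OF \<phi>]])
 have pL: "prim L z : L2 L"
  by (rule L2_continuous[OF continuous_on_subset[OF prim_continuous[OF zi]]]) simp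
 have "ip L w (deriv \<phi>) = ip L (%x. c + prim L z x) (deriv \<phi>)"
  using assms t by (intro inner_L2_cong_AE) (auto simp: L2_iff)
 also have "... = ip L (%x. c) (deriv \<phi>) + ip L (prim L z) (deriv \<phi>)"
  using t pL by (intro inner_L2_add_left L2_const)
 also have "ip L (%x. c) (deriv \<phi>) = 0"
 proof -
  have "ip L (%x. prim L (%y. 0) x) (deriv \<phi>) = 0"
   by (simp add: prim_def inner_L2_def)
  obtain a b where ab: "0 < a" "b < L" "\<forall>x. x \<notin> {a..b} \<longrightarrow> \<phi> x = 0"
   using \<phi> by (auto simp: test_fun_iff)
  have tz: "deriv \<phi> x = 0" if "x <= 0 \<or> L <= x" for x
   using test_fun_eq_0[OF test_fun_deriv[OF \<phi>]] that by blast
  show ?thesis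
  proof (cases "0 <= L")
   case True
   have "(LBINT x. deriv \<phi> x * ind {0..L} x) = \<phi> L - \<phi> 0"
    by (rule integral_FTC_Icc_real)
     (use True smooth_DERIV[OF test_fun_smooth[OF \<phi>]]
      DERIV_isCont[OF smooth_DERIV[OF test_fun_smooth[OF test_fun_deriv[OF \<phi>]]]] in auto)
   moreover have "\<phi> L = 0" "\<phi> 0 = 0" using test_fun_eq_0[OF \<phi>] by auto
   moreover have "(%x. deriv \<phi> x * ind {0..L} x) = (%x. ind {0<..<L} x * deriv \<phi> x)"
   proof
    fix x show "deriv \<phi> x * ind {0..L} x = ind {0<..<L} x * deriv \<phi> x"
     using tz[of x] by (cases "x : {0<..<L}") (auto simp: not_less)
   qed
   ultimately have "(LINT x|leb L. deriv \<phi> x) = 0"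
    by (subst integral_Ioo_eq) (auto intro: test_fun_borel[OF test_fun_deriv[OF \<phi>]])
   thus ?thesis by (simp add: inner_L2_def)
  next
   case False
   thus ?thesis by (simp add: inner_L2_def)
  qed
 qed
 also have "ip L (prim L z) (deriv \<phi>) = - ip L z \<phi>"
  using test_fun_prim_mult[OF zi \<phi>] by (simp add: inner_L2_def)
 finally show "ip L w ((deriv ^^ 1) \<phi>) = (-1) ^ 1 * ip L z \<phi>" by simp
qed

lemma has_wderiv_1_imp_prim:
 assumes "0 < L" "w : L2 L" "z : L2 L" "has_wderiv L 1 w z"
 obtains c where "AE x in leb L. w x = c + prim L z x"
proof (rule du_bois_reymond[OF assms(1) L2_integrable[OF assms(2)] L2_integrable[OF assms(3)]])
 show "(LINT x|leb L. w x * deriv \<phi> x) = - (LINT x|leb L. z x * \<phi> x)"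
  if "test_fun 0 L \<phi>" for \<phi>
  using assms(4) that by (simp add: has_wderiv_def inner_L2_def)
qed (rule that)

section \<open>Bochner integrals\<close>

lemma simple_val_Nil [simp]: "simple_val [] t = (%x. 0)"
 by (simp add: simple_val_def fun_eq_iff)

lemma simple_val_Cons: "simple_val ((A, f) # S) t = (%x. ind A t * f x + simple_val S t x)"
 by (simp add: simple_val_def fun_eq_iff)

lemma simple_val_append: "simple_val (S @ S') t = (%x. simple_val S t x + simple_val S' t x)"
 by (simp add: simple_val_def fun_eq_iff)

lemma simple_int_Nil [simp]: "simple_int [] = (%x. 0)"
 by (simp add: simple_int_def fun_eq_iff)

lemma simple_int_Cons: "simple_int ((A, f) # S) = (%x. measure lebesgue A * f x + simple_int S x)"
 by (simp add: simple_int_def fun_eq_iff)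

lemma simple_int_append: "simple_int (S @ S') = (%x. simple_int S x + simple_int S' x)"
 by (simp add: simple_int_def fun_eq_iff)

lemma simple_fn_Nil [simp]: "simple_fn X a b []"
 by (simp add: simple_fn_def)

lemma simple_fn_Cons: "simple_fn X a b ((A, f) # S) \<longleftrightarrow>
  A : sets lebesgue \<and> A \<subseteq> {a<..<b} \<and> f : fs_carrier X \<and> simple_fn X a b S"
 by (simp add: simple_fn_def)

lemma simple_fn_append: "simple_fn X a b (S @ S') \<longleftrightarrow> simple_fn X a b S \<and> simple_fn X a b S'"
 by (auto simp: simple_fn_def)

definition simple_scale :: "real => (real set \<times> (real => real)) list => (real set \<times> (real => real)) list" where
 "simple_scale c S = map (%(A, f). (A, %x. c * f x)) S"

lemma simple_val_scale: "simple_val (simple_scale c S) t = (%x. c * simple_val S t x)"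
 by (induction S) (auto simp: simple_scale_def simple_val_Cons algebra_simps)

lemma simple_int_scale: "simple_int (simple_scale c S) = (%x. c * simple_int S x)"
 by (induction S) (auto simp: simple_scale_def simple_int_Cons algebra_simps)

lemma simple_fn_scale: "simple_fn (space_L2 L) a b S ==> simple_fn (space_L2 L) a b (simple_scale c S)"
 by (induction S) (auto simp: simple_scale_def simple_fn_Cons intro: L2_scale)

definition simple_restrict :: "real set => (real set \<times> (real => real)) list => (real set \<times> (real => real)) list" where
 "simple_restrict B S = map (%(A, f). (A \<inter> B, f)) S"

lemma simple_val_restrict: "simple_val (simple_restrict B S) t = (%x. ind B t * simple_val S t x)"
 by (induction S) (auto simp: simple_restrict_def simple_val_Cons algebra_simps indicator_inter_arith)

lemma simple_fn_restrict:
 assumes "simple_fn X a b S" "B : sets lebesgue" "B \<inter> {a<..<b} \<subseteq> {c<..<d}"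
 shows "simple_fn X c d (simple_restrict B S)"
 using assms(1)
proof (induction S)
 case (Cons p S)
 obtain A f where p: "p = (A, f)" by (cases p)
 have "A \<inter> B \<subseteq> {c<..<d}" using Cons.prems assms(3) unfolding p simple_fn_Cons by blast
 thus ?case
  using Cons assms(2) by (auto simp: p simple_restrict_def simple_fn_Cons intro: sets.Int)
qed (simp add: simple_restrict_def)

lemma simple_val_L2: "simple_fn (space_L2 L) a b S ==> simple_val S t : L2 L"
 by (induction S) (auto simp: simple_val_Cons simple_fn_Cons intro!: L2_add L2_scale)

lemma simple_int_L2: "simple_fn (space_L2 L) a b S ==> simple_int S : L2 L"
 by (induction S) (auto simp: simple_int_Cons simple_fn_Cons intro!: L2_add L2_scale)

lemma indicator_Ioo_integral:
 assumes "A : sets lebesgue" "A \<subseteq> {a<..<b}"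
 shows "integrable (ivl a b) (ind A :: real => real)"
  "(LINT t|ivl a b. ind A t) = measure lebesgue A"
proof -
 have "emeasure lebesgue A <= emeasure lebesgue {a<..<b}"
  using assms by (intro emeasure_mono) auto
 also have "... < \<infinity>" by (cases "a <= b") (auto simp: not_le)
 finally have fin: "emeasure lebesgue A < \<infinity>" .
 have eq: "(%t. ind {a<..<b} t *\<^sub>R (ind A t :: real)) = ind A"
  using assms(2) by (auto simp: indicator_def fun_eq_iff)
 have ia: "integrable lebesgue (ind A :: real => real)"
  using assms(1) fin by (intro integrable_real_indicator)
 show "integrable (ivl a b) (ind A :: real => real)"
  using ia by (subst integrable_restrict_space) (simp_all only: eq, simp)
 show "(LINT t|ivl a b. ind A t) = measure lebesgue A"
  using assms by (subst integral_restrict_space) (simp_all only: eq, simp_all)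
qed

lemma simple_inner_integral:
 assumes "simple_fn (space_L2 L) a b S" "\<psi> : L2 L"
 shows "integrable (ivl a b) (%t. ip L (simple_val S t) \<psi>)"
  "(LINT t|ivl a b. ip L (simple_val S t) \<psi>) = ip L (simple_int S) \<psi>"
proof -
 have "integrable (ivl a b) (%t. ip L (simple_val S t) \<psi>) \<and>
  (LINT t|ivl a b. ip L (simple_val S t) \<psi>) = ip L (simple_int S) \<psi>"
  using assms(1)
 proof (induction S)
  case (Cons p S)
  obtain A f where p: "p = (A, f)" by (cases p)
  have A: "A : sets lebesgue" "A \<subseteq> {a<..<b}" and f: "f : L2 L" and S: "simple_fn (space_L2 L) a b S"
   using Cons.prems by (auto simp: p simple_fn_Cons)
  have v: "ip L (simple_val (p # S) t) \<psi> = ind A t * ip L f \<psi> + ip L (simple_val S t) \<psi>" for t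
   unfolding p simple_val_Cons
   using f assms(2) simple_val_L2[OF S] by (subst inner_L2_add_left) (auto simp: inner_L2_scale_left L2_scale)
  have i: "ip L (simple_int (p # S)) \<psi> = measure lebesgue A * ip L f \<psi> + ip L (simple_int S) \<psi>"
   unfolding p simple_int_Cons
   using f assms(2) simple_int_L2[OF S] by (subst inner_L2_add_left) (auto simp: inner_L2_scale_left L2_scale)
  show ?case
   unfolding v i using indicator_Ioo_integral[OF A] Cons.IH[OF S] by simp
 qed simp
 thus "integrable (ivl a b) (%t. ip L (simple_val S t) \<psi>)"
  "(LINT t|ivl a b. ip L (simple_val S t) \<psi>) = ip L (simple_int S) \<psi>"
  by auto
qed

lemma simple_inner_measurable:
 assumes "simple_fn (space_L2 L) a b S" "simple_fn (space_L2 L) a b S'"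
 shows "(%t. ip L (simple_val S t) (simple_val S' t)) : bmf (ivl a b)"
 using assms(1)
proof (induction S)
 case (Cons p S)
 obtain A f where p: "p = (A, f)" by (cases p)
 have A: "A : sets lebesgue" "A \<subseteq> {a<..<b}" and f: "f : L2 L" and S: "simple_fn (space_L2 L) a b S"
  using Cons.prems by (auto simp: p simple_fn_Cons)
 have v: "ip L (simple_val (p # S) t) (simple_val S' t) = ind A t * ip L (simple_val S' t) f + ip L (simple_val S t) (simple_val S' t)" for t
  unfolding p simple_val_Cons inner_L2_commute[of L "simple_val S' t" f]
  using f simple_val_L2[OF S] simple_val_L2[OF assms(2)]
  by (subst inner_L2_add_left) (auto simp: inner_L2_scale_left L2_scale)
 show ?case
  unfolding v
  using indicator_Ioo_integral(1)[OF A] simple_inner_integral(1)[OF assms(2) f] Cons.IH[OF S]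
  by (intro borel_measurable_add borel_measurable_times) auto
qed simp

lemma simple_norm_measurable:
 assumes "simple_fn (space_L2 L) a b S"
 shows "(%t. nrm L (simple_val S t)) : bmf (ivl a b)"
 unfolding norm_L2_def
 by (rule measurable_compose[OF simple_inner_measurable[OF assms assms] borel_measurable_sqrt])

lemma simple_norm_integrable:
 assumes "simple_fn (space_L2 L) a b S"
 shows "integrable (ivl a b) (%t. nrm L (simple_val S t))"
proof -
 have "\<exists>B. \<forall>t. nrm L (simple_val S t) <= B"
  using assms
 proof (induction S)
  case (Cons p S)
  obtain A f where p: "p = (A, f)" by (cases p)
  have f: "f : L2 L" and S: "simple_fn (space_L2 L) a b S"
   using Cons.prems by (auto simp: p simple_fn_Cons)
  obtain B where B: "!!t. nrm L (simple_val S t) <= B" using Cons.IH[OF S] by blast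
  have "nrm L (simple_val (p # S) t) <= nrm L f + B" for t
  proof -
   have "nrm L (simple_val (p # S) t) <= nrm L (%x. ind A t * f x) + nrm L (simple_val S t)"
    unfolding p simple_val_Cons using f simple_val_L2[OF S] by (intro norm_L2_triangle) auto
   also have "nrm L (%x. ind A t * f x) <= nrm L f"
    unfolding norm_L2_scale by (auto simp: indicator_def)
   finally show ?thesis using B[of t] by linarith
  qed
  thus ?case by blast
 qed auto
 then obtain B where B: "!!t. nrm L (simple_val S t) <= B" by blast
 show ?thesis
 proof (rule intb_B)
  show "integrable (ivl a b) (%t. B)" by (rule integrable_const_Ioo)
  show "AE t in ivl a b. norm (nrm L (simple_val S t)) <= norm B"
  proof (rule AE_I2)
   fix t show "norm (nrm L (simple_val S t)) <= norm B"
    using B[of t] by simp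
  qed
 qed (rule simple_norm_measurable[OF assms])
qed

text \<open>Pairing the integral with itself turns the estimate into a scalar one. In this way the
  sets in the list never have to be refined to disjoint ones.\<close>

lemma simple_int_norm_le:
 assumes "simple_fn (space_L2 L) a b S"
 shows "nrm L (simple_int S) <= (LINT t|ivl a b. nrm L (simple_val S t))"
proof -
 let ?I = "simple_int S"
 have I: "?I : L2 L" by (rule simple_int_L2[OF assms])
 have "(nrm L ?I)^2 = (LINT t|ivl a b. ip L (simple_val S t) ?I)"
  using simple_inner_integral(2)[OF assms I] by (simp add: norm_L2_square)
 also have "... <= (LINT t|ivl a b. nrm L (simple_val S t) * nrm L ?I)"
 proof (rule integral_mono)
  show "integrable (ivl a b) (%t. nrm L (simple_val S t) * nrm L ?I)"
   using simple_norm_integrable[OF assms] by simp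
  show "ip L (simple_val S t) ?I <= nrm L (simple_val S t) * nrm L ?I" for t
   using inner_L2_Cauchy_Schwarz[OF simple_val_L2[OF assms] I] by (meson abs_le_D1)
 qed (rule simple_inner_integral(1)[OF assms I])
 also have "... = nrm L ?I * (LINT t|ivl a b. nrm L (simple_val S t))"
  by simp
 finally have "nrm L ?I * nrm L ?I <= nrm L ?I * (LINT t|ivl a b. nrm L (simple_val S t))"
  by (simp add: power2_eq_square)
 moreover have "0 <= (LINT t|ivl a b. nrm L (simple_val S t))"
  by simp
 ultimately show ?thesis
  using norm_L2_nonneg[of L ?I] by (metis mult_left_le_imp_le order_le_less)
qed

section \<open>Bochner measurable functions and existence of the integral\<close>

lemma borel_measurable_AE_LIMSEQ:
 fixes f :: "nat => real => real"
 assumes "!!n. f n : bmf (ivl a b)"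
  "AE t in ivl a b. (%n. f n t) ----> g t"
 shows "g : bmf (ivl a b)"
proof (rule measurable_AE_lebesgue_on)
 show "(%t. lim (%n. f n t)) : bmf (ivl a b)"
  by (rule borel_measurable_lim_metric) (rule assms(1))
 show "AE t in ivl a b. lim (%n. f n t) = g t"
  using assms(2) by eventually_elim (rule limI)
qed

abbreviation bmL2 :: "real => real => real => (real => real => real) => bool" where
 "bmL2 L a b v \<equiv> bochner_measurable (space_L2 L) a b v"

lemma norm_space_L2 [simp]: "fs_norm (space_L2 L) = nrm L"
 by (simp add: space_L2_def)

lemma norm_space_H [simp]: "fs_norm (space_H L r) = norm_H L r"
 by (simp add: space_H_def)

lemma bmL2_E:
 assumes "bmL2 L a b v"
 obtains S where "AE t in ivl a b. v t : L2 L" "!!n. simple_fn (space_L2 L) a b (S n)"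
  "AE t in ivl a b. (%n. nrm L (%x. v t x - simple_val (S n) t x)) ----> 0"
 using assms by (auto simp: bochner_measurable_def)

lemma bmL2_I:
 assumes "AE t in ivl a b. v t : L2 L" "!!n. simple_fn (space_L2 L) a b (S n)"
  "AE t in ivl a b. (%n. nrm L (%x. v t x - simple_val (S n) t x)) ----> 0"
 shows "bmL2 L a b v"
 using assms by (auto simp: bochner_measurable_def)

lemma bmL2_AE: "bmL2 L a b v ==> AE t in ivl a b. v t : L2 L"
 by (auto simp: bochner_measurable_def)

lemma bmL2_norm_measurable:
 assumes "bmL2 L a b v" shows "(%t. nrm L (v t)) : bmf (ivl a b)"
proof -
 obtain S where S: "AE t in ivl a b. v t : L2 L" "!!n. simple_fn (space_L2 L) a b (S n)"
  "AE t in ivl a b. (%n. nrm L (%x. v t x - simple_val (S n) t x)) ----> 0"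
  using bmL2_E[OF assms] by blast
 show ?thesis
 proof (rule borel_measurable_AE_LIMSEQ)
  show "(%t. nrm L (simple_val (S n) t)) : bmf (ivl a b)" for n
   by (rule simple_norm_measurable[OF S(2)])
  show "AE t in ivl a b. (%n. nrm L (simple_val (S n) t)) ----> nrm L (v t)"
   using S(1,3)
  proof eventually_elim
   case (elim t)
   show ?case
   proof (rule Lim_null_comparison[THEN LIM_zero_cancel])
    show "(%n. nrm L (%x. v t x - simple_val (S n) t x)) ----> 0" by (rule elim(2))
    show "\<forall>\<^sub>F n in sequentially. norm (nrm L (simple_val (S n) t) - nrm L (v t)) <= nrm L (%x. v t x - simple_val (S n) t x)"
     using norm_L2_diff_abs[OF elim(1) simple_val_L2[OF S(2)]] by (simp add: abs_minus_commute)
   qed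
  qed
 qed
qed

lemma bmL2_inner_measurable:
 assumes "bmL2 L a b v" "\<psi> : L2 L"
 shows "(%t. ip L (v t) \<psi>) : bmf (ivl a b)"
proof -
 obtain S where S: "AE t in ivl a b. v t : L2 L" "!!n. simple_fn (space_L2 L) a b (S n)"
  "AE t in ivl a b. (%n. nrm L (%x. v t x - simple_val (S n) t x)) ----> 0"
  using bmL2_E[OF assms(1)] by blast
 show ?thesis
 proof (rule borel_measurable_AE_LIMSEQ)
  show "(%t. ip L (simple_val (S n) t) \<psi>) : bmf (ivl a b)" for n
   using simple_inner_integral(1)[OF S(2) assms(2)] by auto
  show "AE t in ivl a b. (%n. ip L (simple_val (S n) t) \<psi>) ----> ip L (v t) \<psi>"
   using S(1,3)
  proof eventually_elim
   case (elim t)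
   show ?case
   proof (rule Lim_null_comparison[THEN LIM_zero_cancel])
    show "(%n. nrm L (%x. v t x - simple_val (S n) t x) * nrm L \<psi>) ----> 0"
     using tendsto_mult_left_zero[OF elim(2)] .
    have "\<bar>ip L (simple_val (S n) t) \<psi> - ip L (v t) \<psi>\<bar> <= nrm L (%x. v t x - simple_val (S n) t x) * nrm L \<psi>" for n
     using inner_L2_Cauchy_Schwarz[OF L2_diff[OF elim(1) simple_val_L2[OF S(2)]] assms(2), of n t]
     by (subst (asm) inner_L2_diff_left[OF elim(1) simple_val_L2[OF S(2)] assms(2)]) (simp add: abs_minus_commute)
    thus "\<forall>\<^sub>F n in sequentially. norm (ip L (simple_val (S n) t) \<psi> - ip L (v t) \<psi>) <= nrm L (%x. v t x - simple_val (S n) t x) * nrm L \<psi>"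
     by simp
   qed
  qed
 qed
qed

lemma bmL2_cong_AE:
 assumes "bmL2 L a b v" "AE t in ivl a b. AE x in leb L. v t x = w t x"
 shows "bmL2 L a b w"
proof -
 obtain S where S: "AE t in ivl a b. v t : L2 L" "!!n. simple_fn (space_L2 L) a b (S n)"
  "AE t in ivl a b. (%n. nrm L (%x. v t x - simple_val (S n) t x)) ----> 0"
  using bmL2_E[OF assms(1)] by blast
 show ?thesis
 proof (rule bmL2_I[OF _ S(2)])
  show "AE t in ivl a b. w t : L2 L"
   using S(1) assms(2) by eventually_elim (rule L2_cong_AE)
  show "AE t in ivl a b. (%n. nrm L (%x. w t x - simple_val (S n) t x)) ----> 0"
   using S(1,3) assms(2)
  proof eventually_elim
   case (elim t)
   have "nrm L (%x. w t x - simple_val (S n) t x) = nrm L (%x. v t x - simple_val (S n) t x)" for n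
   proof (rule norm_L2_cong_AE[symmetric])
    show "(%x. v t x - simple_val (S n) t x) : bmf (leb L)"
     by (rule L2_measurable[OF L2_diff[OF elim(1) simple_val_L2[OF S(2)]]])
    show "AE x in leb L. v t x - simple_val (S n) t x = w t x - simple_val (S n) t x"
     using elim(3) by eventually_elim simp
   qed
   thus ?case using elim(2) by simp
  qed
 qed
qed

lemma bmL2_simple: "simple_fn (space_L2 L) a b S ==> bmL2 L a b (simple_val S)"
 by (rule bmL2_I[where S = "%n. S"]) (auto intro: simple_val_L2)

lemma bmL2_const: assumes "f : L2 L" shows "bmL2 L a b (%t. f)"
proof (rule bmL2_cong_AE)
 show "bmL2 L a b (simple_val [({a<..<b}, f)])"
  using assms by (intro bmL2_simple) (simp add: simple_fn_Cons)
 show "AE t in ivl a b. AE x in leb L. simple_val [({a<..<b}, f)] t x = f x"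
  by (intro AE_I2) (simp add: simple_val_Cons)
qed

lemma bmL2_add:
 assumes "bmL2 L a b v" "bmL2 L a b w" shows "bmL2 L a b (%t x. v t x + w t x)"
proof -
 obtain S where S: "AE t in ivl a b. v t : L2 L" "!!n. simple_fn (space_L2 L) a b (S n)"
  "AE t in ivl a b. (%n. nrm L (%x. v t x - simple_val (S n) t x)) ----> 0"
  using bmL2_E[OF assms(1)] by blast
 obtain S' where S': "AE t in ivl a b. w t : L2 L" "!!n. simple_fn (space_L2 L) a b (S' n)"
  "AE t in ivl a b. (%n. nrm L (%x. w t x - simple_val (S' n) t x)) ----> 0"
  using bmL2_E[OF assms(2)] by blast
 show ?thesis
 proof (rule bmL2_I[where S = "%n. S n @ S' n"])
  show "AE t in ivl a b. (%x. v t x + w t x) : L2 L"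
   using S(1) S'(1) by eventually_elim (rule L2_add)
  show "simple_fn (space_L2 L) a b (S n @ S' n)" for n
   using S(2) S'(2) by (simp add: simple_fn_append)
  show "AE t in ivl a b. (%n. nrm L (%x. v t x + w t x - simple_val (S n @ S' n) t x)) ----> 0"
   using S(1,3) S'(1,3)
  proof eventually_elim
   case (elim t)
   show ?case
   proof (rule Lim_null_comparison)
    show "(%n. nrm L (%x. v t x - simple_val (S n) t x) + nrm L (%x. w t x - simple_val (S' n) t x)) ----> 0"
     using tendsto_add[OF elim(2,4)] by simp
    have "nrm L (%x. v t x + w t x - simple_val (S n @ S' n) t x)
     <= nrm L (%x. v t x - simple_val (S n) t x) + nrm L (%x. w t x - simple_val (S' n) t x)" for n
     using norm_L2_triangle[OF L2_diff[OF elim(1) simple_val_L2[OF S(2)[of n]]] L2_diff[OF elim(3) simple_val_L2[OF S'(2)[of n]]], of t t]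
     by (simp add: simple_val_append algebra_simps)
    thus "\<forall>\<^sub>F n in sequentially. norm (nrm L (%x. v t x + w t x - simple_val (S n @ S' n) t x))
     <= nrm L (%x. v t x - simple_val (S n) t x) + nrm L (%x. w t x - simple_val (S' n) t x)"
     by simp
   qed
  qed
 qed
qed

lemma bmL2_subset:
 assumes "bmL2 L a b v" "{c<..<d} \<subseteq> {a<..<b}" shows "bmL2 L c d v"
proof -
 obtain S where S: "AE t in ivl a b. v t : L2 L" "!!n. simple_fn (space_L2 L) a b (S n)"
  "AE t in ivl a b. (%n. nrm L (%x. v t x - simple_val (S n) t x)) ----> 0"
  using bmL2_E[OF assms(1)] by blast
 show ?thesis
 proof (rule bmL2_I[where S = "%n. simple_restrict {c<..<d} (S n)"])
  show "AE t in lebesgue_on {c<..<d}. v t : L2 L"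
   by (rule AE_Ioo_mono_set[OF S(1) assms(2)])
  show "simple_fn (space_L2 L) c d (simple_restrict {c<..<d} (S n))" for n
   by (rule simple_fn_restrict[OF S(2)]) auto
  have "AE t in lebesgue_on {c<..<d}. t : {c<..<d}" by (rule AE_I2) simp
  with AE_Ioo_mono_set[OF S(3) assms(2)]
  show "AE t in lebesgue_on {c<..<d}. (%n. nrm L (%x. v t x - simple_val (simple_restrict {c<..<d} (S n)) t x)) ----> 0"
   by eventually_elim (simp add: simple_val_restrict)
 qed
qed

text \<open>Product of a simple function with a scalar function \<open>m\<close> that takes its
  values in the list \<open>ys\<close>: the simple function is cut along each level set of
  \<open>m\<close> and scaled by the value there.\<close>

definition simple_mult :: "(real => real) => real list => (real set \<times> (real => real)) list => (real set \<times> (real => real)) list" where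
 "simple_mult m ys S = concat (map (%y. simple_scale y (simple_restrict (m -` {y}) S)) ys)"

lemma simple_val_mult:
 assumes "distinct ys" "m t : set ys"
 shows "simple_val (simple_mult m ys S) t = (%x. m t * simple_val S t x)"
proof -
 have "simple_val (simple_mult m ys S) t x = (\<Sum>y\<leftarrow>ys. y * (ind (m -` {y}) t * simple_val S t x))" for x
  by (induction ys) (auto simp: simple_mult_def simple_val_append simple_val_scale simple_val_restrict)
 also have "(\<Sum>y\<leftarrow>ys. y * (ind (m -` {y}) t * simple_val S t x)) = (\<Sum>y\<in>set ys. y * (ind (m -` {y}) t * simple_val S t x))" for x
  using assms(1) by (rule sum_list_distinct_conv_sum_set)
 also have "(\<Sum>y\<in>set ys. y * (ind (m -` {y}) t * simple_val S t x)) = (\<Sum>y\<in>set ys. if y = m t then m t * simple_val S t x else 0)" for x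
  by (intro sum.cong) (auto simp: indicator_def)
 also have "(\<Sum>y\<in>set ys. if y = m t then m t * simple_val S t x else 0) = m t * simple_val S t x" for x
  using assms(2) by (simp add: sum.delta)
 finally show ?thesis by blast
qed

lemma simple_fn_mult:
 assumes "simple_fn (space_L2 L) a b S" "!!y. m -` {y} \<inter> {a<..<b} : sets lebesgue"
 shows "simple_fn (space_L2 L) a b (simple_mult m ys S)"
proof -
 have "simple_fn (space_L2 L) a b (simple_restrict (m -` {y}) S)" for y
  using assms(1)
 proof (induction S)
  case (Cons p S)
  obtain A f where p: "p = (A, f)" by (cases p)
  have "A \<inter> m -` {y} = A \<inter> (m -` {y} \<inter> {a<..<b})"
   using Cons.prems by (auto simp: p simple_fn_Cons)
  moreover have "A \<inter> (m -` {y} \<inter> {a<..<b}) : sets lebesgue"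
   using Cons.prems assms(2) by (intro sets.Int[of A] assms(2)) (auto simp: p simple_fn_Cons)
  ultimately show ?case
   using Cons by (auto simp: p simple_fn_Cons simple_restrict_def)
 qed (simp add: simple_restrict_def)
 hence "simple_fn (space_L2 L) a b (simple_scale y (simple_restrict (m -` {y}) S))" for y
  by (rule simple_fn_scale)
 thus ?thesis
  unfolding simple_mult_def by (induction ys) (auto simp: simple_fn_append)
qed

text \<open>Measurability only asks for pointwise convergence in time, so the multiplier may be
  unbounded, as the singular factor \<open>omega \<alpha> (t - s)\<close> is.\<close>

lemma bmL2_mult:
 assumes v: "bmL2 L a b v" and m: "m : bmf (ivl a b)"
 shows "bmL2 L a b (%t x. m t * v t x)"
proof -
 let ?M = "ivl a b"
 obtain S where S: "AE t in ?M. v t : L2 L" "!!n. simple_fn (space_L2 L) a b (S n)"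
  "AE t in ?M. (%n. nrm L (%x. v t x - simple_val (S n) t x)) ----> 0"
  using bmL2_E[OF v] by blast
 obtain F where F: "!!n. simple_function ?M (F n)" "!!t. t : {a<..<b} ==> (%n. F n t) ----> m t"
  using borel_measurable_implies_sequence_metric[OF m, of 0] unfolding space_lebesgue_on by metis
 define ys where "ys n = sorted_list_of_set (F n ` {a<..<b})" for n
 have ys: "distinct (ys n)" "set (ys n) = F n ` {a<..<b}" for n
  using simple_functionD(1)[OF F(1)] by (auto simp: ys_def)
 have val: "simple_val (simple_mult (F n) (ys n) (S n)) t = (%x. F n t * simple_val (S n) t x)" if "t : {a<..<b}" for n t
  using that ys by (intro simple_val_mult) auto
 show ?thesis
 proof (rule bmL2_I[where S = "%n. simple_mult (F n) (ys n) (S n)"])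
  show "AE t in ?M. (%x. m t * v t x) : L2 L"
   using S(1) by eventually_elim (rule L2_scale)
  show "simple_fn (space_L2 L) a b (simple_mult (F n) (ys n) (S n))" for n
  proof (rule simple_fn_mult[OF S(2)])
   fix y
   have "F n -` {y} \<inter> space ?M : sets ?M" by (rule simple_functionD(2)[OF F(1)])
   thus "F n -` {y} \<inter> {a<..<b} : sets lebesgue"
    by (subst (asm) sets_restrict_space_iff) auto
  qed
  have "AE t in ?M. t : {a<..<b}" by (rule AE_I2) simp
  with S(1,3) show "AE t in ?M. (%n. nrm L (%x. m t * v t x - simple_val (simple_mult (F n) (ys n) (S n)) t x)) ----> 0"
  proof eventually_elim
   case (elim t)
   have Ft: "(%n. F n t) ----> m t" by (rule F(2)[OF elim(3)])
   show ?case
   proof (rule Lim_null_comparison)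
    have "(%n. \<bar>m t - F n t\<bar> * nrm L (v t) + \<bar>F n t\<bar> * nrm L (%x. v t x - simple_val (S n) t x)) ----> \<bar>m t - m t\<bar> * nrm L (v t) + \<bar>m t\<bar> * 0"
     by (intro tendsto_add tendsto_mult tendsto_rabs tendsto_diff tendsto_const Ft elim(2))
    thus "(%n. \<bar>m t - F n t\<bar> * nrm L (v t) + \<bar>F n t\<bar> * nrm L (%x. v t x - simple_val (S n) t x)) ----> 0"
     by simp
    have "nrm L (%x. m t * v t x - simple_val (simple_mult (F n) (ys n) (S n)) t x)
     <= \<bar>m t - F n t\<bar> * nrm L (v t) + \<bar>F n t\<bar> * nrm L (%x. v t x - simple_val (S n) t x)" for n
    proof -
     have "(%x. m t * v t x - simple_val (simple_mult (F n) (ys n) (S n)) t x)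
      = (%x. (m t - F n t) * v t x + F n t * (v t x - simple_val (S n) t x))"
      by (simp add: val[OF elim(3)] algebra_simps)
     thus ?thesis
      using norm_L2_triangle[OF L2_scale[OF elim(1)] L2_scale[OF L2_diff[OF elim(1) simple_val_L2[OF S(2)]]], of "m t - F n t" "F n t" n t]
      by (simp add: norm_L2_scale)
    qed
    thus "\<forall>\<^sub>F n in sequentially. norm (nrm L (%x. m t * v t x - simple_val (simple_mult (F n) (ys n) (S n)) t x))
     <= \<bar>m t - F n t\<bar> * nrm L (v t) + \<bar>F n t\<bar> * nrm L (%x. v t x - simple_val (S n) t x)"
     by simp
   qed
  qed
 qed
qed

lemma bmL2_scale: "bmL2 L a b v ==> bmL2 L a b (%t x. c * v t x)"
 by (rule bmL2_mult) auto

lemma bmL2_diff: "bmL2 L a b v ==> bmL2 L a b w ==> bmL2 L a b (%t x. v t x - w t x)"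
 using bmL2_add[of L a b v "%t x. -1 * w t x"] bmL2_scale[of L a b w "-1"] by simp

lemma bmL2_sum:
 "(!!i. i : I ==> bmL2 L a b (v i)) ==> bmL2 L a b (%t x. \<Sum>i\<in>I. v i t x)"
 by (induction I rule: infinite_finite_induct) (auto intro: bmL2_add bmL2_const)

text \<open>Pairing with a fixed element is continuous, so it passes through both limits in the
  definition of the integral. From here on Bochner integrals are handled by scalar Lebesgue
  integrals of pairings.\<close>

lemma has_bint_inner:
 assumes I: "has_bint (space_L2 L) a b v I" and \<psi>: "\<psi> : L2 L"
 shows "integrable (ivl a b) (%t. ip L (v t) \<psi>)"
  "(LINT t|ivl a b. ip L (v t) \<psi>) = ip L I \<psi>"
proof -
 let ?M = "ivl a b"
 obtain S where v: "bmL2 L a b v" and IL: "I : L2 L" and S: "!!n. simple_fn (space_L2 L) a b (S n)"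
  and lim: "(%n. \<integral>\<^sup>+t. ennreal (nrm L (%x. v t x - simple_val (S n) t x)) \<partial>?M) ----> 0"
  and limI: "(%n. nrm L (%x. I x - simple_int (S n) x)) ----> 0"
  using I by (auto simp: has_bint_def)
 have dm: "(%t. nrm L (%x. v t x - simple_val (S n) t x)) : bmf ?M" for n
  by (rule bmL2_norm_measurable[OF bmL2_diff[OF v bmL2_simple[OF S]]])
 have im: "(%t. ip L (v t) \<psi>) : bmf ?M"
  by (rule bmL2_inner_measurable[OF v \<psi>])
 note si = simple_inner_integral[OF S \<psi>]
 define E where "E n = (\<integral>\<^sup>+t. ennreal \<bar>ip L (v t) \<psi> - ip L (simple_val (S n) t) \<psi>\<bar> \<partial>?M)" for n
 have Ele: "E n <= (\<integral>\<^sup>+t. ennreal (nrm L (%x. v t x - simple_val (S n) t x)) \<partial>?M) * ennreal (nrm L \<psi>)" for n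
 proof -
  have "E n <= (\<integral>\<^sup>+t. ennreal (nrm L (%x. v t x - simple_val (S n) t x)) * ennreal (nrm L \<psi>) \<partial>?M)"
   unfolding E_def
  proof (rule nn_integral_mono_AE)
   show "AE t in ?M. ennreal \<bar>ip L (v t) \<psi> - ip L (simple_val (S n) t) \<psi>\<bar>
    <= ennreal (nrm L (%x. v t x - simple_val (S n) t x)) * ennreal (nrm L \<psi>)"
    using bmL2_AE[OF v]
   proof eventually_elim
    case (elim t)
    show ?case
     using inner_L2_Cauchy_Schwarz[OF L2_diff[OF elim simple_val_L2[OF S]] \<psi>, of n t]
     by (subst (asm) inner_L2_diff_left[OF elim simple_val_L2[OF S] \<psi>])
      (simp add: ennreal_mult[symmetric] ennreal_leI)
   qed
  qed
  also have "... = (\<integral>\<^sup>+t. ennreal (nrm L (%x. v t x - simple_val (S n) t x)) \<partial>?M) * ennreal (nrm L \<psi>)"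
   by (rule nn_integral_multc) (use dm in measurable)
  finally show ?thesis .
 qed
 have Elim: "E ----> 0"
 proof (rule tendsto_sandwich[OF _ _ tendsto_const])
  have "(%n. (\<integral>\<^sup>+t. ennreal (nrm L (%x. v t x - simple_val (S n) t x)) \<partial>?M) * ennreal (nrm L \<psi>)) ----> 0 * ennreal (nrm L \<psi>)"
   by (intro tendsto_mult_ennreal lim tendsto_const) auto
  thus "(%n. (\<integral>\<^sup>+t. ennreal (nrm L (%x. v t x - simple_val (S n) t x)) \<partial>?M) * ennreal (nrm L \<psi>)) ----> 0"
   by simp
 qed (use Ele in auto)
 hence "\<forall>\<^sub>F n in sequentially. E n < 1" by (rule order_tendstoD(2)) simp
 then obtain n where n: "E n < 1" by (metis eventually_happens trivial_limit_sequentially)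
 show int: "integrable ?M (%t. ip L (v t) \<psi>)"
 proof -
  have "E n < \<infinity>" using n by (auto intro: less_trans)
  hence "integrable ?M (%t. ip L (v t) \<psi> - ip L (simple_val (S n) t) \<psi>)"
   unfolding E_def using im si(1)[of n] by (intro integrableI_bounded) auto
  from inta_B[OF this si(1)[of n]] show ?thesis by simp
 qed
 have "(%n. \<integral>t. ip L (simple_val (S n) t) \<psi> \<partial>?M) ----> (\<integral>t. ip L (v t) \<psi> \<partial>?M)"
 proof (rule tendsto_L1_int)
  show "integrable ?M (%t. ip L (simple_val (S n) t) \<psi>)" for n by (rule si(1))
  show "integrable ?M (%t. ip L (v t) \<psi>)" by (rule int)
  have Eeq: "E = (%n. \<integral>\<^sup>+t. ennreal (norm (ip L (simple_val (S n) t) \<psi> - ip L (v t) \<psi>)) \<partial>?M)"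
   unfolding E_def by (simp add: abs_minus_commute)
  show "((%n. \<integral>\<^sup>+t. ennreal (norm (ip L (simple_val (S n) t) \<psi> - ip L (v t) \<psi>)) \<partial>?M) \<longlongrightarrow> 0) sequentially"
   using Elim unfolding Eeq .
 qed
 hence "(%n. ip L (simple_int (S n)) \<psi>) ----> (\<integral>t. ip L (v t) \<psi> \<partial>?M)"
  by (simp only: si(2))
 moreover have "(%n. ip L (simple_int (S n)) \<psi>) ----> ip L I \<psi>"
 proof (rule Lim_null_comparison[THEN LIM_zero_cancel])
  show "(%n. nrm L (%x. I x - simple_int (S n) x) * nrm L \<psi>) ----> 0"
   by (rule tendsto_mult_left_zero[OF limI])
  have "\<bar>ip L (simple_int (S n)) \<psi> - ip L I \<psi>\<bar> <= nrm L (%x. I x - simple_int (S n) x) * nrm L \<psi>" for n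
   using inner_L2_Cauchy_Schwarz[OF L2_diff[OF IL simple_int_L2[OF S]] \<psi>, of n]
   by (subst (asm) inner_L2_diff_left[OF IL simple_int_L2[OF S] \<psi>]) (simp add: abs_minus_commute)
  thus "\<forall>\<^sub>F n in sequentially. norm (ip L (simple_int (S n)) \<psi> - ip L I \<psi>) <= nrm L (%x. I x - simple_int (S n) x) * nrm L \<psi>"
   by simp
 qed
 ultimately show "(\<integral>t. ip L (v t) \<psi> \<partial>?M) = ip L I \<psi>"
  by (rule LIMSEQ_unique)
qed

text \<open>Measurability supplies approximants that converge only pointwise in time. They are
  truncated so that the errors have an integrable majorant; their integrals then form a Cauchy
  sequence, and completeness of the space gives the integral.\<close>

lemma has_bint_exists:
 assumes v: "bmL2 L a b v" and int: "integrable (ivl a b) (%t. nrm L (v t))"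
 shows "\<exists>I. has_bint (space_L2 L) a b v I"
proof -
 let ?M = "ivl a b"
 obtain S where S: "AE t in ?M. v t : L2 L" "!!n. simple_fn (space_L2 L) a b (S n)"
  "AE t in ?M. (%n. nrm L (%x. v t x - simple_val (S n) t x)) ----> 0"
  using bmL2_E[OF v] by blast
 \<comment> \<open>Times at which the approximant is more than twice as large as \<open>v\<close>
   are discarded. What remains differs from \<open>v\<close> by at most three times the norm of
   \<open>v\<close>.\<close>
 define B where "B n = {t\<in>{a<..<b}. nrm L (simple_val (S n) t) <= 2 * nrm L (v t)}" for n
 have Bs: "B n : sets lebesgue" for n
 proof -
  have [measurable]: "(%t. nrm L (simple_val (S n) t)) : bmf ?M"
   "(%t. nrm L (v t)) : bmf ?M"
   using simple_norm_measurable[OF S(2)] bmL2_norm_measurable[OF v] by auto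
  have "{t\<in>space ?M. nrm L (simple_val (S n) t) <= 2 * nrm L (v t)} : sets ?M"
   by measurable
  thus ?thesis
   unfolding B_def by (subst (asm) sets_restrict_space_iff) auto
 qed
 define R where "R n = simple_restrict (B n) (S n)" for n
 have Rs: "simple_fn (space_L2 L) a b (R n)" for n
  unfolding R_def by (rule simple_fn_restrict[OF S(2) Bs]) (auto simp: B_def)
 have Rv: "simple_val (R n) t = (%x. ind (B n) t * simple_val (S n) t x)" for n t
  by (simp add: R_def simple_val_restrict)
 define d where "d n t = nrm L (%x. v t x - simple_val (R n) t x)" for n t
 have dm: "d n : bmf ?M" for n
  unfolding d_def[abs_def] by (rule bmL2_norm_measurable[OF bmL2_diff[OF v bmL2_simple[OF Rs]]])
 have dle: "AE t in ?M. norm (d n t) <= 3 * nrm L (v t)" for n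
  using S(1)
 proof eventually_elim
  case (elim t)
  have "d n t <= nrm L (v t) + nrm L (simple_val (R n) t)"
   using norm_L2_triangle_diff[of "v t" L "%x. 0" "simple_val (R n) t"] elim simple_val_L2[OF Rs]
   by (simp add: d_def norm_L2_minus)
  also have "nrm L (simple_val (R n) t) <= 2 * nrm L (v t)"
   unfolding Rv norm_L2_scale by (auto simp: indicator_def B_def)
  finally show ?case by (simp add: d_def)
 qed
 have AEt: "AE t in ?M. t : {a<..<b}" by (rule AE_I2) simp
 \<comment> \<open>Where \<open>v t\<close> has norm 0 the truncation forces the approximant to have
   norm 0 as well; elsewhere convergence makes the truncation inactive from some index on.\<close>
 have dlim: "AE t in ?M. (%n. d n t) ----> 0"
  using S(1,3) AEt
 proof eventually_elim
  case (elim t)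
  note nS = norm_L2_diff_abs[OF elim(1) simple_val_L2[OF S(2)]]
  show ?case
  proof (cases "nrm L (v t) = 0")
   case True
   have "d n t = 0" for n
   proof -
    have "d n t <= nrm L (v t) + nrm L (simple_val (R n) t)"
     using norm_L2_triangle_diff[of "v t" L "%x. 0" "simple_val (R n) t"] elim simple_val_L2[OF Rs]
     by (simp add: d_def norm_L2_minus)
    also have "nrm L (simple_val (R n) t) = 0"
     unfolding Rv norm_L2_scale using True by (auto simp: indicator_def B_def intro: antisym)
    finally show ?thesis using True by (simp add: d_def antisym)
   qed
   thus ?thesis by simp
  next
   case False
   hence pos: "nrm L (v t) > 0" using norm_L2_nonneg[of L "v t"] by linarith
   have "\<forall>\<^sub>F n in sequentially. nrm L (%x. v t x - simple_val (S n) t x) < nrm L (v t)"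
    using elim(2) pos by (rule order_tendstoD(2))
   hence "\<forall>\<^sub>F n in sequentially. nrm L (%x. v t x - simple_val (S n) t x) = d n t"
   proof eventually_elim
    case (elim n)
    have "nrm L (simple_val (S n) t) <= 2 * nrm L (v t)"
     using nS[of n t] elim by linarith
    hence "t : B n" using \<open>t : {a<..<b}\<close> by (simp add: B_def)
    thus ?case by (simp add: d_def Rv)
   qed
   with elim(2) show ?thesis by (rule Lim_transform_eventually)
  qed
 qed
 have di: "integrable ?M (d n)" for n
 proof (rule intb_B[OF _ dm])
  show "integrable ?M (%t. 3 * nrm L (v t))" using int by simp
  show "AE t in ?M. norm (d n t) <= norm (3 * nrm L (v t))"
   using dle[of n] by eventually_elim simp
 qed
 have lim: "(%n. \<integral>t. d n t \<partial>?M) ----> 0"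
 proof -
  have "(%n. \<integral>t. d n t \<partial>?M) ----> (\<integral>t. 0 \<partial>?M)"
   by (rule integral_dominated_convergence[where w = "%t. 3 * nrm L (v t)"])
    (use dm int dlim dle in auto)
  thus ?thesis by simp
 qed
 have cauchy: "nrm L (%x. simple_int (R m) x - simple_int (R n) x) <= (\<integral>t. d m t \<partial>?M) + (\<integral>t. d n t \<partial>?M)" for m n
 proof -
  define D where "D = R m @ simple_scale (-1) (R n)"
  have D: "simple_fn (space_L2 L) a b D"
   unfolding D_def simple_fn_append using Rs simple_fn_scale by blast
  have "nrm L (simple_int D) <= (\<integral>t. nrm L (simple_val D t) \<partial>?M)"
   by (rule simple_int_norm_le[OF D])
  also have "... <= (\<integral>t. d m t + d n t \<partial>?M)"
  proof (rule integral_mono_AE)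
   show "AE t in ?M. nrm L (simple_val D t) <= d m t + d n t"
    using S(1)
   proof eventually_elim
    case (elim t)
    have "simple_val D t = (%x. simple_val (R m) t x - simple_val (R n) t x)"
     by (simp add: D_def simple_val_append simple_val_scale)
    moreover have "nrm L (%x. simple_val (R m) t x - simple_val (R n) t x)
     <= nrm L (%x. simple_val (R m) t x - v t x) + d n t"
     unfolding d_def by (rule norm_L2_triangle_diff[OF simple_val_L2[OF Rs] elim simple_val_L2[OF Rs]])
    moreover have "nrm L (%x. simple_val (R m) t x - v t x) = d m t"
     unfolding d_def by (rule norm_L2_minus_commute)
    ultimately show ?case by simp
   qed
  qed (use simple_norm_integrable[OF D] di in auto)
  also have "... = (\<integral>t. d m t \<partial>?M) + (\<integral>t. d n t \<partial>?M)" using di by simp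
  finally show ?thesis by (simp add: D_def simple_int_append simple_int_scale)
 qed
 obtain I where I: "I : L2 L" "(%n. nrm L (%x. I x - simple_int (R n) x)) ----> 0"
 proof (rule L2_complete[where f = "%n. simple_int (R n)" and L = L])
  show "simple_int (R n) : L2 L" for n by (rule simple_int_L2[OF Rs])
  fix e :: real assume e: "e > 0"
  have "\<forall>\<^sub>F n in sequentially. (\<integral>t. d n t \<partial>?M) < e / 2"
   by (rule order_tendstoD(2)[OF lim]) (use e in simp)
  then obtain N where N: "!!n. n \<ge> N ==> (\<integral>t. d n t \<partial>?M) < e / 2"
   by (auto simp: eventually_sequentially)
  show "\<exists>N. \<forall>m\<ge>N. \<forall>n\<ge>N. nrm L (%x. simple_int (R m) x - simple_int (R n) x) < e"
  proof (intro exI allI impI)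
   fix m n assume "N <= m" "N <= n"
   thus "nrm L (%x. simple_int (R m) x - simple_int (R n) x) < e"
    using cauchy[of m n] N[of m] N[of n] by linarith
  qed
 qed (rule that)
 have "(\<integral>\<^sup>+t. ennreal (d n t) \<partial>?M) = ennreal (\<integral>t. d n t \<partial>?M)" for n
  by (rule nn_integral_eq_integral[OF di]) (simp add: d_def)
 moreover have "(%n. ennreal (\<integral>t. d n t \<partial>?M)) ----> ennreal 0"
  by (rule tendsto_ennrealI[OF lim])
 ultimately have "(%n. \<integral>\<^sup>+t. ennreal (d n t) \<partial>?M) ----> 0" by simp
 thus ?thesis
  unfolding has_bint_def using v I Rs by (intro exI[of _ I]) (auto simp: d_def[abs_def])
qed

text \<open>The chosen integral is known only through its pairings, and these suffice: the norm
  bound results from pairing it with itself.\<close>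

lemma bint_L2:
 assumes v: "bmL2 L a b v" and int: "integrable (ivl a b) (%t. nrm L (v t))"
 shows "bint (space_L2 L) a b v : L2 L"
  "!!\<psi>. \<psi> : L2 L ==> integrable (ivl a b) (%t. ip L (v t) \<psi>)"
  "!!\<psi>. \<psi> : L2 L ==> ip L (bint (space_L2 L) a b v) \<psi> = (LINT t|ivl a b. ip L (v t) \<psi>)"
  "nrm L (bint (space_L2 L) a b v) <= (LINT t|ivl a b. nrm L (v t))"
proof -
 let ?M = "ivl a b"
 let ?I = "bint (space_L2 L) a b v"
 have hb: "has_bint (space_L2 L) a b v ?I"
  unfolding bint_def using has_bint_exists[OF assms] by (rule someI_ex)
 show I: "?I : L2 L" using hb by (simp add: has_bint_def)
 show *: "!!\<psi>. \<psi> : L2 L ==> integrable ?M (%t. ip L (v t) \<psi>)"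
  "!!\<psi>. \<psi> : L2 L ==> ip L ?I \<psi> = (\<integral>t. ip L (v t) \<psi> \<partial>?M)"
  using has_bint_inner[OF hb] by auto
 have "(nrm L ?I)^2 = (\<integral>t. ip L (v t) ?I \<partial>?M)"
  using *(2)[OF I] by (simp add: norm_L2_square)
 also have "... <= (\<integral>t. nrm L (v t) * nrm L ?I \<partial>?M)"
 proof (rule integral_mono_AE)
  show "AE t in ?M. ip L (v t) ?I <= nrm L (v t) * nrm L ?I"
   using bmL2_AE[OF v]
  proof eventually_elim
   case (elim t)
   show ?case using inner_L2_Cauchy_Schwarz[OF elim I] by (rule abs_le_D1)
  qed
 qed (use *(1)[OF I] int in auto)
 also have "... = nrm L ?I * (\<integral>t. nrm L (v t) \<partial>?M)" by simp
 finally have "nrm L ?I * nrm L ?I <= nrm L ?I * (\<integral>t. nrm L (v t) \<partial>?M)"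
  by (simp add: power2_eq_square)
 moreover have "0 <= (\<integral>t. nrm L (v t) \<partial>?M)" by simp
 ultimately show "nrm L ?I <= (\<integral>t. nrm L (v t) \<partial>?M)"
  using norm_L2_nonneg[of L ?I] by (metis mult_left_le_imp_le order_le_less)
qed

section \<open>Functions of time with values in Sobolev spaces\<close>

definition simple_wderiv :: "real => nat => (real set \<times> (real => real)) list => (real set \<times> (real => real)) list" where
 "simple_wderiv L k S = map (%(A, f). (A, wderiv L k f)) S"

lemma simple_fn_wderiv:
 "simple_fn (space_H L r) a b S ==> k <= r ==> simple_fn (space_L2 L) a b (simple_wderiv L k S)"
 by (induction S) (auto simp: simple_wderiv_def simple_fn_Cons intro: Hk_wderiv)

lemma Hk_zero: "(%x. 0) : Hk L r"
proof -
 have "has_wderiv L k (%x. 0) (%x. 0)" for k by (simp add: has_wderiv_def)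
 thus ?thesis unfolding Hk_iff using L2_zero by blast
qed

lemma Hk_scale: "w : Hk L r ==> (%x. c * w x) : Hk L r"
 using Hk_linear[of w L r w c 0] by simp

lemma wderiv_scale:
 assumes "w : Hk L r" "k <= r"
 shows "AE x in leb L. wderiv L k (%x. c * w x) x = c * wderiv L k w x"
 using wderiv_linear[OF assms(1,1,2), of c 0] by simp

lemma Hk_diff: "w : Hk L r ==> w' : Hk L r ==> (%x. w x - w' x) : Hk L r"
 using Hk_linear[of w L r w' 1 "-1"] by simp

lemma wderiv_diff:
 assumes "w : Hk L r" "w' : Hk L r" "k <= r"
 shows "AE x in leb L. wderiv L k (%x. w x - w' x) x = wderiv L k w x - wderiv L k w' x"
 using wderiv_linear[OF assms, of 1 "-1"] by simp

text \<open>Since \<open>wderiv\<close> is a choice, it is linear only up to null sets and the sum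
  has to be built up element by element. The free coefficient \<open>c\<close> covers values (an
  indicator) and integrals (a measure) of simple functions together.\<close>

lemma simple_wderiv_lincomb:
 assumes "simple_fn (space_H L r) a b S" "k <= r"
 shows "(%x. \<Sum>(A, f)\<leftarrow>S. c A * f x) : Hk L r \<and>
  (AE x in leb L. wderiv L k (%x. \<Sum>(A, f)\<leftarrow>S. c A * f x) x = (\<Sum>(A, f)\<leftarrow>simple_wderiv L k S. c A * f x))"
 using assms(1)
proof (induction S)
 case Nil
 have "AE x in leb L. wderiv L k (%x. 0) x = 0"
  using wderivI(3)[of "%x. 0" L k "%x. 0"] by (simp add: has_wderiv_def)
 thus ?case by (simp add: Hk_zero simple_wderiv_def)
next
 case (Cons p S)
 obtain A f where p: "p = (A, f)" by (cases p)
 have f: "f : Hk L r" and S: "simple_fn (space_H L r) a b S"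
  using Cons.prems by (auto simp: p simple_fn_Cons)
 let ?s = "%x. \<Sum>(A, f)\<leftarrow>S. c A * f x"
 have s: "?s : Hk L r" and as: "AE x in leb L. wderiv L k ?s x = (\<Sum>(A, f)\<leftarrow>simple_wderiv L k S. c A * f x)"
  using Cons.IH[OF S] by auto
 have eq: "(%x. \<Sum>(A, f)\<leftarrow>p # S. c A * f x) = (%x. c A * f x + 1 * ?s x)"
  by (simp add: p)
 have "AE x in leb L. wderiv L k (%x. c A * f x + 1 * ?s x) x = (\<Sum>(A, f)\<leftarrow>simple_wderiv L k (p # S). c A * f x)"
  using as wderiv_linear[OF f s assms(2), of "c A" 1]
  by eventually_elim (simp add: p simple_wderiv_def)
 thus ?case
  unfolding eq using Hk_linear[OF f s, of "c A" 1] by blast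
qed

lemma simple_val_wderiv:
 assumes "simple_fn (space_H L r) a b S" "k <= r"
 shows "simple_val S t : Hk L r"
  "AE x in leb L. wderiv L k (simple_val S t) x = simple_val (simple_wderiv L k S) t x"
 using simple_wderiv_lincomb[OF assms, of "%A. ind A t"] by (auto simp: simple_val_def[abs_def])

lemma simple_int_wderiv:
 assumes "simple_fn (space_H L r) a b S" "k <= r"
 shows "simple_int S : Hk L r"
  "AE x in leb L. wderiv L k (simple_int S) x = simple_int (simple_wderiv L k S) x"
 using simple_wderiv_lincomb[OF assms, of "%A. measure lebesgue A"] by (auto simp: simple_int_def[abs_def])

lemma norm_wderiv_diff_le:
 assumes "w : Hk L r" "w' : Hk L r" "k <= r" "AE x in leb L. wderiv L k w' x = z x"
 shows "nrm L (%x. wderiv L k w x - z x) <= norm_H L r (%x. w x - w' x)"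
proof -
 have "nrm L (%x. wderiv L k w x - z x) = nrm L (wderiv L k (%x. w x - w' x))"
 proof (rule norm_L2_cong_AE[symmetric])
  show "wderiv L k (%x. w x - w' x) : bmf (leb L)"
   by (rule L2_measurable[OF Hk_wderiv(1)[OF Hk_diff[OF assms(1,2)] assms(3)]])
  show "AE x in leb L. wderiv L k (%x. w x - w' x) x = wderiv L k w x - z x"
   using wderiv_diff[OF assms(1-3)] assms(4) by eventually_elim simp
 qed
 also have "... <= norm_H L r (%x. w x - w' x)"
  by (rule norm_wderiv_le_norm_H[OF assms(3)])
 finally show ?thesis .
qed

lemma bm_wderiv:
 assumes "bochner_measurable (space_H L r) a b v" "k <= r"
 shows "bmL2 L a b (%t. wderiv L k (v t))"
proof -
 obtain S where v: "AE t in ivl a b. v t : Hk L r" and S: "!!n. simple_fn (space_H L r) a b (S n)"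
  and lim: "AE t in ivl a b. (%n. norm_H L r (%x. v t x - simple_val (S n) t x)) ----> 0"
  using assms(1) by (auto simp: bochner_measurable_def)
 show ?thesis
 proof (rule bmL2_I[where S = "%n. simple_wderiv L k (S n)"])
  show "AE t in ivl a b. wderiv L k (v t) : L2 L"
   using v by eventually_elim (rule Hk_wderiv(1)[OF _ assms(2)])
  show "simple_fn (space_L2 L) a b (simple_wderiv L k (S n))" for n
   by (rule simple_fn_wderiv[OF S assms(2)])
  show "AE t in ivl a b. (%n. nrm L (%x. wderiv L k (v t) x - simple_val (simple_wderiv L k (S n)) t x)) ----> 0"
   using v lim
  proof eventually_elim
   case (elim t)
   show ?case
   proof (rule Lim_null_comparison[OF _ elim(2)])
    show "\<forall>\<^sub>F n in sequentially. norm (nrm L (%x. wderiv L k (v t) x - simple_val (simple_wderiv L k (S n)) t x)) <= norm_H L r (%x. v t x - simple_val (S n) t x)"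
     using norm_wderiv_diff_le[OF elim(1) simple_val_wderiv(1)[OF S assms(2)] assms(2) simple_val_wderiv(2)[OF S assms(2)]]
     by simp
   qed
  qed
 qed
qed

text \<open>The derivative of order \<open>k\<close> is bounded from \<open>H^r\<close> to
  \<open>L2\<close>, hence it commutes with the Bochner integral: the same approximants work after
  differentiating their values.\<close>

lemma has_bint_wderiv:
 assumes "has_bint (space_H L r) a b v I" "k <= r"
 shows "has_bint (space_L2 L) a b (%t. wderiv L k (v t)) (wderiv L k I)"
proof -
 obtain S where v: "bochner_measurable (space_H L r) a b v" and IH: "I : Hk L r"
  and S: "!!n. simple_fn (space_H L r) a b (S n)"
  and lim: "(%n. \<integral>\<^sup>+t. ennreal (norm_H L r (%x. v t x - simple_val (S n) t x)) \<partial>ivl a b) ----> 0"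
  and limI: "(%n. norm_H L r (%x. I x - simple_int (S n) x)) ----> 0"
  using assms(1) by (auto simp: has_bint_def)
 have vt: "AE t in ivl a b. v t : Hk L r"
  using v by (simp add: bochner_measurable_def)
 have 1: "(%n. \<integral>\<^sup>+t. ennreal (nrm L (%x. wderiv L k (v t) x - simple_val (simple_wderiv L k (S n)) t x)) \<partial>ivl a b) ----> 0"
 proof (rule tendsto_sandwich[OF _ _ tendsto_const lim])
  show "\<forall>\<^sub>F n in sequentially. (\<integral>\<^sup>+t. ennreal (nrm L (%x. wderiv L k (v t) x - simple_val (simple_wderiv L k (S n)) t x)) \<partial>ivl a b)
   <= (\<integral>\<^sup>+t. ennreal (norm_H L r (%x. v t x - simple_val (S n) t x)) \<partial>ivl a b)"
  proof (rule always_eventually, rule allI, rule nn_integral_mono_AE)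
   fix n
   show "AE t in ivl a b. ennreal (nrm L (%x. wderiv L k (v t) x - simple_val (simple_wderiv L k (S n)) t x)) <= ennreal (norm_H L r (%x. v t x - simple_val (S n) t x))"
    using vt
   proof eventually_elim
    case (elim t)
    show ?case
     by (rule ennreal_leI[OF norm_wderiv_diff_le[OF elim simple_val_wderiv(1)[OF S assms(2)] assms(2) simple_val_wderiv(2)[OF S assms(2)]]])
   qed
  qed
 qed simp
 have 2: "(%n. nrm L (%x. wderiv L k I x - simple_int (simple_wderiv L k (S n)) x)) ----> 0"
 proof (rule Lim_null_comparison[OF _ limI])
  show "\<forall>\<^sub>F n in sequentially. norm (nrm L (%x. wderiv L k I x - simple_int (simple_wderiv L k (S n)) x)) <= norm_H L r (%x. I x - simple_int (S n) x)"
   using norm_wderiv_diff_le[OF IH simple_int_wderiv(1)[OF S assms(2)] assms(2) simple_int_wderiv(2)[OF S assms(2)]]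
   by simp
 qed
 show ?thesis
  unfolding has_bint_def norm_space_L2
  using simple_fn_wderiv[OF S assms(2)]
  by (intro conjI exI[of _ "%n. simple_wderiv L k (S n)"] allI bm_wderiv[OF v assms(2)]
    Hk_wderiv(1)[OF IH assms(2)] 1 2)
qed

section \<open>Weak time derivatives through scalar pairings\<close>

text \<open>The scalar shadow of \<open>has_tderiv\<close>. Pairing in space with a fixed element
  leads from the vector valued notion to this one, where primitives and uniqueness are available
  from the one-dimensional theory.\<close>

definition has_weak_tderiv :: "real => (real => real) => (real => real) => bool" where
 "has_weak_tderiv T f g \<longleftrightarrow> integrable (leb T) f \<and> integrable (leb T) g \<and>
  (\<forall>\<phi>. test_fun 0 T \<phi> \<longrightarrow>
    (LINT t|leb T. f t * deriv \<phi> t) = - (LINT t|leb T. g t * \<phi> t))"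

lemma has_weak_tderiv_imp_prim:
 assumes "0 < T" "has_weak_tderiv T f g"
 obtains c where "AE t in leb T. f t = c + prim T g t"
 using assms du_bois_reymond[of T f g] unfolding has_weak_tderiv_def by blast

lemma has_weak_tderiv_unique:
 assumes "has_weak_tderiv T f g" "has_weak_tderiv T f' g'" "AE t in leb T. f t = f' t"
 shows "AE t in leb T. g t = g' t"
proof -
 have i: "integrable (leb T) g" "integrable (leb T) g'"
  "integrable (leb T) f" "integrable (leb T) f'"
  using assms by (auto simp: has_weak_tderiv_def)
 have "AE t in leb T. g t - g' t = 0"
 proof (rule fundamental_lemma)
  show "integrable (leb T) (%t. g t - g' t)" using i by simp
  fix \<phi> assume \<phi>: "test_fun 0 T \<phi>"
  note m = integrable_mult_test_fun[OF i(1) \<phi>] integrable_mult_test_fun[OF i(2) \<phi>]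
   integrable_mult_test_fun[OF i(3) test_fun_deriv[OF \<phi>]] integrable_mult_test_fun[OF i(4) test_fun_deriv[OF \<phi>]]
  have "(LINT t|leb T. f t * deriv \<phi> t) = (LINT t|leb T. f' t * deriv \<phi> t)"
  proof (rule integral_cong_AE)
   show "AE t in leb T. f t * deriv \<phi> t = f' t * deriv \<phi> t"
    using assms(3) by eventually_elim simp
  qed (use m in auto)
  hence "(LINT t|leb T. g t * \<phi> t) = (LINT t|leb T. g' t * \<phi> t)"
   using assms(1)[unfolded has_weak_tderiv_def, THEN conjunct2, THEN conjunct2, rule_format, OF \<phi>]
    assms(2)[unfolded has_weak_tderiv_def, THEN conjunct2, THEN conjunct2, rule_format, OF \<phi>] by linarith
  thus "(LINT t|leb T. (g t - g' t) * \<phi> t) = 0"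
   using m by (simp add: left_diff_distrib)
 qed
 thus ?thesis by eventually_elim simp
qed

lemma has_weak_tderiv_prim:
 assumes "integrable (leb T) g" "AE t in leb T. f t = prim T g t"
 shows "has_weak_tderiv T f g"
proof -
 have pm: "prim T g : bmf (leb T)"
  by (rule borel_measurable_Ioo[OF borel_measurable_continuous_onI[OF prim_continuous[OF assms(1)]]])
 have "integrable (leb T) (%x. 1 * prim T g x)"
  by (rule integrable_bounded_mult(1)[OF integrable_const_Ioo pm prim_bound[OF assms(1)]])
 hence pi: "integrable (leb T) (prim T g)" by simp
 have AE: "AE t in leb T. prim T g t = f t"
  using assms(2) by eventually_elim simp
 have fm: "f : bmf (leb T)"
  by (rule measurable_AE_lebesgue_on[OF pm AE])
 have fi: "integrable (leb T) f"
  by (rule integrable_cong_AE_imp[OF pi fm AE])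
 have "(LINT t|leb T. f t * deriv \<phi> t) = - (LINT t|leb T. g t * \<phi> t)" if \<phi>: "test_fun 0 T \<phi>" for \<phi>
 proof -
  have "(LINT t|leb T. f t * deriv \<phi> t) = (LINT t|leb T. prim T g t * deriv \<phi> t)"
  proof (rule integral_cong_AE)
   show "AE t in leb T. f t * deriv \<phi> t = prim T g t * deriv \<phi> t"
    using assms(2) by eventually_elim simp
  qed (use integrable_mult_test_fun[OF fi test_fun_deriv[OF \<phi>]] integrable_mult_test_fun[OF pi test_fun_deriv[OF \<phi>]] in auto)
  thus ?thesis using test_fun_prim_mult[OF assms(1) \<phi>] by simp
 qed
 thus ?thesis unfolding has_weak_tderiv_def using fi assms(1) by blast
qed

lemma bochner_Lp_L2_integrable:
 assumes "v : bochner_Lp 1 T (space_L2 L)"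
 shows "bmL2 L 0 T v" "integrable (leb T) (%t. nrm L (v t))"
 using assms by (auto simp: bochner_Lp_def)

lemma bochner_Lp_wderiv:
 assumes "v : bochner_Lp p T (space_H L r)" "k <= r" "p > 0"
 shows "(%t. wderiv L k (v t)) : bochner_Lp p T (space_L2 L)"
proof -
 have v: "bochner_measurable (space_H L r) 0 T v" and int: "integrable (leb T) (%t. norm_H L r (v t) powr p)"
  using assms(1) by (auto simp: bochner_Lp_def)
 have b: "bmL2 L 0 T (%t. wderiv L k (v t))" by (rule bm_wderiv[OF v assms(2)])
 have "integrable (leb T) (%t. nrm L (wderiv L k (v t)) powr p)"
 proof (rule intb_B[OF int])
  show "(%t. nrm L (wderiv L k (v t)) powr p) : bmf (leb T)"
   using bmL2_norm_measurable[OF b] by measurable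
  show "AE t in leb T. norm (nrm L (wderiv L k (v t)) powr p) <= norm (norm_H L r (v t) powr p)"
   using norm_wderiv_le_norm_H[OF assms(2)] assms(3) by (intro AE_I2) (auto intro!: powr_mono2)
 qed
 with b show ?thesis by (simp add: bochner_Lp_def)
qed

lemma has_tderiv_L2_inner:
 assumes "has_tderiv (space_L2 L) T v w" "\<psi> : L2 L"
 shows "has_weak_tderiv T (%t. ip L (v t) \<psi>) (%t. ip L (w t) \<psi>)"
proof -
 have v: "v : bochner_Lp 1 T (space_L2 L)" and w: "w : bochner_Lp 1 T (space_L2 L)"
  using assms by (auto simp: has_tderiv_def)
 note v' = bochner_Lp_L2_integrable[OF v] and w' = bochner_Lp_L2_integrable[OF w]
 have "(LINT t|leb T. ip L (v t) \<psi> * deriv \<phi> t) = - (LINT t|leb T. ip L (w t) \<psi> * \<phi> t)"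
  if \<phi>: "test_fun 0 T \<phi>" for \<phi>
 proof -
  obtain I where I: "has_bint (space_L2 L) 0 T (%t x. deriv \<phi> t * v t x) I"
   "has_bint (space_L2 L) 0 T (%t x. \<phi> t * w t x) (%x. - I x)"
   using assms(1) \<phi> by (auto simp: has_tderiv_def)
  have "ip L (%x. - I x) \<psi> = - ip L I \<psi>"
   using inner_L2_scale_left[of L "-1" I \<psi>] by simp
  thus ?thesis
   using has_bint_inner(2)[OF I(1) assms(2)] has_bint_inner(2)[OF I(2) assms(2)]
   by (simp add: inner_L2_scale_left mult.commute)
 qed
 thus ?thesis
  unfolding has_weak_tderiv_def using bint_L2(2)[OF v' assms(2)] bint_L2(2)[OF w' assms(2)] by blast
qed

text \<open>Taking a derivative of order at most \<open>r\<close> and pairing it with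
  \<open>\<psi>\<close> is a bounded functional on \<open>H^r\<close>, so it passes through the
  Bochner integrals that define the weak time derivative.\<close>

lemma has_tderiv_H_inner:
 assumes "has_tderiv (space_H L r) T v w" "\<psi> : L2 L" "k <= r"
 shows "has_weak_tderiv T (%t. ip L (wderiv L k (v t)) \<psi>) (%t. ip L (wderiv L k (w t)) \<psi>)"
proof -
 have vH: "v : bochner_Lp 1 T (space_H L r)" and wH: "w : bochner_Lp 1 T (space_H L r)"
  using assms by (auto simp: has_tderiv_def)
 note v' = bochner_Lp_L2_integrable[OF bochner_Lp_wderiv[OF vH assms(3)]]
  and w' = bochner_Lp_L2_integrable[OF bochner_Lp_wderiv[OF wH assms(3)]]
 have vt: "AE t in leb T. v t : Hk L r" and wt: "AE t in leb T. w t : Hk L r"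
  using vH wH by (auto simp: bochner_Lp_def bochner_measurable_def)
 have vi: "integrable (leb T) (%t. ip L (wderiv L k (v t)) \<psi>)"
  and wi: "integrable (leb T) (%t. ip L (wderiv L k (w t)) \<psi>)"
  using bint_L2(2)[OF v' assms(2)] bint_L2(2)[OF w' assms(2)] by auto
 have mult: "ip L (wderiv L k (%x. c * z x)) \<psi> = c * ip L (wderiv L k z) \<psi>"
  if z: "z : Hk L r" for c z
 proof -
  have "ip L (wderiv L k (%x. c * z x)) \<psi> = ip L (%x. c * wderiv L k z x) \<psi>"
   by (rule inner_L2_cong_AE[OF L2_measurable[OF Hk_wderiv(1)[OF Hk_scale[OF z] assms(3)]] L2_measurable[OF assms(2)] wderiv_scale[OF z assms(3)]])
    simp
  thus ?thesis by (simp add: inner_L2_scale_left)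
 qed
 have key: "(LINT t|leb T. c t * ip L (wderiv L k (z t)) \<psi>) = ip L (wderiv L k I) \<psi>"
  if I: "has_bint (space_H L r) 0 T (%t x. c t * z t x) I" and z: "AE t in leb T. z t : Hk L r"
   and m: "(%t. c t * ip L (wderiv L k (z t)) \<psi>) : bmf (leb T)" for c z I
 proof -
  note hb = has_bint_inner[OF has_bint_wderiv[OF I assms(3)] assms(2)]
  have "(LINT t|leb T. c t * ip L (wderiv L k (z t)) \<psi>) = (LINT t|leb T. ip L (wderiv L k (%x. c t * z t x)) \<psi>)"
  proof (rule integral_cong_AE[OF m])
   show "AE t in leb T. c t * ip L (wderiv L k (z t)) \<psi> = ip L (wderiv L k (%x. c t * z t x)) \<psi>"
    using z by eventually_elim (simp add: mult)
  qed (use hb(1) in auto)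
  thus ?thesis using hb(2) by simp
 qed
 have "(LINT t|leb T. ip L (wderiv L k (v t)) \<psi> * deriv \<phi> t) = - (LINT t|leb T. ip L (wderiv L k (w t)) \<psi> * \<phi> t)"
  if \<phi>: "test_fun 0 T \<phi>" for \<phi>
 proof -
  obtain I where I: "has_bint (space_H L r) 0 T (%t x. deriv \<phi> t * v t x) I"
   "has_bint (space_H L r) 0 T (%t x. \<phi> t * w t x) (%x. - I x)"
   using assms(1) \<phi> by (auto simp: has_tderiv_def)
  have IH: "I : Hk L r" using I(1) by (simp add: has_bint_def)
  have "ip L (wderiv L k (%x. - I x)) \<psi> = - ip L (wderiv L k I) \<psi>"
   using mult[OF IH, of "-1"] by simp
  thus ?thesis
   using key[OF I(1) vt] key[OF I(2) wt] integrable_mult_test_fun[OF vi test_fun_deriv[OF \<phi>]] integrable_mult_test_fun[OF wi \<phi>]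
   by (simp add: mult.commute borel_measurable_integrable)
 qed
 thus ?thesis
  unfolding has_weak_tderiv_def using vi wi by blast
qed

lemma tderiv_has_tderiv:
 assumes "v : bochner_W1p p T (space_L2 L)" shows "has_tderiv (space_L2 L) T v (tderiv L T v)"
proof -
 have "\<exists>w. has_tderiv (space_L2 L) T v w" using assms by (auto simp: bochner_W1p_def)
 thus ?thesis unfolding tderiv_def by (rule someI_ex)
qed

text \<open>Each \<open>\<psi>\<close> comes with its own exceptional null set of times. Indicators
  with rational endpoints separate the elements of the space, so countably many of these null sets
  are enough.\<close>

lemma bmL2_AE_eqI:
 assumes "AE t in M. v t : L2 L" "AE t in M. w t : L2 L"
  and "!!\<psi>. \<psi> : L2 L ==> AE t in M. ip L (v t) \<psi> = ip L (w t) \<psi>"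
 shows "AE t in M. AE x in leb L. v t x = w t x"
proof -
 have "AE t in M. \<forall>q\<in>\<rat>. ip L (v t) (ind {0<..<q}) = ip L (w t) (ind {0<..<q})"
  using assms(3)[OF L2_indicator] by (subst AE_ball_countable) (auto simp: countable_rat)
 with assms(1,2) show ?thesis
 proof eventually_elim
  case (elim t)
  thus ?case by (intro L2_AE_eqI) auto
 qed
qed

text \<open>Both derivatives have the same scalar pairings. This is why a time derivative formed in
  \<open>L2\<close> may be measured in the \<open>H^r\<close> norm and why a regular representative
  of it can be used.\<close>

lemma tderiv_eq_H:
 assumes "has_tderiv (space_L2 L) T v w" "has_tderiv (space_H L r) T v w'"
 shows "AE t in leb T. AE x in leb L. w t x = w' t x"
proof (rule bmL2_AE_eqI)
 have w: "bmL2 L 0 T w" and v: "bmL2 L 0 T v"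
  using assms(1) bochner_Lp_L2_integrable by (auto simp: has_tderiv_def)
 have w'H: "AE t in leb T. w' t : Hk L r" and vH: "AE t in leb T. v t : Hk L r"
  using assms(2) by (auto simp: has_tderiv_def bochner_Lp_def bochner_measurable_def)
 show "AE t in leb T. w t : L2 L" by (rule bmL2_AE[OF w])
 show w'L: "AE t in leb T. w' t : L2 L" using w'H by eventually_elim (rule Hk_L2)
 fix \<psi> assume \<psi>: "\<psi> : L2 L"
 have c: "ip L (wderiv L 0 z) \<psi> = ip L z \<psi>" if "z : L2 L" for z
  using wderivI(1)[OF that has_wderiv_0] wderiv_0(1)[OF that] \<psi>
  by (intro inner_L2_cong_AE) (auto simp: L2_iff)
 have "AE t in leb T. ip L (w t) \<psi> = ip L (wderiv L 0 (w' t)) \<psi>"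
 proof (rule has_weak_tderiv_unique[OF has_tderiv_L2_inner[OF assms(1) \<psi>] has_tderiv_H_inner[OF assms(2) \<psi> le0]])
  show "AE t in leb T. ip L (v t) \<psi> = ip L (wderiv L 0 (v t)) \<psi>"
   using bmL2_AE[OF v] by eventually_elim (simp add: c)
 qed
 with w'L show "AE t in leb T. ip L (w t) \<psi> = ip L (w' t) \<psi>"
  by eventually_elim (simp add: c)
qed

section \<open>Convolution with locally integrable kernels\<close>

lemma has_bochner_integral_of_has_integral:
 fixes f :: "real => real"
 assumes [measurable]: "f : bmf borel" "\<Omega> : sets borel"
  and nonneg: "!!x. x : \<Omega> ==> 0 <= f x" and I: "(f has_integral I) \<Omega>"
 shows "has_bochner_integral lborel (%x. ind \<Omega> x * f x) I"
proof (rule has_bochner_integral_nn_integral)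
 show "(\<integral>\<^sup>+x. ennreal (ind \<Omega> x * f x) \<partial>lborel) = ennreal I"
  by (rule nn_integral_has_integral_lebesgue[OF nonneg I])
 show "0 <= I" using has_integral_nonneg[OF I] nonneg by blast
 show "AE x in lborel. 0 <= ind \<Omega> x * f x"
  using nonneg by (intro AE_I2) (auto simp: indicator_def)
qed measurable

lemma Cauchy_Schwarz_integral:
 fixes g h :: "'a => real"
 assumes g2: "integrable M (%x. (g x)^2)" and h2: "integrable M (%x. (h x)^2)"
  and g: "g : bmf M" and h: "h : bmf M"
 shows "integrable M (%x. g x * h x)"
  "(LINT x|M. g x * h x)^2 <= (LINT x|M. (g x)^2) * (LINT x|M. (h x)^2)"
proof -
 show i: "integrable M (%x. g x * h x)"
 proof (rule intb_B)
  show "integrable M (%x. (g x)^2 + (h x)^2)" using g2 h2 by simp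
  show "AE x in M. norm (g x * h x) <= norm ((g x)^2 + (h x)^2)"
  proof (rule AE_I2)
   fix x
   have "2 * (\<bar>g x\<bar> * \<bar>h x\<bar>) <= (g x)^2 + (h x)^2"
    using sum_squares_bound[of "\<bar>g x\<bar>" "\<bar>h x\<bar>"] by simp
   moreover have "0 <= \<bar>g x\<bar> * \<bar>h x\<bar>" by simp
   ultimately have "\<bar>g x\<bar> * \<bar>h x\<bar> <= (g x)^2 + (h x)^2" by linarith
   thus "norm (g x * h x) <= norm ((g x)^2 + (h x)^2)" by (simp add: abs_mult)
  qed
  show "(%x. g x * h x) : bmf M" using g h by auto
 qed
 define A B C where "A = (LINT x|M. (g x)^2)" and "B = (LINT x|M. g x * h x)" and "C = (LINT x|M. (h x)^2)"
 have q: "0 <= C - 2 * s * B + s^2 * A" for s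
 proof -
  have "0 <= (LINT x|M. (h x - s * g x)^2)" by simp
  also have "... = (LINT x|M. ((h x)^2 - (2 * s) * (g x * h x)) + s^2 * (g x)^2)"
   by (simp add: power2_diff power_mult_distrib algebra_simps)
  also have "... = C - 2 * s * B + s^2 * A"
   using g2 h2 i by (simp add: A_def B_def C_def)
  finally show ?thesis .
 qed
 have "B^2 <= A * C"
 proof (cases "A = 0")
  case True
  hence "AE x in M. g x = 0"
   using integral_nonneg_eq_0_iff_AE[OF g2] by (simp add: A_def)
  hence "B = (LINT x|M. 0)"
   unfolding B_def using i by (intro integral_cong_AE) (auto elim!: eventually_mono)
  thus ?thesis using True by simp
 next
  case False
  hence A: "A > 0" unfolding A_def by (simp add: order_less_le)
  have "0 <= A * (C - 2 * (B / A) * B + (B / A)^2 * A)" using q[of "B / A"] A by simp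
  also have "... = A * C - B^2" using A by (simp add: field_simps power2_eq_square)
  finally show ?thesis by simp
 qed
 thus "(LINT x|M. g x * h x)^2 <= (LINT x|M. (g x)^2) * (LINT x|M. (h x)^2)"
  by (simp add: A_def B_def C_def)
qed

text \<open>Cauchy-Schwarz for the factors \<open>sqrt k\<close> and \<open>sqrt k * h\<close>. The
  mass of the weight appears as a separate factor, and this factor is what the applications make
  explicit or small.\<close>

lemma weighted_Cauchy_Schwarz:
 fixes k h :: "'a => real"
 assumes k: "integrable M k" and kh: "integrable M (%x. k x * (h x)^2)"
  and k0: "!!x. 0 <= k x" and h: "h : bmf M"
 shows "integrable M (%x. k x * h x)"
  "(LINT x|M. k x * h x)^2 <= (LINT x|M. k x) * (LINT x|M. k x * (h x)^2)"
proof -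
 have [measurable]: "k : bmf M" "h : bmf M" using k h by auto
 have eq: "(%x. (sqrt (k x))^2) = k" "(%x. (sqrt (k x) * h x)^2) = (%x. k x * (h x)^2)"
  "(%x. sqrt (k x) * (sqrt (k x) * h x)) = (%x. k x * h x)"
  using k0 by (auto simp: power_mult_distrib mult.assoc[symmetric])
 have m: "(%x. sqrt (k x)) : bmf M" "(%x. sqrt (k x) * h x) : bmf M"
  by measurable
 note CS = Cauchy_Schwarz_integral[of M "%x. sqrt (k x)" "%x. sqrt (k x) * h x", unfolded eq, OF k kh m]
 show "integrable M (%x. k x * h x)" "(LINT x|M. k x * h x)^2 <= (LINT x|M. k x) * (LINT x|M. k x * (h x)^2)"
  by (rule CS)+
qed

text \<open>Causal, nonnegative kernels. Integrability is asked only below each \<open>X\<close>,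
  because neither the fractional kernel nor the Heaviside function is integrable over the whole
  line.\<close>

definition kernel :: "(real => real) => bool" where
 "kernel k \<longleftrightarrow> k : bmf borel \<and> (\<forall>x. 0 <= k x) \<and> (\<forall>x\<le>0. k x = 0) \<and>
  (\<forall>X. integrable lborel (%x. ind {..<X} x * k x))"

definition conv :: "(real => real) => (real => real) => real => real" where
 "conv k f t = (LBINT s. k (t - s) * f s)"

lemma kernelD:
 assumes "kernel k"
 shows "k : bmf borel" "0 <= k x" "x <= 0 ==> k x = 0"
  "integrable lborel (%x. ind {..<X} x * k x)"
 using assms by (auto simp: kernel_def)

lemma conv_product_integrable:
 fixes K f :: "real => real"
 assumes K: "integrable lborel K" and f: "integrable lborel f"
 shows "integrable (lborel \<Otimes>\<^sub>M lborel) (%(t, s). K (t - s) * f s)"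
proof -
 have [measurable]: "K : bmf borel" "f : bmf borel"
  using K f by auto
 have tr: "(LBINT t. \<bar>K (t - s)\<bar>) = (LBINT t. \<bar>K t\<bar>)" "integrable lborel (%t. K (t - s))" for s
  using lborel_integral_real_affine[of 1 "%t. \<bar>K t\<bar>" "- s"]
   lborel_integrable_real_affine[of K 1 "- s"] K by (simp_all add: add.commute)
 have "integrable (lborel \<Otimes>\<^sub>M lborel) (%(s, t). K (t - s) * f s)"
 proof (rule lborel_pair.Fubini_integrable)
  show "(%(s, t). K (t - s) * f s) : bmf (lborel \<Otimes>\<^sub>M lborel)" by measurable
  show "integrable lborel (%s. \<integral>t. norm (case (s, t) of (s, t) => K (t - s) * f s) \<partial>lborel)"
   using f by (simp add: abs_mult tr)
  show "AE s in lborel. integrable lborel (%t. case (s, t) of (s, t) => K (t - s) * f s)"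
   using tr by simp
 qed
 from lborel_pair.integrable_product_swap[OF this] show ?thesis by simp
qed

context
 fixes k f :: "real => real"
 assumes k: "kernel k" and f: "integrable lborel f" and f0: "!!s. s <= 0 ==> f s = 0"
begin

text \<open>Because \<open>f\<close> lives on positive times, values up to time \<open>X\<close>
  only involve arguments of the kernel below \<open>X\<close>. There the kernel can be replaced by
  an integrable truncation, and the theory for integrable functions applies.\<close>

lemma kernel_conv_eq:
 assumes "t <= X" shows "k (t - s) * f s = ind {..<X} (t - s) * k (t - s) * f s"
 using assms f0[of s] by (cases "s <= 0") auto

lemma conv_local_product_integrable:
 "integrable (lborel \<Otimes>\<^sub>M lborel) (%(t, s). ind {..X} t * (k (t - s) * f s))"
proof -
 have [measurable]: "k : bmf borel" "f : bmf borel"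
  using kernelD(1)[OF k] f by auto
 show ?thesis
 proof (rule intb_B)
  show "integrable (lborel \<Otimes>\<^sub>M lborel) (%(t, s). ind {..<X} (t - s) * k (t - s) * f s)"
   using conv_product_integrable[OF kernelD(4)[OF k, of X] f] by simp
  show "(%(t, s). ind {..X} t * (k (t - s) * f s)) : bmf (lborel \<Otimes>\<^sub>M lborel)"
   by measurable
  show "AE p in lborel \<Otimes>\<^sub>M lborel. norm (case p of (t, s) => ind {..X} t * (k (t - s) * f s))
    <= norm (case p of (t, s) => ind {..<X} (t - s) * k (t - s) * f s)"
   using kernel_conv_eq[of _ X] by (intro AE_I2) (auto simp: indicator_def split: prod.split)
 qed
qed

lemma conv_AE_integrable: "AE t in lborel. t <= X \<longrightarrow> integrable lborel (%s. k (t - s) * f s)"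
 using lborel_pair.AE_integrable_fst'[OF conv_local_product_integrable[of X]]
 by eventually_elim auto

lemma conv_integrable: "integrable lborel (%t. ind {..X} t * conv k f t)"
 using lborel_pair.integrable_fst'[OF conv_local_product_integrable[of X]] by (simp add: conv_def)

lemma conv_integral:
 "(LBINT t. ind {..<X} t * conv k f t) = (LBINT s. f s * (LBINT t. ind {..<X - s} t * k t))"
proof -
 have [measurable]: "k : bmf borel" "f : bmf borel"
  using kernelD(1)[OF k] f by auto
 have int: "integrable (lborel \<Otimes>\<^sub>M lborel) (%(t, s). ind {..<X} t * (k (t - s) * f s))"
 proof (rule intb_B[OF conv_local_product_integrable[of X]])
  show "(%(t, s). ind {..<X} t * (k (t - s) * f s)) : bmf (lborel \<Otimes>\<^sub>M lborel)"
   by measurable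
  show "AE p in lborel \<Otimes>\<^sub>M lborel. norm (case p of (t, s) => ind {..<X} t * (k (t - s) * f s))
    <= norm (case p of (t, s) => ind {..X} t * (k (t - s) * f s))"
   by (intro AE_I2) (auto simp: indicator_def split: prod.split)
 qed
 have "(LBINT t. ind {..<X} t * conv k f t) = (LBINT t. \<integral>s. ind {..<X} t * (k (t - s) * f s) \<partial>lborel)"
  by (simp add: conv_def)
 also have "... = (LBINT s. \<integral>t. ind {..<X} t * (k (t - s) * f s) \<partial>lborel)"
  using lborel_pair.Fubini_integral[OF int] by simp
 also have "... = (LBINT s. f s * (LBINT t. ind {..<X - s} t * k t))"
 proof (intro intc_B refl)
  fix s
  have "(LBINT t. ind {..<X} t * (k (t - s) * f s)) = (LBINT t. f s * (ind {..<X} t * k (t - s)))"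
   by (simp add: mult_ac)
  also have "... = f s * (LBINT t. ind {..<X} t * k (t - s))" by simp
  also have "(LBINT t. ind {..<X} t * k (t - s)) = (LBINT t. ind {..<X} (s + t) * k t)"
   using lborel_integral_real_affine[of 1 "%t. ind {..<X} t * k (t - s)" s] by simp
  also have "(%t. ind {..<X} (s + t) * k t) = (%t. ind {..<X - s} t * k t)"
   by (auto simp: indicator_def)
  finally show "(LBINT t. ind {..<X} t * (k (t - s) * f s)) = f s * (LBINT t. ind {..<X - s} t * k t)" .
 qed
 finally show ?thesis .
qed

lemma conv_measurable [measurable]: "conv k f : bmf borel"
proof -
 have [measurable]: "k : bmf borel" "f : bmf borel"
  using kernelD(1)[OF k] f by auto
 show ?thesis unfolding conv_def[abs_def] by measurable
qed

lemma conv_nonpos: assumes "t <= 0" shows "conv k f t = 0"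
proof -
 have "k (t - s) * f s = 0" for s
  using f0[of s] kernelD(3)[OF k, of "t - s"] assms by (cases "s <= 0") auto
 thus ?thesis unfolding conv_def by (simp only: intz_B)
qed

end

lemma conv_mono_nonneg:
 assumes "kernel k" "!!s. 0 <= f s" shows "0 <= conv k f t"
 unfolding conv_def using assms kernelD(2) by (intro integral_nonneg_AE AE_I2) auto

lemma conv_assoc_at:
 assumes k: "kernel k" and l: "kernel l" and f: "f : bmf borel"
  and int: "integrable (lborel \<Otimes>\<^sub>M lborel) (%(s, r). k (t - s) * (l (s - r) * f r))"
 shows "conv k (conv l f) t = conv (conv k l) f t"
proof -
 have [measurable]: "k : bmf borel" "l : bmf borel" "f : bmf borel"
  using kernelD(1)[OF k] kernelD(1)[OF l] f by auto
 have "conv k (conv l f) t = (LBINT s. \<integral>r. k (t - s) * (l (s - r) * f r) \<partial>lborel)"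
  by (simp add: conv_def)
 also have "... = (LBINT r. \<integral>s. k (t - s) * (l (s - r) * f r) \<partial>lborel)"
  using lborel_pair.Fubini_integral[OF int] by simp
 also have "... = conv (conv k l) f t"
  unfolding conv_def
 proof (intro intc_B refl)
  fix r
  have "(LBINT s. k (t - s) * (l (s - r) * f r)) = (LBINT s. f r * (k (t - s) * l (s - r)))"
   by (simp add: mult_ac)
  also have "... = f r * (LBINT s. k (t - s) * l (s - r))" by simp
  also have "(LBINT s. k (t - s) * l (s - r)) = (LBINT s. k (t - r - s) * l s)"
   using lborel_integral_real_affine[of 1 "%s. k (t - s) * l (s - r)" r] by (simp add: diff_diff_eq)
  finally show "(LBINT s. k (t - s) * (l (s - r) * f r)) = (LBINT s. k (t - r - s) * l s) * f r"
   by simp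
 qed
 finally show ?thesis .
qed

text \<open>Associativity is Fubini wherever the double integral converges absolutely. That this
  happens for almost every time follows from the existence of convolutions, applied to absolute
  values.\<close>

lemma conv_assoc_AE:
 assumes k: "kernel k" and l: "kernel l" and f: "integrable lborel f" and f0: "!!s. s <= 0 ==> f s = 0"
 shows "AE t in lborel. t <= X \<longrightarrow> conv k (conv l f) t = conv (conv k l) f t"
proof -
 have [measurable]: "k : bmf borel" "l : bmf borel" "f : bmf borel"
  using kernelD(1)[OF k] kernelD(1)[OF l] f by auto
 let ?f = "%s. \<bar>f s\<bar>"
 have af: "integrable lborel ?f" "!!s. s <= 0 ==> ?f s = 0" using f f0 by auto
 define g where "g s = ind {..X} s * conv l ?f s" for s
 have g: "integrable lborel g" "!!s. s <= 0 ==> g s = 0"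
  using conv_integrable[OF l af] conv_nonpos[OF l af] by (auto simp: g_def[abs_def])
 have AEl: "AE s in lborel. s <= X \<longrightarrow> integrable lborel (%r. l (s - r) * f r)"
  by (rule conv_AE_integrable[OF l f f0])
 have "AE t in lborel. t <= X \<longrightarrow> integrable lborel (%s. k (t - s) * g s)"
  by (rule conv_AE_integrable[OF k g])
 thus ?thesis
 proof eventually_elim
  case (elim t)
  show ?case
  proof
   assume t: "t <= X"
   hence i: "integrable lborel (%s. k (t - s) * g s)" using elim by blast
   show "conv k (conv l f) t = conv (conv k l) f t"
   proof (rule conv_assoc_at[OF k l])
    show "integrable (lborel \<Otimes>\<^sub>M lborel) (%(s, r). k (t - s) * (l (s - r) * f r))"
    proof (rule lborel_pair.Fubini_integrable)
     show "(%(s, r). k (t - s) * (l (s - r) * f r)) : bmf (lborel \<Otimes>\<^sub>M lborel)"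
      by measurable
     have "(LBINT r. norm (k (t - s) * (l (s - r) * f r))) = k (t - s) * g s" for s
     proof (cases "s <= X")
      case True
      have "(LBINT r. norm (k (t - s) * (l (s - r) * f r))) = (LBINT r. k (t - s) * (l (s - r) * \<bar>f r\<bar>))"
       using kernelD(2)[OF k] kernelD(2)[OF l] by (simp add: abs_mult)
      thus ?thesis using True by (simp add: g_def conv_def)
     next
      case False
      thus ?thesis using t kernelD(3)[OF k, of "t - s"] by simp
     qed
     thus "integrable lborel (%s. \<integral>r. norm (case (s, r) of (s, r) => k (t - s) * (l (s - r) * f r)) \<partial>lborel)"
      using i by simp
     show "AE s in lborel. integrable lborel (%r. case (s, r) of (s, r) => k (t - s) * (l (s - r) * f r))"
      using AEl
     proof eventually_elim
      case (elim s)
      show ?case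
      proof (cases "s <= X")
       case True thus ?thesis using elim by simp
      next
       case False
       thus ?thesis using t kernelD(3)[OF k, of "t - s"] by simp
      qed
     qed
    qed
   qed measurable
  qed
 qed
qed

lemma conv_commute:
 assumes "kernel k" "kernel l" shows "conv k l x = conv l k x"
proof -
 have [measurable]: "k : bmf borel" "l : bmf borel"
  using assms kernelD(1) by auto
 show ?thesis
  unfolding conv_def
  using lborel_integral_real_affine[of "-1" "%s. k (x - s) * l s" x] by (simp add: mult.commute)
qed

section \<open>The fractional kernel and its convolution estimates\<close>

text \<open>The kernel \<open>omega\<close> set to 0 at nonpositive arguments: convolution over the
  line with this causal version is then the fractional integral from 0 to \<open>t\<close>.\<close>

definition kern :: "real => real => real" where
 "kern \<beta> t = (if 0 < t then t powr (\<beta> - 1) / Gamma \<beta> else 0)"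

lemma kern_measurable [measurable]: "kern \<beta> : bmf borel"
 unfolding kern_def[abs_def] by measurable

lemma kern_nonneg: "0 < \<beta> ==> 0 <= kern \<beta> t"
 by (simp add: kern_def Gamma_real_pos less_imp_le)

lemma kern_eq_omega: "0 < t ==> kern \<beta> t = omega \<beta> t"
 by (simp add: kern_def omega_def)

lemma kern_kernel: assumes "0 < \<beta>" shows "kernel (kern \<beta>)"
 unfolding kernel_def
proof (intro conjI allI impI)
 fix X :: real
 have hb: "has_bochner_integral lborel (%x. ind {0..max X 0} x * x powr (\<beta> - 1)) (max X 0 powr (\<beta> - 1 + 1) / (\<beta> - 1 + 1))"
  using assms by (intro has_bochner_integral_of_has_integral has_integral_powr_from_0) auto
 hence "integrable lborel (%x. ind {0..max X 0} x * x powr (\<beta> - 1) / Gamma \<beta>)"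
  by (intro Bochner_Integration.integrable_divide) (auto simp: has_bochner_integral_iff)
 thus "integrable lborel (%x. ind {..<X} x * kern \<beta> x)"
  by (rule intb_B) (auto simp: kern_def indicator_def)
qed (use assms kern_nonneg in \<open>auto simp: kern_def\<close>)

definition heaviside :: "real => real" where "heaviside = ind {0<..}"

lemma heaviside_kernel: "kernel heaviside"
proof -
 have "integrable lborel (%x. ind {..<X} x * ind {0<..} x :: real)" for X :: real
 proof -
  have "(%x. ind {..<X} x * ind {0<..} x :: real) = ind {0<..<X}"
   by (auto simp: indicator_def)
  moreover have "emeasure lborel {0<..<X} < \<infinity>" by (cases "0 <= X") auto
  ultimately show ?thesis by simp
 qed
 thus ?thesis by (auto simp: kernel_def heaviside_def)
qed

lemma conv_heaviside: "conv heaviside f t = (LBINT s. ind {..<t} s * f s)"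
 unfolding conv_def heaviside_def
 by (intro intc_B) (auto simp: indicator_def)

text \<open>The square of the kernel of order \<alpha> is a multiple of the kernel of order 2
  \<alpha> - 1, which is positive for \<alpha> > 1/2. Local square integrability of the kernel is
  the way in which this bound on \<alpha> enters.\<close>

lemma kern_square_kernel:
 assumes "1 / 2 < \<alpha>" shows "kernel (%x. (kern \<alpha> x)^2)"
proof -
 have eq: "(kern \<alpha> x)^2 = (Gamma (2 * \<alpha> - 1) / (Gamma \<alpha>)^2) * kern (2 * \<alpha> - 1) x" for x
 proof (cases "0 < x")
  case True
  have "(x powr (\<alpha> - 1))^2 = x powr (2 * \<alpha> - 2)"
   by (simp add: power2_eq_square flip: powr_add)
  moreover have "Gamma (2 * \<alpha> - 1) > 0" by (rule Gamma_real_pos) (use assms in simp)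
  ultimately show ?thesis using True by (simp add: kern_def power_divide)
 qed (simp add: kern_def)
 have "kernel (kern (2 * \<alpha> - 1))" using assms by (intro kern_kernel) simp
 moreover have "(%x. ind {..<X} x * ((kern \<alpha> x)^2)) = (%x. (Gamma (2 * \<alpha> - 1) / (Gamma \<alpha>)^2) * (ind {..<X} x * kern (2 * \<alpha> - 1) x))" for X
  by (simp add: eq mult_ac)
 ultimately show ?thesis
  unfolding kernel_def by (auto simp: kern_def)
qed

abbreviation below :: "real => (real => real) => real" where
 "below t f \<equiv> \<integral>s. ind {..<t} s * f s \<partial>lborel"

text \<open>The local form of Young's inequality for an integrable kernel and a square integrable
  function: Cauchy-Schwarz with the kernel as weight, then Fubini for the convolution of the kernel
  with the square of \<open>f\<close>.\<close>

lemma conv_square_integral_le: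
 assumes k: "kernel k" and f: "f : bmf borel" "integrable lborel (%s. (f s)^2)" "!!s. s <= 0 ==> f s = 0"
 shows "integrable lborel (%s. ind {..<X} s * (conv k f s)^2)"
  "(LBINT s. ind {..<X} s * (conv k f s)^2)
   <= (LBINT x. ind {..<X} x * k x)^2 * (LBINT s. ind {..<X} s * (f s)^2)"
proof -
 define \<kappa> where "\<kappa> = (LBINT x. ind {..<X} x * k x)"
 have [measurable]: "k : bmf borel" "f : bmf borel"
  using kernelD(1)[OF k] f by auto
 have k0: "0 <= k x" for x by (rule kernelD(2)[OF k])
 have \<kappa>0: "0 <= \<kappa>" unfolding \<kappa>_def using k0 by (intro integral_nonneg_AE AE_I2) auto
 define F where "F s = ind {..<X} s * (f s)^2" for s
 have F: "integrable lborel F" "!!s. s <= 0 ==> F s = 0"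
  using integrable_mult_indicator[OF _ f(2), of "{..<X}"] f(3) by (auto simp: F_def[abs_def])
 have F0: "0 <= F s" for s by (simp add: F_def)
 have cAE: "AE s in lborel. s <= X \<longrightarrow> integrable lborel (%r. k (s - r) * F r)"
  by (rule conv_AE_integrable[OF k F])
 have cint: "integrable lborel (%s. ind {..X} s * conv k F s)"
  by (rule conv_integrable[OF k F])
 have cmeas: "conv k F : bmf borel"
  by (rule conv_measurable[OF k F])
 have cval: "(LBINT s. ind {..<X} s * conv k F s) = (LBINT r. F r * (LBINT x. ind {..<X - r} x * k x))"
  by (rule conv_integral[OF k F])
 have mono: "(LBINT x. ind {..<Y} x * k x) <= \<kappa>" if "Y <= X" for Y
  unfolding \<kappa>_def using kernelD(4)[OF k] k0 that by (intro integral_mono) (auto simp: indicator_def)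
 have pt: "AE s in lborel. ind {..<X} s * (conv k f s)^2 <= \<kappa> * (ind {..<X} s * conv k F s)"
  using cAE
 proof eventually_elim
  case (elim s)
  show ?case
  proof (cases "s < X")
   case True
   \<comment> \<open>The reflected kernel, restricted to positive times, acts as the weight. Its
     total mass is that of \<open>k\<close> below \<open>s\<close>, which is at most
     \<open>\<kappa>\<close>.\<close>
   define w where "w r = ind {0<..} r * k (s - r)" for r
   have w: "integrable lborel w" "(LBINT r. w r) = (LBINT x. ind {..<s} x * k x)"
   proof -
    have eq: "(%x. ind {..<s} (s + -1 * x) * k (s + -1 * x)) = w"
     by (auto simp: w_def indicator_def)
    show "integrable lborel w"
     using lborel_integrable_real_affine[OF kernelD(4)[OF k, of s], of "-1" s] eq by simp
    show "(LBINT r. w r) = (LBINT x. ind {..<s} x * k x)"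
     using lborel_integral_real_affine[of "-1" "%x. ind {..<s} x * k x" s] eq by simp
   qed
   have weq: "w r * (f r)^2 = k (s - r) * F r" "w r * f r = k (s - r) * f r" for r
    using f(3)[of r] True kernelD(3)[OF k, of "s - r"] by (auto simp: w_def F_def indicator_def)
   have wi: "integrable lborel (%r. w r * (f r)^2)"
    unfolding weq using elim True by simp
   have "(LBINT r. w r * f r)^2 <= (LBINT r. w r) * (LBINT r. w r * (f r)^2)"
    by (rule weighted_Cauchy_Schwarz(2)[OF w(1) wi]) (use k0 in \<open>auto simp: w_def\<close>)
   hence "(conv k f s)^2 <= (LBINT x. ind {..<s} x * k x) * conv k F s"
    unfolding weq w(2) by (simp add: conv_def)
   also have "... <= \<kappa> * conv k F s"
    using mono[of s] True conv_mono_nonneg[OF k F0] by (intro mult_right_mono) auto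
   finally show ?thesis using True by simp
  qed simp
 qed
 have ii: "integrable lborel (%s. ind {..<X} s * conv k F s)"
 proof (rule intb_B[OF cint])
  show "(%s. ind {..<X} s * conv k F s) : bmf lborel"
   using cmeas by measurable
 qed (auto simp: indicator_def)
 have cm: "conv k f : bmf borel" unfolding conv_def[abs_def] by measurable
 show i: "integrable lborel (%s. ind {..<X} s * (conv k f s)^2)"
 proof (rule intb_B)
  show "integrable lborel (%s. \<kappa> * (ind {..<X} s * conv k F s))" using ii by simp
  show "AE s in lborel. norm (ind {..<X} s * (conv k f s)^2) <= norm (\<kappa> * (ind {..<X} s * conv k F s))"
   using pt by eventually_elim (auto intro: order_trans[OF _ abs_ge_self])
 qed (use cm in measurable)
 have "(LBINT s. ind {..<X} s * (conv k f s)^2) <= (LBINT s. \<kappa> * (ind {..<X} s * conv k F s))"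
  by (rule integral_mono_AE[OF i _ pt]) (use ii in simp)
 also have "... = \<kappa> * (LBINT r. F r * (LBINT x. ind {..<X - r} x * k x))"
  using cval by simp
 also have "(LBINT r. F r * (LBINT x. ind {..<X - r} x * k x)) <= (LBINT r. F r * \<kappa>)"
 proof (rule integral_mono')
  show "integrable lborel (%r. F r * \<kappa>)" using F(1) by simp
  show "F r * (LBINT x. ind {..<X - r} x * k x) <= F r * \<kappa>" for r
  proof (cases "r <= 0")
   case False
   thus ?thesis using mono[of "X - r"] F0[of r] by (intro mult_left_mono) auto
  qed (simp add: F(2))
  show "0 <= F r * \<kappa>" for r using F0 \<kappa>0 by simp
 qed
 hence "\<kappa> * (LBINT r. F r * (LBINT x. ind {..<X - r} x * k x)) <= \<kappa> * (\<kappa> * (LBINT r. F r))"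
  using \<kappa>0 by (intro mult_left_mono) (simp_all add: mult.commute)
 finally show "(LBINT s. ind {..<X} s * (conv k f s)^2) <= \<kappa>^2 * (LBINT s. ind {..<X} s * (f s)^2)"
  by (simp add: F_def power2_eq_square mult.assoc)
qed

text \<open>The roles are exchanged: the kernel is locally square integrable and \<open>f\<close> is
  only integrable, so the absolute value of \<open>f\<close> is the weight. This case is needed
  while the coefficients of theta_t are not yet known to be square integrable.\<close>

lemma conv_square_integrable:
 assumes k: "kernel k" "kernel (%x. (k x)^2)" and f: "integrable lborel f" "!!s. s <= 0 ==> f s = 0"
 shows "integrable lborel (%s. ind {..<X} s * (conv k f s)^2)"
proof -
 let ?g = "%s. \<bar>f s\<bar>"
 have g: "integrable lborel ?g" "!!s. s <= 0 ==> ?g s = 0" using f by auto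
 have [measurable]: "k : bmf borel" "f : bmf borel"
  using kernelD(1)[OF k(1)] f by auto
 define N where "N = (LBINT s. \<bar>f s\<bar>)"
 have cAE: "AE s in lborel. s <= X \<longrightarrow> integrable lborel (%r. (k (s - r))^2 * ?g r)"
  by (rule conv_AE_integrable[OF k(2) g])
 have cint: "integrable lborel (%s. ind {..X} s * conv (%x. (k x)^2) ?g s)"
  by (rule conv_integrable[OF k(2) g])
 have pt: "AE s in lborel. ind {..<X} s * (conv k f s)^2 <= N * (ind {..X} s * conv (%x. (k x)^2) ?g s)"
  using cAE
 proof eventually_elim
  case (elim s)
  show ?case
  proof (cases "s < X")
   case True
   \<comment> \<open>The sign of \<open>f\<close> is moved into the second factor, which leaves a
     nonnegative weight.\<close>
   have eq: "\<bar>f r\<bar> * (k (s - r) * sgn (f r))^2 = (k (s - r))^2 * \<bar>f r\<bar>" "\<bar>f r\<bar> * (k (s - r) * sgn (f r)) = k (s - r) * f r" for r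
    by (auto simp: sgn_if)
   have "(LBINT r. \<bar>f r\<bar> * (k (s - r) * sgn (f r)))^2 <= (LBINT r. \<bar>f r\<bar>) * (LBINT r. \<bar>f r\<bar> * (k (s - r) * sgn (f r))^2)"
   proof (rule weighted_Cauchy_Schwarz(2)[OF g(1)])
    show "integrable lborel (%r. \<bar>f r\<bar> * (k (s - r) * sgn (f r))^2)" unfolding eq using elim True by simp
    show "(%r. k (s - r) * sgn (f r)) : bmf lborel" by measurable
   qed simp
   thus ?thesis using True unfolding eq by (simp add: conv_def N_def)
  qed (use conv_mono_nonneg[OF k(2), of ?g s] in \<open>simp add: N_def indicator_def\<close>)
 qed
 have cm: "conv k f : bmf borel" unfolding conv_def[abs_def] by measurable
 show ?thesis
 proof (rule intb_B)
  show "integrable lborel (%s. N * (ind {..X} s * conv (%x. (k x)^2) ?g s))"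
   using cint by simp
  show "AE s in lborel. norm (ind {..<X} s * (conv k f s)^2) <= norm (N * (ind {..X} s * conv (%x. (k x)^2) ?g s))"
   using pt by eventually_elim (auto intro: order_trans[OF _ abs_ge_self])
 qed (use cm in measurable)
qed

lemma square_add_le: "(a + b)^2 <= 2 * a^2 + 2 * b^2" for a b :: real
 using zero_le_power2[of "a - b"] by (simp add: power2_eq_square algebra_simps)

definition square_int :: "(real => real) => bool" where
 "square_int f \<longleftrightarrow> f : bmf borel \<and> integrable lborel (%s. (f s)^2)"

lemma square_int_add:
 assumes "square_int f" "square_int g" shows "square_int (%s. f s + g s)"
proof -
 have [measurable]: "f : bmf borel" "g : bmf borel" using assms by (auto simp: square_int_def)
 have i: "integrable lborel (%s. (f s)^2)" "integrable lborel (%s. (g s)^2)" using assms by (auto simp: square_int_def)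
 have "integrable lborel (%s. f s * g s)" by (rule Cauchy_Schwarz_integral(1)[OF i]) simp_all
 hence "integrable lborel (%s. (f s)^2 + (g s)^2 + 2 * (f s * g s))" using i by simp
 thus ?thesis by (simp add: square_int_def power2_sum mult.assoc)
qed

lemma square_int_scale: "square_int f ==> square_int (%s. c * f s)"
 by (auto simp: square_int_def power_mult_distrib)

lemma square_int_abs: "square_int f ==> square_int (%s. \<bar>f s\<bar>)"
 by (auto simp: square_int_def)

lemma square_int_zero: "square_int (%s. 0)"
 by (simp add: square_int_def)

lemma square_int_sum: "(!!i. i : I ==> square_int (f i)) ==> square_int (%s. \<Sum>i\<in>I. f i s)"
 by (induction I rule: infinite_finite_induct) (auto intro: square_int_add square_int_zero)

lemma square_int_indicator:
 assumes "f : bmf borel" "integrable lborel (%s. ind {..<X} s * (f s)^2)"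
 shows "square_int (%s. ind {..<X} s * f s)"
proof -
 have "(ind {..<X} s * f s)^2 = ind {..<X} s * (f s)^2" for s by (simp add: indicator_def)
 thus ?thesis using assms by (simp add: square_int_def)
qed

context
 fixes \<alpha> T :: real and \<phi> :: "real => real"
 assumes \<alpha>: "1 / 2 < \<alpha>" "\<alpha> < 1"
  and \<phi>m [measurable]: "\<phi> : bmf borel" and \<phi>2: "integrable lborel (%s. (\<phi> s)^2)"
  and \<phi>0: "!!s. s \<notin> {0<..<T} ==> \<phi> s = 0"
begin

lemma L2_time_integrable: "integrable lborel \<phi>"
proof (rule intb_B)
 show "integrable lborel (%s. ind {0<..<T} s + (\<phi> s)^2)"
  using \<phi>2 emeasure_lborel_Ioo[of 0 T] by (cases "0 <= T") auto
 show "AE s in lborel. norm (\<phi> s) <= norm (ind {0<..<T} s + (\<phi> s)^2)"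
 proof (rule AE_I2)
  fix s
  have "2 * \<bar>\<phi> s\<bar> <= 1 + (\<phi> s)^2" using sum_squares_bound[of 1 "\<bar>\<phi> s\<bar>"] by simp
  thus "norm (\<phi> s) <= norm (ind {0<..<T} s + (\<phi> s)^2)"
   using \<phi>0[of s] by (cases "s : {0<..<T}") auto
 qed
qed measurable

lemma kern_shift_square:
 "integrable lborel (%s. (ind {0<..} s * kern \<alpha> (t - s))^2)"
 "(LBINT s. (ind {0<..} s * kern \<alpha> (t - s))^2) = (LBINT x. ind {..<t} x * (kern \<alpha> x)^2)"
proof -
 note k2 = kernelD(4)[OF kern_square_kernel[OF \<alpha>(1)], of t]
 have eq: "(%x. ind {..<t} (t + -1 * x) * (kern \<alpha> (t + -1 * x))^2) = (%s. (ind {0<..} s * kern \<alpha> (t - s))^2)"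
  by (auto simp: indicator_def)
 show "integrable lborel (%s. (ind {0<..} s * kern \<alpha> (t - s))^2)"
  using lborel_integrable_real_affine[OF k2, of "-1" t] eq by simp
 show "(LBINT s. (ind {0<..} s * kern \<alpha> (t - s))^2) = (LBINT x. ind {..<t} x * (kern \<alpha> x)^2)"
  using lborel_integral_real_affine[of "-1" "%x. ind {..<t} x * (kern \<alpha> x)^2" t] eq by simp
qed

lemma kern_\<phi>_eq: "ind {0<..} s * kern \<alpha> (t - s) * \<phi> s = kern \<alpha> (t - s) * \<phi> s"
 using \<phi>0[of s] by (auto simp: indicator_def)

lemma frac_integrable: "integrable lborel (%s. kern \<alpha> (t - s) * \<phi> s)"
 using Cauchy_Schwarz_integral(1)[OF kern_shift_square(1)[of t] \<phi>2]
 unfolding kern_\<phi>_eq by simp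

lemma frac_bound:
 "(conv (kern \<alpha>) \<phi> t)^2 <= (LBINT x. ind {..<t} x * (kern \<alpha> x)^2) * (LBINT s. (\<phi> s)^2)"
 using Cauchy_Schwarz_integral(2)[OF kern_shift_square(1)[of t] \<phi>2]
 unfolding kern_\<phi>_eq kern_shift_square(2) by (simp add: conv_def)

lemma exp_mult_integrable: "integrable lborel (%s. exp (l * s) * \<phi> s)"
proof -
 have "integrable lborel (%s. (ind {0<..<T} s * exp (l * s)) * \<phi> s)"
 proof (rule integrable_bounded_mult(2)[OF L2_time_integrable, where B = "exp (\<bar>l\<bar> * \<bar>T\<bar>)"])
  show "\<bar>ind {0<..<T} s * exp (l * s)\<bar> <= exp (\<bar>l\<bar> * \<bar>T\<bar>)" for s
  proof (cases "s : {0<..<T}")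
   case True
   hence "\<bar>l\<bar> * \<bar>s\<bar> <= \<bar>l\<bar> * \<bar>T\<bar>" by (intro mult_left_mono) auto
   hence "l * s <= \<bar>l\<bar> * \<bar>T\<bar>" using abs_ge_self[of "l * s"] by (simp add: abs_mult)
   thus ?thesis using True by simp
  qed simp
 qed measurable
 moreover have "(ind {0<..<T} s * exp (l * s)) * \<phi> s = exp (l * s) * \<phi> s" for s
  using \<phi>0[of s] by (cases "s : {0<..<T}") auto
 ultimately show ?thesis by simp
qed

end

section \<open>Exponential weights and the representation of the kernel by exponentials\<close>

lemma below_integrable: "integrable lborel f ==> integrable lborel (%s. ind {..<t} s * f s :: real)" for t :: real
 using integrable_mult_indicator[of "{..<t}" lborel f] by simp

text \<open>Integration by parts for primitives, obtained without differentiating: the square below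
  \<open>t\<close> is cut along its diagonal and each triangle is one of the two integrals. For
  \<open>p = q\<close> it expresses the square of a primitive as an integral.\<close>

lemma below_prod:
 fixes p q :: "real => real"
 assumes p: "integrable lborel p" and q: "integrable lborel q"
 shows "integrable lborel (%s. ind {..<t} s * (p s * below s q))"
  "below t p * below t q = below t (%s. p s * below s q) + below t (%s. q s * below s p)"
proof -
 have [measurable]: "p : bmf borel" "q : bmf borel" using p q by auto
 have pq: "integrable (lborel \<Otimes>\<^sub>M lborel) (%(x, y). p x * q y)" by (rule integrable_lborel_product[OF p q])
 have int: "integrable (lborel \<Otimes>\<^sub>M lborel) (%(x, y). h (x, y) * (p x * q y))"
  if "h : bmf (lborel \<Otimes>\<^sub>M lborel)" "!!z. \<bar>h z\<bar> <= 1" for h :: "real \<times> real => real"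
  using integrable_bounded_mult(2)[OF pq that] by (simp add: case_prod_unfold)
 have i1: "integrable (lborel \<Otimes>\<^sub>M lborel) (%(x, y). (ind {..<t} x * ind {0<..} (x - y)) * (p x * q y))"
  using int[of "%(x, y). ind {..<t} x * ind {0<..} (x - y)"] by (simp add: case_prod_unfold indicator_def)
 have i2: "integrable (lborel \<Otimes>\<^sub>M lborel) (%(x, y). (ind {..<t} y * ind {..0} (x - y)) * (p x * q y))"
  using int[of "%(x, y). ind {..<t} y * ind {..0} (x - y)"] by (simp add: case_prod_unfold indicator_def)
 have e1: "(LBINT y. (ind {..<t} x * ind {0<..} (x - y)) * (p x * q y)) = ind {..<t} x * (p x * below x q)" for x
 proof -
  have "(LBINT y. (ind {..<t} x * ind {0<..} (x - y)) * (p x * q y)) = (LBINT y. (ind {..<t} x * p x) * (ind {..<x} y * q y))"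
   by (rule intc_B) (auto simp: indicator_def)
  thus ?thesis by simp
 qed
 have e2: "(LBINT x. (ind {..<t} y * ind {..0} (x - y)) * (p x * q y)) = ind {..<t} y * (q y * below y p)" for y
 proof -
  have "(LBINT x. (ind {..<t} y * ind {..0} (x - y)) * (p x * q y)) = (LBINT x. (ind {..<t} y * q y) * (ind {..<y} x * p x))"
  proof (rule integral_cong_AE)
   show "AE x in lborel. (ind {..<t} y * ind {..0} (x - y)) * (p x * q y) = (ind {..<t} y * q y) * (ind {..<y} x * p x)"
    using AE_lborel_singleton[of y] by eventually_elim (auto simp: indicator_def)
  qed measurable
  thus ?thesis by simp
 qed
 show j1: "integrable lborel (%s. ind {..<t} s * (p s * below s q))"
  using lborel_pair.integrable_fst[OF i1] by (simp only: e1)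
 have e3: "ind {..<t} x * p x * below t q = ind {..<t} x * (p x * below x q) + (LBINT y. (ind {..<t} y * ind {..0} (x - y)) * (p x * q y))" for x
 proof (cases "x < t")
  case True
  have "below t q = (LBINT y. ind {..<x} y * q y + ind {x..<t} y * q y)"
   by (rule intc_B) (use True in \<open>auto simp: indicator_def\<close>)
  also have "... = below x q + (LBINT y. ind {x..<t} y * q y)"
   using below_integrable[OF q] integrable_mult_indicator[OF _ q, of "{x..<t}"] by simp
  finally have "ind {..<t} x * p x * below t q = p x * below x q + (LBINT y. p x * (ind {x..<t} y * q y))"
   using True by (simp add: distrib_left)
  also have "(LBINT y. p x * (ind {x..<t} y * q y)) = (LBINT y. (ind {..<t} y * ind {..0} (x - y)) * (p x * q y))"
   by (rule intc_B) (auto simp: indicator_def)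
  finally show ?thesis using True by simp
 next
  case False
  hence "(ind {..<t} y * ind {..0} (x - y)) * (p x * q y) = 0" for y by (auto simp: indicator_def)
  thus ?thesis using False by (simp only: intz_B) simp
 qed
 have "below t p * below t q = (LBINT x. ind {..<t} x * p x * below t q)" by simp
 also have "... = below t (%s. p s * below s q) + (LBINT x. \<integral>y. (ind {..<t} y * ind {..0} (x - y)) * (p x * q y) \<partial>lborel)"
  unfolding e3 using lborel_pair.integrable_fst[OF i2] by (intro Bochner_Integration.integral_add j1) simp
 also have "(LBINT x. \<integral>y. (ind {..<t} y * ind {..0} (x - y)) * (p x * q y) \<partial>lborel) = below t (%s. q s * below s p)"
  using lborel_pair.Fubini_integral[OF i2] by (simp only: prod.case e2)
 finally show "below t p * below t q = below t (%s. p s * below s q) + below t (%s. q s * below s p)" .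
qed

text \<open>The product rule for a primitive times an exponential, in integrated form. It is the
  only calculus needed for the scalar differential equations below, in which the data are merely
  integrable.\<close>

lemma exp_weight:
 assumes p: "integrable lborel p" "!!s. s <= 0 ==> p s = 0" and t: "t : {0..T}"
 shows "integrable lborel (%s. ind {..<t} s * (exp (- a * s) * p s))"
  "integrable lborel (%s. ind {..<t} s * (exp (- a * s) * below s p))"
  "exp (- a * t) * below t p = below t (%s. exp (- a * s) * p s) - a * below t (%s. exp (- a * s) * below s p)"
proof -
 \<comment> \<open>The derivative of the exponential, cut off to (0,T) to be integrable. Its
   primitive is the exponential minus 1, and the unweighted terms caused by the 1 cancel at the
   end.\<close>
 define q where "q s = ind {0<..<T} s * (- a * exp (- a * s))" for s
 have qi: "integrable lborel (%s. ind {0<..<T} s * exp (- a * s) :: real)"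
 proof (rule intb_B)
  show "integrable lborel (%x. exp (- a * x) * ind {0..T} x)"
  proof -
   have "continuous_on {0..T} (%x. exp (- a * x))" by (intro continuous_intros)
   from borel_integrable_compact[OF compact_Icc this] show ?thesis by (simp add: mult.commute)
  qed
 qed (auto simp: indicator_def)
 have q: "integrable lborel q"
  unfolding q_def[abs_def] using integrable_mult_right[OF qi, of "- a"] by (simp add: mult.left_commute)
 have bq: "below s q = exp (- a * s) - 1" if s: "s : {0..T}" for s
 proof -
  have "below s q = (LBINT x. (- a * exp (- a * x)) * ind {0..s} x)"
  proof (rule integral_cong_AE)
   show "AE x in lborel. ind {..<s} x * q x = (- a * exp (- a * x)) * ind {0..s} x"
    using AE_lborel_singleton[of 0] AE_lborel_singleton[of s] by eventually_elim (use s in \<open>auto simp: q_def indicator_def\<close>)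
  qed (unfold q_def, measurable)
  also have "... = exp (- a * s) - exp (- a * 0)"
   by (rule integral_FTC_Icc_real) (use s in \<open>auto intro!: derivative_eq_intros continuous_intros\<close>)
  finally show ?thesis by simp
 qed
 have b0: "below s p = 0" if "s <= 0" for s
 proof -
  have "ind {..<s} x * p x = 0" for x using p(2)[of x] that by (cases "x <= 0") auto
  thus ?thesis by (simp only: intz_B)
 qed
 note P = below_prod[OF p(1) q, of t] below_prod(1)[OF q p(1), of t]
 have e1: "ind {..<t} s * (p s * below s q) = ind {..<t} s * (exp (- a * s) * p s) - ind {..<t} s * p s" for s
 proof (cases "0 < s \<and> s < t")
  case True
  hence b: "below s q = exp (- a * s) - 1" using t by (intro bq) auto
  show ?thesis unfolding b by (simp add: algebra_simps)
 next
  case False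
  thus ?thesis using p(2)[of s] by (cases "s <= 0") auto
 qed
 have e2: "ind {..<t} s * (q s * below s p) = - a * (ind {..<t} s * (exp (- a * s) * below s p))" for s
  using b0[of s] t by (cases "s <= 0") (auto simp: q_def indicator_def)
 have pi: "integrable lborel (%s. ind {..<t} s * p s)" by (rule below_integrable[OF p(1)])
 show j1: "integrable lborel (%s. ind {..<t} s * (exp (- a * s) * p s))"
  using inta_B[OF P(1)[unfolded e1] pi] by simp
 show "integrable lborel (%s. ind {..<t} s * (exp (- a * s) * below s p))"
 proof -
  have "integrable lborel (%s. ind {0<..<T} s * exp (- a * s) * (ind {..<t} s * below s p))"
  proof (rule integrable_bounded_mult(1)[OF qi])
   have "p : bmf borel" using p(1) by simp
   hence "(%s. \<integral>x. ind {0<..} (s - x) * p x \<partial>lborel) : bmf borel" by measurable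
   moreover have "below s p = (LBINT x. ind {0<..} (s - x) * p x)" for s
    by (rule intc_B) (auto simp: indicator_def)
   ultimately show "(%s. ind {..<t} s * below s p) : bmf lborel" by simp
   have "\<bar>below s p\<bar> <= (LBINT x. \<bar>p x\<bar>)" for s
   proof -
    have "\<bar>below s p\<bar> <= (LBINT x. \<bar>ind {..<s} x * p x\<bar>)" by (rule integral_abs_bound)
    also have "... <= (LBINT x. \<bar>p x\<bar>)"
     using below_integrable[OF p(1), of s] p(1) by (intro integral_mono) (auto simp: indicator_def)
    finally show ?thesis .
   qed
   thus "\<bar>ind {..<t} s * below s p\<bar> <= (LBINT x. \<bar>p x\<bar>)" for s
    by (auto simp: indicator_def)
  qed
  moreover have "ind {0<..<T} s * exp (- a * s) * (ind {..<t} s * below s p) = ind {..<t} s * (exp (- a * s) * below s p)" for s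
   using b0[of s] t by (cases "s <= 0") (auto simp: indicator_def)
  ultimately show ?thesis by (simp only:)
 qed
 have "below t p * (exp (- a * t) - 1) = below t (%s. p s * below s q) + below t (%s. q s * below s p)"
  using P(2) bq[OF t] by simp
 also have "... = (below t (%s. exp (- a * s) * p s) - below t p) - a * below t (%s. exp (- a * s) * below s p)"
  unfolding e1 e2 using j1 pi by simp
 finally show "exp (- a * t) * below t p = below t (%s. exp (- a * s) * p s) - a * below t (%s. exp (- a * s) * below s p)"
  by (simp add: algebra_simps)
qed

text \<open>The density of the measure whose Laplace transform is the kernel.\<close>

definition dens :: "real => real => real" where
 "dens \<alpha> l = ind {0<..} l * (l powr (- \<alpha>) / (Gamma \<alpha> * Gamma (1 - \<alpha>)))"

lemma dens_measurable [measurable]: "dens \<alpha> : bmf borel"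
 unfolding dens_def[abs_def] by measurable

context
 fixes \<alpha> :: real assumes \<alpha>: "0 < \<alpha>" "\<alpha> < 1"
begin

lemma Gamma_pos: "0 < Gamma \<alpha>" "0 < Gamma (1 - \<alpha>)" using \<alpha> by (simp_all add: Gamma_real_pos)

lemma dens_nonneg: "0 <= dens \<alpha> l" using Gamma_pos by (simp add: dens_def)

text \<open>The substitution of \<open>x * l\<close> in the Gamma integral at 1 - \<alpha>, which
  converges because \<alpha> < 1. The two Gamma values in the density are what this integral and the
  kernel itself contribute.\<close>

lemma dens_laplace:
 assumes x: "0 < x" shows "has_bochner_integral lborel (%l. dens \<alpha> l * exp (- l * x)) (kern \<alpha> x)"
proof -
 have "has_bochner_integral lborel (%l. ind {0..} l * (l powr (1 - \<alpha> - 1) / exp l)) (Gamma (1 - \<alpha>))"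
  by (rule has_bochner_integral_of_has_integral[OF _ _ _ Gamma_integral_real]) (use \<alpha> in auto)
 from lborel_has_bochner_integral_real_affine_iff[THEN iffD1, OF _ this, of x 0]
 have "has_bochner_integral lborel (%l. ind {0..} (x * l) * ((x * l) powr (- \<alpha>) / exp (x * l))) (Gamma (1 - \<alpha>) / x)"
  using x by (simp add: divide_inverse mult.commute)
 from has_bochner_integral_mult_right[OF this, of "x powr \<alpha> / (Gamma \<alpha> * Gamma (1 - \<alpha>))"]
 have h: "has_bochner_integral lborel (%l. x powr \<alpha> / (Gamma \<alpha> * Gamma (1 - \<alpha>)) * (ind {0..} (x * l) * ((x * l) powr (- \<alpha>) / exp (x * l))))
   (x powr \<alpha> / (Gamma \<alpha> * Gamma (1 - \<alpha>)) * (Gamma (1 - \<alpha>) / x))" by simp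
 have "x powr \<alpha> / (Gamma \<alpha> * Gamma (1 - \<alpha>)) * (ind {0..} (x * l) * ((x * l) powr (- \<alpha>) / exp (x * l))) = dens \<alpha> l * exp (- l * x)" for l
 proof (cases "0 < l")
  case True
  hence "(x * l) powr (- \<alpha>) = l powr (- \<alpha>) / x powr \<alpha>" using x by (simp add: powr_mult powr_minus_divide)
  thus ?thesis using True x by (simp add: dens_def exp_minus field_simps)
 next
  case False
  thus ?thesis using x by (cases "l = 0") (auto simp: dens_def indicator_def zero_le_mult_iff)
 qed
 moreover have "x powr \<alpha> / (Gamma \<alpha> * Gamma (1 - \<alpha>)) * (Gamma (1 - \<alpha>) / x) = kern \<alpha> x"
  using x Gamma_pos by (simp add: kern_def omega_def powr_diff)
 ultimately show ?thesis using h by simp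
qed

text \<open>Near 0 the density is the integrable power of exponent -\<alpha>; at infinity the
  division by \<open>l + \<mu>\<close> improves the exponent to -\<alpha> - 1. The two terms of the
  majorant cover the rates below 1 and above 1.\<close>

lemma dens_weight_integrable:
 assumes "1 <= \<mu>" shows "integrable lborel (%l. dens \<alpha> l / (l + \<mu>))"
proof (rule intb_B)
 have 1: "integrable lborel (%l. dens \<alpha> l * exp (- l * 1))" using dens_laplace[of 1] by (auto simp: has_bochner_integral_iff)
 have 2: "integrable lborel (%l. ind {1..} l * l powr (- \<alpha> - 1))"
  using has_bochner_integral_of_has_integral[OF _ _ _ has_integral_powr_to_inf[of "- \<alpha> - 1" 1]] \<alpha> by (auto simp: has_bochner_integral_iff)
 show "integrable lborel (%l. exp 1 * (dens \<alpha> l * exp (- l * 1)) + 1 / (Gamma \<alpha> * Gamma (1 - \<alpha>)) * (ind {1..} l * l powr (- \<alpha> - 1)))"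
  using 1 2 by (intro inta_B integrable_mult_right)
 show "AE l in lborel. norm (dens \<alpha> l / (l + \<mu>)) <= norm (exp 1 * (dens \<alpha> l * exp (- l * 1)) + 1 / (Gamma \<alpha> * Gamma (1 - \<alpha>)) * (ind {1..} l * l powr (- \<alpha> - 1)))"
 proof (rule AE_I2)
  fix l :: real
  have n: "0 <= dens \<alpha> l * exp (- l * 1)" "0 <= 1 / (Gamma \<alpha> * Gamma (1 - \<alpha>)) * (ind {1..} l * l powr (- \<alpha> - 1))"
   using dens_nonneg Gamma_pos by simp_all
  consider "l <= 0" | "0 < l" "l < 1" | "1 <= l" by linarith
  hence "\<bar>dens \<alpha> l / (l + \<mu>)\<bar> <= exp 1 * (dens \<alpha> l * exp (- l * 1)) + 1 / (Gamma \<alpha> * Gamma (1 - \<alpha>)) * (ind {1..} l * l powr (- \<alpha> - 1))"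
  proof cases
   case 2
   have "dens \<alpha> l / (l + \<mu>) <= dens \<alpha> l * 1"
    unfolding divide_inverse using 2 assms dens_nonneg by (intro mult_left_mono) (auto intro!: inverse_le_1_iff[THEN iffD2])
   also have "... <= dens \<alpha> l * exp (1 - l)" using 2 dens_nonneg by (intro mult_left_mono) auto
   also have "... = exp 1 * (dens \<alpha> l * exp (- l * 1))" by (simp add: exp_diff exp_minus field_simps)
   finally show ?thesis using n(2) 2 assms dens_nonneg[of l] by simp
  next
   case 3
   have "dens \<alpha> l / (l + \<mu>) <= dens \<alpha> l / l" using 3 assms dens_nonneg by (intro divide_left_mono) auto
   also have "... = 1 / (Gamma \<alpha> * Gamma (1 - \<alpha>)) * (ind {1..} l * l powr (- \<alpha> - 1))"
    using 3 by (simp add: dens_def powr_diff)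
   finally have "dens \<alpha> l / (l + \<mu>) <= 1 / (Gamma \<alpha> * Gamma (1 - \<alpha>)) * (ind {1..} l * l powr (- \<alpha> - 1))" .
   moreover have g0: "0 <= dens \<alpha> l / (l + \<mu>)" "(0 :: real) <= exp 1" using 3 assms dens_nonneg[of l] by simp_all
   ultimately show ?thesis using mult_nonneg_nonneg[OF g0(2) n(1)] unfolding abs_of_nonneg[OF g0(1)] by linarith
  qed (simp add: dens_def)
  thus "norm (dens \<alpha> l / (l + \<mu>)) <= norm (exp 1 * (dens \<alpha> l * exp (- l * 1)) + 1 / (Gamma \<alpha> * Gamma (1 - \<alpha>)) * (ind {1..} l * l powr (- \<alpha> - 1)))"
   using n by simp
 qed
qed measurable

text \<open>The integral is the Laplace transform of the kernel at \<mu>, that is, \<mu> to the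
  power -\<alpha>. Only its decay matters: it decides how large the exponent of the time weight must
  be to absorb a lower order term.\<close>

lemma dens_weight_small:
 assumes "0 < e" obtains \<mu> where "1 <= \<mu>" "(LBINT l. dens \<alpha> l / (l + \<mu>)) < e"
proof -
 have "(%n. \<integral>l. dens \<alpha> l / (l + real (Suc n)) \<partial>lborel) ----> (\<integral>l. 0 \<partial>(lborel :: real measure))"
 proof (rule integral_dominated_convergence[where w = "%l. dens \<alpha> l / (l + 1)"])
  have "(%n. dens \<alpha> l / (l + real (Suc n))) ----> 0" for l
   by (rule tendsto_divide_0[OF tendsto_const])
    (rule filterlim_at_top_imp_at_infinity[OF filterlim_tendsto_add_at_top[OF tendsto_const filterlim_compose[OF filterlim_real_sequentially filterlim_Suc]]])
  thus "AE l in lborel. (%n. dens \<alpha> l / (l + real (Suc n))) ----> 0" by simp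
  show "AE l in lborel. norm (dens \<alpha> l / (l + real (Suc n))) <= dens \<alpha> l / (l + 1)" for n
  proof (rule AE_I2)
   fix l :: real show "norm (dens \<alpha> l / (l + real (Suc n))) <= dens \<alpha> l / (l + 1)"
   proof (cases "0 < l")
    case True
    hence "dens \<alpha> l / (l + real (Suc n)) <= dens \<alpha> l / (l + 1)" using dens_nonneg[of l] by (intro divide_left_mono) auto
    thus ?thesis using True dens_nonneg[of l] by simp
   qed (simp add: dens_def)
  qed
 qed (use dens_weight_integrable in auto)
 hence "(%n. \<integral>l. dens \<alpha> l / (l + real (Suc n)) \<partial>lborel) ----> 0" by simp
 from order_tendstoD(2)[OF this assms] obtain n where "(LBINT l. dens \<alpha> l / (l + real (Suc n))) < e"
  by (auto simp: eventually_sequentially)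
 thus thesis by (intro that[of "real (Suc n)"]) auto
qed

end

definition exp_kern :: "real => real => real" where
 "exp_kern l x = ind {0<..} x * exp (- l * x)"

lemma exp_kern_measurable [measurable]: "(%p. exp_kern (f p) (g p)) : bmf M"
 if [measurable]: "f : bmf M" "g : bmf M"
 unfolding exp_kern_def[abs_def] by measurable

lemma dens_exp_kern:
 assumes \<alpha>: "0 < \<alpha>" "\<alpha> < 1" shows "has_bochner_integral lborel (%l. dens \<alpha> l * exp_kern l x) (kern \<alpha> x)"
proof (cases "0 < x")
 case True
 thus ?thesis using dens_laplace[OF \<alpha> True] by (simp add: exp_kern_def)
qed (auto simp: exp_kern_def kern_def)

context
 fixes \<alpha> T :: real and \<phi> :: "real => real"
 assumes \<alpha>: "1 / 2 < \<alpha>" "\<alpha> < 1"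
  and \<phi>m [measurable]: "\<phi> : bmf borel" and \<phi>2: "integrable lborel (%s. (\<phi> s)^2)"
  and \<phi>0: "!!s. s \<notin> {0<..<T} ==> \<phi> s = 0"
begin

lemma \<alpha>pos': "0 < \<alpha>" using \<alpha> by simp

lemma abs_frac_integrable: "integrable lborel (%s. kern \<alpha> (t - s) * \<bar>\<phi> s\<bar>)"
 by (rule frac_integrable[OF \<alpha>, where T = T]) (use \<phi>2 \<phi>0 in auto)

text \<open>Fubini in the rate and in time. It is justified at every single time, since the
  fractional integral of the absolute value of \<open>\<phi>\<close> converges everywhere by
  Cauchy-Schwarz.\<close>

lemma cm_conv:
 "integrable lborel (%l. dens \<alpha> l * conv (exp_kern l) \<phi> s)"
 "(LBINT l. dens \<alpha> l * conv (exp_kern l) \<phi> s) = conv (kern \<alpha>) \<phi> s"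
proof -
 have h: "integrable lborel (%l. dens \<alpha> l * exp_kern l x)" "(LBINT l. dens \<alpha> l * exp_kern l x) = kern \<alpha> x" for x
  using dens_exp_kern[OF \<alpha>pos' \<alpha>(2)] by (auto simp: has_bochner_integral_iff)
 have int: "integrable (lborel \<Otimes>\<^sub>M lborel) (%(r, l). (dens \<alpha> l * exp_kern l (s - r)) * \<phi> r)"
 proof (rule lborel_pair.Fubini_integrable)
  have "norm ((dens \<alpha> l * exp_kern l (s - r)) * \<phi> r) = (dens \<alpha> l * exp_kern l (s - r)) * \<bar>\<phi> r\<bar>" for r l
   using dens_nonneg[OF \<alpha>pos' \<alpha>(2), of l] by (simp add: abs_mult exp_kern_def)
  thus "integrable lborel (%r. \<integral>l. norm (case (r, l) of (r, l) => (dens \<alpha> l * exp_kern l (s - r)) * \<phi> r) \<partial>lborel)"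
   using abs_frac_integrable[of s] by (simp add: h(2))
  show "AE r in lborel. integrable lborel (%l. case (r, l) of (r, l) => (dens \<alpha> l * exp_kern l (s - r)) * \<phi> r)"
   using h(1) by simp
 qed measurable
 have e: "(LBINT r. (dens \<alpha> l * exp_kern l (s - r)) * \<phi> r) = dens \<alpha> l * conv (exp_kern l) \<phi> s" for l
  by (simp add: conv_def mult.assoc)
 show "integrable lborel (%l. dens \<alpha> l * conv (exp_kern l) \<phi> s)"
  using lborel_pair.integrable_snd[OF int] by (simp only: e)
 show "(LBINT l. dens \<alpha> l * conv (exp_kern l) \<phi> s) = conv (kern \<alpha>) \<phi> s"
  using lborel_pair.Fubini_integral[OF int] by (simp add: e h(2) conv_def)
qed

lemma exp_conv_eq: "conv (exp_kern l) \<phi> s = exp (- l * s) * below s (%r. exp (l * r) * \<phi> r)"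
proof -
 have "conv (exp_kern l) \<phi> s = (LBINT r. exp (- l * s) * (ind {..<s} r * (exp (l * r) * \<phi> r)))"
  unfolding conv_def
 proof (rule intc_B[OF refl])
  fix r
  have "exp (- l * (s - r)) = exp (- l * s) * exp (l * r)" by (simp add: exp_add[symmetric] algebra_simps)
  thus "exp_kern l (s - r) * \<phi> r = exp (- l * s) * (ind {..<s} r * (exp (l * r) * \<phi> r))"
   by (simp add: exp_kern_def indicator_def)
 qed
 thus ?thesis by simp
qed

text \<open>The convolution \<open>y\<close> with a single exponential solves y' =
  \<open>\<phi>\<close> - l y with y(0) = 0; the second claim is this equation integrated from 0 to
  \<open>t\<close>.\<close>

lemma exp_conv_ode:
 assumes t: "t : {0..T}"
 shows "integrable lborel (%s. ind {..<t} s * conv (exp_kern l) \<phi> s)"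
  "below t \<phi> = conv (exp_kern l) \<phi> t + l * below t (conv (exp_kern l) \<phi>)"
proof -
 have z: "exp (l * s) * \<phi> s = 0" if "s <= 0" for s using \<phi>0[of s] that by simp
 have e: "exp (- l * s) * (exp (l * s) * \<phi> s) = \<phi> s" for s by (simp add: exp_minus)
 have F: "integrable lborel (%s. exp (l * s) * \<phi> s)" by (rule exp_mult_integrable[OF \<alpha> \<phi>m \<phi>2 \<phi>0])
 note w = exp_weight[OF F z t, where a = l, folded exp_conv_eq, unfolded e]
 show "integrable lborel (%s. ind {..<t} s * conv (exp_kern l) \<phi> s)" by (rule w(2))
 show "below t \<phi> = conv (exp_kern l) \<phi> t + l * below t (conv (exp_kern l) \<phi>)" using w(3) by simp
qed

text \<open>The equation y' = \<open>\<phi>\<close> - l y multiplied by the weighted solution and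
  integrated. Differentiating the weight adds \<open>\<mu>\<close> to the rate \<open>l\<close>, so
  the damping can be made as strong as desired uniformly in \<open>l\<close>.\<close>

lemma exp_conv_energy:
 assumes t: "t : {0..T}"
 shows "integrable lborel (%s. ind {..<t} s * (exp (- 2 * \<mu> * s) * (conv (exp_kern l) \<phi> s)^2))"
  "exp (- 2 * \<mu> * t) * (conv (exp_kern l) \<phi> t)^2 / 2 + (l + \<mu>) * below t (%s. exp (- 2 * \<mu> * s) * (conv (exp_kern l) \<phi> s)^2)
   = below t (%s. exp (- 2 * \<mu> * s) * (\<phi> s * conv (exp_kern l) \<phi> s))"
proof -
 define F where "F s = exp (l * s) * \<phi> s" for s
 define h where "h s = below s F" for s
 have F: "integrable lborel F" unfolding F_def by (rule exp_mult_integrable[OF \<alpha> \<phi>m \<phi>2 \<phi>0])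
 \<comment> \<open>Twice \<open>p\<close> is the derivative of \<open>h^2\<close> up to time
   \<open>T\<close>, and the exponential with \<open>a = 2 * (l + \<mu>)\<close> converts
   \<open>h^2\<close> into the weighted square of the convolution.\<close>
 define p where "p s = ind {..<T} s * (F s * h s)" for s
 have p: "integrable lborel p" unfolding p_def h_def by (rule below_prod(1)[OF F F])
 have z: "2 * p s = 0" if "s <= 0" for s using \<phi>0[of s] that by (simp add: p_def F_def)
 have h2: "below s (%r. 2 * p r) = (h s)^2" if "s <= T" for s
 proof -
  have "below s (%r. 2 * p r) = 2 * below s p" by (simp add: mult.left_commute)
  also have "below s p = below s (%r. F r * h r)"
   by (rule intc_B) (use that in \<open>auto simp: p_def indicator_def\<close>)
  finally show ?thesis using below_prod(2)[OF F F, of s] by (simp add: h_def power2_eq_square)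
 qed
 define a where "a = 2 * (l + \<mu>)"
 note w = exp_weight[OF integrable_mult_right[OF p, of 2] z t, of a]
 have y: "conv (exp_kern l) \<phi> s = exp (- l * s) * h s" for s unfolding exp_conv_eq h_def F_def ..
 have ea: "exp (- a * s) = exp (- 2 * \<mu> * s) * (exp (- l * s) * exp (- l * s))" for s
  by (simp add: a_def exp_add[symmetric] algebra_simps)
 have e1: "ind {..<t} s * (exp (- a * s) * below s (%r. 2 * p r)) = ind {..<t} s * (exp (- 2 * \<mu> * s) * (conv (exp_kern l) \<phi> s)^2)" for s
  using h2[of s] t unfolding y ea by (cases "s < t") (simp_all add: power_mult_distrib power2_eq_square)
 have e2: "ind {..<t} s * (exp (- a * s) * (2 * p s)) = 2 * (ind {..<t} s * (exp (- 2 * \<mu> * s) * (\<phi> s * conv (exp_kern l) \<phi> s)))" for s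
 proof -
  have "exp (- l * s) * F s = \<phi> s" by (simp add: F_def exp_minus)
  hence "exp (- a * s) * (F s * h s) = exp (- 2 * \<mu> * s) * (\<phi> s * conv (exp_kern l) \<phi> s)"
   unfolding y ea by (metis (no_types, lifting) mult.assoc mult.left_commute)
  thus ?thesis using t by (simp add: p_def indicator_def)
 qed
 show "integrable lborel (%s. ind {..<t} s * (exp (- 2 * \<mu> * s) * (conv (exp_kern l) \<phi> s)^2))"
  using w(2) unfolding e1 .
 define X Y where "X = below t (%s. exp (- 2 * \<mu> * s) * (conv (exp_kern l) \<phi> s)^2)"
  and "Y = below t (%s. exp (- 2 * \<mu> * s) * (\<phi> s * conv (exp_kern l) \<phi> s))"
 have "exp (- a * t) * (h t)^2 = 2 * Y - a * X"
  using w(3) h2[of t] t unfolding e1 e2 by (simp add: X_def Y_def)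
 moreover have "exp (- a * t) * (h t)^2 = exp (- 2 * \<mu> * t) * (conv (exp_kern l) \<phi> t)^2"
  unfolding y ea by (simp add: power2_eq_square)
 moreover have "a * X = 2 * ((l + \<mu>) * X)" by (simp add: a_def)
 ultimately have "exp (- 2 * \<mu> * t) * (conv (exp_kern l) \<phi> t)^2 / 2 + (l + \<mu>) * X = Y" by linarith
 thus "exp (- 2 * \<mu> * t) * (conv (exp_kern l) \<phi> t)^2 / 2 + (l + \<mu>) * below t (%s. exp (- 2 * \<mu> * s) * (conv (exp_kern l) \<phi> s)^2)
   = below t (%s. exp (- 2 * \<mu> * s) * (\<phi> s * conv (exp_kern l) \<phi> s))"
  unfolding X_def Y_def .
qed

end

context
 fixes \<alpha> T :: real and \<phi> :: "real => real"
 assumes \<alpha>: "1 / 2 < \<alpha>" "\<alpha> < 1"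
  and \<phi>m [measurable]: "\<phi> : bmf borel" and \<phi>2: "integrable lborel (%s. (\<phi> s)^2)"
  and \<phi>0: "!!s. s \<notin> {0<..<T} ==> \<phi> s = 0"
begin

text \<open>The kernel is a superposition of exponentials with rates \<open>l\<close>. For each of them the energy
 identity is elementary, and integrating over \<open>l\<close> shows that the weighted form of
 \<open>conv (kern \<alpha>)\<close> is coercive; the weight \<open>exp (- 2 \<mu> s)\<close> makes the lower order term small.\<close>

lemma cm_coercive:
 fixes M \<mu> t :: real
 defines "w \<equiv> conv (kern \<alpha>) \<phi>"
 assumes t: "t : {0..T}" and \<mu>: "1 <= \<mu>" and M: "0 <= M" "M * (LBINT l. dens \<alpha> l / (l + \<mu>)) <= 1 / 2"
 shows "integrable lborel (%s. ind {..<t} s * (exp (- 2 * \<mu> * s) * (\<phi> s * w s)))"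
  "integrable lborel (%s. ind {..<t} s * (exp (- 2 * \<mu> * s) * (w s)^2))"
  "(LBINT l. ind {0<..<1} l * dens \<alpha> l) * (below t \<phi>)^2
   <= 2 * (exp (2 * \<mu> * T) * (4 + 2 * T)) * (below t (%s. exp (- 2 * \<mu> * s) * (\<phi> s * w s)) - M * below t (%s. exp (- 2 * \<mu> * s) * (w s)^2))"
proof -
 have \<alpha>0: "0 < \<alpha>" using \<alpha> by simp
 have abs: "(%s. \<bar>\<phi> s\<bar>) : bmf borel" "integrable lborel (%s. \<bar>\<phi> s\<bar>^2)" "!!s. s \<notin> {0<..<T} ==> \<bar>\<phi> s\<bar> = 0"
  using \<phi>2 \<phi>0 by auto
 have cm: "integrable lborel (%l. dens \<alpha> l * conv (exp_kern l) \<phi> s)" "(LBINT l. dens \<alpha> l * conv (exp_kern l) \<phi> s) = conv (kern \<alpha>) \<phi> s" for s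
  by (rule cm_conv(1)[OF \<alpha> \<phi>m \<phi>2 \<phi>0], assumption) (rule cm_conv(2)[OF \<alpha> \<phi>m \<phi>2 \<phi>0])
 have cma: "integrable lborel (%l. dens \<alpha> l * conv (exp_kern l) (%r. \<bar>\<phi> r\<bar>) s)"
  "(LBINT l. dens \<alpha> l * conv (exp_kern l) (%r. \<bar>\<phi> r\<bar>) s) = conv (kern \<alpha>) (%r. \<bar>\<phi> r\<bar>) s" for s
  by (rule cm_conv(1)[OF \<alpha> abs], assumption) (rule cm_conv(2)[OF \<alpha> abs])
 have \<phi>i: "integrable lborel \<phi>" by (rule L2_time_integrable[OF \<alpha> \<phi>m \<phi>2 \<phi>0])
 have d0: "0 <= dens \<alpha> l" for l by (rule dens_nonneg[OF \<alpha>0 \<alpha>(2)])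
 define y where "y l s = conv (exp_kern l) \<phi> s" for l s
 define \<omega> where "\<omega> s = exp (- 2 * \<mu> * s)" for s
 have ym: "(%(s, l). y l s) : bmf (lborel \<Otimes>\<^sub>M lborel)" unfolding y_def conv_def by measurable
 hence [measurable]: "(%p. y (snd p) (fst p)) : bmf (lborel \<Otimes>\<^sub>M lborel)" by (simp add: case_prod_unfold)
 have [measurable]: "\<omega> : bmf borel" unfolding \<omega>_def[abs_def] by measurable
 have \<omega>0: "0 < \<omega> s" "0 <= s ==> \<omega> s <= 1" for s using \<mu> by (auto simp: \<omega>_def)
 \<comment> \<open>The energy at rate \<open>l\<close>. After integration over \<open>l\<close> its
   second term bounds \<open>w\<close>; both terms together bound the primitive of
   \<open>\<phi>\<close>.\<close>
 define G where "G l = \<omega> t * (y l t)^2 / 2 + (l + \<mu>) * below t (%s. \<omega> s * (y l s)^2)" for l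
 have G: "G l = below t (%s. \<omega> s * (\<phi> s * y l s))" for l unfolding G_def y_def \<omega>_def by (rule exp_conv_energy(2)[OF \<alpha> \<phi>m \<phi>2 \<phi>0 t])
 have y2i: "integrable lborel (%s. ind {..<t} s * (\<omega> s * (y l s)^2))" for l unfolding y_def \<omega>_def by (rule exp_conv_energy(1)[OF \<alpha> \<phi>m \<phi>2 \<phi>0 t])
 have b0: "0 <= below t (%s. \<omega> s * (y l s)^2)" for l using \<omega>0 by (intro integral_nonneg_AE AE_I2) (simp add: less_imp_le)
 \<comment> \<open>A bound on the fractional integral of the absolute value of
   \<open>\<phi>\<close>, uniform up to time \<open>t\<close>, makes Fubini in \<open>s\<close> and
   \<open>l\<close> applicable although the density has infinite mass.\<close>
 obtain B where B: "0 <= B" "!!s. s <= t ==> \<bar>conv (kern \<alpha>) (%r. \<bar>\<phi> r\<bar>) s\<bar> <= B"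
 proof -
  let ?k = "%s. \<integral>x. ind {..<s} x * (kern \<alpha> x)^2 \<partial>lborel" and ?N = "\<integral>s. \<bar>\<phi> s\<bar>^2 \<partial>lborel"
  have "\<bar>conv (kern \<alpha>) (%r. \<bar>\<phi> r\<bar>) s\<bar> <= sqrt (?k t * ?N)" if "s <= t" for s
  proof -
   have "?k s <= ?k t" using kernelD(4)[OF kern_square_kernel[OF \<alpha>(1)]] that by (intro integral_mono) (auto simp: indicator_def)
   hence "?k s * ?N <= ?k t * ?N" by (rule mult_right_mono) simp
   moreover have "(conv (kern \<alpha>) (%r. \<bar>\<phi> r\<bar>) s)^2 <= ?k s * ?N" by (rule frac_bound[OF \<alpha> abs])
   ultimately have "(conv (kern \<alpha>) (%r. \<bar>\<phi> r\<bar>) s)^2 <= ?k t * ?N" by linarith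
   thus ?thesis by (metis real_sqrt_abs real_sqrt_le_iff)
  qed
  thus thesis by (intro that[of "sqrt (?k t * ?N)"]) auto
 qed
 have yle: "\<bar>y l s\<bar> <= conv (exp_kern l) (%r. \<bar>\<phi> r\<bar>) s" for l s
 proof -
  have "\<bar>y l s\<bar> <= (LBINT r. \<bar>exp_kern l (s - r) * \<phi> r\<bar>)" unfolding y_def conv_def by (rule integral_abs_bound)
  thus ?thesis by (simp add: conv_def abs_mult exp_kern_def)
 qed
 have int: "integrable (lborel \<Otimes>\<^sub>M lborel) (%(s, l). (ind {..<t} s * (\<omega> s * \<phi> s)) * (dens \<alpha> l * y l s))"
 proof (rule lborel_pair.Fubini_integrable)
  show "(%(s, l). (ind {..<t} s * (\<omega> s * \<phi> s)) * (dens \<alpha> l * y l s)) : bmf (lborel \<Otimes>\<^sub>M lborel)"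
   unfolding case_prod_unfold by measurable
  show "AE s in lborel. integrable lborel (%l. case (s, l) of (s, l) => (ind {..<t} s * (\<omega> s * \<phi> s)) * (dens \<alpha> l * y l s))"
   using cm(1) by (simp add: y_def)
  show "integrable lborel (%s. \<integral>l. norm (case (s, l) of (s, l) => (ind {..<t} s * (\<omega> s * \<phi> s)) * (dens \<alpha> l * y l s)) \<partial>lborel)"
  proof (rule intb_B)
   show "integrable lborel (%s. B * \<bar>\<phi> s\<bar>)" using \<phi>i by simp
   have m: "(%(s, l). norm ((ind {..<t} s * (\<omega> s * \<phi> s)) * (dens \<alpha> l * y l s))) : bmf (lborel \<Otimes>\<^sub>M lborel)"
    unfolding case_prod_unfold by measurable
   show "(%s. \<integral>l. norm (case (s, l) of (s, l) => (ind {..<t} s * (\<omega> s * \<phi> s)) * (dens \<alpha> l * y l s)) \<partial>lborel) : bmf lborel"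
    using lborel.borel_measurable_lebesgue_integral[OF m] by simp
   have "(LBINT l. \<bar>(ind {..<t} s * (\<omega> s * \<phi> s)) * (dens \<alpha> l * y l s)\<bar>) <= B * \<bar>\<phi> s\<bar>" for s
   proof (cases "s : {0<..<t}")
    case True
    have "(LBINT l. \<bar>dens \<alpha> l * y l s\<bar>) <= (LBINT l. dens \<alpha> l * conv (exp_kern l) (%r. \<bar>\<phi> r\<bar>) s)"
    proof (rule integral_mono[OF _ cma(1)])
     show "integrable lborel (%l. \<bar>dens \<alpha> l * y l s\<bar>)" using cm(1)[of s] unfolding y_def by (rule integrable_abs)
     show "\<bar>dens \<alpha> l * y l s\<bar> <= dens \<alpha> l * conv (exp_kern l) (%r. \<bar>\<phi> r\<bar>) s" for l
      using mult_left_mono[OF yle[of l s] d0[of l]] d0[of l] by (simp add: abs_mult)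
    qed
    also have "... <= B" unfolding cma(2) using B(2)[of s] True by simp
    finally have "(\<omega> s * \<bar>\<phi> s\<bar>) * (LBINT l. \<bar>dens \<alpha> l * y l s\<bar>) <= (1 * \<bar>\<phi> s\<bar>) * B"
     using \<omega>0[of s] True by (intro mult_mono mult_right_mono) (auto simp: less_imp_le)
    moreover have ce: "(LBINT l. \<bar>c * (dens \<alpha> l * y l s)\<bar>) = \<bar>c\<bar> * (LBINT l. \<bar>dens \<alpha> l * y l s\<bar>)" for c
     unfolding abs_mult[of c] by simp
    moreover have "\<bar>ind {..<t} s * (\<omega> s * \<phi> s)\<bar> = \<omega> s * \<bar>\<phi> s\<bar>" using True \<omega>0(1)[of s] by (simp add: abs_mult)
    ultimately show ?thesis unfolding ce by (simp add: mult.commute)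
   next
    case False
    hence "ind {..<t} s * (\<omega> s * \<phi> s) = 0" using \<phi>0[of s] t by auto
    hence "(ind {..<t} s * (\<omega> s * \<phi> s)) * (dens \<alpha> l * y l s) = 0" for l by (simp only: mult_zero_left)
    thus ?thesis using B(1) by (simp only: abs_zero intz_B) simp
   qed
   thus "AE s in lborel. norm (LBINT l. norm (case (s, l) of (s, l) => (ind {..<t} s * (\<omega> s * \<phi> s)) * (dens \<alpha> l * y l s))) <= norm (B * \<bar>\<phi> s\<bar>)"
    using B(1) by (intro AE_I2) (simp add: abs_of_nonneg[OF integral_nonneg_AE])
  qed
 qed
 have e1: "(LBINT l. (ind {..<t} s * (\<omega> s * \<phi> s)) * (dens \<alpha> l * y l s)) = ind {..<t} s * (\<omega> s * (\<phi> s * w s))" for s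
  using cm(2)[of s] by (simp add: y_def w_def mult.assoc)
 have e2: "(LBINT s. (ind {..<t} s * (\<omega> s * \<phi> s)) * (dens \<alpha> l * y l s)) = dens \<alpha> l * G l" for l
 proof -
  have "(LBINT s. (ind {..<t} s * (\<omega> s * \<phi> s)) * (dens \<alpha> l * y l s)) = (LBINT s. dens \<alpha> l * (ind {..<t} s * (\<omega> s * (\<phi> s * y l s))))"
   by (simp add: mult_ac)
  thus ?thesis unfolding G by simp
 qed
 have Pi: "integrable lborel (%s. ind {..<t} s * (\<omega> s * (\<phi> s * w s)))"
  using lborel_pair.integrable_fst[OF int] by (simp only: e1)
 thus "integrable lborel (%s. ind {..<t} s * (exp (- 2 * \<mu> * s) * (\<phi> s * w s)))" unfolding \<omega>_def .
 have Gi: "integrable lborel (%l. dens \<alpha> l * G l)" using lborel_pair.integrable_snd[OF int] by (simp only: e2)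
 have P: "below t (%s. \<omega> s * (\<phi> s * w s)) = (LBINT l. dens \<alpha> l * G l)"
  using lborel_pair.Fubini_integral[OF int] by (simp only: prod.case e1 e2)
 have G0: "0 <= dens \<alpha> l * G l" "dens \<alpha> l * ((l + \<mu>) * below t (%s. \<omega> s * (y l s)^2)) <= dens \<alpha> l * G l"
  "0 <= dens \<alpha> l * ((l + \<mu>) * below t (%s. \<omega> s * (y l s)^2))" for l
 proof -
  have "dens \<alpha> l = 0 \<or> (0 <= G l \<and> (l + \<mu>) * below t (%s. \<omega> s * (y l s)^2) <= G l \<and> 0 <= (l + \<mu>) * below t (%s. \<omega> s * (y l s)^2))"
  proof (cases "0 < l")
   case True
   hence "0 <= (l + \<mu>) * below t (%s. \<omega> s * (y l s)^2)" "0 <= \<omega> t * (y l t)^2 / 2" using b0 \<mu> \<omega>0(1)[of t] by auto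
   thus ?thesis by (simp add: G_def)
  qed (simp add: dens_def)
  thus "0 <= dens \<alpha> l * G l" "dens \<alpha> l * ((l + \<mu>) * below t (%s. \<omega> s * (y l s)^2)) <= dens \<alpha> l * G l"
   "0 <= dens \<alpha> l * ((l + \<mu>) * below t (%s. \<omega> s * (y l s)^2))"
   using d0[of l] by (auto intro: mult_left_mono)
 qed
 \<comment> \<open>The second energy term before integration in time. It is nonnegative and its
   integral over \<open>s\<close> is dominated by the integrable energy, so the order of integration
   may be exchanged.\<close>
 define H where "H = (%(l, s). ind {..<t} s * (\<omega> s * (dens \<alpha> l * ((l + \<mu>) * (y l s)^2))))"
 have H0: "0 <= H (l, s)" for l s
 proof (cases "0 < l")
  case True
  thus ?thesis using d0[of l] \<omega>0(1)[of s] \<mu> by (simp add: H_def less_imp_le)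
 qed (simp add: H_def dens_def)
 have eH: "(LBINT s. H (l, s)) = dens \<alpha> l * ((l + \<mu>) * below t (%s. \<omega> s * (y l s)^2))" for l
 proof -
  have "(LBINT s. H (l, s)) = (LBINT s. (dens \<alpha> l * (l + \<mu>)) * (ind {..<t} s * (\<omega> s * (y l s)^2)))"
   by (simp add: H_def mult_ac)
  thus ?thesis by simp
 qed
 have Hm: "(%(s, l). H (l, s)) : bmf (lborel \<Otimes>\<^sub>M lborel)" unfolding H_def case_prod_unfold by simp
 have Hm': "H : bmf (lborel \<Otimes>\<^sub>M lborel)"
  using measurable_pair_swap[OF Hm] by (simp add: case_prod_unfold)
 have Hint: "integrable (lborel \<Otimes>\<^sub>M lborel) H"
 proof (rule lborel_pair.Fubini_integrable[OF Hm'])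
  have "integrable lborel (%l. \<integral>s. H (l, s) \<partial>lborel)"
  proof (rule intb_B[OF Gi])
   show "(%l. \<integral>s. H (l, s) \<partial>lborel) : bmf lborel"
    by (rule lborel.borel_measurable_lebesgue_integral) (use Hm' in simp)
   show "AE l in lborel. norm (LBINT s. H (l, s)) <= norm (dens \<alpha> l * G l)"
    unfolding eH using G0 by (intro AE_I2) (simp only: real_norm_def abs_of_nonneg)
  qed
  thus "integrable lborel (%l. \<integral>s. norm (H (l, s)) \<partial>lborel)" using H0 by simp
  have "H (l, s) = (dens \<alpha> l * (l + \<mu>)) * (ind {..<t} s * (\<omega> s * (y l s)^2))" for l s by (simp add: H_def mult_ac)
  thus "AE l in lborel. integrable lborel (%s. H (l, s))" using y2i by simp
 qed
 hence Hint': "integrable (lborel \<Otimes>\<^sub>M lborel) (%(l, s). H (l, s))" by (simp add: case_prod_unfold)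
 define \<kappa> where "\<kappa> = (LBINT l. dens \<alpha> l / (l + \<mu>))"
 have k0: "0 <= dens \<alpha> l / (l + \<mu>)" for l
 proof (cases "0 < l")
  case True thus ?thesis using d0[of l] \<mu> by simp
 qed (simp add: dens_def)
 have \<kappa>0: "0 <= \<kappa>" unfolding \<kappa>_def by (intro integral_nonneg_AE AE_I2 k0)
 \<comment> \<open>Cauchy-Schwarz in \<open>l\<close>: the integrand of \<open>w\<close> is the
   weight \<open>dens \<alpha> l / (l + \<mu>)\<close> times \<open>(l + \<mu>) * y l s\<close>. The
   weight has the small mass \<open>\<kappa>\<close>, and the weighted square of the other factor is
   the energy.\<close>
 have wle: "AE s in lborel. ind {..<t} s * (\<omega> s * (w s)^2) <= \<kappa> * (LBINT l. H (l, s))"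
  using lborel_pair.AE_integrable_snd[OF Hint']
 proof eventually_elim
  case (elim s)
  show ?case
  proof (cases "s < t")
   case True
   have q: "dens \<alpha> l / (l + \<mu>) * ((l + \<mu>) * y l s) = dens \<alpha> l * y l s" "dens \<alpha> l / (l + \<mu>) * ((l + \<mu>) * y l s)^2 = inverse (\<omega> s) * H (l, s)" for l
   proof -
    have "dens \<alpha> l = 0 \<or> l + \<mu> \<noteq> 0" using \<mu> by (cases "0 < l") (auto simp: dens_def)
    thus "dens \<alpha> l / (l + \<mu>) * ((l + \<mu>) * y l s) = dens \<alpha> l * y l s" "dens \<alpha> l / (l + \<mu>) * ((l + \<mu>) * y l s)^2 = inverse (\<omega> s) * H (l, s)"
     using True \<omega>0(1)[of s] by (auto simp: H_def power2_eq_square)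
   qed
   have "(LBINT l. dens \<alpha> l / (l + \<mu>) * ((l + \<mu>) * y l s))^2 <= \<kappa> * (LBINT l. dens \<alpha> l / (l + \<mu>) * ((l + \<mu>) * y l s)^2)"
    unfolding \<kappa>_def
   proof (rule weighted_Cauchy_Schwarz(2)[OF dens_weight_integrable[OF \<alpha>0 \<alpha>(2) \<mu>] _ k0])
    show "integrable lborel (%l. dens \<alpha> l / (l + \<mu>) * ((l + \<mu>) * y l s)^2)" unfolding q using elim by simp
    have "(%l. y l s) : bmf lborel" using measurable_compose[OF measurable_Pair1' ym, of s] by simp
    thus "(%l. (l + \<mu>) * y l s) : bmf lborel" by measurable
   qed
   hence "(w s)^2 <= \<kappa> * (inverse (\<omega> s) * (LBINT l. H (l, s)))" unfolding q using cm(2)[of s] by (simp add: y_def w_def)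
   hence "\<omega> s * (w s)^2 <= \<omega> s * (\<kappa> * (inverse (\<omega> s) * (LBINT l. H (l, s))))" using \<omega>0(1)[of s] by (intro mult_left_mono) auto
   also have "... = \<kappa> * (LBINT l. H (l, s))" using \<omega>0(1)[of s] by (simp add: field_simps)
   finally show ?thesis using True by simp
  next
   case False
   thus ?thesis using \<kappa>0 H0 by (simp add: integral_nonneg_AE)
  qed
 qed
 have wm: "w : bmf borel" unfolding w_def
  by (rule conv_measurable[OF kern_kernel[OF \<alpha>0] \<phi>i]) (use \<phi>0 in auto)
 have Hs: "integrable lborel (%s. \<kappa> * (LBINT l. H (l, s)))" using lborel_pair.integrable_snd[OF Hint'] by simp
 have Wi: "integrable lborel (%s. ind {..<t} s * (\<omega> s * (w s)^2))"
 proof (rule intb_B[OF Hs])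
  show "AE s in lborel. norm (ind {..<t} s * (\<omega> s * (w s)^2)) <= norm (\<kappa> * (LBINT l. H (l, s)))"
   using wle by eventually_elim (use \<omega>0 in \<open>auto simp: less_imp_le intro: order_trans[OF _ abs_ge_self]\<close>)
 qed (use wm in measurable)
 thus "integrable lborel (%s. ind {..<t} s * (exp (- 2 * \<mu> * s) * (w s)^2))" unfolding \<omega>_def .
 have "below t (%s. \<omega> s * (w s)^2) <= (LBINT s. \<kappa> * (LBINT l. H (l, s)))"
  by (rule integral_mono_AE[OF Wi Hs wle])
 also have "... = \<kappa> * (LBINT l. \<integral>s. H (l, s) \<partial>lborel)" using lborel_pair.Fubini_integral[OF Hint'] by simp
 also have "... <= \<kappa> * (LBINT l. dens \<alpha> l * G l)"
  using lborel_pair.integrable_fst[OF Hint'] G0(2) unfolding eH by (intro mult_left_mono[OF _ \<kappa>0] integral_mono Gi) auto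
 finally have "M * below t (%s. \<omega> s * (w s)^2) <= (M * \<kappa>) * (LBINT l. dens \<alpha> l * G l)" using M(1) by (simp add: mult_left_mono mult.assoc)
 also have "... <= 1 / 2 * (LBINT l. dens \<alpha> l * G l)"
  using M(2) G0(1) unfolding \<kappa>_def by (intro mult_right_mono integral_nonneg_AE AE_I2) auto
 \<comment> \<open>The choice of \<open>\<mu>\<close> lets one half of the energy absorb
   \<open>M\<close> times the weighted norm of \<open>w\<close>; the other half remains
   available.\<close>
 finally have half: "(LBINT l. dens \<alpha> l * G l) <= 2 * (below t (%s. \<omega> s * (\<phi> s * w s)) - M * below t (%s. \<omega> s * (w s)^2))"
  unfolding P by simp
 \<comment> \<open>The exponential removes the time weight. The numbers 4 and 2 T stem from
   splitting the primitive of \<open>\<phi>\<close> into two parts by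
   \<open>square_add_le\<close>.\<close>
 define K where "K = exp (2 * \<mu> * T) * (4 + 2 * T)"
 \<comment> \<open>For rates below 1 the integrated equation recovers the primitive of
   \<open>\<phi>\<close> as \<open>y\<close> plus \<open>l\<close> times the primitive of
   \<open>y\<close>, both controlled by the energy. Integrating over these rates against the density
   gives the claim.\<close>
 have \<phi>G: "(below t \<phi>)^2 <= K * G l" if l: "0 < l" "l < 1" for l
 proof -
  have ode: "below t \<phi> = y l t + l * below t (y l)"
   unfolding y_def[abs_def] by (rule exp_conv_ode(2)[OF \<alpha> \<phi>m \<phi>2 \<phi>0 t])
  let ?S = "below t (%s. \<omega> s * (y l s)^2)"
  have T0: "0 <= T" "0 <= t" "t <= T" using t by auto
  have y0: "y l s = 0" if "s <= 0" for s
  proof -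
   have "exp_kern l (s - r) * \<phi> r = 0" for r using \<phi>0[of r] that by (cases "r <= 0") (auto simp: exp_kern_def)
   thus ?thesis unfolding y_def conv_def by (simp only: intz_B)
  qed
  have inv: "exp (2 * \<mu> * T) * \<omega> s \<ge> 1" if "s <= T" for s
  proof -
   have "0 <= 2 * \<mu> * (T - s)" using that \<mu> by simp
   hence "1 <= exp (2 * \<mu> * (T - s))" by simp
   also have "... = exp (2 * \<mu> * T) * \<omega> s" by (simp add: \<omega>_def exp_add[symmetric] algebra_simps)
   finally show ?thesis .
  qed
  have e2: "(ind {0<..<t} s * y l s)^2 = ind {0<..<t} s * (y l s)^2" for s by (simp add: indicator_def)
  have e3: "ind {0<..<t} s * (ind {0<..<t} s * y l s) = ind {..<t} s * y l s" for s
   using y0[of s] by (auto simp: indicator_def)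
  have yw: "ind {0<..<t} s * (y l s)^2 <= exp (2 * \<mu> * T) * (ind {..<t} s * (\<omega> s * (y l s)^2))" for s
   using mult_right_mono[OF inv[of s], of "(y l s)^2"] T0 \<omega>0(1)[of s] by (auto simp: indicator_def mult.assoc)
  have yi: "integrable lborel (%s. ind {0<..<t} s * (y l s)^2)"
  proof (rule intb_B[OF integrable_mult_right[OF y2i[of l], of "exp (2 * \<mu> * T)"]])
   have "(%s. y l s) : bmf lborel" using measurable_compose[OF measurable_Pair2' ym, of l] by simp
   thus "(%s. ind {0<..<t} s * (y l s)^2) : bmf lborel" by measurable
   show "AE s in lborel. norm (ind {0<..<t} s * (y l s)^2) <= norm (exp (2 * \<mu> * T) * (ind {..<t} s * (\<omega> s * (y l s)^2)))"
    using yw by (intro AE_I2) (auto intro: order_trans[OF _ abs_ge_self])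
  qed
  have "(below t (y l))^2 <= t * (LBINT s. ind {0<..<t} s * (y l s)^2)"
  proof -
   have i1: "integrable lborel (%s. ind {0<..<t} s :: real)" using T0(2) by simp
   have "(%s. y l s) : bmf lborel" using measurable_compose[OF measurable_Pair2' ym, of l] by simp
   from weighted_Cauchy_Schwarz(2)[OF i1 yi _ this] T0(2)
   have "(LBINT s. ind {0<..<t} s * y l s)^2 <= t * (LBINT s. ind {0<..<t} s * (y l s)^2)" by simp
   also have "(LBINT s. ind {0<..<t} s * y l s) = below t (y l)"
    by (rule intc_B) (use y0 in \<open>auto simp: indicator_def\<close>)
   finally show ?thesis .
  qed
  also have "... <= T * (exp (2 * \<mu> * T) * ?S)"
  proof (rule mult_mono[OF T0(3) _ T0(1)])
   have "(LBINT s. ind {0<..<t} s * (y l s)^2) <= (LBINT s. exp (2 * \<mu> * T) * (ind {..<t} s * (\<omega> s * (y l s)^2)))"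
    by (rule integral_mono[OF yi _ yw]) (use y2i in simp)
   thus "(LBINT s. ind {0<..<t} s * (y l s)^2) <= exp (2 * \<mu> * T) * ?S" by simp
  qed (simp add: integral_nonneg_AE)
  finally have yT: "(below t (y l))^2 <= T * (exp (2 * \<mu> * T) * ?S)" .
  have l2: "(l * below t (y l))^2 <= 1 * (below t (y l))^2"
   unfolding power_mult_distrib using l by (intro mult_right_mono power_le_one) auto
  have S1: "?S <= G l" "\<omega> t * (y l t)^2 <= 2 * G l"
  proof -
   have "1 * ?S <= (l + \<mu>) * ?S" using l \<mu> b0 by (intro mult_right_mono) auto
   moreover have n: "0 <= \<omega> t * (y l t)^2 / 2" "0 <= (l + \<mu>) * ?S" using \<omega>0(1)[of t] b0 l \<mu> by auto
   ultimately show "?S <= G l" unfolding G_def by linarith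
   show "\<omega> t * (y l t)^2 <= 2 * G l" using n(2) unfolding G_def distrib_left[of 2] by simp
  qed
  have "(y l t)^2 <= exp (2 * \<mu> * T) * (\<omega> t * (y l t)^2)" using mult_right_mono[OF inv[OF T0(3)], of "(y l t)^2"] by (simp add: mult.assoc)
  also have "... <= exp (2 * \<mu> * T) * (2 * G l)" using S1(2) by simp
  finally have y1: "(y l t)^2 <= exp (2 * \<mu> * T) * (2 * G l)" .
  have "T * (exp (2 * \<mu> * T) * ?S) <= T * (exp (2 * \<mu> * T) * G l)" using S1(1) T0(1) by (intro mult_left_mono) auto
  hence "(below t \<phi>)^2 <= 2 * (exp (2 * \<mu> * T) * (2 * G l)) + 2 * (T * (exp (2 * \<mu> * T) * G l))"
   unfolding ode using square_add_le[of "y l t" "l * below t (y l)"] y1 l2 yT by linarith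
  thus ?thesis by (simp add: K_def algebra_simps)
 qed
 have K0: "0 <= K" using t by (simp add: K_def)
 have "(LBINT l. ind {0<..<1} l * dens \<alpha> l) * (below t \<phi>)^2 = (LBINT l. ind {0<..<1} l * dens \<alpha> l * (below t \<phi>)^2)" by simp
 also have "... <= (LBINT l. K * (dens \<alpha> l * G l))"
 proof (rule integral_mono')
  show "integrable lborel (%l. K * (dens \<alpha> l * G l))" using Gi by simp
  show "0 <= K * (dens \<alpha> l * G l)" for l using K0 G0(1) by simp
  show "ind {0<..<1} l * dens \<alpha> l * (below t \<phi>)^2 <= K * (dens \<alpha> l * G l)" for l
   using mult_left_mono[OF \<phi>G[of l] d0[of l]] mult_nonneg_nonneg[OF K0 G0(1)[of l]] by (cases "0 < l \<and> l < 1") (auto simp: mult.left_commute)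
 qed
 also have "... <= K * (2 * (below t (%s. \<omega> s * (\<phi> s * w s)) - M * below t (%s. \<omega> s * (w s)^2)))"
  using mult_left_mono[OF half K0] by simp
 also have "... = 2 * K * (below t (%s. \<omega> s * (\<phi> s * w s)) - M * below t (%s. \<omega> s * (w s)^2))"
  by (simp only: mult.assoc mult.left_commute[of K 2])
 finally show "(LBINT l. ind {0<..<1} l * dens \<alpha> l) * (below t \<phi>)^2
   <= 2 * (exp (2 * \<mu> * T) * (4 + 2 * T)) * (below t (%s. exp (- 2 * \<mu> * s) * (\<phi> s * w s)) - M * below t (%s. exp (- 2 * \<mu> * s) * (w s)^2))"
  unfolding K_def \<omega>_def .
qed

end

section \<open>From scalar to vector valued functions of time\<close>

text \<open>Gram-Schmidt in coordinates: inner products of linear combinations become sums of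
  products of scalar linear forms in the coefficients. A scalar inequality can then be summed over
  these forms, with a constant that does not depend on their number.\<close>

lemma gram_diag:
 assumes "finite I" "!!i. i : I ==> r i : L2 L"
 shows "\<exists>(K :: nat) c. \<forall>a b. ip L (%x. \<Sum>i\<in>I. a i * r i x) (%x. \<Sum>i\<in>I. b i * r i x)
  = (\<Sum>k<K. (\<Sum>i\<in>I. a i * c i k) * (\<Sum>i\<in>I. b i * c i k))"
 using assms
proof (induction I arbitrary: r rule: finite_induct)
 case empty
 thus ?case by (intro exI[of _ 0]) simp
next
 case (insert i I)
 define n where "n = nrm L (r i)"
 \<comment> \<open>If \<open>r i\<close> has norm 0, the division by zero gives coefficient 0. This
   is the right value, because Cauchy-Schwarz makes the inner product vanish too.\<close>
 define \<beta> where "\<beta> j = ip L (r j) (r i) / n^2" for j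
 define r' where "r' j x = r j x - \<beta> j * r i x" for j x
 have rL: "r i : L2 L" "!!j. j : I ==> r j : L2 L" using insert by auto
 have r': "r' j : L2 L" if "j : I" for j unfolding r'_def[abs_def] by (intro L2_diff L2_scale rL that)
 obtain K :: nat and c where c: "!!a b. ip L (%x. \<Sum>i\<in>I. a i * r' i x) (%x. \<Sum>i\<in>I. b i * r' i x)
  = (\<Sum>k<K. (\<Sum>i\<in>I. a i * c i k) * (\<Sum>i\<in>I. b i * c i k))"
  using insert.IH[of r', OF r'] by blast
 define c' where "c' j k = (if k < K then (if j = i then 0 else c j k) else (if j = i then n else \<beta> j * n))" for j and k :: nat
 define s where "s a = a i + (\<Sum>j\<in>I. a j * \<beta> j)" for a
 define A where "A a x = (\<Sum>j\<in>I. a j * r' j x)" for a x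
 have AL: "A a : L2 L" for a unfolding A_def[abs_def] by (intro L2_sum L2_scale r')
 have e: "(%x. \<Sum>j\<in>insert i I. a j * r j x) = (%x. s a * r i x + A a x)" for a
  using insert.hyps by (auto simp: s_def A_def r'_def fun_eq_iff sum_distrib_right sum_distrib_left algebra_simps sum_subtractf)
 have o: "ip L (A a) (r i) = 0" for a
 proof -
  have "ip L (r' j) (r i) = 0" if j: "j : I" for j
  proof -
   have "n = 0 ==> ip L (r j) (r i) = 0" using inner_L2_Cauchy_Schwarz[OF rL(2)[OF j] rL(1)] by (simp add: n_def)
   moreover have "ip L (r' j) (r i) = ip L (r j) (r i) - \<beta> j * n^2"
    unfolding r'_def[abs_def] inner_L2_diff_left[OF rL(2)[OF j] L2_scale[OF rL(1)] rL(1)] inner_L2_scale_left n_def norm_L2_square ..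
   ultimately show ?thesis by (cases "n = 0") (auto simp: \<beta>_def)
  qed
  hence "(\<Sum>j\<in>I. ip L (%x. a j * r' j x) (r i)) = 0" by (simp add: inner_L2_scale_left)
  moreover have "ip L (A a) (r i) = (\<Sum>j\<in>I. ip L (%x. a j * r' j x) (r i))"
   unfolding A_def[abs_def] by (rule inner_L2_sum_left) (intro L2_scale r' rL, assumption | rule rL)+
  ultimately show ?thesis by simp
 qed
 have main: "ip L (%x. s a * r i x + A a x) (%x. s b * r i x + A b x) = s a * n * (s b * n) + ip L (A a) (A b)" for a b
  using o[of a] o[of b] inner_L2_commute[of L "r i" "A b"] norm_L2_square[of L "r i"]
  by (simp add: inner_L2_add_left inner_L2_add_right L2_add L2_scale rL AL inner_L2_scale_left inner_L2_scale_right n_def power2_eq_square)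
 have c1: "(\<Sum>j\<in>insert i I. a j * c' j k) = (\<Sum>j\<in>I. a j * c j k)" if "k < K" for a k
  using insert.hyps that by (auto simp: c'_def intro!: sum.cong)
 have c2: "(\<Sum>j\<in>insert i I. a j * c' j K) = s a * n" for a
 proof -
  have "(\<Sum>j\<in>I. a j * c' j K) = (\<Sum>j\<in>I. a j * \<beta> j * n)" using insert.hyps by (intro sum.cong) (auto simp: c'_def)
  thus ?thesis using insert.hyps by (simp add: s_def c'_def distrib_right sum_distrib_right)
 qed
 show ?case
 proof (intro exI[of _ "Suc K"] exI[of _ c'] allI)
  fix a b
  have "(\<Sum>k<K. (\<Sum>j\<in>I. a j * c j k) * (\<Sum>j\<in>I. b j * c j k)) = (\<Sum>k<K. (\<Sum>j\<in>insert i I. a j * c' j k) * (\<Sum>j\<in>insert i I. b j * c' j k))"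
   by (rule sum.cong[OF refl]) (use c1 in simp)
  thus "ip L (%x. \<Sum>i\<in>insert i I. a i * r i x) (%x. \<Sum>i\<in>insert i I. b i * r i x)
   = (\<Sum>k<Suc K. (\<Sum>j\<in>insert i I. a j * c' j k) * (\<Sum>j\<in>insert i I. b j * c' j k))"
   unfolding e main unfolding A_def[abs_def] c sum.lessThan_Suc c2 by simp
 qed
qed

text \<open>The coefficients \<open>\<phi> i\<close> on the fixed elements \<open>r i\<close> model
  theta_t. Inside, \<open>w\<close> collects the coefficients of its fractional integral,
  \<open>Q\<close> is the squared norm of that integral and \<open>D\<close> its pairing with
  theta_t.\<close>

locale frac_sum =
 fixes \<alpha> T L :: real and I :: "'i set" and \<phi> :: "'i => real => real" and r :: "'i => real => real"
 assumes \<alpha>: "1 / 2 < \<alpha>" "\<alpha> < 1" and I: "finite I" and r: "!!i. i : I ==> r i : L2 L"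
  and \<phi>m: "!!i. \<phi> i : bmf borel" and \<phi>2: "!!i. integrable lborel (%s. (\<phi> i s)^2)"
  and \<phi>0: "!!i s. s \<notin> {0<..<T} ==> \<phi> i s = 0"
begin

definition w :: "'i => real => real" where "w i = conv (kern \<alpha>) (\<phi> i)"

definition Q :: "real => real" where "Q s = (nrm L (%x. \<Sum>i\<in>I. w i s * r i x))^2"

definition D :: "real => real" where
 "D s = ip L (%x. \<Sum>i\<in>I. w i s * r i x) (%x. \<Sum>i\<in>I. \<phi> i s * r i x)"

lemma lincomb:
 defines "f \<equiv> %c s. \<Sum>i\<in>I. \<phi> i s * c i"
 shows "f c : bmf borel" "integrable lborel (%s. (f c s)^2)" "!!s. s \<notin> {0<..<T} ==> f c s = 0"
  "conv (kern \<alpha>) (f c) t = (\<Sum>i\<in>I. w i t * c i)"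
  "below t (f c) = (\<Sum>i\<in>I. below t (\<phi> i) * c i)"
proof -
 have "square_int (f c)" unfolding f_def mult.commute[of "\<phi> _ _"]
  by (intro square_int_sum square_int_scale) (simp add: square_int_def \<phi>m \<phi>2)
 thus "f c : bmf borel" "integrable lborel (%s. (f c s)^2)" by (auto simp: square_int_def)
 show "f c s = 0" if "s \<notin> {0<..<T}" for s using \<phi>0[OF that] by (simp add: f_def)
 have i: "integrable lborel (%s. kern \<alpha> (t - s) * \<phi> i s * c i)" for i
  by (rule integrable_mult_left) (rule frac_integrable[OF \<alpha> \<phi>m \<phi>2 \<phi>0])
 have "conv (kern \<alpha>) (f c) t = (LBINT s. (\<Sum>i\<in>I. kern \<alpha> (t - s) * \<phi> i s * c i))"
  by (simp add: conv_def f_def sum_distrib_left mult.assoc)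
 also have "... = (\<Sum>i\<in>I. \<integral>s. kern \<alpha> (t - s) * \<phi> i s * c i \<partial>lborel)" by (rule ints_B) (rule i)
 finally show "conv (kern \<alpha>) (f c) t = (\<Sum>i\<in>I. w i t * c i)" by (simp add: w_def conv_def)
 have j: "integrable lborel (%s. ind {..<t} s * \<phi> i s * c i)" for i
  by (rule integrable_mult_left, rule below_integrable) (rule L2_time_integrable[OF \<alpha> \<phi>m \<phi>2 \<phi>0])
 have "below t (f c) = (LBINT s. (\<Sum>i\<in>I. ind {..<t} s * \<phi> i s * c i))"
  by (simp add: f_def sum_distrib_left mult.assoc)
 also have "... = (\<Sum>i\<in>I. \<integral>s. ind {..<t} s * \<phi> i s * c i \<partial>lborel)" by (rule ints_B) (rule j)
 finally show "below t (f c) = (\<Sum>i\<in>I. below t (\<phi> i) * c i)" by simp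
qed

text \<open>In Gram coordinates \<open>D\<close>, \<open>Q\<close> and the squared norm of the
  primitive are sums of the corresponding scalar quantities over the same index, so the scalar
  coercivity can be added up before the differential inequality between \<open>D\<close> and
  \<open>Q\<close> is inserted.\<close>

lemma stability:
 fixes M \<mu> t :: real
 assumes t: "t : {0..T}" and \<mu>: "1 <= \<mu>" and M: "0 <= M" "M * (LBINT l. dens \<alpha> l / (l + \<mu>)) <= 1 / 2"
  and E: "integrable lborel E" "!!s. 0 <= E s" and le: "AE s in lborel. s : {0<..<T} \<longrightarrow> D s <= M * Q s + M * E s"
 shows "(LBINT l. ind {0<..<1} l * dens \<alpha> l) * (nrm L (%x. \<Sum>i\<in>I. below t (\<phi> i) * r i x))^2
   <= 2 * (exp (2 * \<mu> * T) * (4 + 2 * T)) * (M * below t E)"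
proof -
 obtain K :: nat and c where c: "!!a b. ip L (%x. \<Sum>i\<in>I. a i * r i x) (%x. \<Sum>i\<in>I. b i * r i x)
  = (\<Sum>k<K. (\<Sum>i\<in>I. a i * c i k) * (\<Sum>i\<in>I. b i * c i k))"
  using gram_diag[of I r L, OF I r] by blast
 define f where "f k s = (\<Sum>i\<in>I. \<phi> i s * c i k)" for k s
 define \<omega> where "\<omega> s = exp (- 2 * \<mu> * s)" for s
 define W where "W k s = (\<Sum>i\<in>I. w i s * c i k)" for k s
 let ?c0 = "\<integral>l. ind {0<..<1} l * dens \<alpha> l \<partial>lborel" and ?K = "2 * (exp (2 * \<mu> * T) * (4 + 2 * T))"
 have fm: "f k : bmf borel" and f2: "integrable lborel (%s. (f k s)^2)" and f0: "!!s. s \<notin> {0<..<T} ==> f k s = 0"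
  and fw: "conv (kern \<alpha>) (f k) = W k" and fb: "below t (f k) = (\<Sum>i\<in>I. below t (\<phi> i) * c i k)" for k
  unfolding f_def[abs_def] W_def[abs_def] using lincomb[where c = "%i. c i k"] by auto
 have cc: "integrable lborel (%s. ind {..<t} s * (\<omega> s * (f k s * W k s)))"
  "integrable lborel (%s. ind {..<t} s * (\<omega> s * (W k s)^2))"
  "?c0 * (below t (f k))^2 <= ?K * (below t (%s. \<omega> s * (f k s * W k s)) - M * below t (%s. \<omega> s * (W k s)^2))" for k
  unfolding \<omega>_def fw[symmetric]
  by (rule cm_coercive(1)[OF \<alpha> fm f2 f0 t \<mu> M], assumption, rule cm_coercive(2)[OF \<alpha> fm f2 f0 t \<mu> M], assumption)
   (rule cm_coercive(3)[OF \<alpha> fm f2 f0 t \<mu> M])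
 have Q: "Q s = (\<Sum>k<K. (W k s)^2)" for s unfolding Q_def norm_L2_square unfolding c W_def power2_eq_square ..
 have D: "D s = (\<Sum>k<K. f k s * W k s)" for s unfolding D_def c W_def f_def by (simp add: mult.commute)
 have N: "(nrm L (%x. \<Sum>i\<in>I. below t (\<phi> i) * r i x))^2 = (\<Sum>k<K. (below t (f k))^2)"
  unfolding norm_L2_square unfolding c fb power2_eq_square ..
 have DQ: "ind {..<t} s * (\<omega> s * D s) - M * (ind {..<t} s * (\<omega> s * Q s))
  = (\<Sum>k<K. ind {..<t} s * (\<omega> s * (f k s * W k s)) - M * (ind {..<t} s * (\<omega> s * (W k s)^2)))" for s
  by (cases "s < t") (simp_all add: Q D sum_distrib_left sum_subtractf)
 have i: "integrable lborel (%s. ind {..<t} s * (\<omega> s * (f k s * W k s)) - M * (ind {..<t} s * (\<omega> s * (W k s)^2)))" for k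
  using cc by simp
 have iDQ: "integrable lborel (%s. ind {..<t} s * (\<omega> s * D s) - M * (ind {..<t} s * (\<omega> s * Q s)))"
  unfolding DQ using i by simp
 have Ei: "integrable lborel (%s. M * (ind {..<t} s * E s))" using below_integrable[OF E(1)] by simp
 have "?c0 * (\<Sum>k<K. (below t (f k))^2) <= (\<Sum>k<K. ?K * (below t (%s. \<omega> s * (f k s * W k s)) - M * below t (%s. \<omega> s * (W k s)^2)))"
  unfolding sum_distrib_left by (rule sum_mono) (rule cc(3))
 also have "... = ?K * (\<Sum>k<K. \<integral>s. ind {..<t} s * (\<omega> s * (f k s * W k s)) - M * (ind {..<t} s * (\<omega> s * (W k s)^2)) \<partial>lborel)"
  using cc by (simp add: sum_distrib_left)
 also have "(\<Sum>k<K. \<integral>s. ind {..<t} s * (\<omega> s * (f k s * W k s)) - M * (ind {..<t} s * (\<omega> s * (W k s)^2)) \<partial>lborel)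
  = (LBINT s. ind {..<t} s * (\<omega> s * D s) - M * (ind {..<t} s * (\<omega> s * Q s)))"
  unfolding DQ by (rule ints_B[symmetric]) (rule i)
 also have "?K * (LBINT s. ind {..<t} s * (\<omega> s * D s) - M * (ind {..<t} s * (\<omega> s * Q s))) <= ?K * (LBINT s. M * (ind {..<t} s * E s))"
 proof (rule mult_left_mono[OF integral_mono_AE[OF iDQ Ei]])
  show "AE s in lborel. ind {..<t} s * (\<omega> s * D s) - M * (ind {..<t} s * (\<omega> s * Q s)) <= M * (ind {..<t} s * E s)"
   using le
  proof eventually_elim
   case (elim s)
   \<comment> \<open>The hypothesis speaks only of times in (0,T). At nonpositive times all
     coefficients vanish, hence so does \<open>D\<close>; at positive times the weight is at most
     1.\<close>
   consider "s <= 0" | "t <= s" | "0 < s" "s < t" by linarith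
   thus ?case
   proof cases
    case 1
    hence z: "f k s = 0" for k using f0 by simp
    have "0 <= M * (ind {..<t} s * (\<omega> s * Q s))" "0 <= M * (ind {..<t} s * E s)"
     using M(1) E(2)[of s] by (simp_all add: Q_def \<omega>_def)
    thus ?thesis by (simp add: D z)
   next
    case 3
    have o: "0 <= \<omega> s" "\<omega> s <= 1" using 3 \<mu> by (auto simp: \<omega>_def)
    have "\<omega> s * (D s - M * Q s) <= \<omega> s * (M * E s)" using elim 3 t o by (intro mult_left_mono) auto
    also have "... <= 1 * (M * E s)" using o M(1) E(2)[of s] by (intro mult_right_mono) auto
    finally show ?thesis using 3 by (simp add: algebra_simps)
   qed simp
  qed
 qed (use t in simp)
 finally show ?thesis unfolding N by simp
qed

end

text \<open>The constant is fixed before the index set, the interval \<open>L\<close> and the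
  elements \<open>r\<close>. This order is what finally makes the error constant independent of the
  mesh.\<close>

lemma frac_stability:
 assumes \<alpha>: "1 / 2 < \<alpha>" "\<alpha> < 1" and M: "0 <= M"
 obtains C where "0 <= C"
  "!!(I :: 'i set) L \<phi> r E. frac_sum \<alpha> T L I \<phi> r ==> integrable lborel E ==> (!!s. 0 <= E s) ==>
   (AE s in lborel. s : {0<..<T} \<longrightarrow> frac_sum.D \<alpha> L I \<phi> r s <= M * frac_sum.Q \<alpha> L I \<phi> r s + M * E s) ==>
   AE t in lborel. t : {0<..<T} \<longrightarrow>
    (nrm L (%x. \<Sum>i\<in>I. below t (\<phi> i) * r i x))^2 <= C * below t E"
proof -
 have \<alpha>0: "0 < \<alpha>" using \<alpha> by simp
 \<comment> \<open>The threshold makes \<open>M\<close> times the integral at most 1/2; adding 1 to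
   \<open>M\<close> keeps it defined for \<open>M = 0\<close>.\<close>
 obtain \<mu> where \<mu>: "1 <= \<mu>" "(LBINT l. dens \<alpha> l / (l + \<mu>)) < 1 / (2 * (M + 1))"
  using dens_weight_small[OF \<alpha>0 \<alpha>(2), of "1 / (2 * (M + 1))"] M by auto
 have "M * (LBINT l. dens \<alpha> l / (l + \<mu>)) <= M * (1 / (2 * (M + 1)))" using \<mu>(2) M by (intro mult_left_mono) auto
 also have "... <= 1 / 2" using M by (simp add: field_simps)
 finally have M2: "M * (LBINT l. dens \<alpha> l / (l + \<mu>)) <= 1 / 2" .
 define c0 where "c0 = (LBINT l. ind {0<..<1} l * dens \<alpha> l)"
 \<comment> \<open>On (0,1) the density is at least its value at 1, which is positive, because it
   decreases in \<open>l\<close>.\<close>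
 have c0: "0 < c0"
 proof -
  have d1: "0 < dens \<alpha> 1" using Gamma_pos[OF \<alpha>0 \<alpha>(2)] by (simp add: dens_def)
  have "integrable lborel (%l. exp 1 * (dens \<alpha> l * exp (- l * 1)))"
   using dens_laplace[OF \<alpha>0 \<alpha>(2), of 1] by (auto simp: has_bochner_integral_iff)
  hence i: "integrable lborel (%l. ind {0<..<1} l * dens \<alpha> l)"
  proof (rule intb_B)
   have "ind {0<..<1} l * dens \<alpha> l <= exp 1 * (dens \<alpha> l * exp (- l * 1))" for l
   proof (cases "l : {0<..<1}")
    case True
    hence "dens \<alpha> l * 1 <= dens \<alpha> l * exp (1 - l)" using dens_nonneg[OF \<alpha>0 \<alpha>(2)] by (intro mult_left_mono) auto
    thus ?thesis using True by (simp add: exp_diff exp_minus field_simps)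
   qed (use dens_nonneg[OF \<alpha>0 \<alpha>(2)] in simp)
   thus "AE l in lborel. norm (ind {0<..<1} l * dens \<alpha> l) <= norm (exp 1 * (dens \<alpha> l * exp (- l * 1)))"
    using dens_nonneg[OF \<alpha>0 \<alpha>(2)] by (intro AE_I2) simp
  qed measurable
  have "dens \<alpha> 1 = (LBINT (l :: real). ind {0<..<1} l * dens \<alpha> 1)" by simp
  also have "... <= c0" unfolding c0_def
  proof (rule integral_mono[OF _ i])
   show "integrable lborel (%l :: real. ind {0<..<1} l * dens \<alpha> 1)" by simp
   show "ind {0<..<1} l * dens \<alpha> 1 <= ind {0<..<1} l * dens \<alpha> l" for l
   proof (cases "l : {0<..<1}")
    case True
    hence "(1 :: real) <= l powr (- \<alpha>)" using powr_mono2'[of "- \<alpha>" l 1] \<alpha>0 by simp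
    thus ?thesis using True Gamma_pos[OF \<alpha>0 \<alpha>(2)] by (simp add: dens_def divide_right_mono)
   qed simp
  qed
  finally show ?thesis using d1 by simp
 qed
 \<comment> \<open>Here \<open>T\<close> is an arbitrary real. The maximum keeps the constant
   nonnegative for negative \<open>T\<close> too, when there is no time in question.\<close>
 define C where "C = max 0 (2 * (exp (2 * \<mu> * T) * (4 + 2 * T)) * M / c0)"
 show thesis
 proof (rule that[of C])
  show "0 <= C" by (simp add: C_def)
  fix I :: "'i set" and L \<phi> r E
  assume fs: "frac_sum \<alpha> T L I \<phi> r" and E: "integrable lborel E" "!!s. 0 <= E s"
   and le: "AE s in lborel. s : {0<..<T} \<longrightarrow> frac_sum.D \<alpha> L I \<phi> r s <= M * frac_sum.Q \<alpha> L I \<phi> r s + M * E s"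
  have "(nrm L (%x. \<Sum>i\<in>I. below t (\<phi> i) * r i x))^2 <= C * below t E" if t: "t : {0<..<T}" for t
  proof -
   have "c0 * (nrm L (%x. \<Sum>i\<in>I. below t (\<phi> i) * r i x))^2 <= 2 * (exp (2 * \<mu> * T) * (4 + 2 * T)) * (M * below t E)"
    unfolding c0_def by (rule frac_sum.stability[OF fs _ \<mu>(1) M M2 E le]) (use t in auto)
   hence "(nrm L (%x. \<Sum>i\<in>I. below t (\<phi> i) * r i x))^2 <= 2 * (exp (2 * \<mu> * T) * (4 + 2 * T)) * M / c0 * below t E"
    using c0 by (simp add: field_simps)
   also have "... <= C * below t E"
    unfolding C_def by (intro mult_right_mono integral_nonneg_AE AE_I2) (auto simp: E(2))
   finally show ?thesis .
  qed
  thus "AE t in lborel. t : {0<..<T} \<longrightarrow> (nrm L (%x. \<Sum>i\<in>I. below t (\<phi> i) * r i x))^2 <= C * below t E" by simp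
 qed
qed

section \<open>Piecewise linear finite elements\<close>

text \<open>\<open>space_H\<close> provides a derivative for each order separately. Testing the
  first order identity with \<open>deriv \<phi>\<close> links the first and the second one.\<close>

lemma Hk_2_wderiv:
 assumes "w : Hk L 2" shows "has_wderiv L 1 (dx L w) (wderiv L 2 w)"
 unfolding has_wderiv_def
proof (intro allI impI)
 fix \<phi> assume \<phi>: "test_fun 0 L \<phi>"
 have "ip L w ((deriv ^^ 1) (deriv \<phi>)) = (-1) ^ 1 * ip L (dx L w) (deriv \<phi>)"
  using Hk_wderiv(2)[OF assms, of 1] test_fun_deriv[OF \<phi>] unfolding has_wderiv_def by simp
 moreover have "ip L w ((deriv ^^ 2) \<phi>) = (-1) ^ 2 * ip L (wderiv L 2 w) \<phi>"
  using Hk_wderiv(2)[OF assms, of 2] \<phi> unfolding has_wderiv_def by simp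
 ultimately show "ip L (dx L w) ((deriv ^^ 1) \<phi>) = (-1) ^ 1 * ip L (wderiv L 2 w) \<phi>"
  by (simp add: numeral_2_eq_2)
qed

lemma prim_diff:
 fixes g :: "real => real"
 assumes g: "integrable (leb L) g" and ab: "0 <= a" "a <= b"
 shows "prim L g b - prim L g a = (LINT y|leb L. ind {a<..<b} y * g y)"
proof -
 have "prim L g b - prim L g a = (LINT y|leb L. ind {0<..<b} y * g y - ind {0<..<a} y * g y)"
  unfolding prim_def using prim_integrable[OF g] by simp
 also have "... = (LINT y|leb L. ind {a<..<b} y * g y)"
 proof (rule integral_cong_AE)
  have i: "(ind {a<..<b} :: real => real) : bmf (leb L)"
   by (rule borel_measurable_Ioo) auto
  show "(%y. ind {a<..<b} y * g y) : bmf (leb L)"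
   using i g by (intro borel_measurable_times) auto
  show "(%y. ind {0<..<b} y * g y - ind {0<..<a} y * g y) : bmf (leb L)"
   using prim_integrable[OF g, of b] prim_integrable[OF g, of a] by (intro borel_measurable_diff) auto
  have "AE y in leb L. y \<noteq> a"
   unfolding AE_Ioo_iff using AE_lborel_singleton[of a] by eventually_elim simp
  thus "AE y in leb L. ind {0<..<b} y * g y - ind {0<..<a} y * g y = ind {a<..<b} y * g y"
   by eventually_elim (use ab in \<open>auto simp: indicator_def\<close>)
 qed
 finally show ?thesis .
qed

lemma prim_sum:
 assumes "!!i. i : I ==> integrable (leb L) (g i)"
 shows "prim L (%x. \<Sum>i\<in>I. c i * g i x) x = (\<Sum>i\<in>I. c i * prim L (g i) x)"
proof -
 have "prim L (%x. \<Sum>i\<in>I. c i * g i x) x = (LINT y|leb L. (\<Sum>i\<in>I. c i * (ind {0<..<x} y * g i y)))"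
  unfolding prim_def by (simp add: sum_distrib_left mult_ac)
 also have "... = (\<Sum>i\<in>I. \<integral>y. c i * (ind {0<..<x} y * g i y) \<partial>leb L)"
  using prim_integrable[OF assms] by (intro ints_B) auto
 finally show ?thesis by (simp add: prim_def)
qed

lemma prim_minus:
 assumes "integrable (leb L) f" "integrable (leb L) g"
 shows "prim L (%x. f x - g x) x = prim L f x - prim L g x"
 unfolding prim_def using prim_integrable[OF assms(1)] prim_integrable[OF assms(2)]
 by (simp add: right_diff_distrib)

lemma prim_L2: "integrable (leb L) g ==> prim L g : L2 L"
 by (rule L2_continuous[OF continuous_on_subset[OF prim_continuous]]) auto

lemma prim_at_end: "prim L g L = ip L g (%x. 1)"
proof -
 have "prim L g L = (LINT x|leb L. g x)"
  unfolding prim_def by (intro intc_B) auto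
 thus ?thesis by (simp add: inner_L2_def)
qed

lemma prim_0 [simp]: "x <= 0 ==> prim L g x = 0"
 by (simp add: prim_def)

section \<open>Zero boundary values expressed by primitives\<close>

lemma test_fun_has_wderiv:
 assumes "test_fun 0 L \<phi>" "0 <= L"
 shows "!!x. x : {0..L} ==> \<phi> x = prim L (deriv \<phi>) x" "has_wderiv L 1 \<phi> (deriv \<phi>)" "prim L (deriv \<phi>) L = 0"
proof -
 note sm = test_fun_smooth[OF assms(1)] test_fun_smooth[OF test_fun_deriv[OF assms(1)]]
 have z: "deriv \<phi> x = 0" if "x <= 0 \<or> L <= x" for x
  by (rule test_fun_eq_0[OF test_fun_deriv[OF assms(1)] that])
 have *: "prim L (deriv \<phi>) x = \<phi> x" if x: "0 <= x" for x
 proof -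
  have "prim L (deriv \<phi>) x = (LBINT y. ind {..<x} y * deriv \<phi> y)"
   by (rule prim_borel_eq[OF test_fun_borel[OF test_fun_deriv[OF assms(1)]]]) (use z in auto)
  also have "... = (LBINT y. deriv \<phi> y * ind {0..x} y)"
  proof (rule integral_cong_AE)
   have [measurable]: "deriv \<phi> : bmf borel" by (rule test_fun_borel[OF test_fun_deriv[OF assms(1)]])
   show "(%y. ind {..<x} y * deriv \<phi> y) : bmf lborel" "(%y. deriv \<phi> y * ind {0..x} y) : bmf lborel"
    by measurable
   show "AE y in lborel. ind {..<x} y * deriv \<phi> y = deriv \<phi> y * ind {0..x} y"
    using AE_lborel_singleton[of x]
   proof eventually_elim
    case (elim y)
    thus ?case using z[of y] by (cases "y <= 0") (auto simp: indicator_def)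
   qed
  qed
  also have "... = \<phi> x - \<phi> 0"
   by (rule integral_FTC_Icc_real[OF x]) (use smooth_DERIV[OF sm(1)] DERIV_isCont[OF smooth_DERIV[OF sm(2)]] in auto)
  also have "\<phi> 0 = 0" by (rule test_fun_eq_0[OF assms(1)]) simp
  finally show ?thesis by simp
 qed
 show "!!x. x : {0..L} ==> \<phi> x = prim L (deriv \<phi>) x" using * by simp
 show "prim L (deriv \<phi>) L = 0" using *[OF assms(2)] test_fun_eq_0[OF assms(1), of L] by simp
 show "has_wderiv L 1 \<phi> (deriv \<phi>)"
  by (rule has_wderiv_1_prim[where c = 0])
   (use * in \<open>auto intro!: AE_I2 L2_test_fun[OF assms(1)] L2_test_fun[OF test_fun_deriv[OF assms(1)]]\<close>)
qed

text \<open>Poincare's inequality; one factor \<open>sqrt L\<close> comes from passing from the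
  integral of the absolute value to the norm, the other from passing from a pointwise bound to the
  norm.\<close>

lemma prim_norm_bound:
 assumes "z : L2 L" "0 <= L" shows "nrm L (prim L z) <= L * nrm L z"
proof -
 have zi: "integrable (leb L) z" by (rule L2_integrable[OF assms(1)])
 have "nrm L (prim L z) <= sqrt L * (sqrt L * nrm L z)"
 proof (rule norm_L2_bound[OF prim_L2[OF zi]])
  show "\<bar>prim L z x\<bar> <= sqrt L * nrm L z" for x
   using prim_bound[OF zi, of x] integral_abs_le_norm_L2[OF assms] by linarith
 qed (use assms in auto)
 thus ?thesis using assms(2) by (simp flip: mult.assoc)
qed

text \<open>Test functions are primitives of their derivatives, and these have mean zero. Both
  properties survive the limit in the \<open>H^1\<close> norm, the first one by Poincare's
  inequality. The mean value zero encodes the boundary condition at \<open>L\<close>.\<close>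

lemma H10_prim:
 assumes "w : H10 L" "0 < L"
 shows "w : Hk L 1" "AE x in leb L. w x = prim L (dx L w) x" "ip L (dx L w) (%x. 1) = 0"
proof -
 show wH: "w : Hk L 1" using assms by (simp add: H10_def)
 obtain \<phi> where \<phi>: "!!n. test_fun 0 L (\<phi> n)" and lim: "(%n. norm_H L 1 (%x. w x - \<phi> n x)) ----> 0"
  using assms by (auto simp: H10_def)
 have wL: "w : L2 L" by (rule Hk_L2[OF wH])
 have zL: "dx L w : L2 L" using Hk_wderiv(1)[OF wH] by simp
 have L0: "0 <= L" using assms by simp
 have \<phi>L: "\<phi> n : L2 L" "deriv (\<phi> n) : L2 L" for n
  using L2_test_fun[OF \<phi>] L2_test_fun[OF test_fun_deriv[OF \<phi>]] by auto
 have \<phi>H: "\<phi> n : Hk L 1" for n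
  unfolding Hk_iff
 proof (intro conjI allI impI \<phi>L)
  fix k :: nat assume "k <= 1"
  then consider "k = 0" | "k = 1" by linarith
  thus "\<exists>z\<in>L2 L. has_wderiv L k (\<phi> n) z"
   using has_wderiv_0[of L "\<phi> n"] test_fun_has_wderiv(2)[OF \<phi> L0, of n] \<phi>L[of n] by cases auto
 qed
 have d: "AE x in leb L. dx L (\<phi> n) x = deriv (\<phi> n) x" for n
  by (rule wderivI(3)[OF \<phi>L(2) test_fun_has_wderiv(2)[OF \<phi> L0]])
 have n1: "nrm L (%x. dx L w x - deriv (\<phi> n) x) <= norm_H L 1 (%x. w x - \<phi> n x)" for n
  by (rule norm_wderiv_diff_le[OF wH \<phi>H le_refl d])
 have n0: "nrm L (%x. w x - \<phi> n x) <= norm_H L 1 (%x. w x - \<phi> n x)" for n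
  using norm_wderiv_le_norm_H[of 0 1 L "%x. w x - \<phi> n x"] wderiv_0(2)[OF L2_diff[OF wL \<phi>L(1)]] by simp
 have l1: "(%n. nrm L (%x. dx L w x - deriv (\<phi> n) x)) ----> 0"
  by (rule Lim_null_comparison[OF _ lim]) (use n1 in simp)
 have zi: "integrable (leb L) (dx L w)" by (rule L2_integrable[OF zL])
 let ?p = "prim L (dx L w)"
 have pL: "?p : L2 L" by (rule prim_L2[OF zi])
 have b: "nrm L (%x. w x - ?p x) <= norm_H L 1 (%x. w x - \<phi> n x) + L * norm_H L 1 (%x. w x - \<phi> n x)" for n
 proof -
  have eq: "prim L (%x. deriv (\<phi> n) x - dx L w x) x = \<phi> n x - ?p x" if "x : {0<..<L}" for x
   using prim_minus[OF L2_integrable[OF \<phi>L(2)[of n]] zi, of x] test_fun_has_wderiv(1)[OF \<phi> L0, of x n] that by simp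
  have "nrm L (%x. w x - ?p x) <= nrm L (%x. w x - \<phi> n x) + nrm L (%x. \<phi> n x - ?p x)"
   by (rule norm_L2_triangle_diff[OF wL \<phi>L(1) pL])
  also have "nrm L (%x. \<phi> n x - ?p x) = nrm L (prim L (%x. deriv (\<phi> n) x - dx L w x))"
   by (rule norm_L2_cong_AE[OF L2_measurable[OF L2_diff[OF \<phi>L(1) pL]]]) (rule AE_I2, simp only: eq space_lebesgue_on)
  also have "... <= L * nrm L (%x. deriv (\<phi> n) x - dx L w x)"
   by (rule prim_norm_bound[OF L2_diff[OF \<phi>L(2) zL] L0])
  also have "nrm L (%x. deriv (\<phi> n) x - dx L w x) = nrm L (%x. dx L w x - deriv (\<phi> n) x)"
   by (rule norm_L2_minus_commute)
  finally show ?thesis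
   using n0[of n] mult_left_mono[OF n1[of n] L0] by linarith
 qed
 have "(%n. norm_H L 1 (%x. w x - \<phi> n x) + L * norm_H L 1 (%x. w x - \<phi> n x)) ----> 0 + L * 0"
  by (intro tendsto_add tendsto_mult lim tendsto_const)
 hence "nrm L (%x. w x - ?p x) <= 0 + L * 0"
  by (rule LIMSEQ_le_const) (use b in blast)
 hence "nrm L (%x. w x - ?p x) = 0" using norm_L2_nonneg[of L "%x. w x - ?p x"] by linarith
 hence "AE x in leb L. w x - ?p x = 0"
  using norm_L2_eq_0_iff[OF L2_diff[OF wL pL]] by simp
 thus "AE x in leb L. w x = ?p x" by eventually_elim simp
 have "ip L (deriv (\<phi> n)) (%x. 1) = 0" for n
  using test_fun_has_wderiv(3)[OF \<phi> L0] by (simp add: prim_at_end)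
 hence "\<bar>ip L (dx L w) (%x. 1)\<bar> <= nrm L (%x. dx L w x - deriv (\<phi> n) x) * nrm L (%x. 1)" for n
  using inner_L2_Cauchy_Schwarz[OF L2_diff[OF zL \<phi>L(2)] L2_const, of n 1]
   inner_L2_diff_left[OF zL \<phi>L(2)[of n] L2_const[of 1 L]] by simp
 moreover have "(%n. nrm L (%x. dx L w x - deriv (\<phi> n) x) * nrm L (%x. 1)) ----> 0 * nrm L (%x. 1)"
  by (intro tendsto_mult l1 tendsto_const)
 ultimately have "\<bar>ip L (dx L w) (%x. 1)\<bar> <= 0 * nrm L (%x. 1)"
  using LIMSEQ_le_const by blast
 thus "ip L (dx L w) (%x. 1) = 0" by simp
qed

text \<open>To approximate a primitive by test functions it suffices to approximate its derivative,
  provided that the approximants have mean zero and hence test functions as antiderivatives.\<close>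

lemma H10_if_prim_limit:
 assumes L: "0 < L" and z: "z : L2 L" and w: "w : L2 L" "!!x. x : {0<..<L} ==> w x = prim L z x"
  and z0: "prim L z L = 0" and \<psi>: "!!n. test_fun 0 L (\<psi> n)" and lim: "(%n. nrm L (%x. z x - \<psi> n x)) ----> 0"
 shows "w : H10 L"
proof -
 have L0: "0 <= L" using L by simp
 have zi: "integrable (leb L) z" by (rule L2_integrable[OF z])
 have wz: "has_wderiv L 1 w z"
  by (rule has_wderiv_1_prim[where c = 0, OF z _ w(1)]) (use w(2) in \<open>auto intro!: AE_I2\<close>)
 have wH: "w : Hk L 1"
  unfolding Hk_iff
 proof (intro conjI allI impI w(1))
  fix k :: nat assume "k <= 1"
  then consider "k = 0" | "k = 1" by linarith
  thus "\<exists>z\<in>L2 L. has_wderiv L k w z"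
   using has_wderiv_0[of L w] wz w(1) z by cases auto
 qed
 obtain \<psi>0 where \<psi>0: "test_fun 0 L \<psi>0" "(LINT x|leb L. \<psi>0 x) > 0"
  using exists_test_fun_integral_pos[OF L] by blast
 define m where "m = ip L \<psi>0 (%x. 1)"
 have m: "m > 0" using \<psi>0(2) by (simp add: m_def inner_L2_def)
 define r where "r n = ip L (\<psi> n) (%x. 1) / m" for n
 have \<psi>L: "\<psi> n : L2 L" "\<psi>0 : L2 L" for n using L2_test_fun \<psi> \<psi>0(1) by blast+
 \<comment> \<open>A multiple of the fixed bump \<open>\<psi>0\<close> restores mean value zero. The
   multiples tend to 0 because the limit \<open>z\<close> has mean zero.\<close>
 define \<zeta> where "\<zeta> n x = 1 * \<psi> n x + (- r n) * \<psi>0 x" for n x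
 have \<zeta>: "test_fun 0 L (\<zeta> n)" for n unfolding \<zeta>_def by (rule test_fun_linear[OF \<psi> \<psi>0(1)])
 have \<zeta>L: "\<zeta> n : L2 L" for n by (rule L2_test_fun[OF \<zeta>])
 have "ip L (\<zeta> n) (%x. 1) = 0" for n
 proof -
  have "ip L (\<zeta> n) (%x. 1) = 1 * ip L (\<psi> n) (%x. 1) + (- r n) * m"
   unfolding \<zeta>_def m_def
   by (subst inner_L2_add_left) (intro L2_scale \<psi>L L2_const, intro L2_scale \<psi>L, rule L2_const, simp only: inner_L2_scale_left)
  thus ?thesis using m by (simp add: r_def)
 qed
 hence "(LINT x|leb L. \<zeta> n x) = 0" for n by (simp add: inner_L2_def)
 hence "\<exists>\<phi>. test_fun 0 L \<phi> \<and> deriv \<phi> = \<zeta> n" for n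
  using test_fun_antiderivative[OF \<zeta>] by metis
 then obtain \<phi> where \<phi>: "!!n. test_fun 0 L (\<phi> n)" "!!n. deriv (\<phi> n) = \<zeta> n" by metis
 have \<phi>L: "\<phi> n : L2 L" for n by (rule L2_test_fun[OF \<phi>(1)])
 have iz: "ip L z (%x. 1) = 0" using z0 by (simp add: prim_at_end)
 have rlim: "r ----> 0"
 proof -
  have "\<bar>ip L (\<psi> n) (%x. 1)\<bar> <= nrm L (%x. z x - \<psi> n x) * nrm L (%x. 1)" for n
   using inner_L2_Cauchy_Schwarz[OF L2_diff[OF z \<psi>L(1)] L2_const, of n 1]
    inner_L2_diff_left[OF z \<psi>L(1)[of n] L2_const[of 1 L]] iz by simp
  hence "norm (ip L (\<psi> n) (%x. 1)) <= nrm L (%x. z x - \<psi> n x) * nrm L (%x. 1)" for n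
   by simp
  hence "(%n. ip L (\<psi> n) (%x. 1)) ----> 0"
   by (intro Lim_null_comparison[OF _ tendsto_mult_left_zero[OF lim]] always_eventually allI)
  hence "(%n. ip L (\<psi> n) (%x. 1) / m) ----> 0 / m"
   by (rule tendsto_divide[OF _ tendsto_const]) (use m in simp)
  thus ?thesis by (simp add: r_def[abs_def])
 qed
 define e where "e n = nrm L (%x. z x - \<psi> n x) + \<bar>r n\<bar> * nrm L \<psi>0" for n
 have e: "nrm L (%x. z x - \<zeta> n x) <= e n" for n
 proof -
  have "nrm L (%x. z x - \<zeta> n x) = nrm L (%x. (z x - \<psi> n x) + r n * \<psi>0 x)"
   by (simp add: \<zeta>_def algebra_simps)
  also have "... <= nrm L (%x. z x - \<psi> n x) + nrm L (%x. r n * \<psi>0 x)"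
   by (intro norm_L2_triangle L2_diff L2_scale z \<psi>L)
  finally show ?thesis by (simp add: e_def norm_L2_scale)
 qed
 have elim: "e ----> 0"
 proof -
  have "e ----> 0 + \<bar>0\<bar> * nrm L \<psi>0"
   unfolding e_def by (intro tendsto_intros lim rlim)
  thus ?thesis by simp
 qed
 have nb: "norm_H L 1 (%x. w x - \<phi> n x) <= L * e n + e n" for n
 proof -
  have d: "has_wderiv L 1 (%x. 1 * w x + (-1) * \<phi> n x) (%x. 1 * z x + (-1) * \<zeta> n x)"
   using test_fun_has_wderiv(2)[OF \<phi>(1) L0, of n] \<phi>(2)[of n] by (intro has_wderiv_linear wz w(1) \<phi>L z \<zeta>L) simp
  have 1: "nrm L (dx L (%x. w x - \<phi> n x)) = nrm L (%x. z x - \<zeta> n x)"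
   using wderivI[OF _ d] z \<zeta>L[of n] by (intro norm_L2_cong_AE L2_measurable) (auto intro!: L2_diff)
  have 0: "nrm L (wderiv L 0 (%x. w x - \<phi> n x)) = nrm L (%x. w x - \<phi> n x)"
   by (rule wderiv_0(2)[OF L2_diff[OF w(1) \<phi>L]])
  have "nrm L (%x. w x - \<phi> n x) = nrm L (prim L (%x. z x - \<zeta> n x))"
  proof (rule norm_L2_cong_AE[OF L2_measurable[OF L2_diff[OF w(1) \<phi>L]]], rule AE_I2)
   fix x assume "x : space (leb L)"
   hence "x : {0<..<L}" "x : {0..L}" by auto
   thus "w x - \<phi> n x = prim L (%x. z x - \<zeta> n x) x"
    using w(2)[of x] test_fun_has_wderiv(1)[OF \<phi>(1) L0, of x n] \<phi>(2)[of n] prim_minus[OF zi L2_integrable[OF \<zeta>L[of n]], of x] by simp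
  qed
  also have "... <= L * nrm L (%x. z x - \<zeta> n x)"
   by (rule prim_norm_bound[OF L2_diff[OF z \<zeta>L] L0])
  also have "... <= L * e n" using e L0 by (rule mult_left_mono)
  finally have 2: "nrm L (%x. w x - \<phi> n x) <= L * e n" .
  have "norm_H L 1 (%x. w x - \<phi> n x) = sqrt ((nrm L (%x. w x - \<phi> n x))^2 + (nrm L (%x. z x - \<zeta> n x))^2)"
   by (simp add: norm_H_def 0 1[simplified])
  also have "... <= nrm L (%x. w x - \<phi> n x) + nrm L (%x. z x - \<zeta> n x)"
   by (rule sqrt_sum_squares_le_sum) simp_all
  finally show ?thesis using 2 e[of n] by linarith
 qed
 have "(%n. norm_H L 1 (%x. w x - \<phi> n x)) ----> 0"
 proof (rule Lim_null_comparison)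
  show "\<forall>\<^sub>F n in sequentially. norm (norm_H L 1 (%x. w x - \<phi> n x)) <= L * e n + e n"
   using nb norm_H_nonneg by simp
  have "(%n. L * e n + e n) ----> L * 0 + 0" by (intro tendsto_intros elim)
  thus "(%n. L * e n + e n) ----> 0" by simp
 qed
 with wH \<phi>(1) show ?thesis unfolding H10_def by blast
qed

lemma indicator_L2_test_approx:
 assumes "0 <= a" "a < b" "b <= L"
 shows "\<exists>\<psi>. (\<forall>n. test_fun 0 L (\<psi> n)) \<and> (%n. nrm L (%x. ind {a<..<b} x - \<psi> n x)) ----> 0"
proof -
 obtain \<psi> where \<psi>: "!!n. test_fun 0 L (\<psi> n)" "!!n x. 0 <= \<psi> n x \<and> \<psi> n x <= 1"
  "!!x. (%n. \<psi> n x) ----> ind {a<..<b} x"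
  using indicator_test_fun_approx[OF assms] by blast
 have "(%n. nrm L (%x. ind {a<..<b} x - \<psi> n x)) ----> 0"
 proof (rule norm_L2_tendsto_dominated)
  show "(%x. ind {a<..<b} x - \<psi> n x) : L2 L" for n
   by (intro L2_diff L2_indicator L2_test_fun[OF \<psi>(1)]) simp
  show "(%x. 1) : L2 L" by (rule L2_const)
  show "AE x in leb L. (%n. ind {a<..<b} x - \<psi> n x) ----> 0"
  proof (rule AE_I2)
   fix x show "(%n. ind {a<..<b} x - \<psi> n x) ----> 0"
    using tendsto_diff[OF tendsto_const[of "ind {a<..<b} x"] \<psi>(3)[of x]] by simp
  qed
  show "AE x in leb L. \<bar>ind {a<..<b} x - \<psi> n x\<bar> <= 1" for n
  proof (rule AE_I2)
   fix x show "\<bar>ind {a<..<b} x - \<psi> n x\<bar> <= 1"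
    using \<psi>(2)[of n x] by (auto simp: indicator_def abs_le_iff)
  qed
 qed
 with \<psi>(1) show ?thesis by blast
qed

section \<open>The mesh, ramps and step functions\<close>

locale fe =
 fixes L :: real and P :: nat and \<xi> :: "nat => real"
 assumes L0: "0 < L" and part: "is_partition L P \<xi>"
begin

definition elem :: "nat => real set" where "elem p = {\<xi> (p - 1)<..<\<xi> p}"

definition len :: "nat => real" where "len p = \<xi> p - \<xi> (p - 1)"

text \<open>The primitive of the indicator of element \<open>p\<close>: zero before the element,
  constant after it. In this basis the coordinates of a finite element function are its slopes, so
  differentiation becomes the passage from ramps to indicators.\<close>

definition ramp :: "nat => real => real" where
 "ramp p x = min (max (x - \<xi> (p - 1)) 0) (len p)"

definition slope :: "(real => real) => nat => real" where
 "slope v p = (v (\<xi> p) - v (\<xi> (p - 1))) / len p"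

lemma len_pos: "p : {1..P} ==> 0 < len p"
 using part by (auto simp: is_partition_def len_def)

lemma len_le_mesh: assumes "p : {1..P}" shows "len p <= mesh_size P \<xi>"
 unfolding mesh_size_def len_def by (rule Max_ge) (use assms in auto)

lemma mesh_pos: "0 < mesh_size P \<xi>"
 using len_pos[of 1] len_le_mesh[of 1] part by (auto simp: is_partition_def)

lemma xi_mono: "p <= q ==> q <= P ==> \<xi> p <= \<xi> q"
proof (induction q rule: dec_induct)
 case (step n)
 have "\<xi> n < \<xi> (Suc n)" using len_pos[of "Suc n"] step by (simp add: len_def)
 thus ?case using step by simp
qed simp

lemma xi_ends: "\<xi> 0 = 0" "\<xi> P = L"
 using part by (auto simp: is_partition_def)

lemma xi_bounds: "p <= P ==> 0 <= \<xi> p" "p <= P ==> \<xi> p <= L"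
 using xi_mono[of 0 p] xi_mono[of p P] xi_ends by auto

lemma elem_subset: assumes "p : {1..P}" shows "elem p \<subseteq> {0<..<L}"
proof -
 have "p - 1 <= P" "p <= P" using assms by auto
 thus ?thesis
  using xi_bounds(1)[of "p - 1"] xi_bounds(2)[of p] unfolding elem_def by fastforce
qed

lemma elem_disjoint:
 assumes "p : {1..P}" "q : {1..P}" "x : elem p" "x : elem q" shows "p = q"
proof (rule ccontr)
 assume "p \<noteq> q"
 then consider "p <= q - 1" | "q <= p - 1" using assms by fastforce
 thus False
 proof cases
  case 1
  moreover have "q - 1 <= P" using assms by auto
  ultimately show False using xi_mono[of p "q - 1"] assms(3,4) by (simp add: elem_def)
 next
  case 2
  moreover have "p - 1 <= P" using assms by auto
  ultimately show False using xi_mono[of q "p - 1"] assms(3,4) by (simp add: elem_def)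
 qed
qed

lemma exists_closed_elem:
 assumes "x : {0..L}" obtains p where "p : {1..P}" "\<xi> (p - 1) <= x" "x <= \<xi> p"
proof -
 have "\<exists>p\<in>{1..P}. \<xi> (p - 1) <= x \<and> x <= \<xi> p"
 proof -
  define p where "p = (LEAST p. 1 <= p \<and> x <= \<xi> p)"
  have ex: "1 <= P \<and> x <= \<xi> P" using assms part by (auto simp: is_partition_def)
  have p: "1 <= p \<and> x <= \<xi> p" unfolding p_def by (rule LeastI[of _ P]) (rule ex)
  have pP: "p <= P" unfolding p_def by (rule Least_le) (rule ex)
  have "\<xi> (p - 1) <= x"
  proof (cases "p = 1")
   case True thus ?thesis using assms xi_ends by simp
  next
   case False
   hence "1 <= p - 1" "p - 1 < p" using p by auto
   hence "\<not> (1 <= p - 1 \<and> x <= \<xi> (p - 1))"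
    using not_less_Least[of "p - 1" "%p. 1 <= p \<and> x <= \<xi> p"] unfolding p_def by blast
   thus ?thesis using \<open>1 <= p - 1\<close> by simp
  qed
  thus ?thesis using p pP by auto
 qed
 thus ?thesis using that by blast
qed

lemma AE_in_elem: "AE x in leb L. \<exists>p\<in>{1..P}. x : elem p"
proof -
 have "AE x in lborel. \<forall>p\<in>{..P}. x \<noteq> \<xi> p"
  using AE_lborel_singleton by (subst AE_ball_countable) auto
 thus ?thesis
  unfolding AE_Ioo_iff
 proof eventually_elim
  case (elim x)
  show ?case
  proof
   assume "x : {0<..<L}"
   then obtain p where "p : {1..P}" "\<xi> (p - 1) <= x" "x <= \<xi> p"
    using exists_closed_elem[of x] by auto
   moreover have "x \<noteq> \<xi> (p - 1)" "x \<noteq> \<xi> p" using elim calculation by auto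
   ultimately show "\<exists>p\<in>{1..P}. x : elem p" by (intro bexI[of _ p]) (auto simp: elem_def)
  qed
 qed
qed

lemma AE_sum_elem:
 fixes g :: "nat => real => real"
 shows "AE x in leb L. (\<Sum>p=1..P. ind (elem p) x * g p x) = g (THE p. p : {1..P} \<and> x : elem p) x"
 using AE_in_elem
proof eventually_elim
 case (elim x)
 then obtain p where p: "p : {1..P}" "x : elem p" by blast
 have the: "(THE p. p : {1..P} \<and> x : elem p) = p"
  using p elem_disjoint by (intro the_equality) blast+
 have "(\<Sum>q\<in>{1..P}. ind (elem q) x * g q x) = (\<Sum>q\<in>{1..P}. if q = p then g p x else 0)"
  using p elem_disjoint by (intro sum.cong) (auto simp: indicator_def)
 thus ?case using p the by simp
qed

lemma ind_elem_L2: "(ind (elem p) :: real => real) : L2 L"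
 by (rule L2_indicator) (simp add: elem_def)

lemma ind_elem_mult_L2: "f : L2 L ==> (%x. ind (elem p) x * f x) : L2 L"
 by (rule L2_bounded_mult[where B = 1]) (auto intro!: borel_measurable_Ioo simp: indicator_def elem_def)

lemma ind_elem_mult_integrable:
 assumes "integrable (leb L) f"
 shows "integrable (leb L) (%x. ind (elem p) x * f x :: real)"
 by (rule integrable_bounded_mult(2)[OF assms, where B = 1])
  (auto intro!: borel_measurable_Ioo simp: indicator_def elem_def)

lemma integral_split_elem:
 fixes f :: "real => real"
 assumes "integrable (leb L) f"
 shows "(LINT x|leb L. f x) = (\<Sum>p=1..P. \<integral>x. ind (elem p) x * f x \<partial>leb L)"
proof -
 have "(LINT x|leb L. f x) = (LINT x|leb L. (\<Sum>p=1..P. ind (elem p) x * f x))"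
 proof (rule integral_cong_AE)
  show "AE x in leb L. f x = (\<Sum>p=1..P. ind (elem p) x * f x)"
   using AE_sum_elem[of "%p. f"] by eventually_elim simp
  show "(%x. \<Sum>p=1..P. ind (elem p) x * f x) : bmf (leb L)"
   using ind_elem_mult_integrable[OF assms] by (intro borel_measurable_sum) auto
 qed (use assms in auto)
 also have "... = (\<Sum>p=1..P. \<integral>x. ind (elem p) x * f x \<partial>leb L)"
  using ind_elem_mult_integrable[OF assms] by (intro ints_B) auto
 finally show ?thesis .
qed

lemma ramp_prim: assumes "p : {1..P}" "x <= L" shows "prim L (ind (elem p)) x = ramp p x"
proof -
 have "prim L (ind (elem p)) x = (LBINT y. ind {..<x} y * ind (elem p) y)"
  using elem_subset[OF assms(1)] by (intro prim_borel_eq) (auto simp: elem_def indicator_def)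
 also have "... = (LBINT y. ind {\<xi> (p - 1)<..<min x (\<xi> p)} y)"
  by (intro intc_B) (auto simp: elem_def indicator_def)
 also have "... = measure lborel {\<xi> (p - 1)<..<min x (\<xi> p)}" by simp
 also have "... = ramp p x"
  using len_pos[OF assms(1)] by (auto simp: ramp_def len_def min_def max_def measure_lborel_Ioo)
 finally show ?thesis .
qed

lemma ramp_continuous: "continuous_on S (ramp p)"
 unfolding ramp_def[abs_def] by (intro continuous_intros)

lemma ramp_L2: "ramp p : L2 L"
 by (rule L2_continuous[OF ramp_continuous])

lemma ramp_before: "p : {1..P} ==> x <= \<xi> (p - 1) ==> ramp p x = 0"
 using len_pos[of p] by (simp add: ramp_def)

lemma ramp_after: "p : {1..P} ==> \<xi> p <= x ==> ramp p x = len p"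
 using len_pos[of p] by (auto simp: ramp_def len_def)

lemma ramp_inside: "\<xi> (p - 1) <= x ==> x <= \<xi> p ==> ramp p x = x - \<xi> (p - 1)"
 by (simp add: ramp_def len_def)

lemma inner_ind_elem:
 assumes "p : {1..P}" "q : {1..P}"
 shows "ip L (ind (elem p)) (ind (elem q)) = (if p = q then len p else 0)"
proof -
 have "ip L (ind (elem p)) (ind (elem q)) = (LBINT x. ind {0<..<L} x * (ind (elem p) x * ind (elem q) x))"
  unfolding inner_L2_def by (rule integral_Ioo_eq) (auto simp: elem_def)
 also have "(%x. ind {0<..<L} x * (ind (elem p) x * ind (elem q) x)) = (%x. if p = q then ind (elem p) x else 0 :: real)"
  using elem_subset[OF assms(1)] elem_disjoint[OF assms] by (auto simp: indicator_def fun_eq_iff)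
 also have "(LBINT x. (if p = q then ind (elem p) x else 0 :: real)) = (if p = q then len p else 0)"
  using len_pos[OF assms(1)] by (auto simp: elem_def len_def)
 finally show ?thesis .
qed

lemma inner_ind_elem_one:
 assumes "p : {1..P}" shows "ip L (ind (elem p)) (%x. 1) = len p"
proof -
 have "ip L (ind (elem p)) (%x. 1) = ip L (ind (elem p)) (ind (elem p))"
  unfolding inner_L2_def by (intro intc_B) (auto simp: indicator_def)
 thus ?thesis using inner_ind_elem[OF assms assms] by simp
qed

text \<open>The value 0 at the left end is built into the ramps; the value 0 at \<open>L\<close>
  becomes the linear constraint on the slopes. Elements to the left of \<open>x\<close> contribute
  their full increments, which telescope.\<close>

lemma fe_space_repr:
 assumes v: "v : fe_space L P \<xi>"
 shows "!!x. x : {0..L} ==> v x = (\<Sum>p=1..P. slope v p * ramp p x)"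
  "(\<Sum>p=1..P. slope v p * len p) = 0"
proof -
 have step: "slope v p * len p = v (\<xi> p) - v (\<xi> (p - 1))" if "p : {1..P}" for p
  using len_pos[OF that] by (simp add: slope_def)
 have tel: "(\<Sum>p\<in>{1..q}. slope v p * len p) = v (\<xi> q)" if "q <= P" for q
  using that
 proof (induction q)
  case 0 thus ?case using v xi_ends by (simp add: fe_space_def)
 next
  case (Suc q) thus ?case using step[of "Suc q"] by simp
 qed
 show "(\<Sum>p=1..P. slope v p * len p) = 0"
  using tel[of P] v xi_ends by (simp add: fe_space_def)
 fix x assume "x : {0..L}"
 then obtain q where q: "q : {1..P}" "\<xi> (q - 1) <= x" "x <= \<xi> q"
  by (rule exists_closed_elem)
 obtain a b where ab: "!!x. x : {\<xi> (q - 1)..\<xi> q} ==> v x = a + b * x"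
  using v q(1) unfolding fe_space_def by blast
 have lq: "0 < len q" by (rule len_pos[OF q(1)])
 have e: "v (\<xi> q) = a + b * \<xi> q" "v (\<xi> (q - 1)) = a + b * \<xi> (q - 1)" using ab lq by (auto simp: len_def)
 have "slope v q = b * len q / len q" unfolding slope_def e by (simp add: len_def algebra_simps)
 hence sl: "slope v q = b" using lq by simp
 have "(\<Sum>p=1..P. slope v p * ramp p x) = (\<Sum>p\<in>{1..q - 1}. slope v p * ramp p x) + (\<Sum>p\<in>{q..P}. slope v p * ramp p x)"
 proof -
  have "{1..P} = {1..q - 1} \<union> {q..P}" "{1..q - 1} \<inter> {q..P} = {}" using q(1) by auto
  thus ?thesis by (simp add: sum.union_disjoint)
 qed
 also have "(\<Sum>p\<in>{1..q - 1}. slope v p * ramp p x) = (\<Sum>p\<in>{1..q - 1}. slope v p * len p)"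
 proof (intro sum.cong refl)
  fix p assume p: "p : {1..q - 1}"
  hence "\<xi> p <= \<xi> (q - 1)" using q(1) by (intro xi_mono) auto
  moreover have "p : {1..P}" using p q(1) by auto
  ultimately show "slope v p * ramp p x = slope v p * len p" using ramp_after[of p x] q by simp
 qed
 also have "... = v (\<xi> (q - 1))" using q(1) by (intro tel) auto
 also have "(\<Sum>p\<in>{q..P}. slope v p * ramp p x) = (\<Sum>p\<in>{q..P}. if p = q then b * (x - \<xi> (q - 1)) else 0)"
 proof (intro sum.cong refl)
  fix p assume p: "p : {q..P}"
  show "slope v p * ramp p x = (if p = q then b * (x - \<xi> (q - 1)) else 0)"
  proof (cases "p = q")
   case True thus ?thesis using ramp_inside[OF q(2,3)] sl by simp
  next
   case False
   hence "\<xi> q <= \<xi> (p - 1)" using p by (intro xi_mono) auto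
   thus ?thesis using ramp_before[of p x] p q False by simp
  qed
 qed
 also have "... = b * (x - \<xi> (q - 1))" using q(1) by simp
 finally show "v x = (\<Sum>p=1..P. slope v p * ramp p x)"
  using ab[of x] q e(2) by (simp add: algebra_simps)
qed

lemma ramp_sum_fe_space:
 assumes "(\<Sum>p=1..P. c p * len p) = 0"
 shows "(%x. \<Sum>p=1..P. c p * ramp p x) : fe_space L P \<xi>"
 unfolding fe_space_def
proof (intro CollectI conjI ballI)
 show "continuous_on {0..L} (%x. \<Sum>p=1..P. c p * ramp p x)"
  by (intro continuous_intros ramp_continuous)
 have "ramp p 0 = 0" if "p : {1..P}" for p
  using ramp_before[OF that, of 0] xi_bounds(1)[of "p - 1"] that by auto
 thus "(\<Sum>p=1..P. c p * ramp p 0) = 0" by simp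
 have "ramp p L = len p" if "p : {1..P}" for p
  using ramp_after[OF that, of L] xi_bounds(2)[of p] that by auto
 thus "(\<Sum>p=1..P. c p * ramp p L) = 0" using assms by simp
 fix q assume q: "q : {1..P}"
 have "\<exists>a b. \<forall>x\<in>{\<xi> (q - 1)..\<xi> q}. ramp p x = a + b * x" if p: "p : {1..P}" for p
 proof -
  consider "p < q" | "p = q" | "q < p" by linarith
  thus ?thesis
  proof cases
   case 1
   hence "\<xi> p <= \<xi> (q - 1)" using q by (intro xi_mono) auto
   thus ?thesis using ramp_after[OF p] by (intro exI[of _ "len p"] exI[of _ 0]) auto
  next
   case 2
   thus ?thesis using ramp_inside[of q] by (intro exI[of _ "- \<xi> (q - 1)"] exI[of _ 1]) auto
  next
   case 3
   hence "\<xi> q <= \<xi> (p - 1)" using p by (intro xi_mono) auto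
   thus ?thesis using ramp_before[OF p] by (intro exI[of _ 0]) auto
  qed
 qed
 then obtain a b where ab: "!!p x. p : {1..P} ==> x : {\<xi> (q - 1)..\<xi> q} ==> ramp p x = a p + b p * x"
  by metis
 show "\<exists>a b. \<forall>x\<in>{\<xi> (q - 1)..\<xi> q}. (\<Sum>p=1..P. c p * ramp p x) = a + b * x"
  by (rule exI[of _ "\<Sum>p=1..P. c p * a p"], rule exI[of _ "\<Sum>p=1..P. c p * b p"])
   (simp add: ab algebra_simps sum.distrib sum_distrib_left)
qed

lemma fe_space_diff:
 assumes "v : fe_space L P \<xi>" "w : fe_space L P \<xi>" shows "(%x. v x - w x) : fe_space L P \<xi>"
 unfolding fe_space_def
proof (intro CollectI conjI ballI)
 show "continuous_on {0..L} (%x. v x - w x)"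
  using assms by (intro continuous_intros) (auto simp: fe_space_def)
 fix q assume q: "q : {1..P}"
 obtain a b where 1: "\<forall>x\<in>{\<xi> (q - 1)..\<xi> q}. v x = a + b * x" using assms(1) q unfolding fe_space_def by blast
 obtain c d where 2: "\<forall>x\<in>{\<xi> (q - 1)..\<xi> q}. w x = c + d * x" using assms(2) q unfolding fe_space_def by blast
 show "\<exists>a b. \<forall>x\<in>{\<xi> (q - 1)..\<xi> q}. v x - w x = a + b * x"
  using 1 2 by (intro exI[of _ "a - c"] exI[of _ "b - d"]) (auto simp: algebra_simps)
qed (use assms in \<open>auto simp: fe_space_def\<close>)

lemma fe_space_L2: "v : fe_space L P \<xi> ==> v : L2 L"
 by (rule L2_continuous) (simp add: fe_space_def)

definition step_fun :: "(nat => real) => real => real" where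
 "step_fun c x = (\<Sum>p=1..P. c p * ind (elem p) x)"

lemma step_fun_L2: "step_fun c : L2 L"
 unfolding step_fun_def[abs_def] by (intro L2_sum L2_scale ind_elem_L2)

lemma step_fun_prim: "x <= L ==> prim L (step_fun c) x = (\<Sum>p=1..P. c p * ramp p x)"
 unfolding step_fun_def[abs_def]
 using prim_sum[of "{1..P}" L "%p. ind (elem p)" c x] L2_integrable[OF ind_elem_L2]
 by (simp add: ramp_prim)

lemma fe_space_wderiv:
 assumes v: "v : fe_space L P \<xi>"
 shows "has_wderiv L 1 v (step_fun (slope v))" "dx L v : L2 L"
  "AE x in leb L. dx L v x = step_fun (slope v) x"
proof -
 show *: "has_wderiv L 1 v (step_fun (slope v))"
  by (rule has_wderiv_1_prim[where c = 0, OF step_fun_L2 _ fe_space_L2[OF v]], rule AE_I2)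
   (simp add: step_fun_prim fe_space_repr(1)[OF v])
 show "dx L v : L2 L" "AE x in leb L. dx L v x = step_fun (slope v) x"
  by (rule wderivI[OF step_fun_L2 *])+
qed

lemma inner_ramp_end: "p : {1..P} ==> ramp p L = len p"
 using ramp_after[of p L] xi_bounds(2)[of p] by auto

text \<open>The method is conforming: finite element functions may be inserted into the equation of
  the exact solution. Their derivatives are step functions, which test functions approximate
  indicator by indicator.\<close>

lemma fe_space_H10: assumes v: "v : fe_space L P \<xi>" shows "v : H10 L"
proof -
 have "\<exists>\<psi>. (\<forall>n. test_fun 0 L (\<psi> n)) \<and> (%n. nrm L (%x. ind (elem p) x - \<psi> n x)) ----> 0" if "p : {1..P}" for p
  unfolding elem_def using xi_bounds(1)[of "p - 1"] xi_bounds(2)[of p] len_pos[OF that] that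
  by (intro indicator_L2_test_approx) (auto simp: len_def)
 hence "\<forall>p. \<exists>\<psi>. p : {1..P} \<longrightarrow> (\<forall>n. test_fun 0 L (\<psi> n)) \<and> (%n. nrm L (%x. ind (elem p) x - \<psi> n x)) ----> 0"
  by blast
 then obtain \<psi> where \<psi>: "!!p n. p : {1..P} ==> test_fun 0 L (\<psi> p n)"
  "!!p. p : {1..P} ==> (%n. nrm L (%x. ind (elem p) x - \<psi> p n x)) ----> 0"
  by metis
 have t0: "test_fun 0 L (%x. 0)"
  using test_fun_linear[OF \<psi>(1) \<psi>(1), of 1 1 0 0 0] part by (auto simp: is_partition_def)
 define \<Psi> where "\<Psi> n x = (\<Sum>p=1..P. slope v p * \<psi> p n x)" for n x
 have \<Psi>: "test_fun 0 L (\<Psi> n)" for n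
 proof -
  have "test_fun 0 L (%x. \<Sum>p\<in>A. slope v p * \<psi> p n x)" if "finite A" "A \<subseteq> {1..P}" for A
   using that
  proof (induction A)
   case (insert p A)
   hence "test_fun 0 L (%x. slope v p * \<psi> p n x + 1 * (\<Sum>p\<in>A. slope v p * \<psi> p n x))"
    by (intro test_fun_linear \<psi>) auto
   thus ?case using insert by simp
  qed (simp add: t0)
  thus ?thesis unfolding \<Psi>_def[abs_def] by simp
 qed
 have lim: "(%n. nrm L (%x. step_fun (slope v) x - \<Psi> n x)) ----> 0"
 proof (rule Lim_null_comparison)
  have "(%n. \<Sum>p=1..P. \<bar>slope v p\<bar> * nrm L (%x. ind (elem p) x - \<psi> p n x)) ----> (\<Sum>p=1..P. \<bar>slope v p\<bar> * 0)"
   by (intro tendsto_sum tendsto_mult tendsto_const \<psi>)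
  thus "(%n. \<Sum>p=1..P. \<bar>slope v p\<bar> * nrm L (%x. ind (elem p) x - \<psi> p n x)) ----> 0" by simp
  have "nrm L (%x. step_fun (slope v) x - \<Psi> n x) <= (\<Sum>p=1..P. \<bar>slope v p\<bar> * nrm L (%x. ind (elem p) x - \<psi> p n x))" for n
  proof -
   have "(%x. step_fun (slope v) x - \<Psi> n x) = (%x. \<Sum>p=1..P. slope v p * (ind (elem p) x - \<psi> p n x))"
    by (simp add: step_fun_def \<Psi>_def sum_subtractf right_diff_distrib)
   thus ?thesis
    using norm_L2_sum_le[of "{1..P}" "%p x. slope v p * (ind (elem p) x - \<psi> p n x)" L] L2_test_fun[OF \<psi>(1)] ind_elem_L2
    by (simp add: norm_L2_scale L2_scale L2_diff)
  qed
  thus "\<forall>\<^sub>F n in sequentially. norm (nrm L (%x. step_fun (slope v) x - \<Psi> n x)) <= (\<Sum>p=1..P. \<bar>slope v p\<bar> * nrm L (%x. ind (elem p) x - \<psi> p n x))"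
   by simp
 qed
 show ?thesis
 proof (rule H10_if_prim_limit[OF L0 step_fun_L2 fe_space_L2[OF v] _ _ \<Psi> lim])
  show "v x = prim L (step_fun (slope v)) x" if "x : {0<..<L}" for x
   using that fe_space_repr(1)[OF v, of x] by (simp add: step_fun_prim)
  show "prim L (step_fun (slope v)) L = 0"
   using fe_space_repr(2)[OF v] by (simp add: step_fun_prim inner_ramp_end)
 qed
qed

section \<open>Element averages, interpolation error and the Ritz projection\<close>

definition avg :: "(real => real) => nat => real" where
 "avg z p = ip L z (ind (elem p)) / len p"

text \<open>The primitive of the elementwise averages of \<open>z\<close>. When \<open>z\<close> is
  the derivative of a function with zero boundary values, this is its nodal interpolant, which in
  one dimension coincides with the Ritz projection.\<close>

definition interp :: "(real => real) => real => real" where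
 "interp z x = (\<Sum>p=1..P. avg z p * ramp p x)"

definition elem_norm :: "(real => real) => nat => real" where
 "elem_norm f p = nrm L (%x. ind (elem p) x * f x)"

lemma norm_split_elem:
 assumes "f : L2 L" shows "(nrm L f)^2 = (\<Sum>p=1..P. (elem_norm f p)^2)"
proof -
 have "(elem_norm f p)^2 = (LINT x|leb L. ind (elem p) x * (f x * f x))" for p
  unfolding elem_norm_def norm_L2_square inner_L2_def
  by (intro intc_B) (auto simp: indicator_def)
 thus ?thesis
  unfolding norm_L2_square inner_L2_def using integral_split_elem[OF L2_mult_integrable[OF assms assms]] by simp
qed

lemma norm_le_if_elem_norm_le:
 assumes "f : L2 L" "g : L2 L" "0 <= c" "!!p. p : {1..P} ==> elem_norm f p <= c * elem_norm g p"
 shows "nrm L f <= c * nrm L g"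
proof (rule power2_le_imp_le)
 have "(nrm L f)^2 <= (\<Sum>p=1..P. (c * elem_norm g p)^2)"
  unfolding norm_split_elem[OF assms(1)] using assms(4)
  by (intro sum_mono power_mono) (auto simp: elem_norm_def)
 also have "... = (c * nrm L g)^2"
  by (simp add: power_mult_distrib norm_split_elem[OF assms(2)] sum_distrib_left)
 finally show "(nrm L f)^2 <= (c * nrm L g)^2" .
qed (use assms in simp)

lemma elem_integral_abs_le:
 assumes "f : L2 L" "p : {1..P}"
 shows "(LINT x|leb L. ind (elem p) x * \<bar>f x\<bar>) <= sqrt (len p) * elem_norm f p"
proof -
 have a: "(%x. \<bar>f x\<bar>) : L2 L" using assms(1) by (auto simp: L2_iff)
 have "(LINT x|leb L. ind (elem p) x * \<bar>f x\<bar>) = ip L (ind (elem p)) (%x. ind (elem p) x * \<bar>f x\<bar>)"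
  unfolding inner_L2_def by (intro intc_B) (auto simp: indicator_def)
 also have "... <= nrm L (ind (elem p)) * nrm L (%x. ind (elem p) x * \<bar>f x\<bar>)"
  using inner_L2_Cauchy_Schwarz[OF ind_elem_L2 ind_elem_mult_L2[OF a]] by (rule abs_le_D1)
 also have "nrm L (ind (elem p)) = sqrt (len p)"
  unfolding norm_L2_def using inner_ind_elem[OF assms(2,2)] by simp
 also have "nrm L (%x. ind (elem p) x * \<bar>f x\<bar>) = elem_norm f p"
  unfolding elem_norm_def norm_L2_def inner_L2_def
  by (intro arg_cong[where f = sqrt] intc_B) (auto simp: indicator_def)
 finally show ?thesis .
qed

lemma elem_norm_le:
 assumes "f : L2 L" "p : {1..P}" "!!x. x : elem p ==> \<bar>f x\<bar> <= G" "0 <= G"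
 shows "elem_norm f p <= sqrt (len p) * G"
proof -
 have "elem_norm f p <= nrm L (%x. G * ind (elem p) x)"
  unfolding elem_norm_def
 proof (rule norm_L2_mono[OF ind_elem_mult_L2[OF assms(1)] L2_scale[OF ind_elem_L2]], rule AE_I2)
  fix x show "\<bar>ind (elem p) x * f x\<bar> <= \<bar>G * ind (elem p) x\<bar>"
   using assms(3)[of x] assms(4) by (auto simp: indicator_def)
 qed
 also have "... = sqrt (len p) * G"
  unfolding norm_L2_scale using assms(4) inner_ind_elem[OF assms(2,2)] by (simp add: norm_L2_def mult.commute)
 finally show ?thesis .
qed

lemma prim_elem_diff_le:
 assumes g: "g : L2 L" and p: "p : {1..P}" and a: "a : {\<xi> (p - 1)..\<xi> p}" and b: "b : {\<xi> (p - 1)..\<xi> p}"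
 shows "\<bar>prim L g b - prim L g a\<bar> <= sqrt (len p) * elem_norm g p"
proof -
 have gi: "integrable (leb L) g" by (rule L2_integrable[OF g])
 have "p - 1 <= P" using p by auto
 hence x0: "0 <= \<xi> (p - 1)" by (rule xi_bounds)
 have *: "\<bar>prim L g d - prim L g c\<bar> <= sqrt (len p) * elem_norm g p" if "c <= d" "\<xi> (p - 1) <= c" "d <= \<xi> p" for c d
 proof -
  have "prim L g d - prim L g c = (LINT y|leb L. ind {c<..<d} y * g y)"
   by (rule prim_diff[OF gi]) (use that x0 in auto)
  hence "\<bar>prim L g d - prim L g c\<bar> <= (LINT y|leb L. \<bar>ind {c<..<d} y * g y\<bar>)"
   using integral_abs_bound by metis
  also have "... <= (LINT y|leb L. ind (elem p) y * \<bar>g y\<bar>)"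
  proof (rule integral_mono')
   show "integrable (leb L) (%y. ind (elem p) y * \<bar>g y\<bar>)"
    using gi by (intro ind_elem_mult_integrable) simp
   show "\<bar>ind {c<..<d} y * g y\<bar> <= ind (elem p) y * \<bar>g y\<bar>" for y
    using that by (auto simp: indicator_def elem_def)
  qed simp
  also have "... <= sqrt (len p) * elem_norm g p" by (rule elem_integral_abs_le[OF g p])
  finally show ?thesis .
 qed
 show ?thesis
 proof (cases "a <= b")
  case True thus ?thesis using *[of a b] a b by simp
 next
  case False thus ?thesis using *[of b a] a b by (simp add: abs_minus_commute)
 qed
qed

lemma avg_sum: assumes "z : L2 L" shows "(\<Sum>p=1..P. avg z p * len p) = ip L z (%x. 1)"
proof -
 have "(\<Sum>p=1..P. avg z p * len p) = (\<Sum>p=1..P. \<integral>x. ind (elem p) x * z x \<partial>leb L)"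
 proof (intro sum.cong refl)
  fix p assume "p : {1..P}"
  thus "avg z p * len p = (LINT x|leb L. ind (elem p) x * z x)"
   using len_pos[of p] by (simp add: avg_def inner_L2_def mult.commute)
 qed
 also have "... = (LINT x|leb L. z x)"
  using integral_split_elem[OF L2_integrable[OF assms]] by simp
 finally show ?thesis by (simp add: inner_L2_def)
qed

lemma inner_step_left: assumes "f : L2 L" shows "ip L f (step_fun c) = (\<Sum>p=1..P. c p * ip L f (ind (elem p)))"
 unfolding step_fun_def[abs_def]
 using inner_L2_sum_right[of "{1..P}" "%p x. c p * ind (elem p) x" L f] ind_elem_L2 assms
 by (simp add: L2_scale inner_L2_scale_right)

lemma inner_step_avg: assumes "f : L2 L" shows "ip L f (step_fun c) = (\<Sum>p=1..P. c p * (avg f p * len p))"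
 unfolding inner_step_left[OF assms]
proof (intro sum.cong refl)
 fix p assume "p : {1..P}"
 thus "c p * ip L f (ind (elem p)) = c p * (avg f p * len p)"
  using len_pos[of p] by (simp add: avg_def)
qed

lemma avg_step: assumes "p : {1..P}" shows "avg (step_fun c) p = c p"
proof -
 have "ip L (ind (elem p)) (step_fun c) = (\<Sum>q\<in>{1..P}. if q = p then c p * len p else 0)"
  unfolding inner_step_left[OF ind_elem_L2] using inner_ind_elem[OF assms] by (intro sum.cong) auto
 thus ?thesis
  using assms len_pos[OF assms] by (simp add: avg_def inner_L2_commute[of L "step_fun c"])
qed

text \<open>The error is the primitive of \<open>\<zeta>\<close>, the difference between
  \<open>z\<close> and its averages, and vanishes at all nodes; Poincare's inequality on each
  element gives one power of the mesh size. A second power is gained if \<open>z\<close> has a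
  derivative, since then \<open>\<zeta>\<close> itself is small.\<close>

lemma interp_error:
 assumes z: "z : L2 L" and y: "y : L2 L" "AE x in leb L. y x = prim L z x"
 shows "nrm L (%x. y x - interp z x) <= mesh_size P \<xi> * nrm L z"
  "z' : L2 L ==> has_wderiv L 1 z z' ==>
   nrm L (%x. y x - interp z x) <= (mesh_size P \<xi>)^2 * nrm L z'"
proof -
 let ?h = "mesh_size P \<xi>"
 define \<zeta> where "\<zeta> x = z x - step_fun (avg z) x" for x
 have \<zeta>: "\<zeta> : L2 L" unfolding \<zeta>_def[abs_def] by (intro L2_diff z step_fun_L2)
 have \<zeta>i: "integrable (leb L) \<zeta>" by (rule L2_integrable[OF \<zeta>])
 have \<zeta>p: "ip L \<zeta> (ind (elem p)) = 0" if "p : {1..P}" for p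
  unfolding \<zeta>_def[abs_def] inner_L2_diff_left[OF z step_fun_L2 ind_elem_L2]
  using avg_step[OF that, of "avg z"] len_pos[OF that] by (simp add: avg_def)
 \<comment> \<open>Between consecutive nodes the primitive changes by the integral of
   \<open>\<zeta>\<close> over the element, which is 0 by the choice of the averages.\<close>
 have pz: "prim L \<zeta> (\<xi> p) = 0" if "p <= P" for p
  using that
 proof (induction p)
  case 0 thus ?case using xi_ends by simp
 next
  case (Suc p)
  have "prim L \<zeta> (\<xi> (Suc p)) - prim L \<zeta> (\<xi> p) = (LINT y|leb L. ind {\<xi> p<..<\<xi> (Suc p)} y * \<zeta> y)"
   using Suc.prems by (intro prim_diff[OF \<zeta>i] xi_bounds xi_mono) auto
  also have "... = ip L \<zeta> (ind (elem (Suc p)))"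
   by (simp add: elem_def inner_L2_def mult.commute)
  also have "... = 0" using Suc.prems by (intro \<zeta>p) auto
  finally show ?case using Suc by simp
 qed
 have eq: "AE x in leb L. y x - interp z x = prim L \<zeta> x"
 proof -
  have "AE x in leb L. x : {0<..<L}" by (rule AE_I2) simp
  with y(2) show ?thesis
  proof eventually_elim
   case (elim x)
   thus ?case
    unfolding \<zeta>_def[abs_def] prim_minus[OF L2_integrable[OF z] L2_integrable[OF step_fun_L2]]
    by (simp add: step_fun_prim interp_def)
  qed
 qed
 have pL: "prim L \<zeta> : L2 L" by (rule prim_L2[OF \<zeta>i])
 have AE': "AE x in leb L. prim L \<zeta> x = y x - interp z x"
  using eq by eventually_elim simp
 have n0: "nrm L (%x. y x - interp z x) = nrm L (prim L \<zeta>)"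
  using norm_L2_cong_AE[OF L2_measurable[OF pL] AE'] by simp
 have n1: "nrm L (prim L \<zeta>) <= ?h * nrm L \<zeta>"
 proof (rule norm_le_if_elem_norm_le[OF pL \<zeta>])
  show "0 <= ?h" using mesh_pos by simp
  fix p assume p: "p : {1..P}"
  have e0: "0 <= elem_norm \<zeta> p" by (simp add: elem_norm_def)
  have "elem_norm (prim L \<zeta>) p <= sqrt (len p) * (sqrt (len p) * elem_norm \<zeta> p)"
  proof (rule elem_norm_le[OF pL p])
   fix x assume "x : elem p"
   hence x: "x : {\<xi> (p - 1)..\<xi> p}" "\<xi> (p - 1) : {\<xi> (p - 1)..\<xi> p}" by (auto simp: elem_def)
   have "prim L \<zeta> (\<xi> (p - 1)) = 0" using p by (intro pz) auto
   thus "\<bar>prim L \<zeta> x\<bar> <= sqrt (len p) * elem_norm \<zeta> p"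
    using prim_elem_diff_le[OF \<zeta> p x(2,1)] by simp
  qed (use e0 len_pos[OF p] in simp)
  also have "... = len p * elem_norm \<zeta> p" using len_pos[OF p] by (simp flip: mult.assoc)
  also have "... <= ?h * elem_norm \<zeta> p" using len_le_mesh[OF p] e0 by (rule mult_right_mono)
  finally show "elem_norm (prim L \<zeta>) p <= ?h * elem_norm \<zeta> p" .
 qed
 \<comment> \<open>Averaging is the orthogonal projection onto step functions, so this is
   Pythagoras.\<close>
 have n2: "nrm L \<zeta> <= nrm L z"
 proof (rule power2_le_imp_le)
  have "ip L \<zeta> (step_fun (avg z)) = 0"
   unfolding inner_step_left[OF \<zeta>] using \<zeta>p by simp
  hence "(nrm L (%x. \<zeta> x + step_fun (avg z) x))^2 = (nrm L \<zeta>)^2 + (nrm L (step_fun (avg z)))^2"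
   by (simp add: norm_L2_add_square[OF \<zeta> step_fun_L2])
  moreover have "(%x. \<zeta> x + step_fun (avg z) x) = z" by (simp add: \<zeta>_def)
  ultimately show "(nrm L \<zeta>)^2 <= (nrm L z)^2" by simp
 qed simp
 show "nrm L (%x. y x - interp z x) <= ?h * nrm L z"
  using n0 n1 order_trans[OF n1 mult_left_mono[OF n2]] mesh_pos by simp
 assume z': "z' : L2 L" "has_wderiv L 1 z z'"
 obtain c where c: "AE x in leb L. z x = c + prim L z' x"
  using has_wderiv_1_imp_prim[OF L0 z z'] by blast
 have pL': "prim L z' : L2 L" by (rule prim_L2[OF L2_integrable[OF z'(1)]])
 \<comment> \<open>\<open>\<zeta>\<close> with \<open>z\<close> replaced by its continuous
   representative, so that single points of an element can be compared with the average.\<close>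
 define \<eta> where "\<eta> x = c + prim L z' x - step_fun (avg z) x" for x
 have \<eta>: "\<eta> : L2 L" unfolding \<eta>_def[abs_def] by (intro L2_diff L2_add L2_const pL' step_fun_L2)
 have ae: "AE x in leb L. \<eta> x = \<zeta> x"
  using c by eventually_elim (simp add: \<eta>_def \<zeta>_def)
 have "nrm L \<zeta> = nrm L \<eta>"
  using norm_L2_cong_AE[OF L2_measurable[OF \<eta>] ae] by simp
 also have "... <= ?h * nrm L z'"
 proof (rule norm_le_if_elem_norm_le[OF \<eta> z'(1)])
  show "0 <= ?h" using mesh_pos by simp
  fix p assume p: "p : {1..P}"
  define G where "G = sqrt (len p) * elem_norm z' p"
  have e0: "0 <= elem_norm z' p" by (simp add: elem_norm_def)
  have G0: "0 <= G" using e0 len_pos[OF p] by (simp add: G_def)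
  have "elem_norm \<eta> p <= sqrt (len p) * G"
  proof (rule elem_norm_le[OF \<eta> p _ G0])
   fix x assume x: "x : elem p"
   have "step_fun (avg z) x = (\<Sum>q\<in>{1..P}. if q = p then avg z p else 0)"
    unfolding step_fun_def
   proof (rule sum.cong[OF refl])
    fix q assume q: "q : {1..P}"
    show "avg z q * ind (elem q) x = (if q = p then avg z p else 0)"
     using x elem_disjoint[OF p q x] by (cases "x : elem q") auto
   qed
   hence st: "step_fun (avg z) x = avg z p" using p by simp
   have i1: "ip L z (ind (elem p)) = ip L (%x. c + prim L z' x) (ind (elem p))"
    by (rule inner_L2_cong_AE[OF L2_measurable[OF z] L2_measurable[OF ind_elem_L2] c]) simp
   have "\<bar>len p * \<eta> x\<bar> <= len p * G"
   proof -
    \<comment> \<open>A value minus the average is the average of the differences of values, and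
      each difference is bounded by the integral of \<open>z'\<close> over the element.\<close>
    have "len p * \<eta> x = len p * (c + prim L z' x) - ip L z (ind (elem p))"
     using len_pos[OF p] by (simp add: \<eta>_def st avg_def algebra_simps)
    also have "... = ip L (%y. c + prim L z' x) (ind (elem p)) - ip L (%x. c + prim L z' x) (ind (elem p))"
    proof -
     have "ip L (%y. (c + prim L z' x) * 1) (ind (elem p)) = (c + prim L z' x) * len p"
      unfolding inner_L2_scale_left inner_L2_commute[of L "%x. 1"] inner_ind_elem_one[OF p] ..
     thus ?thesis by (simp add: i1 mult.commute)
    qed
    also have "... = ip L (%y. (c + prim L z' x) - (c + prim L z' y)) (ind (elem p))"
     by (rule inner_L2_diff_left[symmetric]) (intro L2_const L2_add pL' ind_elem_L2)+
    also have "... = (LINT y|leb L. ind (elem p) y * (prim L z' x - prim L z' y))"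
     by (simp add: inner_L2_def mult.commute)
    finally have "\<bar>len p * \<eta> x\<bar> <= (LINT y|leb L. \<bar>ind (elem p) y * (prim L z' x - prim L z' y)\<bar>)"
     using integral_abs_bound by metis
    also have "... <= (LINT y|leb L. ind (elem p) y * G)"
    proof (rule integral_mono')
     show "integrable (leb L) (%y. ind (elem p) y * G)"
      by (intro ind_elem_mult_integrable integrable_const_Ioo)
     show "\<bar>ind (elem p) y * (prim L z' x - prim L z' y)\<bar> <= ind (elem p) y * G" for y
      using prim_elem_diff_le[OF z'(1) p, of y x] x unfolding G_def by (auto simp: indicator_def elem_def)
     show "0 <= ind (elem p) y * G" for y using G0 by simp
    qed
    also have "... = ip L (ind (elem p)) (%y. 1) * G" by (simp add: inner_L2_def)
    finally show ?thesis using inner_ind_elem_one[OF p] by simp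
   qed
   thus "\<bar>\<eta> x\<bar> <= G" using len_pos[OF p] by (simp add: abs_mult)
  qed
  also have "... = len p * elem_norm z' p" using len_pos[OF p] by (simp add: G_def flip: mult.assoc)
  also have "... <= ?h * elem_norm z' p" using len_le_mesh[OF p] e0 by (rule mult_right_mono)
  finally show "elem_norm \<eta> p <= ?h * elem_norm z' p" .
 qed
 finally have "?h * nrm L \<zeta> <= ?h * (?h * nrm L z')"
  using mesh_pos by (intro mult_left_mono) auto
 thus "nrm L (%x. y x - interp z x) <= ?h^2 * nrm L z'"
  using n0 n1 by (simp add: power2_eq_square mult.assoc)
qed

lemma interp_error_H:
 assumes r: "r : {1, 2}" and y: "y : Hk L r" "AE x in leb L. y x = prim L (dx L y) x"
 shows "nrm L (%x. y x - interp (dx L y) x) <= mesh_size P \<xi> ^ r * norm_H L r y"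
proof -
 have yL: "y : L2 L" by (rule Hk_L2[OF y(1)])
 have 1: "1 <= r" using r by auto
 have z: "dx L y : L2 L" by (rule Hk_wderiv(1)[OF y(1) 1])
 consider "r = 1" | "r = 2" using r by auto
 thus ?thesis
 proof cases
  case 1
  have "mesh_size P \<xi> * nrm L (dx L y) <= mesh_size P \<xi> * norm_H L r y"
   using mesh_pos 1 by (intro mult_left_mono norm_wderiv_le_norm_H) auto
  thus ?thesis using interp_error(1)[OF z yL y(2)] 1 by simp
 next
  case 2
  have y2: "y : Hk L 2" using y 2 by simp
  have "(mesh_size P \<xi>)^2 * nrm L (wderiv L 2 y) <= (mesh_size P \<xi>)^2 * norm_H L r y"
   using 2 by (intro mult_left_mono norm_wderiv_le_norm_H) auto
  thus ?thesis
   using interp_error(2)[OF z yL y(2) Hk_wderiv(1)[OF y2 le_refl] Hk_2_wderiv[OF y2]] 2 by simp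
 qed
qed

lemma slope_ramp_sum: assumes p: "p : {1..P}" shows "slope (%x. \<Sum>q\<in>{1..P}. c q * ramp q x) p = c p"
proof -
 have d: "ramp q (\<xi> p) - ramp q (\<xi> (p - 1)) = (if q = p then len p else 0)" if q: "q : {1..P}" for q
 proof -
  consider "q < p" | "q = p" | "p < q" by linarith
  thus ?thesis
  proof cases
   case 1
   hence "\<xi> q <= \<xi> (p - 1)" "\<xi> q <= \<xi> p" using p by (auto intro!: xi_mono)
   thus ?thesis using ramp_after[OF q] 1 by simp
  next
   case 2
   have "\<xi> (p - 1) <= \<xi> p" using len_pos[OF p] by (simp add: len_def)
   thus ?thesis using ramp_inside[of p "\<xi> p"] ramp_inside[of p "\<xi> (p - 1)"] 2 by (simp add: len_def)
  next
   case 3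
   hence "\<xi> p <= \<xi> (q - 1)" "\<xi> (p - 1) <= \<xi> (q - 1)" using q by (auto intro!: xi_mono)
   thus ?thesis using ramp_before[OF q] 3 by simp
  qed
 qed
 have "(\<Sum>q\<in>{1..P}. c q * ramp q (\<xi> p)) - (\<Sum>q\<in>{1..P}. c q * ramp q (\<xi> (p - 1))) = (\<Sum>q\<in>{1..P}. c q * (ramp q (\<xi> p) - ramp q (\<xi> (p - 1))))"
  by (simp add: right_diff_distrib sum_subtractf)
 also have "... = (\<Sum>q\<in>{1..P}. if q = p then c p * len p else 0)"
  by (rule sum.cong[OF refl]) (use d in \<open>auto simp only: mult_zero_right split: if_splits\<close>)
 finally show ?thesis using p len_pos[OF p] by (simp add: slope_def)
qed

text \<open>Derivatives of finite element functions are step functions, and a step function sees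
  only the averages of \<open>dx L w\<close>. Hence the interpolant satisfies the defining
  equations; its slopes meet the boundary constraint because \<open>dx L w\<close> has mean
  zero.\<close>

lemma ritz_interp:
 assumes w: "w : H10 L"
 shows "ritz L P \<xi> w : fe_space L P \<xi>" "!!p. p : {1..P} ==> slope (ritz L P \<xi> w) p = avg (dx L w) p"
proof -
 have z: "dx L w : L2 L" using Hk_wderiv(1)[OF H10_prim(1)[OF w L0], of 1] by simp
 have wd: "ip L f (dx L v) = ip L f (step_fun (slope v))" if "v : fe_space L P \<xi>" "f : L2 L" for v f
  using fe_space_wderiv(2,3)[OF that(1)] that(2) by (intro inner_L2_cong_AE) (auto simp: L2_iff)
 have dd: "ip L (dx L u) (dx L v) = (\<Sum>p=1..P. slope v p * (slope u p * len p))"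
  if u: "u : fe_space L P \<xi>" and v: "v : fe_space L P \<xi>" for u v
 proof -
  have "ip L (dx L u) (dx L v) = ip L (step_fun (slope u)) (step_fun (slope v))"
   using fe_space_wderiv(2,3)[OF u] fe_space_wderiv(2,3)[OF v] by (intro inner_L2_cong_AE) (auto simp: L2_iff)
  thus ?thesis unfolding inner_step_avg[OF step_fun_L2] by (simp add: avg_step)
 qed
 let ?P = "%z. z : fe_space L P \<xi> \<and> (\<forall>v\<in>fe_space L P \<xi>. ip L (dx L z) (dx L v) = ip L (dx L w) (dx L v))"
 have R: "interp (dx L w) : fe_space L P \<xi>"
  unfolding interp_def[abs_def] using avg_sum[OF z] H10_prim(3)[OF w L0] by (intro ramp_sum_fe_space) simp
 have sR: "slope (interp (dx L w)) p = avg (dx L w) p" if "p : {1..P}" for p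
  unfolding interp_def[abs_def] by (rule slope_ramp_sum[OF that])
 have "?P (interp (dx L w))"
 proof (intro conjI ballI R)
  fix v assume v: "v : fe_space L P \<xi>"
  show "ip L (dx L (interp (dx L w))) (dx L v) = ip L (dx L w) (dx L v)"
   unfolding dd[OF R v] wd[OF v z] inner_step_avg[OF z] by (intro sum.cong refl) (simp only: sR)
 qed
 hence "?P (SOME z. ?P z)" by (rule someI[of ?P])
 hence PR: "?P (ritz L P \<xi> w)" unfolding ritz_def .
 show rf: "ritz L P \<xi> w : fe_space L P \<xi>" using PR by blast
 have ro: "!!v. v : fe_space L P \<xi> ==> ip L (dx L (ritz L P \<xi> w)) (dx L v) = ip L (dx L w) (dx L v)"
  using PR by auto
 \<comment> \<open>\<open>ritz\<close> is a choice, so uniqueness is needed: the difference from the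
   interpolant is itself an admissible test function, and testing with it gives a vanishing sum of
   squares of slopes.\<close>
 define D where "D x = ritz L P \<xi> w x - interp (dx L w) x" for x
 have D: "D : fe_space L P \<xi>" unfolding D_def[abs_def] by (rule fe_space_diff[OF rf R])
 have sD: "slope D p = slope (ritz L P \<xi> w) p - avg (dx L w) p" if "p : {1..P}" for p
  using sR[OF that] by (simp add: slope_def D_def diff_divide_distrib)
 have "(\<Sum>p=1..P. slope D p * (slope (ritz L P \<xi> w) p * len p)) = (\<Sum>p=1..P. slope D p * (avg (dx L w) p * len p))"
  using ro[OF D] unfolding wd[OF D z] dd[OF rf D] inner_step_avg[OF z] .
 hence "(\<Sum>p=1..P. slope D p * (slope (ritz L P \<xi> w) p * len p) - slope D p * (avg (dx L w) p * len p)) = 0"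
  by (simp add: sum_subtractf)
 moreover have "slope D p * (slope (ritz L P \<xi> w) p * len p) - slope D p * (avg (dx L w) p * len p) = len p * (slope D p)^2" if "p : {1..P}" for p
  unfolding sD[OF that] by (simp add: power2_eq_square algebra_simps)
 ultimately have "(\<Sum>p=1..P. len p * (slope D p)^2) = 0" by simp
 hence z0: "len p * (slope D p)^2 = 0" if "p : {1..P}" for p
  using that len_pos sum_nonneg_eq_0_iff[of "{1..P}" "%p. len p * (slope D p)^2"] by (simp add: less_imp_le)
 show "slope (ritz L P \<xi> w) p = avg (dx L w) p" if "p : {1..P}" for p
  using z0[OF that] len_pos[OF that] sD[OF that] by simp
qed

text \<open>The functional that reads off the slope on the element \<open>p\<close>.\<close>

definition dual_fun :: "nat => real => real" where
 "dual_fun p x = ind (elem p) x * (12 / (len p) ^ 3 * (x - (\<xi> (p - 1) + \<xi> p) / 2))"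

lemma dual_fun_L2: "dual_fun p : L2 L"
 unfolding dual_fun_def[abs_def]
 by (intro ind_elem_mult_L2 L2_continuous continuous_intros)

lemma integral_elem_FTC:
 assumes p: "p : {1..P}" and F: "!!x. (F has_real_derivative f x) (at x)" and f: "!!x. isCont f x"
 shows "(LINT x|leb L. ind (elem p) x * f x) = F (\<xi> p) - F (\<xi> (p - 1))"
proof -
 have [measurable]: "f : bmf borel"
  using f by (intro borel_measurable_continuous_onI) (simp add: continuous_on_eq_continuous_at)
 have "(LINT x|leb L. ind (elem p) x * f x) = (LBINT x. ind {0<..<L} x * (ind (elem p) x * f x))"
  by (rule integral_Ioo_eq) (simp add: elem_def)
 also have "... = (LBINT x. f x * ind {\<xi> (p - 1)..\<xi> p} x)"
 proof (rule integral_cong_AE)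
  show "AE x in lborel. ind {0<..<L} x * (ind (elem p) x * f x) = f x * ind {\<xi> (p - 1)..\<xi> p} x"
   using AE_lborel_singleton[of "\<xi> p"] AE_lborel_singleton[of "\<xi> (p - 1)"]
  proof eventually_elim
   case (elim x)
   show ?case
   proof (cases "x : elem p")
    case True
    hence "x : {0<..<L}" using elem_subset[OF p] by blast
    thus ?thesis using True by (simp add: elem_def)
   next
    case False
    thus ?thesis using elim by (auto simp: indicator_def elem_def)
   qed
  qed
 qed (simp_all add: elem_def)
 also have "... = F (\<xi> p) - F (\<xi> (p - 1))"
  by (rule integral_FTC_Icc_real) (use len_pos[OF p] F f in \<open>auto simp: len_def\<close>)
 finally show ?thesis .
qed

text \<open>The dual function is linear on the element and odd about its midpoint, hence blind to
  constants; all ramps except the one of element \<open>p\<close> are constant there. The factor 12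
  over the cubed length normalises the pairing with that one.\<close>

lemma inner_ramp_dual:
 assumes p: "p : {1..P}" and q: "q : {1..P}"
 shows "ip L (ramp q) (dual_fun p) = (if q = p then 1 else 0)"
proof -
 define a where "a = \<xi> (p - 1)"
 define l where "l = len p"
 define K where "K = 12 / l ^ 3"
 have l: "0 < l" using len_pos[OF p] by (simp add: l_def)
 have b: "\<xi> p = a + l" by (simp add: a_def l_def len_def)
 have m: "(\<xi> (p - 1) + \<xi> p) / 2 = a + l / 2" unfolding b by (simp add: a_def)
 have red: "ip L (ramp q) (dual_fun p) = (LINT x|leb L. ind (elem p) x * (K * (R x * (x - (a + l / 2)))))"
  if "!!x. x : elem p ==> ramp q x = R x" for R
  unfolding inner_L2_def dual_fun_def m K_def l_def[symmetric]
  by (intro intc_B refl) (use that in \<open>auto simp: indicator_def\<close>)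
 have const: "ip L (ramp q) (dual_fun p) = 0" if "!!x. x : elem p ==> ramp q x = c" for c
 proof -
  have "ip L (ramp q) (dual_fun p) = (LINT x|leb L. ind (elem p) x * (K * (c * (x - (a + l / 2)))))"
   by (rule red) (rule that)
  also have "... = (%x. K * (c * (x^2 / 2 - (a + l / 2) * x))) (\<xi> p) - (%x. K * (c * (x^2 / 2 - (a + l / 2) * x))) (\<xi> (p - 1))"
   by (rule integral_elem_FTC[OF p]) (auto intro!: derivative_eq_intros continuous_intros)
  also have "... = 0" unfolding b a_def[symmetric] by (simp add: power2_eq_square field_simps)
  finally show ?thesis .
 qed
 consider "q < p" | "q = p" | "p < q" by linarith
 thus ?thesis
 proof cases
  case 1
  hence "\<xi> q <= \<xi> (p - 1)" using p by (intro xi_mono) auto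
  hence "ip L (ramp q) (dual_fun p) = 0"
   by (intro const[of "len q"] ramp_after[OF q]) (auto simp: elem_def)
  thus ?thesis using 1 by simp
 next
  case 3
  hence "\<xi> p <= \<xi> (q - 1)" using q by (intro xi_mono) auto
  hence "ip L (ramp q) (dual_fun p) = 0"
   by (intro const[of 0] ramp_before[OF q]) (auto simp: elem_def)
  thus ?thesis using 3 by simp
 next
  case 2
  have "ip L (ramp q) (dual_fun p) = (LINT x|leb L. ind (elem p) x * (K * ((x - a) * (x - (a + l / 2)))))"
   by (rule red) (use ramp_inside[of p] in \<open>simp add: 2 elem_def a_def\<close>)
  also have "... = (%x. K * ((x - a) ^ 3 / 3 - (l / 2) * ((x - a)^2 / 2))) (\<xi> p) - (%x. K * ((x - a) ^ 3 / 3 - (l / 2) * ((x - a)^2 / 2))) (\<xi> (p - 1))"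
   by (rule integral_elem_FTC[OF p])
    (auto intro!: derivative_eq_intros continuous_intros simp: power2_eq_square field_simps)
  also have "... = K * (l ^ 3 / 12)"
   unfolding b a_def[symmetric] by (simp add: power2_eq_square power3_eq_cube algebra_simps)
  also have "... = 1" using l by (simp add: K_def)
  finally show ?thesis using 2 by simp
 qed
qed

lemma ramp_sum_L2: "(%x. \<Sum>p=1..P. c p * ramp p x) : L2 L"
 by (intro L2_sum L2_scale ramp_L2)

lemma inner_ramp_sum_dual:
 assumes p: "p : {1..P}" shows "ip L (%x. \<Sum>q\<in>{1..P}. c q * ramp q x) (dual_fun p) = c p"
proof -
 have "ip L (%x. \<Sum>q\<in>{1..P}. c q * ramp q x) (dual_fun p) = (\<Sum>q\<in>{1..P}. c q * ip L (ramp q) (dual_fun p))"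
 proof -
  have "ip L (%x. \<Sum>q\<in>{1..P}. c q * ramp q x) (dual_fun p) = (\<Sum>q\<in>{1..P}. ip L (%x. c q * ramp q x) (dual_fun p))"
   by (rule inner_L2_sum_left) (intro L2_scale ramp_L2 dual_fun_L2)+
  thus ?thesis unfolding inner_L2_scale_left .
 qed
 also have "... = (\<Sum>q\<in>{1..P}. if q = p then c p else 0)"
 proof (rule sum.cong[OF refl])
  fix q assume q: "q : {1..P}"
  show "c q * ip L (ramp q) (dual_fun p) = (if q = p then c p else 0)"
   unfolding inner_ramp_dual[OF p q] by simp
 qed
 finally show ?thesis using p by simp
qed

end

section \<open>From almost every time to every time\<close>

lemma prim_eq_integral:
 fixes g :: "real => real"
 assumes "t <= T" shows "prim T g t = (LINT s|leb t. g s)"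
proof -
 have "prim T g t = (LINT s|lebesgue. ind {0<..<T} s *\<^sub>R (ind {0<..<t} s * g s))"
  unfolding prim_def by (rule integral_restrict_space) simp
 also have "... = (LINT s|lebesgue. ind {0<..<t} s *\<^sub>R g s)"
  using assms by (intro intc_B) (auto simp: indicator_def)
 also have "... = (LINT s|leb t. g s)"
  by (rule integral_restrict_space[symmetric]) simp
 finally show ?thesis .
qed

lemma integrable_Ioo_mono:
 fixes g :: "real => real"
 assumes "integrable (leb T) g" "t <= T" shows "integrable (leb t) g"
proof -
 have "integrable lebesgue (%s. ind {0<..<T} s *\<^sub>R g s)"
  using assms(1) by (subst (asm) integrable_restrict_space) auto
 hence "integrable lebesgue (%s. ind {0<..<t} s *\<^sub>R (ind {0<..<T} s *\<^sub>R g s))"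
  by (rule integrable_mult_indicator[rotated]) simp
 moreover have "(%s. ind {0<..<t} s *\<^sub>R (ind {0<..<T} s *\<^sub>R g s)) = (%s. ind {0<..<t} s *\<^sub>R g s)"
  using assms(2) by (auto simp: indicator_def)
 ultimately show ?thesis by (subst integrable_restrict_space) auto
qed

text \<open>A set of full measure meets every interval of positive length. Combined with continuity
  in time this lifts relations from almost every time to every time, the end points
  included.\<close>

lemma AE_Ioo_sequence:
 fixes t T :: real
 assumes P: "AE s in leb T. P s" and t: "t : {0..T}" and T: "0 < T"
 obtains s where "!!n. s n : {0<..<T}" "!!n. P (s n)" "s ----> t"
proof -
 have "\<exists>s\<in>{0<..<T}. P s \<and> \<bar>s - t\<bar> < inverse (real (Suc n))" for n
 proof (rule ccontr)
  assume c: "\<not> ?thesis"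
  define a b where "a = max 0 (t - inverse (real (Suc n)))" and "b = min T (t + inverse (real (Suc n)))"
  have "0 < inverse (real (Suc n))" by simp
  hence "t - inverse (real (Suc n)) < T" "0 < t + inverse (real (Suc n))" using t unfolding atLeastAtMost_iff by linarith+
  hence ab: "a < b" using \<open>0 < inverse (real (Suc n))\<close> T by (simp add: a_def b_def del: of_nat_Suc)
  have "AE s in lborel. s \<notin> {a<..<b}"
   using P[unfolded AE_Ioo_iff]
  proof eventually_elim
   case (elim s)
   show ?case
   proof
    assume "s : {a<..<b}"
    hence "s : {0<..<T}" "\<bar>s - t\<bar> < inverse (real (Suc n))"
     unfolding a_def b_def by (auto simp: abs_less_iff simp del: of_nat_Suc)
    thus False using elim c by blast
   qed
  qed
  hence "{a<..<b} : null_sets lborel" by (subst AE_iff_null_sets) auto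
  thus False using ab by (simp add: null_sets_def)
 qed
 then obtain s where s: "!!n. s n : {0<..<T}" "!!n. P (s n)" "!!n. \<bar>s n - t\<bar> < inverse (real (Suc n))"
  by metis
 have "(%n. s n - t) ----> 0"
  by (rule Lim_null_comparison[OF _ LIMSEQ_inverse_real_of_nat])
   (use s(3) in \<open>auto intro!: always_eventually less_imp_le\<close>)
 hence "s ----> t" by (simp add: LIM_zero_iff)
 with s that show thesis by blast
qed

lemma continuous_AE_le:
 fixes f g :: "real => real"
 assumes "continuous_on {0..T} f" "continuous_on {0..T} g" "AE s in leb T. f s <= g s" "t : {0..T}" "0 < T"
 shows "f t <= g t"
proof -
 obtain s where s: "!!n. s n : {0<..<T}" "!!n. f (s n) <= g (s n)" "s ----> t"
  using AE_Ioo_sequence[OF assms(3-5)] by metis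
 have s': "s n : {0..T}" for n using s(1)[of n] by auto
 have "(%n. f (s n)) ----> f t" "(%n. g (s n)) ----> g t"
  using continuous_on_tendsto_compose[OF assms(1) s(3) assms(4)] continuous_on_tendsto_compose[OF assms(2) s(3) assms(4)] s'
  by auto
 thus ?thesis using s(2) by (intro LIMSEQ_le) auto
qed

lemma continuous_AE_eq:
 fixes f g :: "real => real"
 assumes "continuous_on {0..T} f" "continuous_on {0..T} g" "AE s in leb T. f s = g s" "t : {0..T}" "0 < T"
 shows "f t = g t"
proof (rule antisym)
 have 1: "AE s in leb T. f s <= g s" and 2: "AE s in leb T. g s <= f s"
  using assms(3) by (eventually_elim, simp)+
 show "f t <= g t" by (rule continuous_AE_le[OF assms(1,2) 1 assms(4,5)])
 show "g t <= f t" by (rule continuous_AE_le[OF assms(2,1) 2 assms(4,5)])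
qed

definition cont_L2 :: "real => real => (real => real => real) => bool" where
 "cont_L2 L T v \<longleftrightarrow> (\<forall>t\<in>{0..T}. v t : L2 L) \<and>
  (\<forall>t\<in>{0..T}. ((%s. nrm L (%x. v s x - v t x)) \<longlongrightarrow> 0) (at t within {0..T}))"

lemma cont_L2_inner:
 assumes v: "cont_L2 L T v" and \<psi>: "\<psi> : L2 L"
 shows "continuous_on {0..T} (%t. ip L (v t) \<psi>)"
 unfolding continuous_on_def
proof (intro ballI)
 fix t assume t: "t : {0..T}"
 have "((%s. ip L (v s) \<psi> - ip L (v t) \<psi>) \<longlongrightarrow> 0) (at t within {0..T})"
 proof (rule Lim_null_comparison)
  show "((%s. nrm L (%x. v s x - v t x) * nrm L \<psi>) \<longlongrightarrow> 0) (at t within {0..T})"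
   using v t by (intro tendsto_mult_left_zero) (simp add: cont_L2_def)
  have "norm (ip L (v s) \<psi> - ip L (v t) \<psi>) <= nrm L (%x. v s x - v t x) * nrm L \<psi>"
   if s: "s : {0..T}" for s
  proof -
   have vs: "v s : L2 L" "v t : L2 L" using v s t by (auto simp: cont_L2_def)
   show ?thesis
    using inner_L2_Cauchy_Schwarz[OF L2_diff[OF vs] \<psi>] by (simp add: inner_L2_diff_left[OF vs \<psi>])
  qed
  thus "\<forall>\<^sub>F s in at t within {0..T}. norm (ip L (v s) \<psi> - ip L (v t) \<psi>) <= nrm L (%x. v s x - v t x) * nrm L \<psi>"
   unfolding eventually_at by (intro exI[of _ 1]) auto
 qed
 thus "((%s. ip L (v s) \<psi>) \<longlongrightarrow> ip L (v t) \<psi>) (at t within {0..T})"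
  by (simp add: LIM_zero_iff)
qed

lemma cont_L2_norm:
 assumes v: "cont_L2 L T v" shows "continuous_on {0..T} (%t. nrm L (v t))"
 unfolding continuous_on_def
proof (intro ballI)
 fix t assume t: "t : {0..T}"
 have "((%s. nrm L (v s) - nrm L (v t)) \<longlongrightarrow> 0) (at t within {0..T})"
 proof (rule Lim_null_comparison)
  show "((%s. nrm L (%x. v s x - v t x)) \<longlongrightarrow> 0) (at t within {0..T})"
   using v t by (simp add: cont_L2_def)
  have "norm (nrm L (v s) - nrm L (v t)) <= nrm L (%x. v s x - v t x)" if "s : {0..T}" for s
   using v that t norm_L2_diff_abs[of "v s" L "v t"] by (simp add: cont_L2_def)
  thus "\<forall>\<^sub>F s in at t within {0..T}. norm (nrm L (v s) - nrm L (v t)) <= nrm L (%x. v s x - v t x)"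
   unfolding eventually_at by (intro exI[of _ 1]) auto
 qed
 thus "((%s. nrm L (v s)) \<longlongrightarrow> nrm L (v t)) (at t within {0..T})"
  by (simp add: LIM_zero_iff)
qed

lemma cont_L2_diff:
 assumes v: "cont_L2 L T v" and w: "cont_L2 L T w" shows "cont_L2 L T (%t x. v t x - w t x)"
 unfolding cont_L2_def
proof (intro conjI ballI)
 fix t assume t: "t : {0..T}"
 show "(%x. v t x - w t x) : L2 L" using v w t by (auto simp: cont_L2_def)
 show "((%s. nrm L (%x. v s x - w s x - (v t x - w t x))) \<longlongrightarrow> 0) (at t within {0..T})"
 proof (rule Lim_null_comparison)
  show "((%s. nrm L (%x. v s x - v t x) + nrm L (%x. w s x - w t x)) \<longlongrightarrow> 0) (at t within {0..T})"
   using v w t by (intro tendsto_add_zero) (auto simp: cont_L2_def)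
  have "nrm L (%x. v s x - w s x - (v t x - w t x)) <= nrm L (%x. v s x - v t x) + nrm L (%x. w s x - w t x)"
   if s: "s : {0..T}" for s
  proof -
   have e: "(%x. v s x - w s x - (v t x - w t x)) = (%x. (v s x - v t x) + (w t x - w s x))" by auto
   show ?thesis
    unfolding e norm_L2_minus_commute[of L "w s" "w t"]
    using v w s t by (intro norm_L2_triangle L2_diff) (auto simp: cont_L2_def)
  qed
  thus "\<forall>\<^sub>F s in at t within {0..T}. norm (nrm L (%x. v s x - w s x - (v t x - w t x))) <= nrm L (%x. v s x - v t x) + nrm L (%x. w s x - w t x)"
   unfolding eventually_at by (intro exI[of _ 1]) auto
 qed
qed

text \<open>The primitive formula holds almost everywhere up to a constant by du Bois-Reymond;
  continuity extends it to every time, and evaluation at 0 identifies the constant.\<close>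

lemma tderiv_L2_at:
 assumes T: "0 < T" and d: "has_tderiv (space_L2 L) T v w" and v: "cont_L2 L T v" and \<psi>: "\<psi> : L2 L" and t: "t : {0..T}"
 shows "ip L (v t) \<psi> = ip L (v 0) \<psi> + prim T (%s. ip L (w s) \<psi>) t"
proof -
 have wd: "has_weak_tderiv T (%t. ip L (v t) \<psi>) (%t. ip L (w t) \<psi>)"
  by (rule has_tderiv_L2_inner[OF d \<psi>])
 hence wi: "integrable (leb T) (%t. ip L (w t) \<psi>)" by (simp add: has_weak_tderiv_def)
 obtain c where c: "AE t in leb T. ip L (v t) \<psi> = c + prim T (%t. ip L (w t) \<psi>) t"
  using has_weak_tderiv_imp_prim[OF T wd] by blast
 have eq: "ip L (v t) \<psi> = c + prim T (%t. ip L (w t) \<psi>) t" if "t : {0..T}" for t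
  by (rule continuous_AE_eq[OF cont_L2_inner[OF v \<psi>] _ c that T])
   (intro continuous_intros continuous_on_subset[OF prim_continuous[OF wi]], simp)
 have "ip L (v 0) \<psi> = c" using eq[of 0] T by simp
 thus ?thesis using eq[OF t] by simp
qed

lemma prim_scale: "prim T (%s. c * f s) t = c * prim T f t"
proof -
 have "prim T (%s. c * f s) t = (LINT y|leb T. c * (ind {0<..<t} y * f y))"
  by (simp add: prim_def algebra_simps)
 thus ?thesis by (simp add: prim_def)
qed

text \<open>Values in \<open>H^r\<close> are given only for almost every time, but the initial value
  has to be measured in this norm. Regularity spreads from one good time to all others by adding the
  Bochner integral of the derivative.\<close>

lemma tderiv_H_at:
 assumes T: "0 < T" and dH: "has_tderiv (space_H L r) T v w" and d: "has_tderiv (space_L2 L) T v v'"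
  and v: "cont_L2 L T v" and k: "k <= r" and t: "t : {0..T}"
 shows "\<exists>z\<in>L2 L. has_wderiv L k (v t) z"
  and "\<psi> : L2 L ==> ip L (wderiv L k (v t)) \<psi>
   = ip L (wderiv L k (v 0)) \<psi> + prim T (%s. ip L (wderiv L k (w s)) \<psi>) t"
proof -
 have wH: "w : bochner_Lp 1 T (space_H L r)" and vH: "v : bochner_Lp 1 T (space_H L r)"
  using dH by (auto simp: has_tderiv_def)
 note wk = bochner_Lp_L2_integrable[OF bochner_Lp_wderiv[OF wH k]]
 have wt: "AE t in leb T. w t : Hk L r" and vt: "AE t in leb T. v t : Hk L r"
  using vH wH by (auto simp: bochner_Lp_def bochner_measurable_def)
 obtain s0 where "!!n. s0 n : {0<..<T}" "!!n. v (s0 n) : Hk L r" "s0 ----> 0"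
  using AE_Ioo_sequence[OF vt, of 0] T by auto
 \<comment> \<open>Any time at which the value is regular will do as a starting point; the time 0
   itself might be exceptional.\<close>
 then obtain \<tau> where \<tau>: "\<tau> : {0..T}" "v \<tau> : Hk L r" by (metis greaterThanLessThan_iff atLeastAtMost_iff less_imp_le)
 define J where "J t = bint (space_L2 L) 0 t (%s. wderiv L k (w s))" for t
 have J: "J t : L2 L" "!!\<psi>. \<psi> : L2 L ==> ip L (J t) \<psi> = prim T (%s. ip L (wderiv L k (w s)) \<psi>) t"
  if "t : {0..T}" for t
 proof -
  have tT: "t <= T" using that by simp
  have "{0<..<t} \<subseteq> {0<..<T}" using tT by auto
  note b = bmL2_subset[OF wk(1) this] integrable_Ioo_mono[OF wk(2) tT]
  show "J t : L2 L" unfolding J_def using b tT by (intro bint_L2) auto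
  show "ip L (J t) \<psi> = prim T (%s. ip L (wderiv L k (w s)) \<psi>) t" if "\<psi> : L2 L" for \<psi>
   unfolding J_def prim_eq_integral[OF tT] using b tT that by (intro bint_L2) auto
 qed
 \<comment> \<open>The candidate for the spatial derivative at time \<open>t\<close>. That it is the
   weak derivative is tested in space and reduces to the primitive formula for the scalar
   pairings.\<close>
 define z where "z t x = wderiv L k (v \<tau>) x + (J t x - J \<tau> x)" for t x
 have z\<tau>: "wderiv L k (v \<tau>) : L2 L" "has_wderiv L k (v \<tau>) (wderiv L k (v \<tau>))" using Hk_wderiv[OF \<tau>(2) k] by auto
 have zL: "z t : L2 L" if "t : {0..T}" for t
  unfolding z_def[abs_def] by (intro L2_add L2_diff z\<tau> J that \<tau>)
 have zi: "ip L (z t) \<psi> = ip L (wderiv L k (v \<tau>)) \<psi> + (ip L (J t) \<psi> - ip L (J \<tau>) \<psi>)"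
  if "t : {0..T}" "\<psi> : L2 L" for t \<psi>
  unfolding z_def[abs_def] inner_L2_add_left[OF z\<tau>(1) L2_diff[OF J(1)[OF that(1)] J(1)[OF \<tau>(1)]] that(2)]
   inner_L2_diff_left[OF J(1)[OF that(1)] J(1)[OF \<tau>(1)] that(2)] ..
 have wz: "has_wderiv L k (v t) (z t)" if t: "t : {0..T}" for t
  unfolding has_wderiv_def
 proof (intro allI impI)
  fix \<phi> assume \<phi>: "test_fun 0 L \<phi>"
  let ?D = "(deriv ^^ k) \<phi>"
  have \<phi>L: "\<phi> : L2 L" "?D : L2 L" using L2_test_fun[OF \<phi>] L2_test_fun[OF test_fun_deriv_n[OF \<phi>]] by auto
  have vL: "AE s in leb T. v' s : L2 L"
   using d by (intro bmL2_AE bochner_Lp_L2_integrable(1)) (simp add: has_tderiv_def)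
  have ae: "AE s in leb T. ip L (v' s) ?D = (-1) ^ k * ip L (wderiv L k (w s)) \<phi>"
   using wt tderiv_eq_H[OF d dH] vL
  proof eventually_elim
   case (elim s)
   have "ip L (v' s) ?D = ip L (w s) ?D"
    using elim \<phi>L by (intro inner_L2_cong_AE) (auto simp: L2_iff)
   thus ?case using Hk_wderiv(2)[OF elim(1) k] \<phi> by (simp add: has_wderiv_def)
  qed
  have m: "(%s. ip L (v' s) ?D) : bmf (leb T)"
   using has_tderiv_L2_inner[OF d \<phi>L(2)] by (auto simp: has_weak_tderiv_def)
  have at: "ip L (v s) ?D = ip L (v 0) ?D + (-1) ^ k * ip L (J s) \<phi>" if "s : {0..T}" for s
   using tderiv_L2_at[OF T d v \<phi>L(2) that] prim_cong_AE[OF m ae]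
   by (simp add: J(2)[OF that \<phi>L(1)] prim_scale)
  have "ip L (v \<tau>) ?D = (-1) ^ k * ip L (wderiv L k (v \<tau>)) \<phi>"
   using z\<tau>(2) \<phi> by (simp add: has_wderiv_def)
  thus "ip L (v t) ?D = (-1) ^ k * ip L (z t) \<phi>"
   using at[OF t] at[OF \<tau>(1)] unfolding zi[OF t \<phi>L(1)] by (simp add: algebra_simps)
 qed
 show "\<exists>z\<in>L2 L. has_wderiv L k (v t) z" using zL[OF t] wz[OF t] by blast
 assume \<psi>: "\<psi> : L2 L"
 have wi: "ip L (wderiv L k (v t)) \<psi> = ip L (z t) \<psi>" if "t : {0..T}" for t
  using wderivI[OF zL[OF that] wz[OF that]] \<psi> by (intro inner_L2_cong_AE) (auto simp: L2_iff)
 have "0 : {0..T}" using T by simp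
 thus "ip L (wderiv L k (v t)) \<psi>
   = ip L (wderiv L k (v 0)) \<psi> + prim T (%s. ip L (wderiv L k (w s)) \<psi>) t"
  unfolding wi[OF t] wi[OF \<open>0 : {0..T}\<close>] zi[OF t \<psi>] zi[OF \<open>0 : {0..T}\<close> \<psi>]
  by (simp add: J(2)[OF t \<psi>] J(2)[OF _ \<psi>, of 0] T less_imp_le)
qed

section \<open>Fractional integrals and derivatives of functions of time\<close>

text \<open>The fractional integral of a scalar function in the form that pairings of
  \<open>frac_int\<close> produce. For a Borel function vanishing off (0,T) it is the convolution
  with \<open>kern\<close>, and by this route the results on convolutions apply.\<close>

definition fconv :: "real => (real => real) => real => real" where
 "fconv \<alpha> b t = (LINT s|leb t. omega \<alpha> (t - s) * b s)"

lemma omega_measurable [measurable]: "omega \<alpha> : bmf borel"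
 unfolding omega_def[abs_def] by measurable

lemma fconv_cong_AE:
 assumes b: "b : bmf (leb T)" "AE s in leb T. b s = b' s" and t: "t <= T"
 shows "fconv \<alpha> b t = fconv \<alpha> b' t"
proof -
 have sub: "{0<..<t} \<subseteq> {0<..<T}" using t by auto
 have m: "b : bmf (leb t)"
  by (rule measurable_restrict_mono[OF b(1) sub])
 have ae: "AE s in leb t. b s = b' s" by (rule AE_Ioo_mono_set[OF b(2) sub])
 have m': "b' : bmf (leb t)" by (rule measurable_AE_lebesgue_on[OF m ae])
 have om: "(%s. omega \<alpha> (t - s)) : bmf (leb t)" by (rule borel_measurable_Ioo) measurable
 show ?thesis unfolding fconv_def
 proof (rule integral_cong_AE)
  show "AE s in leb t. omega \<alpha> (t - s) * b s = omega \<alpha> (t - s) * b' s"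
   using ae by eventually_elim simp
 qed (use om m m' in measurable)
qed

lemma kern_mult_eq:
 assumes "!!s. s \<notin> {0<..<T} ==> b s = (0 :: real)"
 shows "ind {0<..<t} s * (omega \<alpha> (t - s) * b s) = kern \<alpha> (t - s) * b s"
proof (cases "s : {0<..<t}")
 case True thus ?thesis by (simp add: kern_eq_omega)
next
 case False
 hence "kern \<alpha> (t - s) = 0 \<or> b s = 0" using assms[of s] by (cases "s <= 0") (auto simp: kern_def)
 thus ?thesis using False by auto
qed

lemma fconv_eq_conv:
 assumes "b : bmf borel" "!!s. s \<notin> {0<..<T} ==> b s = 0"
 shows "fconv \<alpha> b t = conv (kern \<alpha>) b t"
  "integrable (leb t) (%s. omega \<alpha> (t - s) * b s) \<longleftrightarrow> integrable lborel (%s. kern \<alpha> (t - s) * b s)"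
proof -
 have m: "(%s. omega \<alpha> (t - s) * b s) : bmf borel" using assms(1) by measurable
 have e: "ind {0<..<t} s * (omega \<alpha> (t - s) * b s) = kern \<alpha> (t - s) * b s" for s
  by (rule kern_mult_eq) (rule assms(2))
 show "fconv \<alpha> b t = conv (kern \<alpha>) b t" unfolding fconv_def conv_def integral_Ioo_eq[OF m] e ..
 show "integrable (leb t) (%s. omega \<alpha> (t - s) * b s) \<longleftrightarrow> integrable lborel (%s. kern \<alpha> (t - s) * b s)"
  unfolding integrable_Ioo_iff[OF m] e ..
qed

lemma fconv_AE_integrable:
 assumes \<alpha>: "0 < \<alpha>" and b: "integrable (leb T) b"
 shows "AE t in leb T. integrable (leb t) (%s. omega \<alpha> (t - s) * b s)"
proof -
 obtain b' where b': "b' : bmf borel" "!!x. x \<notin> {0<..<T} ==> b' x = 0"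
  "AE x in leb T. b x = b' x" "integrable lborel b'"
  using integrable_borel_representative[OF b] by metis
 have z: "b' s = 0" if "s <= 0" for s using that b'(2)[of s] by simp
 have "AE t in lborel. t <= T \<longrightarrow> integrable lborel (%s. kern \<alpha> (t - s) * b' s)"
  by (rule conv_AE_integrable[OF kern_kernel[OF \<alpha>] b'(4) z])
 thus ?thesis unfolding AE_Ioo_iff
 proof eventually_elim
  case (elim t)
  show ?case
  proof
   assume t: "t : {0<..<T}"
   hence sub: "{0<..<t} \<subseteq> {0<..<T}" by auto
   have i: "integrable (leb t) (%s. omega \<alpha> (t - s) * b' s)"
    by (subst fconv_eq_conv(2)[where T = T]) (use elim t b' in auto)
   have om: "(%s. omega \<alpha> (t - s)) : bmf (leb t)" by (rule borel_measurable_Ioo) measurable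
   have m: "b : bmf (leb t)"
    by (rule measurable_restrict_mono[OF _ sub]) (use b in simp)
   show "integrable (leb t) (%s. omega \<alpha> (t - s) * b s)"
   proof (rule integrable_cong_AE_imp[OF i])
    show "AE s in leb t. omega \<alpha> (t - s) * b' s = omega \<alpha> (t - s) * b s"
     using AE_Ioo_mono_set[OF b'(3) sub] by eventually_elim simp
   qed (use om m in measurable)
  qed
 qed
qed

lemma fconv_linear:
 assumes \<alpha>: "0 < \<alpha>" and b: "integrable (leb T) b" "integrable (leb T) c"
 shows "AE t in leb T. fconv \<alpha> (%s. x * b s + y * c s) t = x * fconv \<alpha> b t + y * fconv \<alpha> c t"
 using fconv_AE_integrable[OF \<alpha> b(1)] fconv_AE_integrable[OF \<alpha> b(2)]
proof eventually_elim
 case (elim t)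
 have "fconv \<alpha> (%s. x * b s + y * c s) t = (LINT s|leb t. x * (omega \<alpha> (t - s) * b s) + y * (omega \<alpha> (t - s) * c s))"
  by (simp add: fconv_def algebra_simps)
 thus ?case using elim by (simp add: fconv_def)
qed

text \<open>The coefficients are quantified inside the almost everywhere statement: the exceptional
  null set depends only on the finitely many functions \<open>b i\<close>, not on the
  combination.\<close>

lemma fconv_sum:
 assumes \<alpha>: "0 < \<alpha>" and I: "finite I" and b: "!!i. i : I ==> integrable (leb T) (b i)"
 shows "AE t in leb T. \<forall>c. fconv \<alpha> (%s. \<Sum>i\<in>I. c i * b i s) t = (\<Sum>i\<in>I. c i * fconv \<alpha> (b i) t)"
proof -
 have "AE t in leb T. \<forall>i\<in>I. integrable (leb t) (%s. omega \<alpha> (t - s) * b i s)"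
  using I fconv_AE_integrable[OF \<alpha> b] by (subst AE_ball_countable) (auto intro: countable_finite)
 thus ?thesis
 proof eventually_elim
  case (elim t)
  have "fconv \<alpha> (%s. \<Sum>i\<in>I. c i * b i s) t = (LINT s|leb t. (\<Sum>i\<in>I. c i * (omega \<alpha> (t - s) * b i s)))" for c
   by (simp add: fconv_def sum_distrib_left mult.left_commute)
  thus ?case using elim by (simp add: fconv_def ints_B)
 qed
qed

lemma fconv_L2:
 assumes \<alpha>: "0 < \<alpha>" and v: "v : bochner_Lp 1 T (space_L2 L)"
 shows "AE t in leb T. frac_int L \<alpha> v t : L2 L \<and>
  (\<forall>\<psi>\<in>L2 L. ip L (frac_int L \<alpha> v t) \<psi> = fconv \<alpha> (%s. ip L (v s) \<psi>) t) \<and>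
  nrm L (frac_int L \<alpha> v t) <= fconv \<alpha> (%s. nrm L (v s)) t"
proof -
 note v' = bochner_Lp_L2_integrable[OF v]
 have "AE t in leb T. t : {0<..<T}" by (rule AE_I2) simp
 with fconv_AE_integrable[OF \<alpha> v'(2)] show ?thesis
 proof eventually_elim
  case (elim t)
  have om: "(%s. omega \<alpha> (t - s)) : bmf (leb t)" by (rule borel_measurable_Ioo) measurable
  have b: "bmL2 L 0 t (%s x. omega \<alpha> (t - s) * v s x)"
   by (rule bmL2_mult[OF bmL2_subset[OF v'(1)] om]) (use elim in auto)
  have "omega \<alpha> (t - s) \<ge> 0" for s using \<alpha> by (simp add: omega_def Gamma_real_pos)
  hence n: "nrm L (%x. omega \<alpha> (t - s) * v s x) = omega \<alpha> (t - s) * nrm L (v s)" for s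
   by (simp add: norm_L2_scale)
  have i: "integrable (leb t) (%s. nrm L (%x. omega \<alpha> (t - s) * v s x))"
   unfolding n by (rule elim(1))
  show ?case
   using bint_L2[OF b i] unfolding n by (simp add: frac_int_def fconv_def inner_L2_scale_left)
 qed
qed

text \<open>The Riemann-Liouville derivative of \<open>a\<close> plus a primitive of
  \<open>b\<close> is the kernel times \<open>a\<close> plus the fractional integral of
  \<open>b\<close>. Thus fractional derivatives of the solutions are expressed through initial
  values and ordinary time derivatives.\<close>

lemma frac_deriv_inner:
 assumes \<alpha>: "0 < \<alpha>" and v: "v : bochner_Lp 1 T (space_L2 L)"
  and I: "frac_int L \<alpha> v : bochner_W1p 1 T (space_L2 L)" and \<psi>: "\<psi> : L2 L"
  and b: "integrable (leb T) b"
  and p: "AE s in leb T. ip L (v s) \<psi> = a + prim T b s"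
 shows "AE t in leb T. ip L (frac_deriv L T \<alpha> v t) \<psi> = kern \<alpha> t * a + fconv \<alpha> b t"
proof -
 obtain b' where b': "b' : bmf borel" "!!x. x \<notin> {0<..<T} ==> b' x = 0"
  "AE x in leb T. b x = b' x" "integrable lborel b'"
  using integrable_borel_representative[OF b] by metis
 note ker = kern_kernel[OF \<alpha>]
 have bz: "b' s = 0" if "s <= 0" for s using that b'(2)[of s] by simp
 have [measurable]: "b' : bmf borel" by (rule b'(1))
 \<comment> \<open>The Borel version of the pairing, with its constant part \<open>f1\<close> and
   its primitive part \<open>f2\<close> cut off at \<open>T\<close> so that both are
   integrable.\<close>
 define c where "c s = ind {0<..<T} s * (a + conv heaviside b' s)" for s
 define f1 :: "real => real" where "f1 s = ind {0<..<T} s" for s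
 define f2 where "f2 s = ind {..T} s * conv heaviside b' s" for s
 define g where "g t = ind {0<..<T} t * (a * kern \<alpha> t + conv (kern \<alpha>) b' t)" for t
 have hz: "conv heaviside b' s = 0" if "s <= 0" for s
  by (rule conv_nonpos[OF heaviside_kernel b'(4) bz that])
 have cv [measurable]: "conv heaviside b' : bmf borel" "conv (kern \<alpha>) b' : bmf borel"
  by (rule conv_measurable[OF heaviside_kernel b'(4) bz], assumption) (rule conv_measurable[OF ker b'(4) bz])
 have kz: "conv (kern \<alpha>) b' s = 0" if "s <= 0" for s
  by (rule conv_nonpos[OF ker b'(4) bz that])
 have cm: "c : bmf borel" and cz: "!!s. s \<notin> {0<..<T} ==> c s = 0"
  unfolding c_def[abs_def]
  by (intro borel_measurable_times borel_measurable_add borel_measurable_indicator borel_measurable_const cv(1), simp, simp)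
 have f2i: "integrable lborel f2" unfolding f2_def by (rule conv_integrable[OF heaviside_kernel b'(4) bz])
 have f3i: "integrable lborel (%s. ind {..T} s * conv (kern \<alpha>) b' s)" by (rule conv_integrable[OF ker b'(4) bz])
 have f1i: "integrable lborel f1" unfolding f1_def by (rule integrable_real_indicator) (use emeasure_bounded_finite[of "{0<..<T}"] in simp_all)
 have pb: "prim T b s = conv heaviside b' s" for s
 proof -
  have "prim T b s = prim T b' s" using b b'(3) by (intro prim_cong_AE) auto
  moreover have "prim T b' s = (LBINT y. ind {..<s} y * b' y)" by (rule prim_borel_eq[OF b'(1,2)])
  ultimately show ?thesis by (simp add: conv_heaviside)
 qed
 have pc: "AE s in leb T. ip L (v s) \<psi> = c s"
 proof -
  have "AE t in leb T. t : {0<..<T}" by (rule AE_I2) simp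
  with p show ?thesis by eventually_elim (simp add: c_def pb)
 qed
 have vm: "(%s. ip L (v s) \<psi>) : bmf (leb T)"
  by (rule bmL2_inner_measurable[OF bochner_Lp_L2_integrable(1)[OF v] \<psi>])
 have gi: "integrable lborel g"
 proof -
  have "integrable lborel (%t. ind {0<..<T} t * (a * (ind {..<T} t * kern \<alpha> t) + ind {..T} t * conv (kern \<alpha>) b' t))"
  proof (rule integrable_bounded_mult(2)[where B = 1])
   show "integrable lborel (%t. a * (ind {..<T} t * kern \<alpha> t) + ind {..T} t * conv (kern \<alpha>) b' t)"
    by (intro inta_B integrable_mult_right kernelD(4)[OF ker] f3i)
  qed (auto simp: indicator_def)
  also have "(%t. ind {0<..<T} t * (a * (ind {..<T} t * kern \<alpha> t) + ind {..T} t * conv (kern \<alpha>) b' t)) = g"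
   by (auto simp: g_def indicator_def)
  finally show ?thesis .
 qed
 have [measurable]: "g : bmf borel" using gi by simp
 have gi': "integrable (leb T) g"
 proof -
  have e: "ind {0<..<T} x * g x = g x" for x by (simp add: g_def indicator_def)
  have "g : bmf borel" by measurable
  thus ?thesis unfolding integrable_Ioo_iff[OF \<open>g : bmf borel\<close>] e by (intro gi)
 qed
 have "AE t in lborel. t <= T \<longrightarrow> integrable lborel (%s. kern \<alpha> (t - s) * f1 s)"
  by (rule conv_AE_integrable[OF ker f1i]) (simp add: f1_def)
 moreover have "AE t in lborel. t <= T \<longrightarrow> integrable lborel (%s. kern \<alpha> (t - s) * f2 s)"
  by (rule conv_AE_integrable[OF ker f2i]) (simp add: f2_def hz)
 moreover have "AE t in lborel. t <= T \<longrightarrow> conv (kern \<alpha>) (conv heaviside b') t = conv (conv (kern \<alpha>) heaviside) b' t"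
  by (rule conv_assoc_AE[OF ker heaviside_kernel b'(4) bz])
 moreover have "AE t in lborel. t <= T \<longrightarrow> conv heaviside (conv (kern \<alpha>) b') t = conv (conv heaviside (kern \<alpha>)) b' t"
  by (rule conv_assoc_AE[OF heaviside_kernel ker b'(4) bz])
 moreover have "AE t in lborel. t <= T \<longrightarrow> integrable lborel (%s. heaviside (t - s) * (ind {..T} s * conv (kern \<alpha>) b' s))"
  by (rule conv_AE_integrable[OF heaviside_kernel f3i]) (simp add: kz)
 \<comment> \<open>Convolution with \<open>heaviside\<close> is integration. Commuting it with the
   fractional kernel moves it to the outside, which presents the fractional integral as a primitive
   of \<open>g\<close> and so exhibits \<open>g\<close> as its derivative.\<close>
 ultimately have cc: "AE t in lborel. t : {0<..<T} \<longrightarrow> conv (kern \<alpha>) c t = prim T g t"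
 proof eventually_elim
  case (elim t)
  show ?case
  proof
   assume t: "t : {0<..<T}"
   have "conv (kern \<alpha>) c t = (LBINT s. a * (kern \<alpha> (t - s) * f1 s) + kern \<alpha> (t - s) * f2 s)"
    unfolding conv_def
   proof (rule intc_B[OF refl])
    fix s show "kern \<alpha> (t - s) * c s = a * (kern \<alpha> (t - s) * f1 s) + kern \<alpha> (t - s) * f2 s"
     using t hz[of s] by (auto simp: c_def f1_def f2_def indicator_def kern_def algebra_simps)
   qed
   also have "... = a * conv (kern \<alpha>) f1 t + conv (kern \<alpha>) f2 t"
    using elim t by (simp add: conv_def)
   also have "conv (kern \<alpha>) f1 t = conv (kern \<alpha>) heaviside t"
    unfolding conv_def
    by (rule intc_B[OF refl]) (use t in \<open>auto simp: f1_def heaviside_def indicator_def kern_def\<close>)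
   also have "... = conv heaviside (kern \<alpha>) t" by (rule conv_commute[OF ker heaviside_kernel])
   also have "conv (kern \<alpha>) f2 t = conv (kern \<alpha>) (conv heaviside b') t"
    unfolding conv_def[of "kern \<alpha>"]
    by (rule intc_B[OF refl]) (use t in \<open>auto simp: f2_def indicator_def kern_def\<close>)
   also have "... = conv (conv (kern \<alpha>) heaviside) b' t" using elim t by simp
   also have "conv (kern \<alpha>) heaviside = conv heaviside (kern \<alpha>)" using conv_commute[OF ker heaviside_kernel] by blast
   also have "conv (conv heaviside (kern \<alpha>)) b' t = conv heaviside (conv (kern \<alpha>) b') t" using elim t by simp
   also have "conv heaviside (conv (kern \<alpha>) b') t = (LBINT s. heaviside (t - s) * (ind {..T} s * conv (kern \<alpha>) b' s))"
    unfolding conv_def[of heaviside]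
    by (rule intc_B[OF refl]) (use t in \<open>auto simp: heaviside_def indicator_def\<close>)
   also have "a * conv heaviside (kern \<alpha>) t = (LBINT s. a * (ind {..<t} s * kern \<alpha> s))"
    by (simp add: conv_heaviside)
   also have "(LBINT s. a * (ind {..<t} s * kern \<alpha> s)) + (LBINT s. heaviside (t - s) * (ind {..T} s * conv (kern \<alpha>) b' s))
     = (LBINT s. a * (ind {..<t} s * kern \<alpha> s) + heaviside (t - s) * (ind {..T} s * conv (kern \<alpha>) b' s))"
    using elim t kernelD(4)[OF ker, of t] by simp
   also have "... = (LBINT s. ind {..<t} s * g s)"
   proof (rule intc_B[OF refl])
    fix s show "a * (ind {..<t} s * kern \<alpha> s) + heaviside (t - s) * (ind {..T} s * conv (kern \<alpha>) b' s) = ind {..<t} s * g s"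
     using t kernelD(3)[OF ker, of s] kz[of s]
     by (auto simp: g_def heaviside_def indicator_def)
   qed
   also have "... = prim T g t"
    by (rule prim_borel_eq[symmetric]) (auto simp: g_def)
   finally show "conv (kern \<alpha>) c t = prim T g t" .
  qed
 qed
 have tin: "AE t in leb T. t : {0<..<T}" by (rule AE_I2) simp
 have ae: "AE t in leb T. ip L (frac_int L \<alpha> v t) \<psi> = prim T g t"
  using fconv_L2[OF \<alpha> v] cc[folded AE_Ioo_iff] tin
 proof eventually_elim
  case (elim t)
  have "fconv \<alpha> (%s. ip L (v s) \<psi>) t = conv (kern \<alpha>) c t" if "t <= T"
   unfolding fconv_cong_AE[OF vm pc that] by (rule fconv_eq_conv(1)[OF cm cz])
  thus ?case using elim \<psi> by auto
 qed
 have w1: "has_weak_tderiv T (%t. ip L (frac_int L \<alpha> v t) \<psi>) g"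
  by (rule has_weak_tderiv_prim[OF gi' ae])
 have "has_weak_tderiv T (%t. ip L (frac_int L \<alpha> v t) \<psi>) (%t. ip L (frac_deriv L T \<alpha> v t) \<psi>)"
  unfolding frac_deriv_def by (rule has_tderiv_L2_inner[OF tderiv_has_tderiv[OF I] \<psi>])
 from has_weak_tderiv_unique[OF this w1 AE_I2]
 have "AE t in leb T. ip L (frac_deriv L T \<alpha> v t) \<psi> = g t" by simp
 with tin show ?thesis
 proof eventually_elim
  case (elim t)
  have "fconv \<alpha> b t = fconv \<alpha> b' t" by (rule fconv_cong_AE[OF _ b'(3)]) (use b elim in auto)
  also have "... = conv (kern \<alpha>) b' t" by (rule fconv_eq_conv(1)[OF b'(1,2)])
  finally have "fconv \<alpha> b t = conv (kern \<alpha>) b' t" .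
  thus ?case using elim by (simp add: g_def)
 qed
qed

section \<open>The discrete error equation at a fixed time\<close>

context fe
begin

definition ramp_sum :: "(nat => real) => real => real" where
 "ramp_sum c x = (\<Sum>p=1..P. c p * ramp p x)"

lemma ramp_sum_in_L2: "ramp_sum c : L2 L"
 unfolding ramp_sum_def[abs_def] by (rule ramp_sum_L2)

lemma inner_ramp_sum_coeff: "p : {1..P} ==> ip L (ramp_sum c) (dual_fun p) = c p"
 unfolding ramp_sum_def[abs_def] by (rule inner_ramp_sum_dual)

lemma inner_step_step: "ip L (step_fun b) (step_fun c) = (\<Sum>p=1..P. c p * (b p * len p))"
 unfolding inner_step_avg[OF step_fun_L2] by (rule sum.cong[OF refl]) (simp only: avg_step)

lemma step_fun_linear: "step_fun (%p. a * b p + c p) x = a * step_fun b x + step_fun c x"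
 unfolding step_fun_def sum_distrib_left sum.distrib[symmetric] by (rule sum.cong[OF refl]) (simp add: algebra_simps)

lemma ramp_sum_linear: "ramp_sum (%p. a * b p + c p) x = a * ramp_sum b x + ramp_sum c x"
 by (simp add: ramp_sum_def sum_distrib_left sum.distrib algebra_simps)

text \<open>Equivalence of norms on a finite-dimensional space, made explicit by the dual functions.
  The constant depends on the mesh; it serves only to prove integrability and does not reach the
  error bound.\<close>

lemma coeff_bounds:
 obtains K where "0 <= K" "!!c p. p : {1..P} ==> \<bar>c p\<bar> <= K * nrm L (ramp_sum c)"
  "!!c. nrm L (step_fun c) <= K * (\<Sum>p=1..P. \<bar>c p\<bar>)"
  "!!c. nrm L (ramp_sum c) <= K * (\<Sum>p=1..P. \<bar>c p\<bar>)"
proof -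
 define N where "N p = nrm L (dual_fun p) + nrm L (ind (elem p)) + nrm L (ramp p)" for p
 define K where "K = (\<Sum>p=1..P. N p)"
 have N0: "0 <= N p" for p by (simp add: N_def)
 have NK: "N p <= K" if "p : {1..P}" for p
  unfolding K_def by (rule member_le_sum) (use that N0 in auto)
 show thesis
 proof (rule that[of K])
  show "0 <= K" unfolding K_def by (rule sum_nonneg) (rule N0)
  fix c :: "nat => real"
  show "\<bar>c p\<bar> <= K * nrm L (ramp_sum c)" if p: "p : {1..P}" for p
  proof -
   have "nrm L (dual_fun p) <= K" using NK[OF p] by (simp add: N_def) (meson add_increasing2 norm_L2_nonneg order_trans le_add_same_cancel1 add_nonneg_nonneg)
   hence "nrm L (ramp_sum c) * nrm L (dual_fun p) <= K * nrm L (ramp_sum c)"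
    by (subst mult.commute) (rule mult_right_mono, simp_all)
   thus ?thesis
    using inner_L2_Cauchy_Schwarz[OF ramp_sum_in_L2[of c] dual_fun_L2[of p]] unfolding inner_ramp_sum_coeff[OF p] by simp
  qed
  have gen: "nrm L (%x. \<Sum>p=1..P. c p * f p x) <= K * (\<Sum>p=1..P. \<bar>c p\<bar>)"
   if f: "!!p. f p : L2 L" and n: "!!p. nrm L (f p) <= N p" for f
  proof -
   have "nrm L (%x. \<Sum>p=1..P. c p * f p x) <= (\<Sum>p=1..P. nrm L (%x. c p * f p x))"
    by (rule norm_L2_sum_le) (intro L2_scale f)
   also have "... <= (\<Sum>p=1..P. K * \<bar>c p\<bar>)"
   proof (rule sum_mono)
    fix p assume "p : {1..P}"
    hence "nrm L (f p) <= K" using n[of p] NK[of p] by simp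
    thus "nrm L (%x. c p * f p x) <= K * \<bar>c p\<bar>"
     unfolding norm_L2_scale by (subst mult.commute) (rule mult_right_mono, simp_all)
   qed
   finally show ?thesis by (simp add: sum_distrib_left)
  qed
  show "nrm L (step_fun c) <= K * (\<Sum>p=1..P. \<bar>c p\<bar>)"
   unfolding step_fun_def[abs_def] by (rule gen[OF ind_elem_L2]) (simp add: N_def)
  show "nrm L (ramp_sum c) <= K * (\<Sum>p=1..P. \<bar>c p\<bar>)"
   unfolding ramp_sum_def[abs_def] by (rule gen[OF ramp_L2]) (simp add: N_def)
 qed
qed

text \<open>Here \<open>\<kappa>\<close> is the kernel at the time in question,
  \<open>\<theta>\<close> the slopes of theta(0), \<open>\<phi>\<close> those of theta_t and
  \<open>w\<close> their fractional integrals; \<open>R\<close> stands for rho_t and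
  \<open>D\<close> for the fractional derivative of rho. The constraint on \<open>c\<close> is the
  boundary value at \<open>L\<close>. In the diffusion term rho is absent by Ritz
  orthogonality.\<close>

definition error_eq ::
  "real => (nat => real) => (real => real) => (real => real) => (real => real) => (nat => real) => (nat => real) => bool" where
 "error_eq \<kappa> \<theta> f R D \<phi> w \<longleftrightarrow> (\<forall>c. (\<Sum>p=1..P. c p * len p) = 0 \<longrightarrow>
  ip L (ramp_sum \<phi>) (ramp_sum c) + ip L (step_fun (%p. \<kappa> * \<theta> p + w p)) (step_fun c)
  = ip L R (ramp_sum c) + ip L (%x. f x * (ramp_sum (%p. \<kappa> * \<theta> p + w p) x - D x)) (step_fun c))"

lemma bounded_mult_norm:
 assumes f: "f : bmf (leb L)" "!!x. x : {0<..<L} ==> (f x)^2 <= B^2" and B: "0 <= B"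
  and g: "g : L2 L"
 shows "(%x. f x * g x) : L2 L" "nrm L (%x. f x * g x) <= B * nrm L g"
proof -
 show fg: "(%x. f x * g x) : L2 L" by (rule L2_bounded_mult[OF g f])
 have "nrm L (%x. f x * g x) <= nrm L (%x. B * g x)"
 proof (rule norm_L2_mono[OF fg L2_scale[OF g]], rule AE_I2)
  fix x assume "x : space (leb L)"
  hence "x : {0<..<L}" by simp
  hence "\<bar>f x\<bar> <= B" using f(2)[of x] B by (intro abs_le_square_iff[THEN iffD2, of _ B, simplified abs_of_nonneg[OF B]]) auto
  thus "\<bar>f x * g x\<bar> <= \<bar>B * g x\<bar>" using B by (simp add: abs_mult mult_right_mono)
 qed
 thus "nrm L (%x. f x * g x) <= B * nrm L g" using B by (simp add: norm_L2_scale)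
qed

lemma error_eq_estimate:
 assumes f: "f : bmf (leb L)" "!!x. x : {0<..<L} ==> (f x)^2 <= B^2" and B: "0 <= B"
  and R: "R : L2 L" and D: "D : L2 L" and \<kappa>: "0 <= \<kappa>" and eq: "error_eq \<kappa> \<theta> f R D \<phi> w"
  and c: "(\<Sum>p=1..P. c p * len p) = 0"
 shows "ip L (ramp_sum \<phi>) (ramp_sum c) + ip L (step_fun w) (step_fun c)
  <= nrm L R * nrm L (ramp_sum c)
   + (\<kappa> * nrm L (step_fun \<theta>) + B * (\<kappa> * nrm L (ramp_sum \<theta>) + nrm L (ramp_sum w) + nrm L D)) * nrm L (step_fun c)"
proof -
 define b where "b p = \<kappa> * \<theta> p + w p" for p
 define g where "g x = ramp_sum b x - D x" for x
 have g: "g : L2 L" unfolding g_def[abs_def] by (intro L2_diff ramp_sum_in_L2 D)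
 have "nrm L g <= nrm L (%x. \<kappa> * ramp_sum \<theta> x + ramp_sum w x) + nrm L (%x. - D x)"
 proof -
  have "g = (%x. (\<kappa> * ramp_sum \<theta> x + ramp_sum w x) + (- D x))"
   by (rule ext) (simp add: g_def b_def[abs_def] ramp_sum_linear)
  thus ?thesis
   using norm_L2_triangle[OF L2_add[OF L2_scale[OF ramp_sum_in_L2] ramp_sum_in_L2] L2_uminus[OF D]] by simp
 qed
 also have "... <= \<kappa> * nrm L (ramp_sum \<theta>) + nrm L (ramp_sum w) + nrm L D"
  using norm_L2_triangle[OF L2_scale[OF ramp_sum_in_L2, of \<kappa> \<theta>] ramp_sum_in_L2[of w]] \<kappa>
  by (simp add: norm_L2_minus norm_L2_scale)
 finally have gn: "nrm L g <= \<kappa> * nrm L (ramp_sum \<theta>) + nrm L (ramp_sum w) + nrm L D" .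
 note fg = bounded_mult_norm[OF f B g]
 have 1: "ip L R (ramp_sum c) <= nrm L R * nrm L (ramp_sum c)"
  using inner_L2_Cauchy_Schwarz[OF R ramp_sum_in_L2[of c]] by simp
 have 2: "- (\<kappa> * ip L (step_fun \<theta>) (step_fun c)) <= \<kappa> * nrm L (step_fun \<theta>) * nrm L (step_fun c)"
  using mult_left_mono[OF abs_le_D2[OF inner_L2_Cauchy_Schwarz[OF step_fun_L2[of \<theta>] step_fun_L2[of c]]] \<kappa>] by (simp add: mult.assoc)
 have "ip L (%x. f x * g x) (step_fun c) <= nrm L (%x. f x * g x) * nrm L (step_fun c)"
  using inner_L2_Cauchy_Schwarz[OF fg(1) step_fun_L2[of c]] by simp
 also have "... <= (B * (\<kappa> * nrm L (ramp_sum \<theta>) + nrm L (ramp_sum w) + nrm L D)) * nrm L (step_fun c)"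
  using fg(2) mult_left_mono[OF gn B] by (intro mult_right_mono) auto
 finally have 3: "ip L (%x. f x * g x) (step_fun c) <= (B * (\<kappa> * nrm L (ramp_sum \<theta>) + nrm L (ramp_sum w) + nrm L D)) * nrm L (step_fun c)" .
 have "step_fun b = (%x. \<kappa> * step_fun \<theta> x + step_fun w x)"
  by (intro ext) (simp add: b_def[abs_def] step_fun_linear)
 hence 4: "ip L (step_fun b) (step_fun c) = \<kappa> * ip L (step_fun \<theta>) (step_fun c) + ip L (step_fun w) (step_fun c)"
  using inner_L2_add_left[OF L2_scale[OF step_fun_L2] step_fun_L2 step_fun_L2] by (simp add: inner_L2_scale_left)
 have 5: "ip L (ramp_sum \<phi>) (ramp_sum c) + ip L (step_fun b) (step_fun c)
  = ip L R (ramp_sum c) + ip L (%x. f x * g x) (step_fun c)"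
  using eq c unfolding error_eq_def b_def[abs_def] g_def by blast
 show ?thesis using 1 2 3 4 5 unfolding distrib_right by linarith
qed

text \<open>The test function is the fractional integral \<open>w\<close>, so that the diffusion
  term yields the full square of the norm of its derivative. This square absorbs every slope of
  \<open>w\<close> created by the advection term and by the initial value.\<close>

lemma error_energy:
 assumes f: "f : bmf (leb L)" "!!x. x : {0<..<L} ==> (f x)^2 <= B^2" and B: "0 <= B"
  and R: "R : L2 L" and D: "D : L2 L" and \<kappa>: "0 <= \<kappa>" and eq: "error_eq \<kappa> \<theta> f R D \<phi> w"
  and w: "(\<Sum>p=1..P. w p * len p) = 0"
 shows "ip L (ramp_sum \<phi>) (ramp_sum w) <= (B^2 + 1) * (nrm L (ramp_sum w))^2
  + (B^2 + 1) * ((nrm L R)^2 + (nrm L D)^2 + \<kappa>^2 * ((nrm L (ramp_sum \<theta>))^2 + (nrm L (step_fun \<theta>))^2))"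
proof -
 define X W r d s t where "X = nrm L (step_fun w)" "W = nrm L (ramp_sum w)" "r = nrm L R" "d = nrm L D"
  "s = \<kappa> * nrm L (step_fun \<theta>)" "t = \<kappa> * nrm L (ramp_sum \<theta>)"
 note ab = this
 have ineq: "ip L (ramp_sum \<phi>) (ramp_sum w) + X^2 <= r * W + (s + B * (t + W + d)) * X"
  using error_eq_estimate[OF f B R D \<kappa> eq w] unfolding ab norm_L2_square .
 \<comment> \<open>Four products with \<open>X\<close> occur, so a quarter of \<open>X^2\<close> is
   spent on each.\<close>
 have y: "a * X <= a^2 + X^2 / 4" for a
  using zero_le_power2[of "a - X / 2"] by (simp add: power2_eq_square algebra_simps)
 have "r * W = r^2 + W^2 / 4 - (r - W / 2)^2" by (simp add: power2_eq_square algebra_simps)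
 hence "r * W <= r^2 + W^2"
  using zero_le_power2[of "r - W / 2"] zero_le_power2[of W] by linarith
 moreover have "(s + B * (t + W + d)) * X = s * X + (B * t) * X + (B * W) * X + (B * d) * X" by (simp add: algebra_simps)
 moreover note y[of s] y[of "B * t"] y[of "B * W"] y[of "B * d"]
 ultimately have "ip L (ramp_sum \<phi>) (ramp_sum w) <= r^2 + W^2 + s^2 + (B * t)^2 + (B * W)^2 + (B * d)^2"
  using ineq by linarith
 also have "... <= (B^2 + 1) * W^2 + (B^2 + 1) * (r^2 + d^2 + (t^2 + s^2))"
  by (simp add: power_mult_distrib algebra_simps)
 also have "t^2 + s^2 = \<kappa>^2 * ((nrm L (ramp_sum \<theta>))^2 + (nrm L (step_fun \<theta>))^2)"
  by (simp add: ab power_mult_distrib distrib_left)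
 finally show ?thesis by (simp add: ab)
qed

text \<open>Testing with theta_t itself and using an inverse estimate bounds its slopes, at a single
  time, by the data and by the fractional integrals \<open>w\<close>. The estimate is not uniform in
  the mesh; its purpose is to make theta_t square integrable in time.\<close>

lemma error_a_priori:
 assumes B: "0 <= B"
 obtains K where "0 <= K"
  "!!\<kappa> f R D \<phi> w p. f : bmf (leb L) ==> (!!x. x : {0<..<L} ==> (f x)^2 <= B^2) ==>
   R : L2 L ==> D : L2 L ==> 0 <= \<kappa> ==> error_eq \<kappa> \<theta> f R D \<phi> w ==> (\<Sum>p=1..P. \<phi> p * len p) = 0 ==> p : {1..P} ==>
   \<bar>\<phi> p\<bar> <= K * (nrm L R + nrm L D + \<kappa> + (\<Sum>q\<in>{1..P}. \<bar>w q\<bar>))"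
proof -
 obtain k where k: "0 <= k" "!!c p. p : {1..P} ==> \<bar>c p\<bar> <= k * nrm L (ramp_sum c)"
  "!!c. nrm L (step_fun c) <= k * (\<Sum>p=1..P. \<bar>c p\<bar>)"
  "!!c. nrm L (ramp_sum c) <= k * (\<Sum>p=1..P. \<bar>c p\<bar>)"
  using coeff_bounds by blast
 define n where "n = nrm L (step_fun \<theta>) + B * nrm L (ramp_sum \<theta>) + k + B * k + B"
 \<comment> \<open>The constant of the inverse estimate, which bounds the derivative of a finite
   element function by the function itself.\<close>
 define m where "m = k * (real P * k)"
 have m0: "0 <= m" and n0: "0 <= n" using k(1) B by (simp_all add: m_def n_def)
 have st: "nrm L (step_fun c) <= m * nrm L (ramp_sum c)" for c
 proof -
  have "(\<Sum>p=1..P. \<bar>c p\<bar>) <= (\<Sum>p=1..P. k * nrm L (ramp_sum c))" by (rule sum_mono) (rule k(2))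
  hence "(\<Sum>p=1..P. \<bar>c p\<bar>) <= real P * k * nrm L (ramp_sum c)" by simp
  from order_trans[OF k(3) mult_left_mono[OF this k(1)]] show ?thesis by (simp add: m_def mult.assoc)
 qed
 show thesis
 proof (rule that[of "k * (1 + m * n)"])
  show "0 <= k * (1 + m * n)" using k(1) m0 n0 by simp
  fix \<kappa> f R D \<phi> w p
  assume f: "f : bmf (leb L)" "!!x. x : {0<..<L} ==> (f x)^2 <= B^2"
   and R: "R : L2 L" and D: "D : L2 L" and \<kappa>: "0 <= \<kappa>" and eq: "error_eq \<kappa> \<theta> f R D \<phi> w"
   and \<phi>: "(\<Sum>p=1..P. \<phi> p * len p) = 0" and p: "p : {1..P}"
  define N where "N = nrm L (ramp_sum \<phi>)"
  define Z where "Z = nrm L R + nrm L D + \<kappa> + (\<Sum>q\<in>{1..P}. \<bar>w q\<bar>)"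
  define S where "S = \<kappa> * nrm L (step_fun \<theta>) + B * (\<kappa> * nrm L (ramp_sum \<theta>) + nrm L (ramp_sum w) + nrm L D)"
  have w0: "0 <= (\<Sum>q\<in>{1..P}. \<bar>w q\<bar>)" by (rule sum_nonneg) simp
  have Z: "nrm L R <= Z" "nrm L D <= Z" "\<kappa> <= Z" "(\<Sum>q\<in>{1..P}. \<bar>w q\<bar>) <= Z" "0 <= Z"
   using w0 \<kappa> by (auto simp: Z_def)
  have "- ip L (step_fun w) (step_fun \<phi>) <= nrm L (step_fun w) * nrm L (step_fun \<phi>)"
   using inner_L2_Cauchy_Schwarz[OF step_fun_L2[of w] step_fun_L2[of \<phi>]] by simp
  hence "N^2 <= nrm L R * N + (S + nrm L (step_fun w)) * nrm L (step_fun \<phi>)"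
   using error_eq_estimate[OF f B R D \<kappa> eq \<phi>] unfolding N_def S_def norm_L2_square by (simp add: algebra_simps)
  also have "... <= Z * N + (Z * n) * (m * N)"
  proof (intro add_mono mult_mono)
   show "nrm L R <= Z" by (rule Z)
   have kw: "nrm L (ramp_sum w) <= k * Z" "nrm L (step_fun w) <= k * Z"
    using order_trans[OF k(4) mult_left_mono[OF Z(4) k(1)]] order_trans[OF k(3) mult_left_mono[OF Z(4) k(1)]] by auto
   have "S + nrm L (step_fun w) <= Z * nrm L (step_fun \<theta>) + B * (Z * nrm L (ramp_sum \<theta>) + k * Z + Z) + k * Z"
    unfolding S_def using Z kw B by (intro add_mono mult_mono mult_left_mono mult_right_mono) auto
   also have "... = Z * n" by (simp add: n_def algebra_simps)
   finally show "S + nrm L (step_fun w) <= Z * n" .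
   show "nrm L (step_fun \<phi>) <= m * N" unfolding N_def by (rule st)
  qed (use Z n0 in \<open>simp_all add: N_def\<close>)
  finally have "N * N <= (Z * (1 + m * n)) * N" by (simp add: power2_eq_square algebra_simps)
  moreover have "0 <= N" "0 <= Z * (1 + m * n)" using Z m0 n0 by (auto simp: N_def)
  ultimately have "N <= Z * (1 + m * n)" by (cases "N = 0") (auto simp: mult_le_cancel_right)
  hence "k * N <= k * (Z * (1 + m * n))" using k(1) by (rule mult_left_mono)
  thus "\<bar>\<phi> p\<bar> <= k * (1 + m * n) * (nrm L R + nrm L D + \<kappa> + (\<Sum>q\<in>{1..P}. \<bar>w q\<bar>))"
   using k(2)[OF p, of \<phi>] unfolding N_def Z_def by (simp add: mult_ac)
 qed
qed

end

declare One_nat_def [simp del]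

section \<open>The Galerkin error as a function of time\<close>

text \<open>Fubini. The identity links the mean of a function to its derivative exactly when the
  integration constant is 0, so it expresses the boundary condition at 0 by bounded
  functionals.\<close>

lemma prim_inner_one:
 assumes "z : L2 L" shows "ip L (prim L z) (%x. 1) = ip L z (%x. L - x)"
proof -
 obtain z' where z': "z' : bmf borel" "!!x. x \<notin> {0<..<L} ==> z' x = 0"
  "AE x in leb L. z x = z' x" "integrable lborel z'"
  using integrable_borel_representative[OF L2_integrable[OF assms]] by metis
 have z0: "z' s = 0" if "s <= 0" for s using z'(2)[of s] that by simp
 have pb: "prim L z x = conv heaviside z' x" for x
 proof -
  have "prim L z x = prim L z' x" by (rule prim_cong_AE[OF L2_measurable[OF assms] z'(3)])
  also have "... = (LBINT y. ind {..<x} y * z' y)" by (rule prim_borel_eq[OF z'(1,2)])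
  finally show ?thesis by (simp add: conv_heaviside)
 qed
 have cm: "conv heaviside z' : bmf borel"
  by (rule conv_measurable[OF heaviside_kernel z'(4) z0])
 have "ip L (prim L z) (%x. 1) = (LBINT x. ind {0<..<L} x * conv heaviside z' x)"
  unfolding inner_L2_def pb[abs_def] mult_1_right by (rule integral_Ioo_eq[OF cm])
 also have "... = (LBINT x. ind {..<L} x * conv heaviside z' x)"
 proof (rule intc_B[OF refl])
  fix x
  have "conv heaviside z' x = 0" if "x <= 0" by (rule conv_nonpos[OF heaviside_kernel z'(4) z0 that])
  thus "ind {0<..<L} x * conv heaviside z' x = ind {..<L} x * conv heaviside z' x"
   by (cases "x <= 0") (auto simp: indicator_def)
 qed
 also have "... = (LBINT s. z' s * (LBINT t. ind {..<L - s} t * heaviside t))"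
  by (rule conv_integral[OF heaviside_kernel z'(4) z0])
 also have "... = (LBINT s. ind {0<..<L} s * (z' s * (L - s)))"
 proof (rule intc_B[OF refl])
  fix s
  show "z' s * (LBINT t. ind {..<L - s} t * heaviside t) = ind {0<..<L} s * (z' s * (L - s))"
  proof (cases "s : {0<..<L}")
   case True
   have "(LBINT t. ind {..<L - s} t * heaviside t) = (LBINT t. ind {0<..<L - s} t)"
    by (rule intc_B) (auto simp: heaviside_def indicator_def)
   thus ?thesis using True by (simp add: measure_lborel_Ioo)
  next
   case False thus ?thesis using z'(2)[OF False] by simp
  qed
 qed
 also have "... = (LINT x|leb L. z' x * (L - x))"
  by (rule integral_Ioo_eq[symmetric]) (use z'(1) in measurable)
 also have "... = ip L z (%x. L - x)"
  unfolding inner_L2_def[symmetric]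
  by (rule inner_L2_cong_AE[symmetric, OF L2_measurable[OF assms] L2_measurable[OF L2_continuous] z'(3)])
   (auto intro!: continuous_intros)
 finally show ?thesis .
qed

lemma H10_L2: "0 < L ==> v : H10 L ==> v : L2 L"
 by (rule Hk_L2[OF H10_prim(1)])

lemma variational_solution_basic:
 assumes "variational_solution L T \<alpha> F g V u0 u" and V: "V \<subseteq> L2 L"
 shows "!!t. t : {0..T} ==> u t : V" "cont_L2 L T u" "u : bochner_Lp 1 T (space_L2 L)"
  "(%t. dx L (u t)) : bochner_Lp 1 T (space_L2 L)"
  "has_tderiv (space_L2 L) T u (tderiv L T u)" "frac_int L \<alpha> u : bochner_W1p 1 T (space_L2 L)"
  "frac_int L \<alpha> (%t. dx L (u t)) : bochner_W1p 1 T (space_L2 L)"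
  "AE x in leb L. u 0 x = u0 x" "u0 : V"
  "AE t in leb T. tderiv L T u t : L2 L"
  "AE t in leb T. frac_deriv L T \<alpha> u t : L2 L"
  "AE t in leb T. frac_deriv L T \<alpha> (%t. dx L (u t)) t : L2 L"
  "AE t in leb T. \<forall>v\<in>V.
    ip L (tderiv L T u t) v
    + ip L (frac_deriv L T \<alpha> (%t. dx L (u t)) t) (dx L v)
    - ip L (%x. F t x * frac_deriv L T \<alpha> u t x) (dx L v)
    = ip L (g t) v"
proof -
 note a = assms(1)[unfolded variational_solution_def]
 show "u t : V" if "t : {0..T}" for t using a that by blast
 show "cont_L2 L T u" unfolding cont_L2_def using a V by blast
 show "u : bochner_Lp 1 T (space_L2 L)" using a by (auto simp: bochner_W1p_def)
 have "u : bochner_Lp 1 T (space_H L 1)" using a by blast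
 thus "(%t. dx L (u t)) : bochner_Lp 1 T (space_L2 L)" by (rule bochner_Lp_wderiv) simp_all
 have t: "AE t in leb T. tderiv L T v t : L2 L" if "v : bochner_W1p 1 T (space_L2 L)" for v
  using tderiv_has_tderiv[OF that] by (intro bmL2_AE bochner_Lp_L2_integrable(1)) (simp add: has_tderiv_def)
 have u1: "u : bochner_W1p 1 T (space_L2 L)" and f1: "frac_int L \<alpha> u : bochner_W1p 1 T (space_L2 L)"
  and f2: "frac_int L \<alpha> (%t. dx L (u t)) : bochner_W1p 1 T (space_L2 L)" using a by blast+
 show "has_tderiv (space_L2 L) T u (tderiv L T u)" by (rule tderiv_has_tderiv[OF u1])
 show "frac_int L \<alpha> u : bochner_W1p 1 T (space_L2 L)" "frac_int L \<alpha> (%t. dx L (u t)) : bochner_W1p 1 T (space_L2 L)"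
  by (rule f1, rule f2)
 show "AE x in leb L. u 0 x = u0 x" "u0 : V" using a by blast+
 show "AE t in leb T. tderiv L T u t : L2 L" by (rule t[OF u1])
 show "AE t in leb T. frac_deriv L T \<alpha> u t : L2 L"
  "AE t in leb T. frac_deriv L T \<alpha> (%t. dx L (u t)) t : L2 L"
  unfolding frac_deriv_def by (rule t[OF f1], rule t[OF f2])
 show "AE t in leb T. \<forall>v\<in>V.
    ip L (tderiv L T u t) v
    + ip L (frac_deriv L T \<alpha> (%t. dx L (u t)) t) (dx L v)
    - ip L (%x. F t x * frac_deriv L T \<alpha> u t x) (dx L v)
    = ip L (g t) v" using a by blast
qed

text \<open>\<open>w\<close> is the time derivative of \<open>u\<close> with values in
  \<open>H^r\<close>; it agrees with \<open>tderiv L T u\<close> almost everywhere and can be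
  differentiated in space. The number \<open>B\<close> bounds the absolute value of
  \<open>F\<close>.\<close>

locale galerkin = fe L P \<xi> for L P \<xi> +
 fixes T \<alpha> B :: real and F g u uh w :: "real => real => real" and u0 u0h :: "real => real" and r :: nat
 assumes T: "0 < T" and \<alpha>: "1 / 2 < \<alpha>" "\<alpha> < 1" and B: "0 <= B"
  and Fm: "AE t in leb T. F t : bmf (leb L)"
  and FB: "!!t x. t : {0<..<T} ==> x : {0<..<L} ==> (F t x)^2 <= B^2"
  and sol: "variational_solution L T \<alpha> F g (H10 L) u0 u"
  and solh: "variational_solution L T \<alpha> F g (fe_space L P \<xi>) u0h uh"
  and w: "has_tderiv (space_H L r) T u w" and w2: "w : bochner_Lp 2 T (space_H L r)" and r: "r : {1, 2}"
begin

lemma \<alpha>0: "0 < \<alpha>" "0 < 1 - \<alpha>" using \<alpha> by auto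

lemma r1: "1 <= r" using r by auto

lemma test_spaces_L2: "H10 L \<subseteq> L2 L" "fe_space L P \<xi> \<subseteq> L2 L"
 using H10_L2[OF L0] fe_space_L2 by blast+

lemmas u = variational_solution_basic[OF sol test_spaces_L2(1)]
lemmas uh = variational_solution_basic[OF solh test_spaces_L2(2)]

lemma AE_in: "AE t in leb T. t : {0<..<T}" by (rule AE_I2) simp

lemma zero_in: "0 : {0..T}" using T by simp

lemma AE_tderiv_u: "AE t in leb T. AE x in leb L. tderiv L T u t x = w t x"
 by (rule tderiv_eq_H[OF u(5) w])

lemma w_Hk: "AE t in leb T. w t : Hk L r"
 using w by (auto simp: has_tderiv_def bochner_Lp_def bochner_measurable_def)

lemma u_Hk: "t : {0..T} ==> u t : Hk L r"
 unfolding Hk_iff using tderiv_H_at(1)[OF T w u(5,2)] u(2) by (auto simp: cont_L2_def)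

lemma inner_u_weak: "\<psi> : L2 L ==> has_weak_tderiv T (%t. ip L (u t) \<psi>) (%t. ip L (tderiv L T u t) \<psi>)"
 by (rule has_tderiv_L2_inner[OF u(5)])

lemma inner_dx_u_weak: "\<psi> : L2 L ==> has_weak_tderiv T (%t. ip L (dx L (u t)) \<psi>) (%t. ip L (dx L (w t)) \<psi>)"
 by (rule has_tderiv_H_inner[OF w _ r1])

lemma inner_uh_weak: "\<psi> : L2 L ==> has_weak_tderiv T (%t. ip L (uh t) \<psi>) (%t. ip L (tderiv L T uh t) \<psi>)"
 by (rule has_tderiv_L2_inner[OF uh(5)])

lemma inner_dx_u:
 "\<psi> : L2 L ==> t : {0..T} ==> ip L (dx L (u t)) \<psi> = ip L (dx L (u 0)) \<psi> + prim T (%s. ip L (dx L (w s)) \<psi>) t"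
 by (rule tderiv_H_at(2)[OF T w u(5,2) r1])

text \<open>The boundary conditions pass from \<open>u\<close> to its time derivative: they are
  expressed as equalities of scalar pairings with \<open>u\<close> and its spatial derivative, and
  such equalities can be differentiated weakly in time.\<close>

lemma AE_w_H10:
 "AE s in leb T. dx L (w s) : L2 L \<and> ip L (dx L (w s)) (%x. 1) = 0
  \<and> (AE x in leb L. w s x = prim L (dx L (w s)) x)"
proof -
 have lin: "(%x. L - x) : L2 L" by (intro L2_continuous continuous_intros)
 \<comment> \<open>The mean of the spatial derivative is zero because the two boundary values
   agree.\<close>
 have d1: "AE s in leb T. ip L (dx L (w s)) (%x. 1) = ip L (dx L (w s)) (%x. 0)"
 proof (rule has_weak_tderiv_unique[OF inner_dx_u_weak[OF L2_const] inner_dx_u_weak[OF L2_const]])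
  show "AE t in leb T. ip L (dx L (u t)) (%x. 1) = ip L (dx L (u t)) (%x. 0)"
   using AE_in
  proof eventually_elim
   case (elim t)
   hence "u t : H10 L" by (intro u(1)) auto
   thus ?case using H10_prim(3)[OF _ L0] inner_L2_commute[of L _ "%x. 0"] by simp
  qed
 qed
 \<comment> \<open>Together with the representation of \<open>w s\<close> as constant plus
   primitive, this moment identity forces the constant to be 0.\<close>
 have d2: "AE s in leb T. ip L (tderiv L T u s) (%x. 1) = ip L (dx L (w s)) (%x. L - x)"
 proof (rule has_weak_tderiv_unique[OF inner_u_weak[OF L2_const] inner_dx_u_weak[OF lin]])
  show "AE t in leb T. ip L (u t) (%x. 1) = ip L (dx L (u t)) (%x. L - x)"
   using AE_in
  proof eventually_elim
   case (elim t)
   hence v: "u t : H10 L" by (intro u(1)) auto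
   have z: "dx L (u t) : L2 L" by (rule Hk_wderiv(1)[OF H10_prim(1)[OF v L0] order_refl])
   have "ip L (u t) (%x. 1) = ip L (prim L (dx L (u t))) (%x. 1)"
    by (rule inner_L2_cong_AE[OF L2_measurable[OF H10_L2[OF L0 v]] L2_measurable[OF L2_const] H10_prim(2)[OF v L0]]) simp
   thus ?case using prim_inner_one[OF z] by simp
  qed
 qed
 show ?thesis
  using d1 d2 w_Hk AE_tderiv_u
 proof eventually_elim
  case (elim s)
  have z: "dx L (w s) : L2 L" "has_wderiv L 1 (w s) (dx L (w s))" using Hk_wderiv[OF elim(3) r1] by auto
  have wL: "w s : L2 L" by (rule Hk_L2[OF elim(3)])
  obtain c where c: "AE x in leb L. w s x = c + prim L (dx L (w s)) x"
   using has_wderiv_1_imp_prim[OF L0 wL z] by blast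
  have pL: "prim L (dx L (w s)) : L2 L" by (rule prim_L2[OF L2_integrable[OF z(1)]])
  have sw: "AE x in leb L. w s x = tderiv L T u s x" using elim(4) by eventually_elim simp
  have "ip L (w s) (%x. 1) = ip L (tderiv L T u s) (%x. 1)"
   by (rule inner_L2_cong_AE[OF L2_measurable[OF wL] L2_measurable[OF L2_const] sw]) simp
  moreover have "ip L (w s) (%x. 1) = ip L (%x. c + prim L (dx L (w s)) x) (%x. 1)"
   by (rule inner_L2_cong_AE[OF L2_measurable[OF wL] L2_measurable[OF L2_const] c]) simp
  moreover have "... = ip L (%x. c * 1) (%x. 1) + ip L (prim L (dx L (w s))) (%x. 1)"
   unfolding mult_1_right by (rule inner_L2_add_left[OF L2_const pL L2_const])
  ultimately have "c * ip L (%x. 1) (%x. 1) = 0"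
   using elim(2) prim_inner_one[OF z(1)] unfolding inner_L2_scale_left by linarith
  moreover have "ip L (%x. 1) (%x. 1) = L" using L0 by (simp add: inner_L2_def measure_restrict_space)
  ultimately have "c = 0" using L0 by simp
  thus ?case using z(1) c elim(1) inner_L2_commute[of L "dx L (w s)" "%x. 0"] by simp
 qed
qed

text \<open>The slopes of theta_t. Values of \<open>tderiv\<close> are determined only up to null
  sets and have no nodal values, therefore the slopes of the discrete part are read off by the dual
  functions.\<close>

definition \<phi> :: "nat => real => real" where
 "\<phi> p s = ip L (tderiv L T uh s) (dual_fun p) - avg (dx L (w s)) p"

definition \<theta>0 :: "nat => real" where "\<theta>0 p = slope (uh 0) p - avg (dx L (u 0)) p"

definition \<rho>t :: "real => real => real" where "\<rho>t s x = w s x - ramp_sum (avg (dx L (w s))) x"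

definition \<rho> :: "real => real => real" where "\<rho> t x = u t x - ramp_sum (avg (dx L (u t))) x"

text \<open>The fractional derivative of rho, written down by the formula of
  \<open>frac_deriv_inner\<close>, so that its norm can be estimated directly through rho(0) and
  rho_t.\<close>

definition D\<rho> :: "real => real => real" where "D\<rho> t x = kern \<alpha> t * \<rho> 0 x + frac_int L \<alpha> \<rho>t t x"

lemma interp_ramp_sum: "interp z = ramp_sum (avg z)"
 by (rule ext) (simp add: interp_def ramp_sum_def)

lemma fe_eq_ramp_sum:
 assumes "v : fe_space L P \<xi>" shows "AE x in leb L. v x = ramp_sum (slope v) x"
 by (rule AE_I2) (use fe_space_repr(1)[OF assms] in \<open>auto simp: ramp_sum_def\<close>)

lemma fe_slope_dual:
 assumes v: "v : fe_space L P \<xi>" and p: "p : {1..P}" shows "ip L v (dual_fun p) = slope v p"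
proof -
 have "ip L v (dual_fun p) = ip L (ramp_sum (slope v)) (dual_fun p)"
  by (rule inner_L2_cong_AE[OF L2_measurable[OF fe_space_L2[OF v]] L2_measurable[OF dual_fun_L2] fe_eq_ramp_sum[OF v]]) simp
 thus ?thesis using inner_ramp_sum_coeff[OF p] by simp
qed

lemma inner_ramp_sum: "\<psi> : L2 L ==> ip L (ramp_sum c) \<psi> = (\<Sum>p=1..P. c p * ip L (ramp p) \<psi>)"
 unfolding ramp_sum_def[abs_def]
 by (subst inner_L2_sum_left) (auto intro: L2_scale ramp_L2 simp: inner_L2_scale_left)

text \<open>The projection built from ramps and dual functions fixes every value of
  \<open>uh\<close>. As it is linear and bounded it commutes with the weak time derivative, which
  therefore takes its values in the span of the ramps.\<close>

lemma tderiv_uh_repr: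
 "AE s in leb T. AE x in leb L. tderiv L T uh s x = ramp_sum (%p. ip L (tderiv L T uh s) (dual_fun p)) x"
proof (rule bmL2_AE_eqI[OF uh(10)])
 show "AE s in leb T. ramp_sum (%p. ip L (tderiv L T uh s) (dual_fun p)) : L2 L"
  by (rule AE_I2) (rule ramp_sum_in_L2)
 fix \<psi> assume \<psi>: "\<psi> : L2 L"
 \<comment> \<open>The adjoint of the projection applied to \<open>\<psi>\<close>: pairing with
   \<open>\<chi>'\<close> means projecting first and then pairing with
   \<open>\<psi>\<close>.\<close>
 define \<chi>' where "\<chi>' x = (\<Sum>p=1..P. ip L (ramp p) \<psi> * dual_fun p x)" for x
 have c: "\<chi>' : L2 L" unfolding \<chi>'_def[abs_def] by (intro L2_sum L2_scale dual_fun_L2)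
 have i: "ip L v \<chi>' = (\<Sum>p=1..P. ip L v (dual_fun p) * ip L (ramp p) \<psi>)" if "v : L2 L" for v
 proof -
  have "ip L v \<chi>' = (\<Sum>p=1..P. ip L v (%x. ip L (ramp p) \<psi> * dual_fun p x))"
   unfolding \<chi>'_def[abs_def] by (rule inner_L2_sum_right) (intro L2_scale dual_fun_L2 that)+
  thus ?thesis unfolding inner_L2_scale_right by (simp add: mult.commute)
 qed
 have "AE s in leb T. ip L (tderiv L T uh s) \<psi> = ip L (tderiv L T uh s) \<chi>'"
 proof (rule has_weak_tderiv_unique[OF inner_uh_weak[OF \<psi>] inner_uh_weak[OF c]])
  show "AE t in leb T. ip L (uh t) \<psi> = ip L (uh t) \<chi>'"
   using AE_in
  proof eventually_elim
   case (elim t)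
   hence v: "uh t : fe_space L P \<xi>" by (intro uh(1)) auto
   have "ip L (uh t) \<psi> = ip L (ramp_sum (slope (uh t))) \<psi>"
    by (rule inner_L2_cong_AE[OF L2_measurable[OF fe_space_L2[OF v]] L2_measurable[OF \<psi>] fe_eq_ramp_sum[OF v]]) simp
   also have "... = ip L (uh t) \<chi>'"
    unfolding inner_ramp_sum[OF \<psi>] i[OF fe_space_L2[OF v]] using fe_slope_dual[OF v] by simp
   finally show ?case .
  qed
 qed
 with uh(10) show "AE s in leb T. ip L (tderiv L T uh s) \<psi> = ip L (ramp_sum (%p. ip L (tderiv L T uh s) (dual_fun p))) \<psi>"
  by eventually_elim (simp add: i inner_ramp_sum[OF \<psi>])
qed

text \<open>The boundary value at \<open>L\<close> is a bounded functional of finite element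
  functions, given by a combination of dual functions, so it stays 0 after differentiation in
  time.\<close>

lemma AE_sum_dual:
 "AE s in leb T. (\<Sum>p=1..P. ip L (tderiv L T uh s) (dual_fun p) * len p) = 0"
proof -
 define \<zeta> where "\<zeta> x = (\<Sum>p=1..P. len p * dual_fun p x)" for x
 have c: "\<zeta> : L2 L" unfolding \<zeta>_def[abs_def] by (intro L2_sum L2_scale dual_fun_L2)
 have i: "ip L v \<zeta> = (\<Sum>p=1..P. ip L v (dual_fun p) * len p)" if "v : L2 L" for v
 proof -
  have "ip L v \<zeta> = (\<Sum>p=1..P. ip L v (%x. len p * dual_fun p x))"
   unfolding \<zeta>_def[abs_def] by (rule inner_L2_sum_right) (intro L2_scale dual_fun_L2 that)+
  thus ?thesis unfolding inner_L2_scale_right by (simp add: mult.commute)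
 qed
 have "AE s in leb T. ip L (tderiv L T uh s) \<zeta> = ip L (tderiv L T uh s) (%x. 0)"
 proof (rule has_weak_tderiv_unique[OF inner_uh_weak[OF c] inner_uh_weak[OF L2_zero]])
  show "AE t in leb T. ip L (uh t) \<zeta> = ip L (uh t) (%x. 0)"
   using AE_in
  proof eventually_elim
   case (elim t)
   hence v: "uh t : fe_space L P \<xi>" by (intro uh(1)) auto
   show ?case
    unfolding i[OF fe_space_L2[OF v]] using fe_slope_dual[OF v] fe_space_repr(2)[OF v] inner_L2_commute[of L _ "%x. 0"] by simp
  qed
 qed
 with uh(10) show ?thesis
 proof eventually_elim
  case (elim s)
  thus ?case using i[OF elim(1)] inner_L2_commute[of L _ "%x. 0"] by simp
 qed
qed

lemma \<phi>_integrable: "integrable (leb T) (\<phi> p)"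
proof -
 have "integrable (leb T) (%s. ip L (tderiv L T uh s) (dual_fun p))"
  "integrable (leb T) (%s. ip L (dx L (w s)) (ind (elem p)))"
  using inner_uh_weak[OF dual_fun_L2, of p] inner_dx_u_weak[OF ind_elem_L2, of p] by (auto simp: has_weak_tderiv_def)
 thus ?thesis unfolding \<phi>_def[abs_def] avg_def by simp
qed

lemma AE_sum_\<phi>: "AE s in leb T. (\<Sum>p=1..P. \<phi> p s * len p) = 0"
 using AE_sum_dual AE_w_H10
proof eventually_elim
 case (elim s)
 thus ?case using avg_sum[of "dx L (w s)"] by (simp add: \<phi>_def left_diff_distrib sum_subtractf)
qed

lemma AE_sum_fconv: "AE t in leb T. (\<Sum>p=1..P. fconv \<alpha> (\<phi> p) t * len p) = 0"
proof -
 have m: "(%s. \<Sum>p=1..P. len p * \<phi> p s) : bmf (leb T)"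
  using \<phi>_integrable by (intro borel_measurable_sum borel_measurable_times borel_measurable_const) auto
 have ae: "AE s in leb T. (\<Sum>p=1..P. len p * \<phi> p s) = 0"
  using AE_sum_\<phi> by eventually_elim (simp add: mult.commute)
 have "AE t in leb T. \<forall>c. fconv \<alpha> (%s. \<Sum>i\<in>{1..P}. c i * \<phi> i s) t = (\<Sum>i\<in>{1..P}. c i * fconv \<alpha> (\<phi> i) t)"
  by (rule fconv_sum[OF \<alpha>0(1) finite_atLeastAtMost \<phi>_integrable])
 thus ?thesis using AE_in
 proof eventually_elim
  case (elim t)
  have "fconv \<alpha> (%s. \<Sum>p=1..P. len p * \<phi> p s) t = fconv \<alpha> (%s. 0) t"
   by (rule fconv_cong_AE[OF m ae]) (use elim in auto)
  thus ?case using elim by (simp add: fconv_def[of _ "%s. 0"] mult.commute)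
 qed
qed

lemma \<rho>_L2: "t : {0..T} ==> \<rho> t : L2 L"
 unfolding \<rho>_def[abs_def] by (intro L2_diff ramp_sum_in_L2 Hk_L2[OF u_Hk])

lemma \<rho>0_bound: "nrm L (\<rho> 0) <= mesh_size P \<xi> ^ r * norm_H L r (u 0)"
 unfolding \<rho>_def[abs_def] interp_ramp_sum[symmetric]
 by (rule interp_error_H[OF r u_Hk[OF zero_in] H10_prim(2)[OF u(1)[OF zero_in] L0]])

lemma \<rho>t_bound: "AE s in leb T. \<rho>t s : L2 L \<and> nrm L (\<rho>t s) <= mesh_size P \<xi> ^ r * norm_H L r (w s)"
 using w_Hk AE_w_H10
proof eventually_elim
 case (elim s)
 thus ?case
  unfolding \<rho>t_def[abs_def] using interp_error_H[OF r elim(1)] L2_diff[OF Hk_L2[OF elim(1)] ramp_sum_in_L2]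
  by (simp add: interp_ramp_sum)
qed

lemma \<rho>t_bm: "bmL2 L 0 T \<rho>t"
proof -
 have "bmL2 L 0 T (tderiv L T u)" using u(5) by (intro bochner_Lp_L2_integrable(1)) (simp add: has_tderiv_def)
 hence 1: "bmL2 L 0 T w" by (rule bmL2_cong_AE[OF _ AE_tderiv_u])
 have m: "(%s. avg (dx L (w s)) p) : bmf (leb T)" for p
  unfolding avg_def using inner_dx_u_weak[OF ind_elem_L2, of p] by (auto simp: has_weak_tderiv_def)
 have "bmL2 L 0 T (%s x. \<Sum>p=1..P. avg (dx L (w s)) p * ramp p x)"
  by (intro bmL2_sum bmL2_mult bmL2_const ramp_L2 m)
 from bmL2_diff[OF 1 this] show ?thesis unfolding \<rho>t_def[abs_def] ramp_sum_def[abs_def] .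
qed

lemma w_norm: "integrable (leb T) (%s. norm_H L r (w s))"
  "integrable (leb T) (%s. (norm_H L r (w s))^2)"
proof -
 have "integrable (leb T) (%s. norm_H L r (w s) powr 1)"
  using w by (simp add: has_tderiv_def bochner_Lp_def)
 thus "integrable (leb T) (%s. norm_H L r (w s))" by (simp add: norm_H_nonneg)
 have "integrable (leb T) (%s. norm_H L r (w s) powr 2)" using w2 by (simp add: bochner_Lp_def)
 moreover have "norm_H L r v powr 2 = (norm_H L r v)^2" for v
  using norm_H_nonneg[of L r v] by (cases "norm_H L r v = 0") (auto simp: powr_realpow[of _ 2, simplified])
 ultimately show "integrable (leb T) (%s. (norm_H L r (w s))^2)" by simp
qed

lemma \<rho>t_norm: "integrable (leb T) (%s. nrm L (\<rho>t s))"
  "integrable (leb T) (%s. (nrm L (\<rho>t s))^2)"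
proof -
 have m: "(%s. nrm L (\<rho>t s)) : bmf (leb T)" by (rule bmL2_norm_measurable[OF \<rho>t_bm])
 show "integrable (leb T) (%s. nrm L (\<rho>t s))"
 proof (rule intb_B[OF integrable_mult_right[OF w_norm(1), of "mesh_size P \<xi> ^ r"] m])
  show "AE s in leb T. norm (nrm L (\<rho>t s)) <= norm (mesh_size P \<xi> ^ r * norm_H L r (w s))"
   using \<rho>t_bound by eventually_elim (auto intro: order_trans[OF _ abs_ge_self])
 qed
 show "integrable (leb T) (%s. (nrm L (\<rho>t s))^2)"
 proof (rule intb_B[OF integrable_mult_right[OF w_norm(2), of "(mesh_size P \<xi> ^ r)^2"]])
  show "AE s in leb T. norm ((nrm L (\<rho>t s))^2) <= norm ((mesh_size P \<xi> ^ r)^2 * (norm_H L r (w s))^2)"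
   using \<rho>t_bound
  proof eventually_elim
   case (elim s)
   hence "(nrm L (\<rho>t s))^2 <= (mesh_size P \<xi> ^ r * norm_H L r (w s))^2" by (intro power_mono) auto
   thus ?case by (simp add: power_mult_distrib)
  qed
 qed (use m in measurable)
qed

lemma \<rho>t_Lp: "\<rho>t : bochner_Lp 1 T (space_L2 L)"
 using \<rho>t_bm \<rho>t_norm(1) by (simp add: bochner_Lp_def)

lemma \<rho>0_pair: "\<psi> : L2 L ==> ip L (uh 0) \<psi> - ip L (u 0) \<psi> = ip L (ramp_sum \<theta>0) \<psi> - ip L (\<rho> 0) \<psi>"
proof -
 assume \<psi>: "\<psi> : L2 L"
 have v: "uh 0 : fe_space L P \<xi>" by (rule uh(1)[OF zero_in])
 have 1: "ip L (uh 0) \<psi> = ip L (ramp_sum (slope (uh 0))) \<psi>"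
  by (rule inner_L2_cong_AE[OF L2_measurable[OF fe_space_L2[OF v]] L2_measurable[OF \<psi>] fe_eq_ramp_sum[OF v]]) simp
 have 2: "ip L (\<rho> 0) \<psi> = ip L (u 0) \<psi> - ip L (ramp_sum (avg (dx L (u 0)))) \<psi>"
  unfolding \<rho>_def[abs_def] by (rule inner_L2_diff_left[OF Hk_L2[OF u_Hk[OF zero_in]] ramp_sum_in_L2 \<psi>])
 show ?thesis unfolding 1 2 inner_ramp_sum[OF \<psi>] by (simp add: \<theta>0_def left_diff_distrib sum_subtractf)
qed

lemma tderiv_pair:
 assumes \<psi>: "\<psi> : L2 L"
 shows "AE s in leb T. ip L (tderiv L T uh s) \<psi> - ip L (tderiv L T u s) \<psi>
  = ip L (ramp_sum (%p. \<phi> p s)) \<psi> - ip L (\<rho>t s) \<psi>"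
 using tderiv_uh_repr AE_tderiv_u uh(10) u(10) w_Hk
proof eventually_elim
 case (elim s)
 have 1: "ip L (tderiv L T uh s) \<psi> = ip L (ramp_sum (%p. ip L (tderiv L T uh s) (dual_fun p))) \<psi>"
  by (rule inner_L2_cong_AE[OF L2_measurable[OF elim(3)] L2_measurable[OF \<psi>] elim(1)]) simp
 have 2: "ip L (tderiv L T u s) \<psi> = ip L (w s) \<psi>"
  by (rule inner_L2_cong_AE[OF L2_measurable[OF elim(4)] L2_measurable[OF \<psi>] elim(2)]) simp
 have 3: "ip L (\<rho>t s) \<psi> = ip L (w s) \<psi> - ip L (ramp_sum (avg (dx L (w s)))) \<psi>"
  unfolding \<rho>t_def[abs_def] by (rule inner_L2_diff_left[OF Hk_L2[OF elim(5)] ramp_sum_in_L2 \<psi>])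
 show ?case unfolding 1 2 3 unfolding inner_ramp_sum[OF \<psi>] by (simp add: \<phi>_def left_diff_distrib sum_subtractf)
qed

lemma frac_int_\<rho>t:
 "AE t in leb T. frac_int L \<alpha> \<rho>t t : L2 L \<and>
  (\<forall>\<psi>\<in>L2 L. ip L (frac_int L \<alpha> \<rho>t t) \<psi> = fconv \<alpha> (%s. ip L (\<rho>t s) \<psi>) t) \<and>
  nrm L (frac_int L \<alpha> \<rho>t t) <= fconv \<alpha> (%s. nrm L (\<rho>t s)) t"
 by (rule fconv_L2[OF \<alpha>0(1) \<rho>t_Lp])

lemma D\<rho>_L2: "AE t in leb T. D\<rho> t : L2 L"
 using frac_int_\<rho>t unfolding D\<rho>_def[abs_def]
 by eventually_elim (auto intro!: L2_add L2_scale \<rho>_L2 zero_in)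

text \<open>Both fractional derivatives are reduced by \<open>frac_deriv_inner\<close> to initial
  values and time derivatives; there the difference splits into theta and rho, and linearity of the
  fractional integral carries the splitting over.\<close>

lemma frac_deriv_diff:
 "AE t in leb T. AE x in leb L. frac_deriv L T \<alpha> uh t x - frac_deriv L T \<alpha> u t x
  = ramp_sum (%p. kern \<alpha> t * \<theta>0 p + fconv \<alpha> (\<phi> p) t) x - D\<rho> t x"
proof (rule bmL2_AE_eqI)
 show "AE t in leb T. (%x. frac_deriv L T \<alpha> uh t x - frac_deriv L T \<alpha> u t x) : L2 L"
  using uh(11) u(11) by eventually_elim (rule L2_diff)
 show "AE t in leb T. (%x. ramp_sum (%p. kern \<alpha> t * \<theta>0 p + fconv \<alpha> (\<phi> p) t) x - D\<rho> t x) : L2 L"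
  using D\<rho>_L2 by eventually_elim (intro L2_diff ramp_sum_in_L2)
 fix \<psi> assume \<psi>: "\<psi> : L2 L"
 let ?bh = "%s. ip L (tderiv L T uh s) \<psi>" and ?bu = "%s. ip L (tderiv L T u s) \<psi>"
 let ?br = "%s. ip L (\<rho>t s) \<psi>" and ?bf = "%s. \<Sum>p=1..P. ip L (ramp p) \<psi> * \<phi> p s"
 have i: "integrable (leb T) ?bh" "integrable (leb T) ?bu"
  using inner_uh_weak[OF \<psi>] inner_u_weak[OF \<psi>] by (auto simp: has_weak_tderiv_def)
 have ir: "integrable (leb T) ?br" by (rule bint_L2(2)[OF \<rho>t_bm \<rho>t_norm(1) \<psi>])
 have if': "integrable (leb T) ?bf" using \<phi>_integrable by simp
 have fh: "AE t in leb T. ip L (frac_deriv L T \<alpha> uh t) \<psi> = kern \<alpha> t * ip L (uh 0) \<psi> + fconv \<alpha> ?bh t"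
 proof (rule frac_deriv_inner[OF \<alpha>0(1) uh(3,6) \<psi> i(1)])
  show "AE s in leb T. ip L (uh s) \<psi> = ip L (uh 0) \<psi> + prim T ?bh s"
   using AE_in by eventually_elim (rule tderiv_L2_at[OF T uh(5,2) \<psi>], simp)
 qed
 have fu: "AE t in leb T. ip L (frac_deriv L T \<alpha> u t) \<psi> = kern \<alpha> t * ip L (u 0) \<psi> + fconv \<alpha> ?bu t"
 proof (rule frac_deriv_inner[OF \<alpha>0(1) u(3,6) \<psi> i(2)])
  show "AE s in leb T. ip L (u s) \<psi> = ip L (u 0) \<psi> + prim T ?bu s"
   using AE_in by eventually_elim (rule tderiv_L2_at[OF T u(5,2) \<psi>], simp)
 qed
 have eq: "AE s in leb T. 1 * ?bh s + (-1) * ?bu s = 1 * ?bf s + (-1) * ?br s"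
  using tderiv_pair[OF \<psi>] by eventually_elim (simp add: inner_ramp_sum[OF \<psi>] mult.commute)
 have m: "(%s. 1 * ?bh s + (-1) * ?bu s) : bmf (leb T)" using i by measurable
 have l1: "AE t in leb T. fconv \<alpha> (%s. 1 * ?bh s + (-1) * ?bu s) t = 1 * fconv \<alpha> ?bh t + (-1) * fconv \<alpha> ?bu t"
  by (rule fconv_linear[OF \<alpha>0(1) i])
 have l2: "AE t in leb T. fconv \<alpha> (%s. 1 * ?bf s + (-1) * ?br s) t = 1 * fconv \<alpha> ?bf t + (-1) * fconv \<alpha> ?br t"
  by (rule fconv_linear[OF \<alpha>0(1) if' ir])
 have l3: "AE t in leb T. \<forall>c. fconv \<alpha> (%s. \<Sum>i\<in>{1..P}. c i * \<phi> i s) t = (\<Sum>i\<in>{1..P}. c i * fconv \<alpha> (\<phi> i) t)"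
  by (rule fconv_sum[OF \<alpha>0(1) finite_atLeastAtMost \<phi>_integrable])
 show "AE t in leb T. ip L (%x. frac_deriv L T \<alpha> uh t x - frac_deriv L T \<alpha> u t x) \<psi>
  = ip L (%x. ramp_sum (%p. kern \<alpha> t * \<theta>0 p + fconv \<alpha> (\<phi> p) t) x - D\<rho> t x) \<psi>"
  using fh fu l1 l2 l3 AE_in uh(11) u(11) frac_int_\<rho>t D\<rho>_L2
 proof eventually_elim
  case (elim t)
  have c: "fconv \<alpha> (%s. 1 * ?bh s + (-1) * ?bu s) t = fconv \<alpha> (%s. 1 * ?bf s + (-1) * ?br s) t"
   by (rule fconv_cong_AE[OF m eq]) (use elim in auto)
  have d: "ip L (D\<rho> t) \<psi> = kern \<alpha> t * ip L (\<rho> 0) \<psi> + fconv \<alpha> ?br t"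
   using elim(9) \<psi> unfolding D\<rho>_def[abs_def]
   by (subst inner_L2_add_left) (auto intro: L2_scale \<rho>_L2 zero_in simp: inner_L2_scale_left)
  have s: "ip L (ramp_sum (%p. kern \<alpha> t * \<theta>0 p + fconv \<alpha> (\<phi> p) t)) \<psi> = kern \<alpha> t * ip L (ramp_sum \<theta>0) \<psi> + fconv \<alpha> ?bf t"
   unfolding inner_ramp_sum[OF \<psi>] elim(5)[rule_format]
   by (simp add: sum.distrib sum_distrib_left algebra_simps)
  show ?case
   unfolding inner_L2_diff_left[OF elim(7,8) \<psi>] inner_L2_diff_left[OF ramp_sum_in_L2 elim(10) \<psi>] d s
   using arg_cong[OF \<rho>0_pair[OF \<psi>], of "%a. kern \<alpha> t * a"] c
   unfolding elim(1-4) right_diff_distrib by linarith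
 qed
qed

text \<open>Test functions have step functions as derivatives, so pairings with element indicators
  are all that is required. On an element the Ritz slope is the average of the spatial derivative,
  hence rho leaves no trace: this is Ritz orthogonality in coordinates.\<close>

lemma frac_deriv_dx_diff:
 "AE t in leb T. \<forall>p\<in>{1..P}. ip L (frac_deriv L T \<alpha> (%t. dx L (uh t)) t) (ind (elem p))
  - ip L (frac_deriv L T \<alpha> (%t. dx L (u t)) t) (ind (elem p)) = len p * (kern \<alpha> t * \<theta>0 p + fconv \<alpha> (\<phi> p) t)"
proof -
 have "AE t in leb T. ip L (frac_deriv L T \<alpha> (%t. dx L (uh t)) t) (ind (elem p))
  - ip L (frac_deriv L T \<alpha> (%t. dx L (u t)) t) (ind (elem p)) = len p * (kern \<alpha> t * \<theta>0 p + fconv \<alpha> (\<phi> p) t)"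
  if p: "p : {1..P}" for p
 proof -
  let ?bh = "%s. ip L (tderiv L T uh s) (dual_fun p)" and ?bu = "%s. ip L (dx L (w s)) (ind (elem p))"
  have i: "integrable (leb T) ?bh" "integrable (leb T) ?bu"
   using inner_uh_weak[OF dual_fun_L2, of p] inner_dx_u_weak[OF ind_elem_L2, of p] by (auto simp: has_weak_tderiv_def)
  have dh: "ip L (dx L v) (ind (elem p)) = len p * slope v p" if v: "v : fe_space L P \<xi>" for v
  proof -
   have "ip L (dx L v) (ind (elem p)) = ip L (step_fun (slope v)) (ind (elem p))"
    by (rule inner_L2_cong_AE[OF L2_measurable[OF fe_space_wderiv(2)[OF v]] L2_measurable[OF ind_elem_L2] fe_space_wderiv(3)[OF v]]) simp
   thus ?thesis using avg_step[OF p, of "slope v"] len_pos[OF p] by (simp add: avg_def field_simps)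
  qed
  have fh: "AE t in leb T. ip L (frac_deriv L T \<alpha> (%t. dx L (uh t)) t) (ind (elem p))
    = kern \<alpha> t * (len p * slope (uh 0) p) + fconv \<alpha> (%s. len p * ?bh s) t"
  proof (rule frac_deriv_inner[OF \<alpha>0(1) uh(4,7) ind_elem_L2 integrable_mult_right[OF i(1)]])
   show "AE s in leb T. ip L (dx L (uh s)) (ind (elem p)) = len p * slope (uh 0) p + prim T (%s. len p * ?bh s) s"
    using AE_in
   proof eventually_elim
    case (elim s)
    hence s: "s : {0..T}" by auto
    show ?case
     using tderiv_L2_at[OF T uh(5,2) dual_fun_L2 s, of p]
     unfolding dh[OF uh(1)[OF s]] fe_slope_dual[OF uh(1)[OF s] p] fe_slope_dual[OF uh(1)[OF zero_in] p] prim_scale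
     by (simp add: distrib_left)
   qed
  qed
  have fu: "AE t in leb T. ip L (frac_deriv L T \<alpha> (%t. dx L (u t)) t) (ind (elem p))
    = kern \<alpha> t * ip L (dx L (u 0)) (ind (elem p)) + fconv \<alpha> ?bu t"
  proof (rule frac_deriv_inner[OF \<alpha>0(1) u(4,7) ind_elem_L2 i(2)])
   show "AE s in leb T. ip L (dx L (u s)) (ind (elem p)) = ip L (dx L (u 0)) (ind (elem p)) + prim T ?bu s"
    using AE_in by eventually_elim (rule inner_dx_u[OF ind_elem_L2], simp)
  qed
  have l: "AE t in leb T. fconv \<alpha> (%s. 1 * (len p * ?bh s) + (-1) * ?bu s) t = 1 * fconv \<alpha> (%s. len p * ?bh s) t + (-1) * fconv \<alpha> ?bu t"
   by (rule fconv_linear[OF \<alpha>0(1) integrable_mult_right[OF i(1)] i(2)])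
  have e: "1 * (len p * ?bh s) + (-1) * ?bu s = len p * \<phi> p s" for s
   using len_pos[OF p] by (simp add: \<phi>_def avg_def right_diff_distrib)
  have fs: "fconv \<alpha> (%s. len p * \<phi> p s) t = len p * fconv \<alpha> (\<phi> p) t" for t
   by (simp add: fconv_def mult.left_commute)
  have th: "len p * slope (uh 0) p - ip L (dx L (u 0)) (ind (elem p)) = len p * \<theta>0 p"
   using len_pos[OF p] by (simp add: \<theta>0_def avg_def right_diff_distrib)
  show ?thesis
   using fh fu l[unfolded e fs]
  proof eventually_elim
   case (elim t)
   have "kern \<alpha> t * (len p * slope (uh 0) p) - kern \<alpha> t * ip L (dx L (u 0)) (ind (elem p)) = kern \<alpha> t * (len p * \<theta>0 p)"
    unfolding th[symmetric] by (simp add: right_diff_distrib)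
   thus ?case unfolding elim(1,2) using elim(3) by (simp add: algebra_simps)
  qed
 qed
 thus ?thesis by (subst AE_ball_countable) auto
qed

text \<open>The two variational equations are subtracted. A single null set of times serves all test
  functions, because the differences are identified as functions, or on finitely many elements,
  before a test function is chosen.\<close>

lemma AE_error_eq:
 "AE t in leb T. error_eq (kern \<alpha> t) \<theta>0 (F t) (\<rho>t t) (D\<rho> t) (%p. \<phi> p t) (%p. fconv \<alpha> (\<phi> p) t)"
proof -
 have tp: "AE s in leb T. AE x in leb L. tderiv L T uh s x - tderiv L T u s x = ramp_sum (%p. \<phi> p s) x - \<rho>t s x"
 proof (rule bmL2_AE_eqI)
  show "AE t in leb T. (%x. tderiv L T uh t x - tderiv L T u t x) : L2 L"
   using uh(10) u(10) by eventually_elim (rule L2_diff)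
  show "AE t in leb T. (%x. ramp_sum (%p. \<phi> p t) x - \<rho>t t x) : L2 L"
   using bmL2_AE[OF \<rho>t_bm] by eventually_elim (intro L2_diff ramp_sum_in_L2)
  fix \<psi> assume \<psi>: "\<psi> : L2 L"
  show "AE t in leb T. ip L (%x. tderiv L T uh t x - tderiv L T u t x) \<psi> = ip L (%x. ramp_sum (%p. \<phi> p t) x - \<rho>t t x) \<psi>"
   using tderiv_pair[OF \<psi>] uh(10) u(10) bmL2_AE[OF \<rho>t_bm]
   by eventually_elim (simp add: inner_L2_diff_left \<psi> ramp_sum_in_L2)
 qed
 show ?thesis
  using tp frac_deriv_diff frac_deriv_dx_diff uh(10-13) u(10-13) Fm AE_in D\<rho>_L2 bmL2_AE[OF \<rho>t_bm]
 proof eventually_elim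
  case (elim t)
  have FL: "(%x. F t x * f x) : L2 L" if "f : L2 L" for f
   by (rule bounded_mult_norm(1)[OF elim(12) _ B that]) (rule FB[OF elim(13)])
  show ?case
   unfolding error_eq_def
  proof (intro allI impI)
   fix c assume c: "(\<Sum>p=1..P. c p * len p) = 0"
   let ?v = "ramp_sum c"
   have v: "?v : fe_space L P \<xi>" unfolding ramp_sum_def[abs_def] by (rule ramp_sum_fe_space[OF c])
   have sl: "step_fun (slope ?v) = step_fun c"
    unfolding step_fun_def[abs_def] ramp_sum_def[abs_def]
    by (rule ext, rule sum.cong[OF refl]) (simp add: slope_ramp_sum)
   have dv: "ip L f (dx L ?v) = ip L f (step_fun c)" if "f : L2 L" for f
    using inner_L2_cong_AE[OF L2_measurable[OF that] L2_measurable[OF fe_space_wderiv(2)[OF v]] _ fe_space_wderiv(3)[OF v], of f]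
    by (simp add: sl)
   have e1: "ip L (tderiv L T uh t) ?v - ip L (tderiv L T u t) ?v = ip L (ramp_sum (%p. \<phi> p t)) ?v - ip L (\<rho>t t) ?v"
    unfolding inner_L2_diff_left[OF elim(4,8) ramp_sum_in_L2, symmetric] inner_L2_diff_left[OF ramp_sum_in_L2 elim(15) ramp_sum_in_L2, symmetric]
    by (rule inner_L2_cong_AE[OF L2_measurable[OF L2_diff[OF elim(4,8)]] L2_measurable[OF ramp_sum_in_L2] elim(1)]) simp
   have e2: "ip L (%x. F t x * frac_deriv L T \<alpha> uh t x) (dx L ?v) - ip L (%x. F t x * frac_deriv L T \<alpha> u t x) (dx L ?v)
     = ip L (%x. F t x * (ramp_sum (%p. kern \<alpha> t * \<theta>0 p + fconv \<alpha> (\<phi> p) t) x - D\<rho> t x)) (step_fun c)"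
   proof -
    have ae: "AE x in leb L. F t x * frac_deriv L T \<alpha> uh t x - F t x * frac_deriv L T \<alpha> u t x
      = F t x * (ramp_sum (%p. kern \<alpha> t * \<theta>0 p + fconv \<alpha> (\<phi> p) t) x - D\<rho> t x)"
     using elim(2) by eventually_elim (simp flip: right_diff_distrib)
    show ?thesis
     unfolding dv[OF FL[OF elim(5)]] dv[OF FL[OF elim(9)]] inner_L2_diff_left[OF FL[OF elim(5)] FL[OF elim(9)] step_fun_L2, symmetric]
     by (rule inner_L2_cong_AE[OF L2_measurable[OF L2_diff[OF FL[OF elim(5)] FL[OF elim(9)]]] L2_measurable[OF step_fun_L2] ae]) simp
   qed
   have e3: "ip L (frac_deriv L T \<alpha> (%t. dx L (uh t)) t) (dx L ?v) - ip L (frac_deriv L T \<alpha> (%t. dx L (u t)) t) (dx L ?v)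
     = ip L (step_fun (%p. kern \<alpha> t * \<theta>0 p + fconv \<alpha> (\<phi> p) t)) (step_fun c)"
    unfolding dv[OF elim(6)] dv[OF elim(10)] inner_step_left[OF elim(6)] inner_step_left[OF elim(10)] inner_step_step
     sum_subtractf[symmetric]
   proof (rule sum.cong[OF refl])
    fix p assume p: "p : {1..P}"
    show "c p * ip L (frac_deriv L T \<alpha> (%t. dx L (uh t)) t) (ind (elem p))
      - c p * ip L (frac_deriv L T \<alpha> (%t. dx L (u t)) t) (ind (elem p)) = c p * ((kern \<alpha> t * \<theta>0 p + fconv \<alpha> (\<phi> p) t) * len p)"
     unfolding right_diff_distrib[symmetric] using bspec[OF elim(3) p] by (simp add: mult.commute)
   qed
   \<comment> \<open>A finite element function is admissible in both equations, so both sides equal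
     the same pairing with \<open>g t\<close>.\<close>
   have "ip L (tderiv L T uh t) ?v + ip L (frac_deriv L T \<alpha> (%t. dx L (uh t)) t) (dx L ?v)
     - ip L (%x. F t x * frac_deriv L T \<alpha> uh t x) (dx L ?v)
    = ip L (tderiv L T u t) ?v + ip L (frac_deriv L T \<alpha> (%t. dx L (u t)) t) (dx L ?v)
     - ip L (%x. F t x * frac_deriv L T \<alpha> u t x) (dx L ?v)"
    using bspec[OF elim(7) v] bspec[OF elim(11) fe_space_H10[OF v]] by simp
   thus "ip L (ramp_sum (%p. \<phi> p t)) ?v + ip L (step_fun (%p. kern \<alpha> t * \<theta>0 p + fconv \<alpha> (\<phi> p) t)) (step_fun c)
     = ip L (\<rho>t t) ?v + ip L (%x. F t x * (ramp_sum (%p. kern \<alpha> t * \<theta>0 p + fconv \<alpha> (\<phi> p) t) x - D\<rho> t x)) (step_fun c)"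
    using e1 e2 e3 by linarith
  qed
 qed
qed

end

section \<open>Stability and the final error bound\<close>

text \<open>The conclusion of \<open>frac_stability\<close> as a property of the number
  \<open>C\<close>. In this way \<open>C\<close> can be fixed before the mesh and the solutions and
  still be used inside the context that depends on them.\<close>

definition stability_const :: "real => real => real => real => bool" where
 "stability_const \<alpha> T M C \<longleftrightarrow> 0 <= C \<and>
  (\<forall>(I :: nat set) L \<phi> r E. frac_sum \<alpha> T L I \<phi> r \<longrightarrow> integrable lborel E \<longrightarrow> (\<forall>s. 0 <= E s) \<longrightarrow>
   (AE s in lborel. s : {0<..<T} \<longrightarrow> frac_sum.D \<alpha> L I \<phi> r s <= M * frac_sum.Q \<alpha> L I \<phi> r s + M * E s) \<longrightarrow>
   (AE t in lborel. t : {0<..<T} \<longrightarrow>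
    (nrm L (%x. \<Sum>i\<in>I. (LBINT s. ind {..<t} s * \<phi> i s) * r i x))^2 <= C * (LBINT s. ind {..<t} s * E s)))"

lemma stability_const_exists:
 assumes "1 / 2 < \<alpha>" "\<alpha> < 1" "0 <= M" shows "\<exists>C. stability_const \<alpha> T M C"
proof (rule frac_stability[OF assms, of T])
 fix C :: real
 assume C: "0 <= C" "!!(I :: nat set) L \<phi> r E. frac_sum \<alpha> T L I \<phi> r ==> integrable lborel E ==> (!!s. 0 <= E s) ==>
   (AE s in lborel. s : {0<..<T} \<longrightarrow> frac_sum.D \<alpha> L I \<phi> r s <= M * frac_sum.Q \<alpha> L I \<phi> r s + M * E s) ==>
   AE t in lborel. t : {0<..<T} \<longrightarrow>
    (nrm L (%x. \<Sum>i\<in>I. (LBINT s. ind {..<t} s * \<phi> i s) * r i x))^2 <= C * (LBINT s. ind {..<t} s * E s)"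
 show ?thesis
  unfolding stability_const_def by (rule exI[of _ C], intro conjI C(1) allI impI) (rule C(2), auto)
qed

context galerkin
begin

text \<open>Mass and, in \<open>k2\<close>, squared \<open>L2\<close> norm of the kernel on (0,T).
  They are the only traces of the kernel in the final constant apart from the stability
  constant.\<close>

definition k1 :: real where "k1 = (LBINT s. ind {..<T} s * kern \<alpha> s)"
definition k2 :: real where "k2 = (LBINT s. ind {..<T} s * (kern \<alpha> s)^2)"
definition N0 :: real where "N0 = (nrm L (ramp_sum \<theta>0))^2 + (nrm L (step_fun \<theta>0))^2"
definition R :: "real => real" where "R t = prim T (%s. (nrm L (\<rho>t s))^2) t"

lemma k_nonneg: "0 <= k1" "0 <= k2"
 unfolding k1_def k2_def using kern_nonneg[OF \<alpha>0(1)] by (auto intro!: integral_nonneg_AE)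

lemma N0_nonneg: "0 <= N0" by (simp add: N0_def)

lemma prim_mono:
 assumes "integrable (leb T) f" "integrable (leb T) h"
  "AE s in leb T. f s <= h s"
 shows "prim T f t <= prim T h t"
 unfolding prim_def
proof (rule integral_mono_AE)
 show "AE y in leb T. ind {0<..<t} y * f y <= ind {0<..<t} y * h y"
  using assms(3) by eventually_elim (simp add: mult_left_mono)
qed (rule prim_integrable[OF assms(1)], rule prim_integrable[OF assms(2)])

lemma prim_nonneg: "(!!s. 0 <= f s) ==> 0 <= prim T f t"
 unfolding prim_def by (intro integral_nonneg_AE AE_I2) simp

lemma R_nonneg: "0 <= R t" unfolding R_def by (rule prim_nonneg) simp

lemma avg_dx_u:
 assumes "t : {0..T}" shows "avg (dx L (u t)) p = avg (dx L (u 0)) p + prim T (%s. avg (dx L (w s)) p) t"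
proof -
 have "prim T (%s. avg (dx L (w s)) p) t = prim T (%s. inverse (len p) * ip L (dx L (w s)) (ind (elem p))) t"
  by (simp add: avg_def divide_inverse mult.commute)
 thus ?thesis
  unfolding prim_scale by (simp add: avg_def inner_dx_u[OF ind_elem_L2 assms] add_divide_distrib divide_inverse distrib_right)
qed

text \<open>Primitive formulas are available only for scalar pairings, so the value at time
  \<open>t\<close> is paired with itself and one factor is cancelled. The factor \<open>T\<close> is
  the price of Cauchy-Schwarz in time.\<close>

lemma \<rho>_norm_le:
 assumes t: "t : {0..T}" shows "(nrm L (\<rho> t))^2 <= 2 * (nrm L (\<rho> 0))^2 + 2 * T * R t"
proof -
 let ?n = "nrm L (\<rho> t)" and ?b = "%s. ip L (\<rho>t s) (\<rho> t)" and ?m = "prim T (%s. nrm L (\<rho>t s)) t"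
 have \<psi>: "\<rho> t : L2 L" by (rule \<rho>_L2[OF t])
 have bi: "integrable (leb T) ?b" by (rule bint_L2(2)[OF \<rho>t_bm \<rho>t_norm(1) \<psi>])
 have iu: "integrable (leb T) (%s. ip L (tderiv L T u s) (\<rho> t))"
  using inner_u_weak[OF \<psi>] by (simp add: has_weak_tderiv_def)
 have ia: "integrable (leb T) (%s. ip L (dx L (w s)) (ind (elem p)))" for p
  using inner_dx_u_weak[OF ind_elem_L2, of p] by (auto simp: has_weak_tderiv_def)
 have expand: "ip L (\<rho> s) (\<rho> t) = ip L (u s) (\<rho> t) - (\<Sum>p=1..P. avg (dx L (u s)) p * ip L (ramp p) (\<rho> t))"
  if "s : {0..T}" for s
 proof -
  have "\<rho> s = (%x. u s x - ramp_sum (avg (dx L (u s))) x)" by (rule ext) (rule \<rho>_def)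
  thus ?thesis
   using inner_L2_diff_left[OF Hk_L2[OF u_Hk[OF that]] ramp_sum_in_L2 \<psi>] inner_ramp_sum[OF \<psi>] by simp
 qed
 have ae: "AE s in leb T. ip L (tderiv L T u s) (\<rho> t) - (\<Sum>p=1..P. ip L (ramp p) (\<rho> t) * avg (dx L (w s)) p) = ?b s"
  using AE_tderiv_u u(10) w_Hk
 proof eventually_elim
  case (elim s)
  have "ip L (tderiv L T u s) (\<rho> t) = ip L (w s) (\<rho> t)"
   by (rule inner_L2_cong_AE[OF L2_measurable[OF elim(2)] L2_measurable[OF \<psi>] elim(1)]) simp
  thus ?case
   unfolding \<rho>t_def[abs_def] inner_L2_diff_left[OF Hk_L2[OF elim(3)] ramp_sum_in_L2 \<psi>] inner_ramp_sum[OF \<psi>] by (simp add: mult.commute)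
 qed
 have isum: "integrable (leb T) (%s. \<Sum>p=1..P. ip L (ramp p) (\<rho> t) * avg (dx L (w s)) p)"
  unfolding avg_def using ia by simp
 have "prim T ?b t = prim T (%s. ip L (tderiv L T u s) (\<rho> t) - (\<Sum>p=1..P. ip L (ramp p) (\<rho> t) * avg (dx L (w s)) p)) t"
  by (rule prim_cong_AE[symmetric, OF _ ae]) (use iu isum in measurable)
 also have "... = prim T (%s. ip L (tderiv L T u s) (\<rho> t)) t - (\<Sum>p=1..P. ip L (ramp p) (\<rho> t) * prim T (%s. avg (dx L (w s)) p) t)"
  unfolding prim_minus[OF iu isum] by (subst prim_sum) (use ia in \<open>auto simp: avg_def\<close>)
 finally have n2: "?n^2 = ip L (\<rho> 0) (\<rho> t) + prim T ?b t"
  unfolding norm_L2_square expand[OF t] expand[OF zero_in] tderiv_L2_at[OF T u(5,2) \<psi> t] avg_dx_u[OF t]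
  by (simp add: sum.distrib algebra_simps)
 have "prim T ?b t <= prim T (%s. ?n * nrm L (\<rho>t s)) t"
 proof (rule prim_mono[OF bi integrable_mult_right[OF \<rho>t_norm(1)]])
  show "AE s in leb T. ?b s <= ?n * nrm L (\<rho>t s)"
   using bmL2_AE[OF \<rho>t_bm]
  proof eventually_elim
   case (elim s)
   thus ?case using inner_L2_Cauchy_Schwarz[OF elim \<psi>] by (simp add: mult.commute)
  qed
 qed
 hence b: "prim T ?b t <= ?n * ?m" unfolding prim_scale .
 have "ip L (\<rho> 0) (\<rho> t) <= nrm L (\<rho> 0) * ?n"
  by (rule abs_le_D1[OF inner_L2_Cauchy_Schwarz[OF \<rho>_L2[OF zero_in] \<psi>]])
 with n2 b have "?n * ?n <= nrm L (\<rho> 0) * ?n + ?n * ?m" unfolding power2_eq_square by linarith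
 hence "?n * ?n <= (nrm L (\<rho> 0) + ?m) * ?n" by (simp add: algebra_simps)
 moreover have m0: "0 <= ?m" by (rule prim_nonneg) simp
 moreover have "0 <= ?n" "0 <= nrm L (\<rho> 0)" by simp_all
 ultimately have "?n <= nrm L (\<rho> 0) + ?m"
  using mult_right_le_imp_le[of ?n ?n "nrm L (\<rho> 0) + ?m"] by (cases "?n = 0") auto
 hence "?n^2 <= (nrm L (\<rho> 0) + ?m)^2" by (intro power_mono) auto
 also have "... <= 2 * (nrm L (\<rho> 0))^2 + 2 * ?m^2"
  by (rule square_add_le)
 finally have n3: "?n^2 <= 2 * (nrm L (\<rho> 0))^2 + 2 * ?m^2" .
 have "?m^2 <= T * R t"
 proof -
  let ?M = "leb T"
  have i0: "integrable ?M (%s. ind {0<..<t} s * (1 :: real))" by (rule prim_integrable[OF integrable_const_Ioo])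
  have "(ind {0<..<t} s :: real)^2 = ind {0<..<t} s * 1" for s by (simp add: indicator_def)
  hence i1: "integrable ?M (%s. (ind {0<..<t} s :: real)^2)" using i0 by (simp only:)
  have "(\<integral>s. ind {0<..<t} s * nrm L (\<rho>t s) \<partial>?M) = (\<integral>s. ind {0<..<t} s * (ind {0<..<t} s * nrm L (\<rho>t s)) \<partial>?M)"
   by (rule intc_B) (auto simp: indicator_def)
  have e2: "(ind {0<..<t} s * nrm L (\<rho>t s))^2 = ind {0<..<t} s * (nrm L (\<rho>t s))^2" for s
   by (simp add: indicator_def)
  have "(\<integral>s. ind {0<..<t} s * (ind {0<..<t} s * nrm L (\<rho>t s)) \<partial>?M)^2
    <= (\<integral>s. (ind {0<..<t} s)^2 \<partial>?M) * (\<integral>s. (ind {0<..<t} s * nrm L (\<rho>t s))^2 \<partial>?M)"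
  proof (rule Cauchy_Schwarz_integral(2)[OF i1])
   show "integrable ?M (%s. (ind {0<..<t} s * nrm L (\<rho>t s))^2)"
    unfolding e2 by (rule prim_integrable[OF \<rho>t_norm(2)])
  qed (use prim_integrable[OF \<rho>t_norm(1)] in \<open>auto intro!: borel_measurable_Ioo\<close>)
  also have "(\<integral>s. (ind {0<..<t} s :: real)^2 \<partial>?M) <= (\<integral>s. 1 \<partial>?M)"
   using i1 integrable_const_Ioo by (intro integral_mono) (auto simp: indicator_def)
  also have "(\<integral>s. (1 :: real) \<partial>?M) = T" using T by (simp add: measure_restrict_space)
  finally show ?thesis
   unfolding \<open>(\<integral>s. ind {0<..<t} s * nrm L (\<rho>t s) \<partial>?M) = _\<close>[symmetric] e2 R_def prim_def
   by (simp add: mult_right_mono integral_nonneg_AE)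
 qed
 with n3 show ?thesis by simp
qed

text \<open>Convolution estimates need Borel functions on the line that vanish off (0,T).
  Coefficients outside the index range are set to 0 so that the family satisfies its properties for
  all indices.\<close>

lemma borel_data:
 obtains \<psi> n where "!!p. \<psi> p : bmf borel" "!!p s. s \<notin> {0<..<T} ==> \<psi> p s = 0" "!!p. integrable lborel (\<psi> p)"
  "!!p. p : {1..P} ==> AE s in leb T. \<phi> p s = \<psi> p s" "!!p. p \<notin> {1..P} ==> \<psi> p = (%s. 0)"
  "n : bmf borel" "!!s. s \<notin> {0<..<T} ==> n s = 0" "AE s in leb T. nrm L (\<rho>t s) = n s" "integrable lborel n"
  "integrable lborel (%s. (n s)^2)"
proof -
 have "\<exists>f. f : bmf borel \<and> (\<forall>s. s \<notin> {0<..<T} \<longrightarrow> f s = 0) \<and> (AE s in leb T. \<phi> p s = f s) \<and> integrable lborel f" for p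
  using integrable_borel_representative[OF \<phi>_integrable[of p]] by metis
 then obtain f where f: "!!p. f p : bmf borel" "!!p s. s \<notin> {0<..<T} ==> f p s = 0"
  "!!p. AE s in leb T. \<phi> p s = f p s" "!!p. integrable lborel (f p)"
  by metis
 obtain n where n: "n : bmf borel" "!!x. x \<notin> {0<..<T} ==> n x = 0"
  "AE x in leb T. nrm L (\<rho>t x) = n x" "integrable lborel n"
  using integrable_borel_representative[OF \<rho>t_norm(1)] by metis
 have n2m: "(%s. (n s)^2) : bmf borel" using n(1) by measurable
 have "integrable (leb T) (%s. (n s)^2)"
 proof (rule integrable_cong_AE_imp[OF \<rho>t_norm(2) borel_measurable_Ioo[OF n2m]])
  show "AE x in leb T. (nrm L (\<rho>t x))^2 = (n x)^2" using n(3) by eventually_elim simp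
 qed
 moreover have "ind {0<..<T} s * (n s)^2 = (n s)^2" for s using n(2)[of s] by (cases "s : {0<..<T}") auto
 ultimately have n2: "integrable lborel (%s. (n s)^2)" by (simp add: integrable_Ioo_iff[OF n2m])
 show thesis
  by (rule that[of "%p. if p : {1..P} then f p else (%s. 0)" n]) (use f n n2 in auto)
qed

text \<open>The error is theta(0) plus the integral of theta_t minus rho, whence the factor 3. The
  middle part is bounded by the stability estimate, whose right-hand side is then integrated term by
  term with the convolution inequalities.\<close>

lemma AE_bound:
 assumes C: "stability_const \<alpha> T (B^2 + 1) C"
 shows "AE t in leb T. (nrm L (%x. uh t x - u t x))^2
  <= 3 * (N0 + C * ((1 + 2 * k1^2) * R t + 2 * k2 * (nrm L (\<rho> 0))^2 + k2 * N0) + (2 * (nrm L (\<rho> 0))^2 + 2 * T * R t))"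
proof -
 obtain \<psi> n where \<psi>: "!!p. \<psi> p : bmf borel" "!!p s. s \<notin> {0<..<T} ==> \<psi> p s = 0" "!!p. integrable lborel (\<psi> p)"
  "!!p. p : {1..P} ==> AE s in leb T. \<phi> p s = \<psi> p s" "!!p. p \<notin> {1..P} ==> \<psi> p = (%s. 0)"
  and n: "n : bmf borel" "!!s. s \<notin> {0<..<T} ==> n s = 0" "AE s in leb T. nrm L (\<rho>t s) = n s" "integrable lborel n"
  "integrable lborel (%s. (n s)^2)"
  by (rule borel_data) (rule that)
 note ker = kern_kernel[OF \<alpha>0(1)] and ker2 = kern_square_kernel[OF \<alpha>(1)]
 have \<psi>0: "\<psi> p s = 0" if "s <= 0" for p s using \<psi>(2)[of s p] that by simp
 have n0: "n s = 0" if "s <= 0" for s using n(2)[of s] that by simp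
 define v where "v p = conv (kern \<alpha>) (\<psi> p)" for p
 define m where "m = conv (kern \<alpha>) n"
 have vm: "v p : bmf borel" for p unfolding v_def by (rule conv_measurable[OF ker \<psi>(3) \<psi>0])
 have mm: "m : bmf borel" unfolding m_def by (rule conv_measurable[OF ker n(4) n0])
 have fv: "fconv \<alpha> (\<phi> p) t = v p t" if "p : {1..P}" "t : {0<..<T}" for p t
 proof -
  have "fconv \<alpha> (\<phi> p) t = fconv \<alpha> (\<psi> p) t"
   by (rule fconv_cong_AE[OF _ \<psi>(4)[OF that(1)]]) (use \<phi>_integrable that in auto)
  also have "... = v p t" unfolding v_def by (rule fconv_eq_conv(1)[OF \<psi>(1,2)])
  finally show ?thesis .
 qed
 have fm: "fconv \<alpha> (%s. nrm L (\<rho>t s)) t = m t" if "t : {0<..<T}" for t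
 proof -
  have "fconv \<alpha> (%s. nrm L (\<rho>t s)) t = fconv \<alpha> n t"
   by (rule fconv_cong_AE[OF _ n(3)]) (use \<rho>t_norm(1) that in auto)
  also have "... = m t" unfolding m_def by (rule fconv_eq_conv(1)[OF n(1,2)])
  finally show ?thesis .
 qed
 define \<nu> where "\<nu> = nrm L (\<rho> 0)"
 have D: "AE t in leb T. nrm L (D\<rho> t) <= kern \<alpha> t * \<nu> + m t"
  using frac_int_\<rho>t AE_in
 proof eventually_elim
  case (elim t)
  have "nrm L (D\<rho> t) <= nrm L (%x. kern \<alpha> t * \<rho> 0 x) + nrm L (frac_int L \<alpha> \<rho>t t)"
   unfolding D\<rho>_def[abs_def] using elim by (intro norm_L2_triangle L2_scale \<rho>_L2 zero_in) simp
  thus ?case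
   using elim fm[OF elim(2)] kern_nonneg[OF \<alpha>0(1), of t] by (simp add: norm_L2_scale \<nu>_def)
 qed
 have vsq: "square_int (%s. ind {..<T} s * v p s)" for p
  by (rule square_int_indicator[OF vm]) (unfold v_def, rule conv_square_integrable[OF ker ker2 \<psi>(3) \<psi>0])
 have msq: "square_int (%s. ind {..<T} s * m s)"
  by (rule square_int_indicator[OF mm]) (unfold m_def, rule conv_square_integrable[OF ker ker2 n(4) n0])
 have ksq: "square_int (%s. ind {..<T} s * kern \<alpha> s)"
  by (rule square_int_indicator) (use kernelD(4)[OF ker2, of T] in auto)
 have nsq: "square_int n" using n by (simp add: square_int_def)
 have AEp: "AE t in leb T. \<forall>p\<in>{1..P}. \<phi> p t = \<psi> p t"
  using \<psi>(4) by (subst AE_ball_countable) auto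
 \<comment> \<open>The passage from integrable to square integrable coefficients: the a priori bound
   dominates them by \<open>H\<close>, a sum of the kernel, the norm of rho_t and convolutions of
   the kernel with integrable functions, all square integrable up to \<open>T\<close>.\<close>
 have \<psi>2: "integrable lborel (%s. (\<psi> p s)^2)" for p
 proof (rule error_a_priori[OF B, of \<theta>0])
 fix K
 assume K: "0 <= K"
  "!!\<kappa> f R D \<phi> w p. f : bmf (leb L) ==> (!!x. x : {0<..<L} ==> (f x)^2 <= B^2) ==>
   R : L2 L ==> D : L2 L ==> 0 <= \<kappa> ==> error_eq \<kappa> \<theta>0 f R D \<phi> w ==> (\<Sum>p=1..P. \<phi> p * len p) = 0 ==> p : {1..P} ==>
   \<bar>\<phi> p\<bar> <= K * (nrm L R + nrm L D + \<kappa> + (\<Sum>q\<in>{1..P}. \<bar>w q\<bar>))"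
 define H where "H s = K * (n s + (\<nu> * (ind {..<T} s * kern \<alpha> s) + (ind {..<T} s * m s + (ind {..<T} s * kern \<alpha> s + (\<Sum>q\<in>{1..P}. \<bar>ind {..<T} s * v q s\<bar>)))))" for s
 have Hsq: "square_int H"
  unfolding H_def[abs_def]
  by (intro square_int_scale square_int_add nsq msq ksq square_int_sum square_int_abs vsq)
 have \<psi>H: "AE t in lborel. t : {0<..<T} \<longrightarrow> \<bar>\<psi> p t\<bar> <= H t" if p: "p : {1..P}" for p
  using AE_error_eq Fm AE_in AE_sum_\<phi> D\<rho>_L2 bmL2_AE[OF \<rho>t_bm] AEp D n(3) unfolding AE_Ioo_iff[symmetric]
 proof eventually_elim
  case (elim t)
  have "\<bar>\<phi> p t\<bar> <= K * (nrm L (\<rho>t t) + nrm L (D\<rho> t) + kern \<alpha> t + (\<Sum>q\<in>{1..P}. \<bar>fconv \<alpha> (\<phi> q) t\<bar>))"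
   by (rule K(2)[OF elim(2) FB[OF elim(3)] elim(6,5) kern_nonneg[OF \<alpha>0(1)] elim(1,4) p])
  also have "... <= H t"
   unfolding H_def
  proof (rule mult_left_mono[OF _ K(1)])
   have "(\<Sum>q\<in>{1..P}. \<bar>fconv \<alpha> (\<phi> q) t\<bar>) = (\<Sum>q\<in>{1..P}. \<bar>ind {..<T} t * v q t\<bar>)"
    by (rule sum.cong[OF refl]) (use fv elim(3) in auto)
   thus "nrm L (\<rho>t t) + nrm L (D\<rho> t) + kern \<alpha> t + (\<Sum>q\<in>{1..P}. \<bar>fconv \<alpha> (\<phi> q) t\<bar>)
    <= n t + (\<nu> * (ind {..<T} t * kern \<alpha> t) + (ind {..<T} t * m t + (ind {..<T} t * kern \<alpha> t + (\<Sum>q\<in>{1..P}. \<bar>ind {..<T} t * v q t\<bar>))))"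
    using elim(3,8,9) by (simp add: mult.commute)
  qed
  finally show ?case using bspec[OF elim(7) p] by simp
 qed
 show ?thesis
 proof (cases "p : {1..P}")
  case True
  show ?thesis
  proof (rule intb_B)
   show "integrable lborel (%s. (H s)^2)" using Hsq by (simp add: square_int_def)
   show "(%s. (\<psi> p s)^2) : bmf lborel" using \<psi>(1)[of p] by simp
   show "AE s in lborel. norm ((\<psi> p s)^2) <= norm ((H s)^2)"
    using \<psi>H[OF True]
   proof eventually_elim
    case (elim s)
    show ?case
    proof (cases "s : {0<..<T}")
     case in0: True
     hence "\<bar>\<psi> p s\<bar>^2 <= (H s)^2" using elim by (intro power_mono) auto
     thus ?thesis by simp
    next
     case False thus ?thesis using \<psi>(2)[OF False] by simp
    qed
   qed
  qed
 next
  case False thus ?thesis using \<psi>(5)[OF False] by simp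
 qed
 qed
 have fs: "frac_sum \<alpha> T L {1..P} \<psi> ramp"
  by unfold_locales (use \<alpha> ramp_L2 \<psi>(1,2) \<psi>2 in auto)
 interpret fs: frac_sum \<alpha> T L "{1..P}" \<psi> ramp by (rule fs)
 have fw: "fs.w p = v p" for p by (simp add: fs.w_def v_def)
 \<comment> \<open>The data terms of \<open>error_energy\<close>. The squared norm of the fractional
   derivative of rho is split into its initial part with \<open>\<nu>\<close> and its integral part
   \<open>m\<close>, which explains the two factors 2; \<open>N0\<close> comes from the initial
   slopes.\<close>
 define E where "E s = ind {0<..<T} s * ((n s)^2 + (2 * \<nu>^2 + N0) * (kern \<alpha> s)^2 + 2 * (m s)^2)" for s
 have i3: "integrable lborel (%s. (n s)^2)" "integrable lborel (%s. ind {..<t} s * (kern \<alpha> s)^2)"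
  "integrable lborel (%s. ind {..<t} s * (m s)^2)" "integrable lborel (%s. ind {..<t} s * (n s)^2)" for t
  using n(5) kernelD(4)[OF ker2] conv_square_integrable[OF ker ker2 n(4) n0] integrable_mult_indicator[OF _ n(5), of "{..<t}"]
  by (auto simp: m_def)
 have mz: "m s = 0" if "s <= 0" for s unfolding m_def by (rule conv_nonpos[OF ker n(4) n0 that])
 have Eeq: "ind {..<t} s * E s = ind {..<t} s * (n s)^2 + (2 * \<nu>^2 + N0) * (ind {..<t} s * (kern \<alpha> s)^2) + 2 * (ind {..<t} s * (m s)^2)"
  if "t <= T" for s t
  using that n0[of s] mz[of s] kernelD(3)[OF ker, of s] by (cases "s <= 0") (auto simp: E_def indicator_def)
 have Ei: "integrable lborel (%s. ind {..<t} s * E s)" if "t <= T" for t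
  unfolding Eeq[OF that] by (intro inta_B integrable_mult_right i3)
 have "ind {..<T} s * E s = E s" for s by (simp add: E_def indicator_def)
 hence Ei0: "integrable lborel E" using Ei[OF order_refl] by (simp only:)
 have E0: "0 <= E s" for s using N0_nonneg by (simp add: E_def)
 have key: "AE s in lborel. s : {0<..<T} \<longrightarrow> fs.D s <= (B^2 + 1) * fs.Q s + (B^2 + 1) * E s"
  using AE_error_eq Fm AE_in AE_sum_fconv D\<rho>_L2 bmL2_AE[OF \<rho>t_bm] AEp D n(3) unfolding AE_Ioo_iff[symmetric]
 proof eventually_elim
  case (elim t)
  have sp: "ramp_sum (%p. \<phi> p t) = (%x. \<Sum>p=1..P. \<psi> p t * ramp p x)"
   unfolding ramp_sum_def[abs_def] by (intro ext sum.cong refl) (use elim(7) in simp)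
  have sv: "ramp_sum (%p. fconv \<alpha> (\<phi> p) t) = (%x. \<Sum>p=1..P. fs.w p t * ramp p x)"
   unfolding ramp_sum_def[abs_def] fw by (intro ext sum.cong refl) (use fv elim(3) in simp)
  have "fs.D t = ip L (ramp_sum (%p. \<phi> p t)) (ramp_sum (%p. fconv \<alpha> (\<phi> p) t))"
   unfolding fs.D_def sp sv by (rule inner_L2_commute)
  also have "... <= (B^2 + 1) * (nrm L (ramp_sum (%p. fconv \<alpha> (\<phi> p) t)))^2
    + (B^2 + 1) * ((nrm L (\<rho>t t))^2 + (nrm L (D\<rho> t))^2 + (kern \<alpha> t)^2 * ((nrm L (ramp_sum \<theta>0))^2 + (nrm L (step_fun \<theta>0))^2))"
   by (rule error_energy[OF elim(2) FB[OF elim(3)] B elim(6,5) kern_nonneg[OF \<alpha>0(1)] elim(1,4)])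
  also have "... <= (B^2 + 1) * fs.Q t + (B^2 + 1) * E t"
  proof (intro add_mono mult_left_mono)
   show "(nrm L (ramp_sum (%p. fconv \<alpha> (\<phi> p) t)))^2 <= fs.Q t" unfolding fs.Q_def sv by simp
   have "(nrm L (D\<rho> t))^2 <= (kern \<alpha> t * \<nu> + m t)^2" using elim(8) by (intro power_mono) auto
   also have "... <= 2 * (kern \<alpha> t * \<nu>)^2 + 2 * (m t)^2"
    by (rule square_add_le)
   finally show "(nrm L (\<rho>t t))^2 + (nrm L (D\<rho> t))^2 + (kern \<alpha> t)^2 * ((nrm L (ramp_sum \<theta>0))^2 + (nrm L (step_fun \<theta>0))^2) <= E t"
    using elim(3,9) by (simp add: E_def N0_def power_mult_distrib algebra_simps)
  qed simp_all
  finally show ?case .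
 qed
 have st: "AE t in leb T. (nrm L (%x. \<Sum>p=1..P. (LBINT s. ind {..<t} s * \<psi> p s) * ramp p x))^2 <= C * (LBINT s. ind {..<t} s * E s)"
  unfolding AE_Ioo_iff using C[unfolded stability_const_def, THEN conjunct2, rule_format, OF fs Ei0 E0] key by blast
 have C0: "0 <= C" using C by (simp add: stability_const_def)
 show ?thesis
  using st AE_in
 proof eventually_elim
  case (elim t)
  have tT: "t <= T" "t : {0..T}" using elim(2) by auto
  have v: "uh t : fe_space L P \<xi>" by (rule uh(1)[OF tT(2)])
  define \<Theta> where "\<Theta> p = (LBINT s. ind {..<t} s * \<psi> p s)" for p
  have pr: "slope (uh t) p - avg (dx L (u t)) p = \<theta>0 p + \<Theta> p" if p: "p : {1..P}" for p
  proof -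
   have ih: "integrable (leb T) (%s. ip L (tderiv L T uh s) (dual_fun p))"
    using inner_uh_weak[OF dual_fun_L2, of p] by (simp add: has_weak_tderiv_def)
   have ia: "integrable (leb T) (%s. avg (dx L (w s)) p)"
    unfolding avg_def using inner_dx_u_weak[OF ind_elem_L2, of p] by (simp add: has_weak_tderiv_def)
   have 1: "slope (uh t) p = slope (uh 0) p + prim T (%s. ip L (tderiv L T uh s) (dual_fun p)) t"
    using tderiv_L2_at[OF T uh(5,2) dual_fun_L2 tT(2), of p] unfolding fe_slope_dual[OF v p] fe_slope_dual[OF uh(1)[OF zero_in] p] .
   have "prim T (\<phi> p) t = prim T (\<psi> p) t" by (rule prim_cong_AE[OF _ \<psi>(4)[OF p]]) (use \<phi>_integrable in auto)
   also have "... = \<Theta> p" unfolding \<Theta>_def by (rule prim_borel_eq[OF \<psi>(1,2)])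
   finally have "prim T (%s. ip L (tderiv L T uh s) (dual_fun p)) t - prim T (%s. avg (dx L (w s)) p) t = \<Theta> p"
    unfolding \<phi>_def[abs_def] prim_minus[OF ih ia] .
   thus ?thesis unfolding 1 avg_dx_u[OF tT(2)] \<theta>0_def by simp
  qed
  have eL: "(%x. uh t x - u t x) : L2 L" by (intro L2_diff fe_space_L2[OF v] Hk_L2[OF u_Hk[OF tT(2)]])
  have ae: "AE x in leb L. uh t x - u t x = (ramp_sum \<theta>0 x + ramp_sum \<Theta> x) + - \<rho> t x"
   using fe_eq_ramp_sum[OF v]
  proof eventually_elim
   case (elim x)
   have "ramp_sum (slope (uh t)) x - ramp_sum (avg (dx L (u t))) x = (\<Sum>p=1..P. (slope (uh t) p - avg (dx L (u t)) p) * ramp p x)"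
    by (simp add: ramp_sum_def sum_subtractf left_diff_distrib)
   also have "... = (\<Sum>p=1..P. (\<theta>0 p + \<Theta> p) * ramp p x)" by (rule sum.cong[OF refl]) (simp only: pr)
   also have "... = ramp_sum \<theta>0 x + ramp_sum \<Theta> x" by (simp add: ramp_sum_def sum.distrib distrib_right)
   finally show ?case using elim by (simp add: \<rho>_def)
  qed
  define a b c where abc: "a = nrm L (ramp_sum \<theta>0)" "b = nrm L (ramp_sum \<Theta>)" "c = nrm L (\<rho> t)"
  have "nrm L (%x. uh t x - u t x) = nrm L (%x. (ramp_sum \<theta>0 x + ramp_sum \<Theta> x) + - \<rho> t x)"
   by (rule norm_L2_cong_AE[OF L2_measurable[OF eL] ae])
  also have "... <= nrm L (%x. ramp_sum \<theta>0 x + ramp_sum \<Theta> x) + nrm L (%x. - \<rho> t x)"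
   by (intro norm_L2_triangle L2_add ramp_sum_in_L2 L2_uminus \<rho>_L2 tT)
  also have "... <= a + b + c"
   using norm_L2_triangle[OF ramp_sum_in_L2 ramp_sum_in_L2, of \<theta>0 \<Theta>] by (simp add: abc norm_L2_minus)
  finally have "(nrm L (%x. uh t x - u t x))^2 <= (a + b + c)^2" by (intro power_mono) auto
  also have "... <= 3 * (a^2 + b^2 + c^2)"
  proof -
   have "3 * (a^2 + b^2 + c^2) - (a + b + c)^2 = (a - b)^2 + (b - c)^2 + (a - c)^2" by (simp add: power2_eq_square algebra_simps)
   thus ?thesis using zero_le_power2[of "a - b"] zero_le_power2[of "b - c"] zero_le_power2[of "a - c"] by linarith
  qed
  also have "... <= 3 * (N0 + C * ((1 + 2 * k1^2) * R t + 2 * k2 * \<nu>^2 + k2 * N0) + (2 * \<nu>^2 + 2 * T * R t))"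
  proof (intro mult_left_mono add_mono)
   show "a^2 <= N0" by (simp add: abc N0_def)
   show "c^2 <= 2 * \<nu>^2 + 2 * T * R t" unfolding abc \<nu>_def by (rule \<rho>_norm_le[OF tT(2)])
   have "b^2 <= C * (LBINT s. ind {..<t} s * E s)"
    using elim(1) unfolding abc ramp_sum_def[abs_def] \<Theta>_def .
   also have "(LBINT s. ind {..<t} s * E s) <= (1 + 2 * k1^2) * R t + 2 * k2 * \<nu>^2 + k2 * N0"
   proof -
    have Rn: "(LBINT s. ind {..<t} s * (n s)^2) = R t"
    proof -
     have n2m: "(%s. (n s)^2) : bmf borel" using n(1) by measurable
     have "R t = prim T (%s. (n s)^2) t" unfolding R_def
     proof (rule prim_cong_AE)
      show "AE x in leb T. (nrm L (\<rho>t x))^2 = (n x)^2" using n(3) by eventually_elim simp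
     qed (use \<rho>t_norm(2) in simp)
     also have "... = (LBINT s. ind {..<t} s * (n s)^2)"
      by (rule prim_borel_eq[OF n2m]) (simp add: n(2))
     finally show ?thesis ..
    qed
    have kk: "(LBINT s. ind {..<t} s * kern \<alpha> s) <= k1" "0 <= (LBINT s. ind {..<t} s * kern \<alpha> s)"
     unfolding k1_def using tT kernelD(4)[OF ker] kern_nonneg[OF \<alpha>0(1)]
     by (auto intro!: integral_mono integral_nonneg_AE simp: indicator_def)
    have k2': "(LBINT s. ind {..<t} s * (kern \<alpha> s)^2) <= k2"
     unfolding k2_def using tT i3(2) by (intro integral_mono) (auto simp: indicator_def)
    have "(LBINT s. ind {..<t} s * (m s)^2) <= (LBINT s. ind {..<t} s * kern \<alpha> s)^2 * (LBINT s. ind {..<t} s * (n s)^2)"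
     unfolding m_def by (rule conv_square_integral_le(2)[OF ker n(1,5) n0])
    also have "... <= k1^2 * R t"
     unfolding Rn using power_mono[OF kk] R_nonneg by (intro mult_right_mono) auto
    finally have mR: "(LBINT s. ind {..<t} s * (m s)^2) <= k1^2 * R t" .
    have "(LBINT s. ind {..<t} s * E s)
     = (LBINT s. ind {..<t} s * (n s)^2) + (2 * \<nu>^2 + N0) * (LBINT s. ind {..<t} s * (kern \<alpha> s)^2) + 2 * (LBINT s. ind {..<t} s * (m s)^2)"
     unfolding Eeq[OF tT(1)] using i3 by simp
    also have "... <= R t + (2 * \<nu>^2 + N0) * k2 + 2 * (k1^2 * R t)"
     unfolding Rn using mR mult_left_mono[OF k2', of "2 * \<nu>^2 + N0"] N0_nonneg by simp
    finally show ?thesis by (simp add: algebra_simps)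
   qed
   finally show "b^2 <= C * ((1 + 2 * k1^2) * R t + 2 * k2 * \<nu>^2 + k2 * N0)" using C0 by (simp add: mult_left_mono)
  qed simp
  finally show ?case unfolding \<nu>_def .
 qed
qed

text \<open>By the description of the Ritz projection through averages, the slopes
  \<open>\<theta>0\<close> are those of the initial error, so the two terms of \<open>N0\<close> are
  the squares that make up its \<open>H^1\<close> norm.\<close>

lemma N0_eq: "N0 = (norm_H L 1 (%x. u0h x - ritz L P \<xi> u0 x))^2"
proof -
 define z where "z x = u0h x - ritz L P \<xi> u0 x" for x
 have zf: "z : fe_space L P \<xi>" unfolding z_def[abs_def] by (rule fe_space_diff[OF uh(9) ritz_interp(1)[OF u(9)]])
 have v0: "uh 0 : fe_space L P \<xi>" by (rule uh(1)[OF zero_in])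
 have du: "dx L (u 0) = dx L u0" by (rule wderiv_cong_AE[OF Hk_L2[OF u_Hk[OF zero_in]] u(8)])
 have sl: "slope z p = \<theta>0 p" if p: "p : {1..P}" for p
 proof -
  have "slope z p = slope u0h p - slope (ritz L P \<xi> u0) p" by (simp add: slope_def z_def diff_divide_distrib)
  also have "slope u0h p = ip L u0h (dual_fun p)" by (rule fe_slope_dual[OF uh(9) p, symmetric])
  also have "... = ip L (uh 0) (dual_fun p)"
   by (rule inner_L2_cong_AE[symmetric, OF L2_measurable[OF fe_space_L2[OF v0]] L2_measurable[OF dual_fun_L2] uh(8)]) simp
  also have "... = slope (uh 0) p" by (rule fe_slope_dual[OF v0 p])
  also have "slope (ritz L P \<xi> u0) p = avg (dx L u0) p" by (rule ritz_interp(2)[OF u(9) p])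
  finally show ?thesis by (simp add: \<theta>0_def du)
 qed
 have r: "ramp_sum (slope z) = ramp_sum \<theta>0" and s: "step_fun (slope z) = step_fun \<theta>0"
  unfolding ramp_sum_def[abs_def] step_fun_def[abs_def] by (intro ext sum.cong refl; simp add: sl)+
 have "nrm L (wderiv L 0 z) = nrm L (ramp_sum \<theta>0)"
  using wderiv_0(2)[OF fe_space_L2[OF zf]] norm_L2_cong_AE[OF L2_measurable[OF fe_space_L2[OF zf]] fe_eq_ramp_sum[OF zf]] by (simp add: r)
 moreover have "nrm L (wderiv L 1 z) = nrm L (step_fun \<theta>0)"
  using norm_L2_cong_AE[OF L2_measurable[OF fe_space_wderiv(2)[OF zf]] fe_space_wderiv(3)[OF zf]] by (simp add: s)
 moreover have "{..1::nat} = {0, 1}" by auto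
 ultimately show ?thesis
  unfolding z_def[symmetric, abs_def] by (simp add: norm_H_def N0_def)
qed

text \<open>It remains to insert the projection errors of the initial value and of the time
  derivative, and to replace \<open>u 0\<close> and \<open>w\<close> by \<open>u0\<close> and
  \<open>tderiv L T u\<close>, with which they agree almost everywhere.\<close>

lemma error_bound:
 assumes C: "stability_const \<alpha> T (B^2 + 1) C" and t: "t : {0..T}"
  and G: "G = 3 * (1 + C * (1 + 2 * k1^2 + 3 * k2) + 2 + 2 * T)"
 shows "(nrm L (%x. uh t x - u t x))^2
  <= G * (norm_H L 1 (%x. u0h x - ritz L P \<xi> u0 x))^2
   + G * mesh_size P \<xi> ^ (2 * r) * ((norm_H L r u0)^2 + (LINT s|leb t. (norm_H L r (tderiv L T u s))^2))"
proof -
 have C0: "0 <= C" using C by (simp add: stability_const_def)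
 define \<nu> where "\<nu> = nrm L (\<rho> 0)"
 define hr where "hr = mesh_size P \<xi> ^ (2 * r)"
 define J where "J = prim T (%s. (norm_H L r (w s))^2) t"
 have hr0: "0 <= hr" and hre: "hr = (mesh_size P \<xi> ^ r)^2" using mesh_pos by (simp_all add: hr_def power_mult[symmetric] mult.commute)
 \<comment> \<open>Both sides of \<open>AE_bound\<close> are continuous in time, so the inequality
   extends to every \<open>t\<close>, including 0 and \<open>T\<close>.\<close>
 have ce: "continuous_on {0..T} (%t. (nrm L (%x. uh t x - u t x))^2)"
  by (intro continuous_intros cont_L2_norm[OF cont_L2_diff[OF uh(2) u(2)]])
 have cR: "continuous_on {0..T} R"
  unfolding R_def[abs_def] by (rule continuous_on_subset[OF prim_continuous[OF \<rho>t_norm(2)]]) simp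
 have main: "(nrm L (%x. uh t x - u t x))^2
  <= 3 * (N0 + C * ((1 + 2 * k1^2) * R t + 2 * k2 * \<nu>^2 + k2 * N0) + (2 * \<nu>^2 + 2 * T * R t))"
  unfolding \<nu>_def by (rule continuous_AE_le[OF ce _ AE_bound[OF C] t T]) (intro continuous_intros cR)
 have RJ: "R t <= hr * J"
  unfolding R_def J_def prim_scale[symmetric]
 proof (rule prim_mono[OF \<rho>t_norm(2) integrable_mult_right[OF w_norm(2)]])
  show "AE s in leb T. (nrm L (\<rho>t s))^2 <= hr * (norm_H L r (w s))^2"
   using \<rho>t_bound
  proof eventually_elim
   case (elim s)
   hence "(nrm L (\<rho>t s))^2 <= (mesh_size P \<xi> ^ r * norm_H L r (w s))^2" by (intro power_mono) auto
   thus ?case by (simp add: power_mult_distrib hre)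
  qed
 qed
 have "norm_H L r (u 0) = norm_H L r u0" by (rule norm_H_cong_AE[OF Hk_L2[OF u_Hk[OF zero_in]] u(8)])
 hence \<nu>h: "\<nu>^2 <= hr * (norm_H L r u0)^2"
  using power_mono[OF \<rho>0_bound, of 2] by (simp add: \<nu>_def hre power_mult_distrib)
 have J0: "0 <= J" unfolding J_def by (rule prim_nonneg) simp
 have Jeq: "(LINT s|leb t. (norm_H L r (tderiv L T u s))^2) = J"
 proof -
  have ae: "AE s in leb T. (norm_H L r (w s))^2 = (norm_H L r (tderiv L T u s))^2"
   using AE_tderiv_u w_Hk
  proof eventually_elim
   case (elim s)
   have "AE x in leb L. w s x = tderiv L T u s x" using elim(1) by eventually_elim simp
   thus ?case using norm_H_cong_AE[OF Hk_L2[OF elim(2)]] by simp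
  qed
  have "J = prim T (%s. (norm_H L r (tderiv L T u s))^2) t"
   unfolding J_def by (rule prim_cong_AE[OF _ ae]) (use w_norm(2) in simp)
  thus ?thesis using t by (simp add: prim_eq_integral)
 qed
 \<comment> \<open>A common bound for both contributions of rho. With it the term
   \<open>3 * k2\<close> in \<open>G\<close> arises from \<open>2 * k2\<close> for the initial value
   of rho and \<open>k2\<close> for that of theta.\<close>
 define A where "A = hr * ((norm_H L r u0)^2 + J)"
 have "0 <= hr * J" "0 <= hr * (norm_H L r u0)^2" using hr0 J0 by simp_all
 hence A: "R t <= A" "\<nu>^2 <= A" "0 <= A"
  using RJ \<nu>h unfolding A_def distrib_left by linarith+
 have c: "0 <= 1 + 2 * k1^2" "0 <= 2 * k2" "0 <= 2 * T" "0 <= k2" using k_nonneg T by auto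
 have "N0 + C * ((1 + 2 * k1^2) * R t + 2 * k2 * \<nu>^2 + k2 * N0) + (2 * \<nu>^2 + 2 * T * R t)
   <= N0 + C * ((1 + 2 * k1^2) * A + 2 * k2 * A + k2 * N0) + (2 * A + 2 * T * A)"
  using mult_left_mono[OF A(1) c(1)] mult_left_mono[OF A(2) c(2)] mult_left_mono[OF A(1) c(3)] A(2)
  by (intro add_mono mult_left_mono[OF _ C0]) auto
 also have "... = (1 + C * k2) * N0 + (C * (1 + 2 * k1^2 + 2 * k2) + 2 + 2 * T) * A" by (simp add: algebra_simps)
 also have "... <= G / 3 * N0 + G / 3 * A"
 proof (intro add_mono mult_right_mono A(3) N0_nonneg)
  have p: "0 <= C * k2" "0 <= C * (1 + 2 * k1^2)" using C0 c by auto
  show "1 + C * k2 <= G / 3" "C * (1 + 2 * k1^2 + 2 * k2) + 2 + 2 * T <= G / 3"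
   unfolding G using p T by (simp_all add: algebra_simps)
 qed
 finally have "(nrm L (%x. uh t x - u t x))^2 <= G * N0 + G * A" using main by simp
 thus ?thesis unfolding Jeq N0_eq[symmetric] A_def hr_def by (simp add: mult.assoc)
qed

end

theorem theorem3p4:
  fixes L T \<alpha> C\<^sub>F :: real and F :: "real \<Rightarrow> real \<Rightarrow> real"
  assumes "0 < L" and "0 < T" and "1/2 < \<alpha>" and "\<alpha> < 1"
    and "F \<in> bochner_W1inf T (space_Linf L)"
    and "\<And>x t. 0 < x \<Longrightarrow> x < L \<Longrightarrow> 0 < t \<Longrightarrow> t < T \<Longrightarrow> 1 + (F t x)\<^sup>2 \<le> C\<^sub>F"
  shows "\<exists>C::real. \<forall>(g :: real \<Rightarrow> real \<Rightarrow> real) (u0 :: real \<Rightarrow> real) (u :: real \<Rightarrow> real \<Rightarrow> real)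
           (P :: nat) (\<xi> :: nat \<Rightarrow> real) (u0h :: real \<Rightarrow> real) (uh :: real \<Rightarrow> real \<Rightarrow> real).
           g \<in> bochner_Lp 1 T (space_L2 L) \<longrightarrow>
           variational_solution L T \<alpha> F g (H10 L) u0 u \<longrightarrow>
           is_partition L P \<xi> \<longrightarrow>
           variational_solution L T \<alpha> F g (fe_space L P \<xi>) u0h uh \<longrightarrow>
           (\<forall>r\<in>{1::nat, 2}. u \<in> bochner_W1p 2 T (space_H L r) \<longrightarrow>
             (\<forall>t\<in>{0..T}.
               (norm_L2 L (\<lambda>x. uh t x - u t x))\<^sup>2
               \<le> C * (norm_H L 1 (\<lambda>x. u0h x - ritz L P \<xi> u0 x))\<^sup>2
                 + C * mesh_size P \<xi> ^ (2 * r) *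
                   ((norm_H L r u0)\<^sup>2
                    + (\<integral>s. (norm_H L r (tderiv L T u s))\<^sup>2 \<partial>lebesgue_on {0<..<t}))))"
proof -
 \<comment> \<open>Evaluation at one interior point shows that the bound is nonnegative, so its
   square root can serve as \<open>B\<close>.\<close>
 have "1 + (F (T / 2) (L / 2))^2 <= C\<^sub>F" using assms(1,2) by (intro assms(6)) auto
 hence CF: "0 <= C\<^sub>F" using zero_le_power2[of "F (T / 2) (L / 2)"] by linarith
 define B where "B = sqrt C\<^sub>F"
 have B: "0 <= B" "B^2 = C\<^sub>F" using CF by (simp_all add: B_def)
 obtain C where C: "stability_const \<alpha> T (B^2 + 1) C"
  using stability_const_exists[OF assms(3,4), of "B^2 + 1" T] by auto
 have Fm: "AE t in leb T. F t : bmf (leb L)"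
  using assms(5) by (auto simp: bochner_W1inf_def bochner_Linf_def bochner_measurable_def space_Linf_def)
 \<comment> \<open>The constants \<open>k1\<close> and \<open>k2\<close> are written out because
   \<open>G\<close> is fixed before the mesh and the solutions, which the context
   \<open>galerkin\<close> takes as parameters.\<close>
 define G where "G = 3 * (1 + C * (1 + 2 * (LBINT s. ind {..<T} s * kern \<alpha> s)^2
  + 3 * (LBINT s. ind {..<T} s * (kern \<alpha> s)^2)) + 2 + 2 * T)"
 show ?thesis
 proof (rule exI[of _ G], intro allI impI ballI)
  fix g u0 u P \<xi> u0h uh r t
  assume g: "g : bochner_Lp 1 T (space_L2 L)"
   and u: "variational_solution L T \<alpha> F g (H10 L) u0 u" and P: "is_partition L P \<xi>"
   and uh: "variational_solution L T \<alpha> F g (fe_space L P \<xi>) u0h uh"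
   and r: "r : {1::nat, 2}" and ur: "u : bochner_W1p 2 T (space_H L r)" and t: "t : {0..T}"
  obtain w where w: "w : bochner_Lp 2 T (space_H L r)" "has_tderiv (space_H L r) T u w"
   using ur by (auto simp: bochner_W1p_def)
  interpret galerkin L P \<xi> T \<alpha> B F g u uh w u0 u0h r
  proof unfold_locales
   show "(F t x)^2 <= B^2" if "t : {0<..<T}" "x : {0<..<L}" for t x
    using assms(6)[of x t] that unfolding B(2) by simp
  qed (use assms P B Fm u uh w r in auto)
  show "(nrm L (%x. uh t x - u t x))^2
       <= G * (norm_H L 1 (%x. u0h x - ritz L P \<xi> u0 x))^2
        + G * mesh_size P \<xi> ^ (2 * r) *
         ((norm_H L r u0)^2
          + (LINT s|leb t. (norm_H L r (tderiv L T u s))^2))"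
   by (rule error_bound[OF C t]) (simp add: G_def k1_def k2_def)
 qed
qed

end
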